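(* Let $u_0\in L^\infty_{loc}(\mathbb{R}^d)$ and assume that the graphs $\mathcal{A}_{F}\subset\mathbb{R}^d\times\mathbb{R}$ and $\mathcal{A}_G\subset\mathbb{R}\times\mathbb{R}$ admit a continuous parametrization $(U,A,a)$. Then a function $u:\mathbb{R}^{d+1}_+\to\mathbb{R}$ is an entropy weak solution with initial data $u_0$ (Definition E in the context) if and only if it is a kinetic solution with initial data $u_0$ in the sense of Definition K2 in the context. Moreover, if $U,a\in W^{1,1}_{loc}(\mathbb{R})$ and $A\in W^{1,1}_{loc}(\mathbb{R};\mathbb{R}^d)$, then Definitions K1 and K2 in the context are equivalent, i.e. $u$ is a kinetic solution with initial data $u_0$ in the sense of K1 if and only if it is one in the sense of K2.
   Context: Notation: $d\ge 1$, $\mathbb{R}^{d+1}_+=(0,\infty)\times\mathbb{R}^d\ni(t,x)$, $\mathbb{R}^{d+2}_+=(0,\infty)\times\mathbb{R}^d\times\mathbb{R}\ni(t,x,\xi)$; $\mathcal{D}$ denotes smooth compactly supported functions. The problem under consideration is $\partial_t u+\operatorname{div}F=G$ in $\mathbb{R}^{d+1}_+$ with $(F,u)\in\mathcal{A}_F$, $(G,u)\in\mathcal{A}_G$, and $u(0)=u_0$. Continuous parametrization: the graphs $\mathcal{A}_F\subset\mathbb{R}^d\times\mathbb{R}$ and $\mathcal{A}_G\subset\mathbb{R}\times\mathbb{R}$ admit a continuous parametrization $(U,A,a)$ if $U:\mathbb{R}\to\mathbb{R}$ is Lipschitz continuous and nondecreasing with $U(\mathbb{R})=\mathbb{R}$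 (normalized so that $U(0)=0$), $A:\mathbb{R}\to\mathbb{R}^d$ and $a:\mathbb{R}\to\mathbb{R}$ are continuous, and $(A(s),U(s))\in\mathcal{A}_F$, $(a(s),U(s))\in\mathcal{A}_G$ for all $s\in\mathbb{R}$. Indicator function: $\chi(\xi,v)=1$ if $0<\xi<v$, $\chi(\xi,v)=-1$ if $v<\xi<0$, and $\chi(\xi,v)=0$ otherwise. For fixed $v$, its distributional derivative in $\xi$ is the measure $\partial_\xi\chi(\xi,v)=\delta_0(\xi)-\delta_v(\xi)$, and $\langle g(\xi),\partial_\xi\chi(\xi,v)\rangle=g(0)-g(v)$ for continuous $g$. All three definitions below require: (0) $u\in L^\infty(0,T;L^\infty_{loc}(\mathbb{R}^d))$ for every $T<\infty$; (1) there exist measurable $v:\mathbb{R}^{d+1}_+\to\mathbb{R}$ and $v_0:\mathbb{R}^d\to\mathbb{R}$ with $u=U(v)$ a.e. in $\mathbb{R}^{d+1}_+$ and $u_0=U(v_0)$ a.e. in $\mathbb{R}^d$; and in addition (2) as follows. Definition E (entropy weak solution): for every $T<\infty$, all smooth convex $E:\mathbb{R}\to\mathbb{R}$ with $E''\in\mathcal{D}(\mathbb{R})$ and all nonnegative $\varphi\in\mathcal{D}((-\infty,T)\times\mathbb{R}^d)$, $$\int_{\mathbb{R}^{d+1}_+}Q_U(v)\partial_t\varphi+Q_A(v)\cdot\nabla_x\varphi\,dx\,dt\ge-\int_{\mathbb{R}^{d+1}_+}a(v)E'(v)\varphi\,dx\,dt-\int_{\mathbb{R}^d}Q_U(v_0(x))\varphi(0,x)\,dx,$$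 where $Q_U'=U'E'$, $Q_A'=A'E'$, understood (up to additive constants) as $Q_U(s)=U(s)E'(s)-\int_0^sU(t)E''(t)\,dt$ and $Q_A(s)=A(s)E'(s)-\int_0^sA(t)E''(t)\,dt$. Measures in K1 and K2: "$m$ is locally (with respect to $(t,x)$) compactly supported (with respect to $\xi$)" means that for every compact $K\subset\mathbb{R}\times\mathbb{R}^d$ the set of $\xi$ for which $m$ does not vanish at $(t,x,\xi)$ for some $(t,x)\in K$ is compact, i.e. the part of $m$ over $(t,x)\in K$ is carried by a compact set of $\xi$. Definition K1 (kinetic solution I; for $U,A,a$ in $W^{1,1}_{loc}$): there exists a nonnegative measure $m\in\mathcal{M}(\mathbb{R}^{d+2}_+)$, locally (in $(t,x)$) compactly supported in $\xi$, such that for all $\varphi\in\mathcal{D}(\mathbb{R}^{d+2})$ $$\begin{aligned}\langle m,\partial_\xi\varphi\rangle=&\int_{\mathbb{R}^{d+1}}U'(\xi)\chi(\xi,v_0(x))\varphi(0,x,\xi)\,d\xi\,dx\\&+\int_{\mathbb{R}^{d+2}_+}\Big(U'(\xi)\chi(\xi,v)\partial_t\varphi+\chi(\xi,v)A'(\xi)\cdot\nabla_x\varphi+a'(\xi)\chi(\xi,v)\varphi+a(\xi)\chi(\xi,v)\partial_\xi\varphi\Big)d\xi\,dx\,dt\\&+\int_{\mathbb{R}^{d+1}_+}a(0)\varphi(t,x,0)\,dx\,dt,\end{aligned}$$ where $v=v(t,x)$ and $\varphi=\varphi(t,x,\xi)$. Definition K2 (kinetic solution II; $U,A,a$ as in the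 definition of continuous parametrization): there exists a nonnegative measure $m\in\mathcal{M}(\mathbb{R}^{d+2}_+)$, locally (in $(t,x)$) compactly supported in $\xi$, such that for all $\varphi\in\mathcal{D}(\mathbb{R}^{d+2})$ $$\begin{aligned}\langle m,\partial_\xi\varphi\rangle=&-\int_{\mathbb{R}^{d+1}}U(\xi)\chi(\xi,v_0)\partial_\xi\varphi(0,x,\xi)\,d\xi\,dx-\int_{\mathbb{R}^d}\langle U(\xi)\varphi(0,x,\xi),\partial_\xi\chi(\xi,v_0(x))\rangle\,dx\\&-\int_{\mathbb{R}^{d+2}_+}U(\xi)\chi(\xi,v)\partial_t\partial_\xi\varphi\,d\xi\,dx\,dt-\int_{\mathbb{R}^{d+1}_+}\langle U(\xi)\partial_t\varphi,\partial_\xi\chi(\xi,v)\rangle\,dx\,dt\\&-\int_{\mathbb{R}^{d+2}_+}\chi(\xi,v)A(\xi)\cdot\nabla_x\partial_\xi\varphi\,d\xi\,dx\,dt-\int_{\mathbb{R}^{d+1}_+}\langle A(\xi)\cdot\nabla_x\varphi,\partial_\xi\chi(\xi,v)\rangle\,dx\,dt\\&+\int_{\mathbb{R}^{d+1}_+}\Big(a(0)\varphi(t,x,0)-\langle a(\xi)\varphi(t,x,\xi),\partial_\xi\chi(\xi,v)\rangle\Big)dx\,dt.\end{aligned}$$ *)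

theory Defs
  imports "HOL-Analysis.Analysis"
begin

section \<open>Test functions and derivatives\<close>

text \<open>A function is of class \<open>C\<^sup>k\<close> on the whole space; a differentiable function whose
  directional derivatives in every fixed direction are continuous is \<open>C\<^sup>1\<close>.\<close>

primrec C_k :: "nat \<Rightarrow> ('a::euclidean_space \<Rightarrow> real) \<Rightarrow> bool" where
  "C_k 0 f \<longleftrightarrow> continuous_on UNIV f"
| "C_k (Suc k) f \<longleftrightarrow>
     (\<forall>x. f differentiable (at x)) \<and> (\<forall>h. C_k k (\<lambda>x. frechet_derivative f (at x) h))"

definition smooth :: "('a::euclidean_space \<Rightarrow> real) \<Rightarrow> bool" where
  "smooth f \<longleftrightarrow> (\<forall>k. C_k k f)"

text \<open>\<open>\<D>(\<Omega>)\<close> for open \<open>\<Omega>\<close>; its elements are extended by zero to the whole space.\<close>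

definition test_function :: "'a::euclidean_space set \<Rightarrow> ('a \<Rightarrow> real) \<Rightarrow> bool" where
  "test_function \<Omega> \<phi> \<longleftrightarrow>
     smooth \<phi> \<and> compact (closure {x. \<phi> x \<noteq> 0}) \<and> closure {x. \<phi> x \<noteq> 0} \<subseteq> \<Omega>"

definition grad :: "(real^'d \<Rightarrow> real) \<Rightarrow> real^'d \<Rightarrow> real^'d" where
  "grad f x = (\<chi> i. frechet_derivative f (at x) (axis i 1))"

text \<open>The space variable of \<open>\<partial>\<^sub>t\<close> is left generic: it is \<open>x\<close> for functions of \<open>(t, x)\<close> and
  \<open>(x, \<xi>)\<close> for functions of \<open>(t, x, \<xi>)\<close>.\<close>

definition D_t :: "(real \<times> 'a \<Rightarrow> real) \<Rightarrow> real \<times> 'a \<Rightarrow> real" where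
  "D_t \<phi> = (\<lambda>(t, y). deriv (\<lambda>s. \<phi> (s, y)) t)"

definition D_xi :: "(real \<times> (real^'d) \<times> real \<Rightarrow> real) \<Rightarrow> real \<times> (real^'d) \<times> real \<Rightarrow> real" where
  "D_xi \<phi> = (\<lambda>(t, x, \<xi>). deriv (\<lambda>\<eta>. \<phi> (t, x, \<eta>)) \<xi>)"

definition grad_x :: "(real \<times> (real^'d) \<Rightarrow> real) \<Rightarrow> real \<times> (real^'d) \<Rightarrow> real^'d" where
  "grad_x \<phi> = (\<lambda>(t, x). grad (\<lambda>y. \<phi> (t, y)) x)"

definition kgrad_x ::
  "(real \<times> (real^'d) \<times> real \<Rightarrow> real) \<Rightarrow> real \<times> (real^'d) \<times> real \<Rightarrow> real^'d" where
  "kgrad_x \<phi> = (\<lambda>(t, x, \<xi>). grad (\<lambda>y. \<phi> (t, y, \<xi>)) x)"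

section \<open>Function spaces\<close>

text \<open>\<open>(0,\<infinity>) \<times> Y\<close>: with \<open>Y = \<real>\<^sup>d\<close> this is \<open>\<real>\<^sup>d\<^sup>+\<^sup>1\<^sub>+\<close>, with \<open>Y = \<real>\<^sup>d \<times> \<real>\<close> it is \<open>\<real>\<^sup>d\<^sup>+\<^sup>2\<^sub>+\<close>.\<close>

abbreviation upper_half :: "(real \<times> 'a) set" where
  "upper_half \<equiv> {0<..} \<times> UNIV"

definition Linf_loc :: "(real^'d \<Rightarrow> real) \<Rightarrow> bool" where
  "Linf_loc f \<longleftrightarrow> f \<in> borel_measurable lebesgue \<and>
     (\<forall>K. compact K \<longrightarrow> (\<exists>C. AE x in lebesgue_on K. \<bar>f x\<bar> \<le> C))"

text \<open>\<open>u \<in> L\<^sup>\<infinity>(0,T; L\<^sup>\<infinity>\<^sub>l\<^sub>o\<^sub>c(\<real>\<^sup>d))\<close> for every finite \<open>T\<close>, i.e. \<open>u\<close> is measurable and essentially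
  bounded on \<open>(0,T) \<times> K\<close> for every compact \<open>K\<close>.\<close>

definition Linf_time_Linf_loc :: "(real \<times> (real^'d) \<Rightarrow> real) \<Rightarrow> bool" where
  "Linf_time_Linf_loc u \<longleftrightarrow> u \<in> borel_measurable (lebesgue_on upper_half) \<and>
     (\<forall>T>0. \<forall>K. compact K \<longrightarrow> (\<exists>C. AE p in lebesgue_on ({0<..<T} \<times> K). \<bar>u p\<bar> \<le> C))"

definition L1_loc :: "(real \<Rightarrow> 'b::euclidean_space) \<Rightarrow> bool" where
  "L1_loc f \<longleftrightarrow> (\<forall>K. compact K \<longrightarrow> f absolutely_integrable_on K)"

definition has_weak_deriv :: "(real \<Rightarrow> 'b::euclidean_space) \<Rightarrow> (real \<Rightarrow> 'b) \<Rightarrow> bool" where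
  "has_weak_deriv f g \<longleftrightarrow> L1_loc g \<and>
     (\<forall>\<phi>. test_function UNIV \<phi> \<longrightarrow>
        (LINT s|lebesgue. deriv \<phi> s *\<^sub>R f s) = - (LINT s|lebesgue. \<phi> s *\<^sub>R g s))"

definition W11_loc :: "(real \<Rightarrow> 'b::euclidean_space) \<Rightarrow> bool" where
  "W11_loc f \<longleftrightarrow> L1_loc f \<and> (\<exists>g. has_weak_deriv f g)"

text \<open>A representative of the weak derivative, which is unique up to null sets.
  It is meaningful only for functions in \<open>W\<^sup>1\<^sup>,\<^sup>1\<^sub>l\<^sub>o\<^sub>c\<close>.\<close>

definition weak_deriv :: "(real \<Rightarrow> 'b::euclidean_space) \<Rightarrow> real \<Rightarrow> 'b" where
  "weak_deriv f = (SOME g. has_weak_deriv f g)"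

section \<open>Continuous parametrization\<close>

definition continuous_parametrization ::
  "((real^'d) \<times> real) set \<Rightarrow> (real \<times> real) set \<Rightarrow>
   (real \<Rightarrow> real) \<Rightarrow> (real \<Rightarrow> real^'d) \<Rightarrow> (real \<Rightarrow> real) \<Rightarrow> bool" where
  "continuous_parametrization AF AG U A a \<longleftrightarrow>
     (\<exists>L. L-lipschitz_on UNIV U) \<and> mono U \<and> range U = UNIV \<and> U 0 = 0 \<and>
     continuous_on UNIV A \<and> continuous_on UNIV a \<and>
     (\<forall>s. (A s, U s) \<in> AF \<and> (a s, U s) \<in> AG)"

section \<open>The indicator function of the kinetic formulation\<close>

definition chi :: "real \<Rightarrow> real \<Rightarrow> real" where
  "chi \<xi> v = (if 0 < \<xi> \<and> \<xi> < v then 1 else if v < \<xi> \<and> \<xi> < 0 then - 1 else 0)"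

text \<open>\<open>\<langle>g, \<partial>\<^sub>\<xi>\<chi>(\<xi>,v)\<rangle>\<close>, where the distributional derivative \<open>\<partial>\<^sub>\<xi>\<chi>(\<xi>,v)\<close> is the measure
  \<open>\<delta>\<^sub>0 - \<delta>\<^sub>v\<close> (see \<open>distributional_deriv_chi\<close> below).\<close>

definition pair_dchi :: "(real \<Rightarrow> real) \<Rightarrow> real \<Rightarrow> real" where
  "pair_dchi g v = g 0 - g v"

lemma smooth_deriv_real:
  fixes \<phi> :: "real \<Rightarrow> real"
  assumes "smooth \<phi>"
  shows "(\<phi> has_real_derivative deriv \<phi> x) (at x)" and "continuous_on UNIV (deriv \<phi>)"
proof -
  have "C_k (Suc 0) \<phi>"
    using assms unfolding smooth_def by blast
  then have diff: "\<phi> differentiable (at x)"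
    and cont: "continuous_on UNIV (\<lambda>x. frechet_derivative \<phi> (at x) 1)" for x
    by auto
  show D: "(\<phi> has_real_derivative deriv \<phi> x) (at x)" for x
    using diff[of x] DERIV_deriv_iff_real_differentiable by blast
  have "frechet_derivative \<phi> (at x) 1 = deriv \<phi> x" for x
  proof -
    have "(\<phi> has_derivative (*) (deriv \<phi> x)) (at x)"
      using D[of x] by (simp add: has_field_derivative_def)
    then have "(*) (deriv \<phi> x) = frechet_derivative \<phi> (at x)"
      by (rule frechet_derivative_at)
    then show ?thesis
      by (metis mult.right_neutral)
  qed
  then show "continuous_on UNIV (deriv \<phi>)"
    using cont by simp
qed

lemma distributional_deriv_chi:
  assumes "test_function UNIV \<phi>"
  shows "- (LINT \<xi>|lebesgue. chi \<xi> v * deriv \<phi> \<xi>) = pair_dchi \<phi> v"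
proof -
  have sm: "smooth \<phi>"
    using assms by (simp add: test_function_def)
  have m: "deriv \<phi> \<in> borel_measurable borel"
    using smooth_deriv_real(2)[OF sm] by (rule borel_measurable_continuous_onI)
  have FTC: "(LINT \<xi>|lebesgue. indicator {p..q} \<xi> *\<^sub>R deriv \<phi> \<xi>) = \<phi> q - \<phi> p" if "p \<le> q" for p q
  proof -
    have "(LINT \<xi>|lborel. indicator {p..q} \<xi> *\<^sub>R deriv \<phi> \<xi>) = \<phi> q - \<phi> p"
    proof (rule integral_FTC_Icc[OF that])
      show "(\<phi> has_vector_derivative deriv \<phi> x) (at x within {p..q})" for x
        using smooth_deriv_real(1)[OF sm, of x] has_vector_derivative_at_within
        by (auto simp: has_real_derivative_iff_has_vector_derivative)
      show "continuous_on {p..q} (deriv \<phi>)"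
        using smooth_deriv_real(2)[OF sm] continuous_on_subset by blast
    qed
    then show ?thesis
      using m by (subst integral_completion) auto
  qed
  have swap: "(LINT \<xi>|lebesgue. chi \<xi> v * deriv \<phi> \<xi>) = (LINT \<xi>|lebesgue. f \<xi>)"
    if "\<And>\<xi>. \<xi> \<noteq> 0 \<Longrightarrow> \<xi> \<noteq> v \<Longrightarrow> chi \<xi> v * deriv \<phi> \<xi> = f \<xi>"
      and "f \<in> borel_measurable lebesgue" for f
  proof (rule integral_cong_AE)
    show "(\<lambda>\<xi>. chi \<xi> v * deriv \<phi> \<xi>) \<in> borel_measurable lebesgue"
      unfolding chi_def by (intro measurable_completion) (use m in measurable)
    show "AE \<xi> in lebesgue. chi \<xi> v * deriv \<phi> \<xi> = f \<xi>"
      using that(1) by (intro AE_I'[of "{0, v}"]) auto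
  qed fact
  show ?thesis
  proof (cases "0 \<le> v")
    case True
    have "(LINT \<xi>|lebesgue. chi \<xi> v * deriv \<phi> \<xi>) = (LINT \<xi>|lebesgue. indicator {0..v} \<xi> *\<^sub>R deriv \<phi> \<xi>)"
      by (rule swap) (use True m in \<open>auto simp: chi_def indicator_def intro!: measurable_completion\<close>)
    then show ?thesis
      using FTC[OF True] by (simp add: pair_dchi_def)
  next
    case False
    have "(LINT \<xi>|lebesgue. chi \<xi> v * deriv \<phi> \<xi>) = (LINT \<xi>|lebesgue. - (indicator {v..0} \<xi> *\<^sub>R deriv \<phi> \<xi>))"
      by (rule swap) (use False m in \<open>auto simp: chi_def indicator_def intro!: measurable_completion\<close>)
    then show ?thesis
      using FTC[of v 0] False by (simp add: pair_dchi_def)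
  qed
qed

section \<open>The three notions of solution\<close>

definition solution_lift ::
  "(real \<Rightarrow> real) \<Rightarrow> (real^'d \<Rightarrow> real) \<Rightarrow> (real \<times> (real^'d) \<Rightarrow> real) \<Rightarrow>
   (real \<times> (real^'d) \<Rightarrow> real) \<Rightarrow> (real^'d \<Rightarrow> real) \<Rightarrow> bool" where
  "solution_lift U u\<^sub>0 u v v\<^sub>0 \<longleftrightarrow>
     v \<in> borel_measurable (lebesgue_on upper_half) \<and> v\<^sub>0 \<in> borel_measurable lebesgue \<and>
     (AE p in lebesgue_on upper_half. u p = U (v p)) \<and>
     (AE x in lebesgue. u\<^sub>0 x = U (v\<^sub>0 x))"

text \<open>The entropy flux \<open>Q\<^sub>f(s) = f(s) E'(s) - \<integral>\<^sub>0\<^sup>s f(t) E''(t) dt\<close>, an antiderivative of \<open>f' E'\<close>.\<close>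

definition entropy_flux ::
  "(real \<Rightarrow> real) \<Rightarrow> (real \<Rightarrow> 'b::euclidean_space) \<Rightarrow> real \<Rightarrow> 'b" where
  "entropy_flux E f s =
     deriv E s *\<^sub>R f s - (LBINT t=ereal 0..ereal s. deriv (deriv E) t *\<^sub>R f t)"

definition entropy_weak_solution ::
  "(real \<Rightarrow> real) \<Rightarrow> (real \<Rightarrow> real^'d) \<Rightarrow> (real \<Rightarrow> real) \<Rightarrow>
   (real^'d \<Rightarrow> real) \<Rightarrow> (real \<times> (real^'d) \<Rightarrow> real) \<Rightarrow> bool" where
  "entropy_weak_solution U A a u\<^sub>0 u \<longleftrightarrow>
     Linf_time_Linf_loc u \<and>
     (\<exists>v v\<^sub>0. solution_lift U u\<^sub>0 u v v\<^sub>0 \<and>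
       (\<forall>T>0. \<forall>E \<phi>.
          smooth E \<and> convex_on UNIV E \<and> test_function UNIV (deriv (deriv E)) \<and>
          test_function ({..<T} \<times> UNIV) \<phi> \<and> (\<forall>p. 0 \<le> \<phi> p) \<longrightarrow>
          (LINT p|lebesgue_on upper_half.
             entropy_flux E U (v p) * D_t \<phi> p + entropy_flux E A (v p) \<bullet> grad_x \<phi> p)
          \<ge> - (LINT p|lebesgue_on upper_half. a (v p) * deriv E (v p) * \<phi> p)
            - (LINT x|lebesgue. entropy_flux E U (v\<^sub>0 x) * \<phi> (0, x))))"

text \<open>Nonnegative Radon measures on the open set \<open>\<real>\<^sup>d\<^sup>+\<^sup>2\<^sub>+\<close>: Borel measures that are finite on its
  compact subsets.\<close>

definition kinetic_measure :: "(real \<times> (real^'d) \<times> real) measure \<Rightarrow> bool" where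
  "kinetic_measure m \<longleftrightarrow>
     sets m = sets (restrict_space borel upper_half) \<and>
     (\<forall>K. compact K \<and> K \<subseteq> upper_half \<longrightarrow> emeasure m K < \<infinity>)"

text \<open>Locally in \<open>(t,x)\<close> compactly supported in \<open>\<xi>\<close>. The compact sets \<open>K\<close> are taken in the full space
  \<open>\<real> \<times> \<real>\<^sup>d\<close>, so the bound on the support in \<open>\<xi>\<close> is uniform up to \<open>t = 0\<close>.\<close>

definition locally_xi_compactly_supported :: "(real \<times> (real^'d) \<times> real) measure \<Rightarrow> bool" where
  "locally_xi_compactly_supported m \<longleftrightarrow>
     (\<forall>K. compact K \<longrightarrow>
        (\<exists>C. compact C \<and> emeasure m {(t, x, \<xi>). 0 < t \<and> (t, x) \<in> K \<and> \<xi> \<notin> C} = 0))"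

text \<open>The test functions of the kinetic formulations need not vanish at \<open>t = 0\<close>, where a measure
  in the above class may have infinite mass. That \<open>\<langle>m, \<partial>\<^sub>\<xi>\<phi>\<rangle>\<close> is defined is part of the two
  definitions, hence the explicit integrability condition.\<close>

definition kinetic_solution_I ::
  "(real \<Rightarrow> real) \<Rightarrow> (real \<Rightarrow> real^'d) \<Rightarrow> (real \<Rightarrow> real) \<Rightarrow>
   (real^'d \<Rightarrow> real) \<Rightarrow> (real \<times> (real^'d) \<Rightarrow> real) \<Rightarrow> bool" where
  "kinetic_solution_I U A a u\<^sub>0 u \<longleftrightarrow>
     Linf_time_Linf_loc u \<and>
     (\<exists>v v\<^sub>0. solution_lift U u\<^sub>0 u v v\<^sub>0 \<and>
       (\<exists>m. kinetic_measure m \<and> locally_xi_compactly_supported m \<and>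
         (\<forall>\<phi>. test_function UNIV \<phi> \<longrightarrow>
            integrable m (D_xi \<phi>) \<and>
            (LINT q|m. D_xi \<phi> q) =
              (LINT (x, \<xi>)|lebesgue. weak_deriv U \<xi> * chi \<xi> (v\<^sub>0 x) * \<phi> (0, x, \<xi>))
              + (LINT (t, x, \<xi>)|lebesgue_on upper_half.
                   weak_deriv U \<xi> * chi \<xi> (v (t, x)) * D_t \<phi> (t, x, \<xi>)
                   + chi \<xi> (v (t, x)) * (weak_deriv A \<xi> \<bullet> kgrad_x \<phi> (t, x, \<xi>))
                   + weak_deriv a \<xi> * chi \<xi> (v (t, x)) * \<phi> (t, x, \<xi>)
                   + a \<xi> * chi \<xi> (v (t, x)) * D_xi \<phi> (t, x, \<xi>))
              + (LINT (t, x)|lebesgue_on upper_half. a 0 * \<phi> (t, x, 0)))))"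

definition kinetic_solution_II ::
  "(real \<Rightarrow> real) \<Rightarrow> (real \<Rightarrow> real^'d) \<Rightarrow> (real \<Rightarrow> real) \<Rightarrow>
   (real^'d \<Rightarrow> real) \<Rightarrow> (real \<times> (real^'d) \<Rightarrow> real) \<Rightarrow> bool" where
  "kinetic_solution_II U A a u\<^sub>0 u \<longleftrightarrow>
     Linf_time_Linf_loc u \<and>
     (\<exists>v v\<^sub>0. solution_lift U u\<^sub>0 u v v\<^sub>0 \<and>
       (\<exists>m. kinetic_measure m \<and> locally_xi_compactly_supported m \<and>
         (\<forall>\<phi>. test_function UNIV \<phi> \<longrightarrow>
            integrable m (D_xi \<phi>) \<and>
            (LINT q|m. D_xi \<phi> q) =
              - (LINT (x, \<xi>)|lebesgue. U \<xi> * chi \<xi> (v\<^sub>0 x) * D_xi \<phi> (0, x, \<xi>))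
              - (LINT x|lebesgue. pair_dchi (\<lambda>\<xi>. U \<xi> * \<phi> (0, x, \<xi>)) (v\<^sub>0 x))
              - (LINT (t, x, \<xi>)|lebesgue_on upper_half.
                   U \<xi> * chi \<xi> (v (t, x)) * D_t (D_xi \<phi>) (t, x, \<xi>))
              - (LINT (t, x)|lebesgue_on upper_half.
                   pair_dchi (\<lambda>\<xi>. U \<xi> * D_t \<phi> (t, x, \<xi>)) (v (t, x)))
              - (LINT (t, x, \<xi>)|lebesgue_on upper_half.
                   chi \<xi> (v (t, x)) * (A \<xi> \<bullet> kgrad_x (D_xi \<phi>) (t, x, \<xi>)))
              - (LINT (t, x)|lebesgue_on upper_half.
                   pair_dchi (\<lambda>\<xi>. A \<xi> \<bullet> kgrad_x \<phi> (t, x, \<xi>)) (v (t, x)))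
              + (LINT (t, x)|lebesgue_on upper_half.
                   a 0 * \<phi> (t, x, 0) - pair_dchi (\<lambda>\<xi>. a \<xi> * \<phi> (t, x, \<xi>)) (v (t, x))))))"

end

theory Submission
  imports Defs
begin

text \<open>Fix a lift \<open>v\<close>, \<open>v\<^sub>0\<close>; it is locally bounded because \<open>U\<close> is monotone and onto. Integration by
  parts in \<open>\<xi>\<close> turns the right-hand sides of both kinetic formulations into \<open>T (\<partial>\<^sub>\<xi> \<phi>)\<close> for one and the
  same distribution \<open>T\<close>, whose coefficients are the fluxes of the Kruzhkov entropies
  \<open>max 0 (\<xi> - k)\<close> evaluated at \<open>v\<close>, and on a tensor product \<open>E'' \<otimes> \<phi>\<close> the value of \<open>T\<close> is the entropy
  production of \<open>E\<close> tested with \<open>\<phi>\<close>. Hence a kinetic solution satisfies the entropy inequalities: test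
  with \<open>\<phi> E'\<close>, cut off in \<open>\<xi>\<close> outside the range of \<open>v\<close> and the support of \<open>m\<close>.

  Conversely, the entropy inequalities make \<open>T\<close> nonnegative on tensor products, hence, by a partition of
  unity in \<open>\<xi>\<close>, on all nonnegative test functions, and Riesz's theorem represents it by a Radon measure
  on the whole space. Outside the range of \<open>v\<close> the entropies are affine and their production vanishes,
  which bounds the support in \<open>\<xi>\<close>. The measure does not charge \<open>t = 0\<close>: the affine entropies
  \<open>E(\<xi>) = \<plusminus>\<xi>\<close> show that \<open>U(v(t))\<close> tends weakly to \<open>U(v\<^sub>0)\<close> as \<open>t\<close> tends to \<open>0\<close>, and an entropy is a
  convex function of \<open>U\<close>, so that it cannot drop in the limit.\<close>

section \<open>Calculus of smooth functions, cutoffs and test functions\<close>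

section \<open>Smooth functions\<close>

text \<open>Both kinetic formulations see the measure only through \<open>D_xi \<phi>\<close>, and
  no nonzero nonnegative test function has this form, whereas Riesz's theorem wants a functional on
  all test functions. The way out is that T takes no \<xi>-derivative of its argument: it extends at
  once, and entropies are recovered with E' normalized to vanish near minus infinity. The constant
  lost by this normalization is free, because an affine entropy and its negative are both
  admissible, so their production is 0.

  Test functions do not vanish at t = 0, so mass of the Riesz measure on the initial hyperplane
  would be a genuine error term. Only weak convergence of U(v) to U(\<open>v\<^sub>0\<close>) is at
  hand; it is enough because the subgradient inequality is used at \<open>v\<^sub>0\<close>, whose
  slope E'(\<open>v\<^sub>0\<close>) is independent of t and serves as a fixed integrable weight.

  U may have flat pieces, so u does not determine v. All three notions are therefore compared for
  one and the same lift, after replacing it by a Borel representative that is bounded at every point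
  of each compact set.\<close>

lemma C_k_SucI:
  assumes "\<And>x. (f has_derivative f' x) (at x)" and "\<And>h. C_k k (\<lambda>x. f' x h)"
  shows "C_k (Suc k) f"
proof -
  have "frechet_derivative f (at x) = f' x" for x
    using frechet_derivative_at[OF assms(1)] by simp
  then show ?thesis
    using assms by (auto simp: differentiable_def)
qed

lemma C_k_Suc_has_derivative:
  "C_k (Suc k) f \<Longrightarrow> (f has_derivative frechet_derivative f (at x)) (at x)"
  by (simp add: frechet_derivative_works)

text \<open>\<open>C_k (Suc k)\<close> asks for differentiability and regular directional
  derivatives but does not list continuity of the function itself; that comes back from
  differentiability, in the base case.\<close>

lemma C_k_Suc_imp: "C_k (Suc k) f \<Longrightarrow> C_k k f"
proof (induction k arbitrary: f)
  case 0
  then show ?case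
    by (auto intro!: continuous_at_imp_continuous_on differentiable_imp_continuous_within)
qed auto

lemma C_k_imp_continuous: "C_k k f \<Longrightarrow> continuous_on UNIV f"
  by (induction k) (use C_k_Suc_imp in \<open>auto simp del: C_k.simps(2)\<close>)

lemma C_k_const: "C_k k (\<lambda>x. c)"
proof (induction k arbitrary: c)
  case (Suc k)
  show ?case by (rule C_k_SucI[where f'="\<lambda>x h. 0"]) (auto intro: Suc)
qed auto

lemma C_k_linear:
  assumes "bounded_linear l"
  shows "C_k k l"
proof (cases k)
  case 0
  then show ?thesis
    using assms by (simp add: linear_continuous_on)
next
  case (Suc n)
  show ?thesis unfolding Suc
    by (rule C_k_SucI[where f'="\<lambda>x. l"]) (use assms bounded_linear_imp_has_derivative C_k_const in auto)
qed

lemma C_k_add: "C_k k f \<Longrightarrow> C_k k g \<Longrightarrow> C_k k (\<lambda>x. f x + g x)"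
proof (induction k arbitrary: f g)
  case (Suc k)
  show ?case
    by (rule C_k_SucI[where f'="\<lambda>x h. frechet_derivative f (at x) h + frechet_derivative g (at x) h"])
       (use Suc C_k_Suc_has_derivative in \<open>auto intro!: has_derivative_add Suc.IH simp: frechet_derivative_works[symmetric]\<close>)
qed (auto intro: continuous_intros)

lemma C_k_mult: "C_k k f \<Longrightarrow> C_k k g \<Longrightarrow> C_k k (\<lambda>x. f x * g x)"
proof (induction k arbitrary: f g)
  case (Suc k)
  have *: "C_k k f" "C_k k g" using C_k_Suc_imp[OF Suc.prems(1)] C_k_Suc_imp[OF Suc.prems(2)] by auto
  show ?case
  proof (rule C_k_SucI[where f'="\<lambda>x h. f x * frechet_derivative g (at x) h + frechet_derivative f (at x) h * g x"])
    show "((\<lambda>x. f x * g x) has_derivative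
        (\<lambda>h. f x * frechet_derivative g (at x) h + frechet_derivative f (at x) h * g x)) (at x)" for x
      by (intro has_derivative_mult C_k_Suc_has_derivative[OF Suc.prems(1)] C_k_Suc_has_derivative[OF Suc.prems(2)])
    show "C_k k (\<lambda>x. f x * frechet_derivative g (at x) h + frechet_derivative f (at x) h * g x)" for h
      using * Suc.prems by (intro C_k_add Suc.IH) simp_all
  qed
qed (auto intro: continuous_intros)

lemma C_k_compose_affine:
  assumes "bounded_linear l"
  shows "C_k k f \<Longrightarrow> C_k k (\<lambda>x. f (c + l x))"
proof (induction k arbitrary: f)
  case 0
  then show ?case
    using continuous_on_compose2[of UNIV f UNIV "\<lambda>x. c + l x"] linear_continuous_on[OF assms]
    by (simp add: continuous_on_add)
next
  case (Suc k)
  show ?case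
  proof (rule C_k_SucI[where f'="\<lambda>x h. frechet_derivative f (at (c + l x)) (l h)"])
    show "((\<lambda>x. f (c + l x)) has_derivative (\<lambda>h. frechet_derivative f (at (c + l x)) (l h))) (at x)" for x
      by (rule has_derivative_compose[of "\<lambda>x. c + l x" l x UNIV f])
         (use assms Suc.prems in \<open>auto intro!: derivative_eq_intros bounded_linear_imp_has_derivative C_k_Suc_has_derivative\<close>)
    show "C_k k (\<lambda>x. frechet_derivative f (at (c + l x)) (l h))" for h
      using Suc by auto
  qed
qed

lemma frechet_derivative_real:
  fixes g :: "real \<Rightarrow> real"
  assumes "g differentiable (at y)"
  shows "frechet_derivative g (at y) h = deriv g y * h"
proof -
  have "(g has_derivative (*) (deriv g y)) (at y)"
    using assms DERIV_deriv_iff_real_differentiable has_field_derivative_def by blast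
  then show ?thesis
    using frechet_derivative_at by metis
qed

lemma C_k_compose_real:
  fixes g :: "real \<Rightarrow> real"
  shows "C_k k g \<Longrightarrow> C_k k f \<Longrightarrow> C_k k (\<lambda>x. g (f x))"
proof (induction k arbitrary: f g)
  case 0
  then show ?case by (auto intro: continuous_on_compose2[of UNIV g])
next
  case (Suc k)
  have *: "C_k k f" using Suc.prems C_k_Suc_imp by blast
  have d: "C_k k (deriv g)"
  proof -
    have "C_k k (\<lambda>x. frechet_derivative g (at x) 1)" using Suc.prems by simp
    moreover have "(\<lambda>x. frechet_derivative g (at x) 1) = deriv g"
      using Suc.prems frechet_derivative_real[of g _ 1] by auto
    ultimately show ?thesis by simp
  qed
  show ?case
  proof (rule C_k_SucI[where f'="\<lambda>x h. deriv g (f x) * frechet_derivative f (at x) h"])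
    show "((\<lambda>x. g (f x)) has_derivative (\<lambda>h. deriv g (f x) * frechet_derivative f (at x) h)) (at x)" for x
    proof -
      have "(g has_derivative (*) (deriv g (f x))) (at (f x))"
        using Suc.prems(1) DERIV_deriv_iff_real_differentiable[of g "f x"]
        by (simp add: has_field_derivative_def)
      from has_derivative_compose[OF C_k_Suc_has_derivative[OF Suc.prems(2)] this] show ?thesis .
    qed
    show "C_k k (\<lambda>x. deriv g (f x) * frechet_derivative f (at x) h)" for h
    proof (rule C_k_mult)
      show "C_k k (\<lambda>x. deriv g (f x))" by (rule Suc.IH[OF d *])
      show "C_k k (\<lambda>x. frechet_derivative f (at x) h)" using Suc.prems(2) by simp
    qed
  qed
qed

lemma smooth_C_k: "smooth f \<Longrightarrow> C_k k f"
  by (simp add: smooth_def)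

lemma smooth_continuous: "smooth f \<Longrightarrow> continuous_on UNIV f"
  using C_k_imp_continuous smooth_C_k by blast

lemma smooth_has_derivative: "smooth f \<Longrightarrow> (f has_derivative frechet_derivative f (at x)) (at x)"
  using C_k_Suc_has_derivative smooth_C_k by blast

lemma smooth_frechet: "smooth f \<Longrightarrow> smooth (\<lambda>x. frechet_derivative f (at x) h)"
  unfolding smooth_def using C_k.simps(2) by blast

lemma smooth_const [simp, intro]: "smooth (\<lambda>x. c)"
  by (simp add: smooth_def C_k_const)

lemma smooth_linear: "bounded_linear l \<Longrightarrow> smooth l"
  by (simp add: smooth_def C_k_linear)

lemma smooth_add: "smooth f \<Longrightarrow> smooth g \<Longrightarrow> smooth (\<lambda>x. f x + g x)"
  by (simp add: smooth_def C_k_add)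

lemma smooth_mult: "smooth f \<Longrightarrow> smooth g \<Longrightarrow> smooth (\<lambda>x. f x * g x)"
  by (simp add: smooth_def C_k_mult)

lemma smooth_cmult: "smooth f \<Longrightarrow> smooth (\<lambda>x. c * f x)"
  by (intro smooth_mult smooth_const)

lemma smooth_diff: "smooth f \<Longrightarrow> smooth g \<Longrightarrow> smooth (\<lambda>x. f x - g x)"
  using smooth_add[of f "\<lambda>x. (-1) * g x"] smooth_cmult[of g "-1"] by simp

lemma smooth_sum: "(\<And>i. i \<in> I \<Longrightarrow> smooth (f i)) \<Longrightarrow> smooth (\<lambda>x. \<Sum>i\<in>I. f i x)"
  by (induction I rule: infinite_finite_induct) (auto intro: smooth_add)

lemma smooth_compose_affine: "smooth f \<Longrightarrow> bounded_linear l \<Longrightarrow> smooth (\<lambda>x. f (c + l x))"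
  by (simp add: smooth_def C_k_compose_affine)

lemma smooth_compose_linear: "smooth f \<Longrightarrow> bounded_linear l \<Longrightarrow> smooth (\<lambda>x. f (l x))"
  using smooth_compose_affine[of f l 0] by simp

lemma smooth_compose_real: "smooth (g :: real \<Rightarrow> real) \<Longrightarrow> smooth f \<Longrightarrow> smooth (\<lambda>x. g (f x))"
  by (simp add: smooth_def C_k_compose_real)

lemma smooth_deriv: "smooth (f :: real \<Rightarrow> real) \<Longrightarrow> smooth (deriv f)"
  using smooth_frechet[of f 1] frechet_derivative_real[of f _ 1] smooth_has_derivative[of f]
  by (simp add: differentiable_def) (metis (no_types, lifting) ext)

text \<open>Entropies are built from their derivatives, so smoothness has to pass from a derivative
  to its primitive.\<close>

lemma smooth_antiderivative:
  fixes F f :: "real \<Rightarrow> real"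
  assumes "\<And>x. (F has_real_derivative f x) (at x)" and "smooth f"
  shows "smooth F"
  unfolding smooth_def
proof
  fix k
  show "C_k k F"
  proof (rule C_k_Suc_imp, rule C_k_SucI)
    show "(F has_derivative (*) (f x)) (at x)" for x
      using assms(1) by (simp add: has_field_derivative_def)
    show "C_k k (\<lambda>x. f x * h)" for h
      using assms(2) by (simp add: smooth_C_k C_k_mult C_k_const)
  qed
qed

lemma smooth_dist_square: "smooth (\<lambda>x::'a::euclidean_space. (x - a) \<bullet> (x - a))"
proof -
  have "smooth (\<lambda>x. (-(a \<bullet> b) + x \<bullet> b) * (-(a \<bullet> b) + x \<bullet> b))" for b :: 'a
    by (intro smooth_mult smooth_add smooth_const smooth_linear bounded_linear_inner_left)
  then have "smooth (\<lambda>x. \<Sum>b\<in>Basis. (-(a \<bullet> b) + x \<bullet> b) * (-(a \<bullet> b) + x \<bullet> b))"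
    by (rule smooth_sum)
  moreover have "(x - a) \<bullet> (x - a) = (\<Sum>b\<in>Basis. (-(a \<bullet> b) + x \<bullet> b) * (-(a \<bullet> b) + x \<bullet> b))" for x
    by (subst euclidean_inner) (simp add: inner_diff_left algebra_simps)
  ultimately show ?thesis by simp
qed

text \<open>The second difference of f over the parallelogram spanned by multiples e h and e k is
  symmetric in h and k. Two applications of the mean value theorem express it through either mixed
  derivative at a nearby point, and continuity of both lets e tend to 0.\<close>

lemma schwarz_mixed_derivative:
  fixes f :: "'a::euclidean_space \<Rightarrow> real"
  assumes "smooth f"
  shows "frechet_derivative (\<lambda>y. frechet_derivative f (at y) h) (at x) k =
         frechet_derivative (\<lambda>y. frechet_derivative f (at y) k) (at x) h"
proof -
  define D where "D h y = frechet_derivative f (at y) h" for h y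
  define D2 where "D2 h k y = frechet_derivative (D h) (at y) k" for h k y
  have smD: "smooth (D h)" for h unfolding D_def by (rule smooth_frechet[OF assms])
  have cD2: "continuous_on UNIV (D2 h k)" for h k
    unfolding D2_def by (rule smooth_continuous[OF smooth_frechet[OF smD]])
  have line: "((\<lambda>s. g (y + s *\<^sub>R w)) has_real_derivative frechet_derivative g (at (y + s *\<^sub>R w)) w) (at s)"
    if "smooth g" for g :: "'a \<Rightarrow> real" and y w s
  proof -
    have "((\<lambda>s. g (y + s *\<^sub>R w)) has_derivative (\<lambda>r. frechet_derivative g (at (y + s *\<^sub>R w)) (r *\<^sub>R w))) (at s)"
      by (rule has_derivative_compose[OF _ smooth_has_derivative[OF that]]) (auto intro!: derivative_eq_intros)
    moreover have "frechet_derivative g (at (y + s *\<^sub>R w)) (r *\<^sub>R w) = frechet_derivative g (at (y + s *\<^sub>R w)) w * r" for r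
      using linear_cmul[OF has_derivative_linear[OF smooth_has_derivative[OF that]]] by simp
    ultimately show ?thesis by (simp add: has_field_derivative_def)
  qed
  have key: "\<exists>s r. 0 < s \<and> s < e \<and> 0 < r \<and> r < e \<and>
      f (x + e *\<^sub>R h + e *\<^sub>R k) - f (x + e *\<^sub>R h) - f (x + e *\<^sub>R k) + f x = e * e * D2 h k (x + s *\<^sub>R h + r *\<^sub>R k)"
    if e: "0 < e" for e :: real and h k
  proof -
    \<comment> \<open>Mean value theorem along h for this increment in the direction e k; a second
      application, along k, then acts on \<open>D h\<close>.\<close>
    define G where "G s = f ((x + e *\<^sub>R k) + s *\<^sub>R h) - f (x + s *\<^sub>R h)" for s
    have "(G has_real_derivative (D h ((x + e *\<^sub>R k) + s *\<^sub>R h) - D h (x + s *\<^sub>R h))) (at s)" for s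
      unfolding G_def D_def by (intro DERIV_diff line assms)
    from MVT2[OF e this] obtain s where s: "0 < s" "s < e"
      "G e - G 0 = (e - 0) * (D h ((x + e *\<^sub>R k) + s *\<^sub>R h) - D h (x + s *\<^sub>R h))" by blast
    have "((\<lambda>r. D h ((x + s *\<^sub>R h) + r *\<^sub>R k)) has_real_derivative D2 h k ((x + s *\<^sub>R h) + r *\<^sub>R k)) (at r)" for r
      unfolding D2_def by (rule line[OF smD])
    from MVT2[OF e this] obtain r where r: "0 < r" "r < e"
      "D h ((x + s *\<^sub>R h) + e *\<^sub>R k) - D h ((x + s *\<^sub>R h) + 0 *\<^sub>R k) = (e - 0) * D2 h k ((x + s *\<^sub>R h) + r *\<^sub>R k)" by blast
    show ?thesis
      by (rule exI[of _ s], rule exI[of _ r]) (use s r in \<open>simp add: G_def algebra_simps\<close>)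
  qed
  have lim: "(\<lambda>n. D2 h k (x + s n *\<^sub>R h + r n *\<^sub>R k)) \<longlonglongrightarrow> D2 h k x"
    if "\<And>n. 0 < s n \<and> s n < inverse (real (Suc n))" "\<And>n. 0 < r n \<and> r n < inverse (real (Suc n))" for s r h k h' k'
  proof -
    have "s \<longlonglongrightarrow> 0" "r \<longlonglongrightarrow> 0"
      using that by (auto intro!: real_tendsto_sandwich[OF _ _ tendsto_const LIMSEQ_inverse_real_of_nat] always_eventually less_imp_le)
    then have "(\<lambda>n. x + s n *\<^sub>R h + r n *\<^sub>R k) \<longlonglongrightarrow> x + 0 *\<^sub>R h + 0 *\<^sub>R k"
      by (intro tendsto_intros)
    then show ?thesis
      using cD2[of h k] by (auto simp: continuous_on_eq_continuous_at intro: isCont_tendsto_compose[where g="D2 h k"])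
  qed
  have lim': "(\<lambda>n. D2 h k (x + r n *\<^sub>R k + s n *\<^sub>R h)) \<longlonglongrightarrow> D2 h k x"
    if "\<And>n. 0 < s n \<and> s n < inverse (real (Suc n))" "\<And>n. 0 < r n \<and> r n < inverse (real (Suc n))" for s r h k
    using lim[OF that, of h k] by (simp add: algebra_simps)
  have "\<forall>n. \<exists>s r. 0 < s \<and> s < inverse (real (Suc n)) \<and> 0 < r \<and> r < inverse (real (Suc n)) \<and>
     f (x + inverse (real (Suc n)) *\<^sub>R h + inverse (real (Suc n)) *\<^sub>R k) - f (x + inverse (real (Suc n)) *\<^sub>R h) - f (x + inverse (real (Suc n)) *\<^sub>R k) + f x
      = inverse (real (Suc n)) * inverse (real (Suc n)) * D2 h k (x + s *\<^sub>R h + r *\<^sub>R k)"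
    by (intro allI key) simp
  then obtain s r where sr: "\<And>n. 0 < s n \<and> s n < inverse (real (Suc n))" "\<And>n. 0 < r n \<and> r n < inverse (real (Suc n))"
    "\<And>n. f (x + inverse (real (Suc n)) *\<^sub>R h + inverse (real (Suc n)) *\<^sub>R k) - f (x + inverse (real (Suc n)) *\<^sub>R h) - f (x + inverse (real (Suc n)) *\<^sub>R k) + f x
      = inverse (real (Suc n)) * inverse (real (Suc n)) * D2 h k (x + s n *\<^sub>R h + r n *\<^sub>R k)"
    by metis
  have "\<forall>n. \<exists>s r. 0 < s \<and> s < inverse (real (Suc n)) \<and> 0 < r \<and> r < inverse (real (Suc n)) \<and>
     f (x + inverse (real (Suc n)) *\<^sub>R k + inverse (real (Suc n)) *\<^sub>R h) - f (x + inverse (real (Suc n)) *\<^sub>R k) - f (x + inverse (real (Suc n)) *\<^sub>R h) + f x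
      = inverse (real (Suc n)) * inverse (real (Suc n)) * D2 k h (x + s *\<^sub>R k + r *\<^sub>R h)"
    by (intro allI key) simp
  then obtain s' r' where sr': "\<And>n. 0 < s' n \<and> s' n < inverse (real (Suc n))" "\<And>n. 0 < r' n \<and> r' n < inverse (real (Suc n))"
    "\<And>n. f (x + inverse (real (Suc n)) *\<^sub>R k + inverse (real (Suc n)) *\<^sub>R h) - f (x + inverse (real (Suc n)) *\<^sub>R k) - f (x + inverse (real (Suc n)) *\<^sub>R h) + f x
      = inverse (real (Suc n)) * inverse (real (Suc n)) * D2 k h (x + s' n *\<^sub>R k + r' n *\<^sub>R h)"
    by metis
  have "D2 h k (x + s n *\<^sub>R h + r n *\<^sub>R k) = D2 k h (x + s' n *\<^sub>R k + r' n *\<^sub>R h)" for n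
  proof -
    let ?e = "inverse (real (Suc n))"
    have "?e * ?e * D2 h k (x + s n *\<^sub>R h + r n *\<^sub>R k) = ?e * ?e * D2 k h (x + s' n *\<^sub>R k + r' n *\<^sub>R h)"
      unfolding sr(3)[symmetric] sr'(3)[symmetric] by (simp add: algebra_simps)
    moreover have "?e * ?e \<noteq> 0" by simp
    ultimately show ?thesis using mult_left_cancel by blast
  qed
  then have "(\<lambda>n. D2 h k (x + s n *\<^sub>R h + r n *\<^sub>R k)) \<longlonglongrightarrow> D2 k h x"
    using lim[OF sr'(1,2), of k h] by simp
  with lim[OF sr(1,2), of h k] have "D2 h k x = D2 k h x"
    using LIMSEQ_unique by blast
  then show ?thesis by (simp add: D2_def D_def[abs_def])
qed

section \<open>Smooth cutoffs\<close>

text \<open>The derivatives of exp(-1/x), extended by 0, are combinations of these functions.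
  Carrying the power n as a parameter makes the family closed under differentiation up to linear
  combinations, so smoothness of all members is one induction.\<close>

definition flat_exp :: "nat \<Rightarrow> real \<Rightarrow> real" where
  "flat_exp n x = (if x \<le> 0 then 0 else inverse x ^ n * exp (- inverse x))"

lemma flat_exp_tendsto: "(flat_exp n \<longlongrightarrow> 0) (at 0)"
proof -
  have "((\<lambda>x. inverse x ^ n / exp (inverse x)) \<longlongrightarrow> 0) (at_right (0::real))"
    using filterlim_compose[OF tendsto_power_div_exp_0 filterlim_inverse_at_top_right] .
  then have "(flat_exp n \<longlongrightarrow> 0) (at_right 0)"
    by (rule tendsto_cong[THEN iffD1, rotated])
       (auto simp: flat_exp_def eventually_at_right_less exp_minus divide_inverse intro!: eventually_at_rightI[of 0 1])
  moreover have "(flat_exp n \<longlongrightarrow> 0) (at_left 0)"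
    by (rule tendsto_cong[THEN iffD1, OF _ tendsto_const])
       (auto simp: flat_exp_def intro!: eventually_at_leftI[of "-1" 0])
  ultimately show ?thesis
    using filterlim_at_split by blast
qed

lemma flat_exp_deriv:
  "(flat_exp n has_real_derivative (flat_exp (n+2) x - real n * flat_exp (n+1) x)) (at x)"
proof -
  consider "x < 0" | "x = 0" | "x > 0" by linarith
  then show ?thesis
  proof cases
    case 1
    have "((\<lambda>x. 0) has_real_derivative 0) (at x)" by simp
    then have "(flat_exp n has_real_derivative 0) (at x)"
      by (rule has_field_derivative_transform_within_open[of _ _ _ "{..<0}"]) (use 1 in \<open>auto simp: flat_exp_def\<close>)
    then show ?thesis using 1 by (simp add: flat_exp_def)
  next
    case 2
    \<comment> \<open>For y different from 0 the difference quotient at 0 is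
      \<open>flat_exp (Suc n) y\<close>.\<close>
    have "((\<lambda>y. (flat_exp n y - flat_exp n 0) / (y - 0)) \<longlongrightarrow> 0) (at 0)"
      by (rule tendsto_cong[THEN iffD1, OF _ flat_exp_tendsto[of "Suc n"]])
         (auto simp: flat_exp_def eventually_at_filter divide_inverse)
    then show ?thesis using 2 by (simp add: has_field_derivative_iff flat_exp_def)
  next
    case 3
    have i: "(inverse has_real_derivative - (inverse x * inverse x)) (at x)"
      using 3 by (auto intro!: derivative_eq_intros)
    have "((\<lambda>x. inverse x ^ n * exp (- inverse x)) has_real_derivative
        (real n * (- (inverse x * inverse x) * inverse x ^ (n - Suc 0)) * exp (- inverse x)
          + exp (- inverse x) * - (- (inverse x * inverse x)) * inverse x ^ n)) (at x)"
      by (intro DERIV_mult DERIV_power i DERIV_fun_exp DERIV_minus)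
    also have "real n * (- (inverse x * inverse x) * inverse x ^ (n - Suc 0)) * exp (- inverse x)
          + exp (- inverse x) * - (- (inverse x * inverse x)) * inverse x ^ n =
        inverse x ^ (n+2) * exp (- inverse x) - real n * (inverse x ^ (n+1) * exp (- inverse x))"
      by (cases n) (simp_all add: algebra_simps)
    finally have "((\<lambda>x. inverse x ^ n * exp (- inverse x)) has_real_derivative
        (inverse x ^ (n+2) * exp (- inverse x) - real n * (inverse x ^ (n+1) * exp (- inverse x)))) (at x)" .
    then have "(flat_exp n has_real_derivative
        (inverse x ^ (n+2) * exp (- inverse x) - real n * (inverse x ^ (n+1) * exp (- inverse x)))) (at x)"
      by (rule has_field_derivative_transform_within_open[of _ _ _ "{0<..}"]) (use 3 in \<open>auto simp: flat_exp_def\<close>)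
    then show ?thesis using 3 by (simp add: flat_exp_def)
  qed
qed

lemma smooth_flat_exp: "smooth (flat_exp n)"
  unfolding smooth_def
proof
  fix k show "C_k k (flat_exp n)"
  proof (induction k arbitrary: n)
    case 0
    show ?case
      using DERIV_isCont[OF flat_exp_deriv] by (auto intro!: continuous_at_imp_continuous_on)
  next
    case (Suc k)
    show ?case
    proof (rule C_k_SucI)
      show "(flat_exp n has_derivative (*) (flat_exp (n+2) x - real n * flat_exp (n+1) x)) (at x)" for x
        using flat_exp_deriv by (simp add: has_field_derivative_def)
      have "C_k k (\<lambda>x. (flat_exp (n+2) x + (- real n) * flat_exp (n+1) x) * h)" for h
        by (intro C_k_mult C_k_add Suc.IH C_k_const)
      then show "C_k k (\<lambda>x. (flat_exp (n+2) x - real n * flat_exp (n+1) x) * h)" for h by simp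
    qed
  qed
qed

lemma flat_exp_nonneg: "0 \<le> flat_exp n x" and flat_exp_0_pos_iff: "0 < flat_exp 0 x \<longleftrightarrow> 0 < x"
  by (auto simp: flat_exp_def)

lemma continuous_antiderivative:
  fixes f :: "real \<Rightarrow> real"
  assumes "continuous_on UNIV f"
  obtains F where "\<And>x. (F has_real_derivative f x) (at x)" "F 0 = 0"
proof -
  obtain F where F: "\<And>x. (F has_vector_derivative f x) (at x)"
    using einterval_antiderivative[of "-\<infinity>" \<infinity> f] assms
    by (auto simp: continuous_on_eq_continuous_at)
  show ?thesis
    by (rule that[of "\<lambda>x. F x - F 0"])
       (auto simp: has_real_derivative_iff_has_vector_derivative intro!: derivative_eq_intros F)
qed

text \<open>A primitive of a bump living on [0,1], divided by its total mass.\<close>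

lemma smooth_step_exists:
  "\<exists>S :: real \<Rightarrow> real. smooth S \<and> (\<forall>x\<le>0. S x = 0) \<and> (\<forall>x\<ge>1. S x = 1) \<and> mono S"
proof -
  define b where "b x = flat_exp 0 x * flat_exp 0 (1 + (-1) * x)" for x
  have sb: "smooth b"
    unfolding b_def by (intro smooth_mult smooth_compose_affine smooth_flat_exp bounded_linear_mult_right)
  obtain F where F: "\<And>x. (F has_real_derivative b x) (at x)" "F 0 = 0"
    using continuous_antiderivative[OF smooth_continuous[OF sb]] by blast
  have b0: "0 \<le> b x" for x by (simp add: b_def flat_exp_nonneg)
  have bz: "b x = 0" if "x \<le> 0 \<or> 1 \<le> x" for x using that by (auto simp: b_def flat_exp_def)
  have mono: "F x \<le> F y" if "x \<le> y" for x y
    using DERIV_nonneg_imp_nondecreasing[OF that] F(1) b0 by meson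
  have const: "F x = F y" if "x \<le> y" "\<And>z. z \<in> {x..y} \<Longrightarrow> b z = 0" for x y
  proof -
    have "F y \<le> F x"
      by (rule DERIV_nonpos_imp_nonincreasing[OF that(1)]) (use F(1) that(2) in force)
    then show ?thesis using mono[OF that(1)] by simp
  qed
  have le0: "F x = F 0" if "x \<le> 0" for x
    by (rule const[OF that]) (auto simp: bz)
  have ge1: "F x = F 1" if "1 \<le> x" for x
    by (rule const[OF that, symmetric]) (auto simp: bz)
  \<comment> \<open>Zero mass would make F constant on (0,1), against b(1/2) > 0.\<close>
  have pos: "0 < F 1"
  proof (rule ccontr)
    assume "\<not> 0 < F 1"
    then have "F x = 0" if "x \<in> {0<..<1}" for x
      using mono[of 0 x] mono[of x 1] F(2) that by auto
    then have "((\<lambda>x. 0) has_real_derivative b (1/2)) (at (1/2))"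
      by (intro has_field_derivative_transform_within_open[OF F(1)[of "1/2"], of "{0<..<1}"]) auto
    then have "b (1/2) = 0" using DERIV_unique DERIV_const by blast
    then show False by (simp add: b_def flat_exp_def)
  qed
  show ?thesis
  proof (intro exI[of _ "\<lambda>x. inverse (F 1) * F x"] conjI allI impI)
    show "smooth (\<lambda>x. inverse (F 1) * F x)"
      by (intro smooth_cmult smooth_antiderivative[OF F(1) sb])
    show "mono (\<lambda>x. inverse (F 1) * F x)"
      using mono pos by (auto intro!: monoI mult_left_mono)
    show "inverse (F 1) * F x = 0" if "x \<le> 0" for x using le0[OF that] F(2) by simp
    show "inverse (F 1) * F x = 1" if "1 \<le> x" for x using ge1[OF that] pos by simp
  qed
qed

definition smooth_step :: "real \<Rightarrow> real" where
  "smooth_step = (SOME S. smooth S \<and> (\<forall>x\<le>0. S x = 0) \<and> (\<forall>x\<ge>1. S x = 1) \<and> mono S)"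

lemma smooth_step:
  shows smooth_smooth_step: "smooth smooth_step"
    and smooth_step_eq_0: "x \<le> 0 \<Longrightarrow> smooth_step x = 0"
    and smooth_step_eq_1: "1 \<le> x \<Longrightarrow> smooth_step x = 1"
    and mono_smooth_step: "mono smooth_step"
proof -
  from someI_ex[OF smooth_step_exists, folded smooth_step_def] show "smooth smooth_step" "x \<le> 0 \<Longrightarrow> smooth_step x = 0" "1 \<le> x \<Longrightarrow> smooth_step x = 1" "mono smooth_step"
    by simp_all
qed

lemma smooth_step_bounds: "0 \<le> smooth_step x" "smooth_step x \<le> 1"
  using monoD[OF mono_smooth_step, of "min x 0" x] monoD[OF mono_smooth_step, of x "max x 1"]
    smooth_step_eq_0[of "min x 0"] smooth_step_eq_1[of "max x 1"] by auto

section \<open>Test functions\<close>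

text \<open>Any compact set outside which f vanishes will do, so that closures of supports never
  have to be computed.\<close>

lemma test_functionI:
  assumes "smooth f" "compact K" "K \<subseteq> \<Omega>" "\<And>x. x \<notin> K \<Longrightarrow> f x = 0"
  shows "test_function \<Omega> f"
proof -
  have "closure {x. f x \<noteq> 0} \<subseteq> K"
    using assms by (intro closure_minimal) (auto simp: compact_imp_closed)
  moreover from this have "compact (closure {x. f x \<noteq> 0})"
    using compact_Int_closed[OF assms(2), of "closure {x. f x \<noteq> 0}"] by (simp add: Int_absorb1)
  ultimately show ?thesis
    using assms by (auto simp: test_function_def)
qed

lemma test_functionE:
  assumes "test_function \<Omega> f"
  obtains K where "smooth f" "compact K" "K \<subseteq> \<Omega>" "\<And>x. x \<notin> K \<Longrightarrow> f x = 0"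
  using assms closure_subset[of "{x. f x \<noteq> 0}"] unfolding test_function_def by blast

lemma test_function_smooth: "test_function \<Omega> f \<Longrightarrow> smooth f"
  by (simp add: test_function_def)

lemma test_function_subset: "test_function \<Omega> f \<Longrightarrow> \<Omega> \<subseteq> \<Omega>' \<Longrightarrow> test_function \<Omega>' f"
  by (auto simp: test_function_def)

lemma test_function_outside: "test_function \<Omega> f \<Longrightarrow> x \<notin> \<Omega> \<Longrightarrow> f x = 0"
  by (erule test_functionE) auto

lemma test_function_zero: "test_function \<Omega> (\<lambda>x. 0)"
  by (rule test_functionI[of _ "{}"]) auto

lemma test_function_mult: "test_function \<Omega> f \<Longrightarrow> smooth g \<Longrightarrow> test_function \<Omega> (\<lambda>x. f x * g x)"
  by (erule test_functionE) (rule test_functionI, auto intro: smooth_mult)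

lemma test_function_cmult: "test_function \<Omega> f \<Longrightarrow> test_function \<Omega> (\<lambda>x. c * f x)"
  using test_function_mult[of \<Omega> f "\<lambda>x. c"] by (simp add: mult.commute)

lemma test_function_add:
  assumes "test_function \<Omega> f" "test_function \<Omega> g"
  shows "test_function \<Omega> (\<lambda>x. f x + g x)"
proof -
  obtain K where K: "smooth f" "compact K" "K \<subseteq> \<Omega>" "\<And>x. x \<notin> K \<Longrightarrow> f x = 0"
    using assms(1) by (rule test_functionE) blast
  obtain L where L: "smooth g" "compact L" "L \<subseteq> \<Omega>" "\<And>x. x \<notin> L \<Longrightarrow> g x = 0"
    using assms(2) by (rule test_functionE) blast
  show ?thesis
    by (rule test_functionI[of _ "K \<union> L"]) (use K L in \<open>auto intro: smooth_add\<close>)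
qed

lemma test_function_diff:
  "test_function \<Omega> f \<Longrightarrow> test_function \<Omega> g \<Longrightarrow> test_function \<Omega> (\<lambda>x. f x - g x)"
  using test_function_add[of \<Omega> f "\<lambda>x. (-1) * g x"] test_function_cmult[of \<Omega> g "-1"] by simp

lemma test_function_sum:
  "(\<And>i. i \<in> I \<Longrightarrow> test_function \<Omega> (f i)) \<Longrightarrow> test_function \<Omega> (\<lambda>x. \<Sum>i\<in>I. f i x)"
  by (induction I rule: infinite_finite_induct) (auto intro: test_function_add test_function_zero)

lemma frechet_derivative_eq_0_outside:
  assumes "compact K" "\<And>y. y \<notin> K \<Longrightarrow> f y = 0" "x \<notin> K"
  shows "frechet_derivative f (at x) h = 0"
proof -
  have "(f has_derivative (\<lambda>h. 0)) (at x)"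
    by (rule has_derivative_transform_within_open[of "\<lambda>x. 0" _ _ _ "- K"])
       (use assms in \<open>auto simp: compact_imp_closed open_Compl\<close>)
  then show ?thesis using frechet_derivative_at by metis
qed

lemma test_function_frechet:
  assumes "test_function \<Omega> f"
  shows "test_function \<Omega> (\<lambda>x. frechet_derivative f (at x) h)"
  using assms
proof (rule test_functionE)
  fix K assume K: "smooth f" "compact K" "K \<subseteq> \<Omega>" "\<And>x. x \<notin> K \<Longrightarrow> f x = 0"
  show ?thesis
    by (rule test_functionI[OF smooth_frechet[OF K(1)] K(2,3)])
       (use K frechet_derivative_eq_0_outside[OF K(2,4)] in auto)
qed

lemma test_function_bounded:
  assumes "test_function \<Omega> f"
  obtains C where "0 \<le> C" "\<And>x. \<bar>f x\<bar> \<le> C"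
  using assms
proof (rule test_functionE)
  fix K assume K: "smooth f" "compact K" "K \<subseteq> \<Omega>" "\<And>x. x \<notin> K \<Longrightarrow> f x = 0"
  have "bounded (f ` K)"
    by (intro compact_imp_bounded compact_continuous_image K(2)
        continuous_on_subset[OF smooth_continuous[OF K(1)]]) simp
  then obtain C where C: "\<And>x. x \<in> K \<Longrightarrow> \<bar>f x\<bar> \<le> C" by (auto simp: bounded_iff)
  have "\<bar>f x\<bar> \<le> max 0 C" for x
    using C[of x] K(4)[of x] by (cases "x \<in> K") auto
  then show ?thesis
    by (intro that[of "max 0 C"]) auto
qed

text \<open>Finitely many closed balls inside O' whose interiors cover K carry a sum w of flat
  bumps, bounded below by some c > 0 on K. Composing with a step that is already 1 at c/2 gives the
  value 1 on an open neighbourhood W of K and not only on K: products with 1 - h then vanish near K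
  and have their support at a distance from it.\<close>

lemma smooth_urysohn:
  fixes K :: "'a::euclidean_space set"
  assumes "compact K" "open O'" "K \<subseteq> O'"
  obtains h W where "test_function O' h" "\<And>x. 0 \<le> h x" "\<And>x. h x \<le> 1"
    "open W" "K \<subseteq> W" "\<And>x. x \<in> W \<Longrightarrow> h x = 1"
proof -
  have "\<forall>a\<in>K. \<exists>r>0. cball a r \<subseteq> O'"
    using assms open_contains_cball by (metis subsetD)
  then obtain r where r: "\<And>a. a \<in> K \<Longrightarrow> r a > 0 \<and> cball a (r a) \<subseteq> O'" by metis
  have "K \<subseteq> (\<Union>a\<in>K. ball a (r a))" using r by force
  then obtain F where F: "F \<subseteq> K" "finite F" "K \<subseteq> (\<Union>a\<in>F. ball a (r a))"
    using compactE_image[OF assms(1), of K "\<lambda>a. ball a (r a)"] by auto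
  \<comment> \<open>Each summand is positive exactly on its open ball, because
    \<open>flat_exp 0\<close> vanishes for arguments that are not positive.\<close>
  define w where "w x = (\<Sum>a\<in>F. flat_exp 0 (r a * r a - (x - a) \<bullet> (x - a)))" for x
  have smw: "smooth w"
    unfolding w_def by (intro smooth_sum smooth_compose_real[OF smooth_flat_exp] smooth_diff smooth_const smooth_dist_square)
  have in_ball: "0 < r a * r a - (x - a) \<bullet> (x - a) \<longleftrightarrow> x \<in> ball a (r a)" if "a \<in> F" for a x
  proof -
    have "0 < r a" using r F(1) that by blast
    then have "(norm (x - a))\<^sup>2 < (r a)\<^sup>2 \<longleftrightarrow> norm (x - a) < r a"
      using abs_le_square_iff[of "r a" "norm (x - a)"] by (auto simp: linorder_not_le[symmetric])
    then have "(x - a) \<bullet> (x - a) < r a * r a \<longleftrightarrow> norm (x - a) < r a"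
      by (simp add: power2_norm_eq_inner power2_eq_square[of "r a"])
    then show ?thesis by (simp add: dist_norm norm_minus_commute[of a x])
  qed
  have wpos: "0 < w x" if x: "x \<in> K" for x
  proof -
    obtain a where a: "a \<in> F" "x \<in> ball a (r a)" using F(3) x by auto
    then have "0 < flat_exp 0 (r a * r a - (x - a) \<bullet> (x - a))"
      using in_ball[OF a(1)] flat_exp_0_pos_iff by blast
    then show ?thesis unfolding w_def
      by (intro sum_pos2[OF F(2) a(1)]) (simp_all add: flat_exp_nonneg)
  qed
  have w0: "w x = 0" if "x \<notin> (\<Union>a\<in>F. cball a (r a))" for x
    unfolding w_def
  proof (rule sum.neutral, rule ballI)
    fix a assume a: "a \<in> F"
    then have "x \<notin> ball a (r a)" using that by auto
    then have "\<not> 0 < flat_exp 0 (r a * r a - (x - a) \<bullet> (x - a))"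
      using in_ball[OF a] flat_exp_0_pos_iff by blast
    then show "flat_exp 0 (r a * r a - (x - a) \<bullet> (x - a)) = 0"
      using flat_exp_nonneg[of 0 "r a * r a - (x - a) \<bullet> (x - a)"] by linarith
  qed
  have cont: "continuous_on UNIV w" by (rule smooth_continuous[OF smw])
  obtain c where c: "0 < c" "\<And>x. x \<in> K \<Longrightarrow> c \<le> w x"
  proof (cases "K = {}")
    case False
    then obtain y where "y \<in> K" "\<forall>x\<in>K. w y \<le> w x"
      using continuous_attains_inf[OF assms(1) False continuous_on_subset[OF cont]] by auto
    then show ?thesis using that[of "w y"] wpos by auto
  qed (use that[of 1] in auto)
  show ?thesis
  proof (rule that[of "\<lambda>x. smooth_step (2 / c * w x)" "{x. c / 2 < w x}"])
    show "test_function O' (\<lambda>x. smooth_step (2 / c * w x))"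
    proof (rule test_functionI[of _ "\<Union>a\<in>F. cball a (r a)"])
      show "smooth (\<lambda>x. smooth_step (2 / c * w x))"
        by (intro smooth_compose_real[OF smooth_smooth_step] smooth_cmult smw)
      show "(\<Union>a\<in>F. cball a (r a)) \<subseteq> O'" using r F(1) by blast
    qed (use F(2) w0 in \<open>auto simp: smooth_step_eq_0 intro!: compact_UN\<close>)
    show "open {x. c / 2 < w x}"
      using cont by (intro open_Collect_less continuous_intros)
    show "K \<subseteq> {x. c / 2 < w x}" using c by force
    show "smooth_step (2 / c * w x) = 1" if "x \<in> {x. c / 2 < w x}" for x
      using that c(1) by (intro smooth_step_eq_1) (auto simp: field_simps)
  qed (auto simp: smooth_step_bounds)
qed

section \<open>The Riesz representation theorem with smooth test functions\<close>

section \<open>Positive functionals on test functions\<close>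

text \<open>The levels j with j \<delta> < y are exactly those below the ceiling of y / \<delta>,
  and each of them contributes a full \<delta>. Level 0 is counted, which is what makes the sum an
  upper bound.\<close>

lemma staircase_ge:
  fixes a :: "nat \<Rightarrow> real"
  assumes "0 < \<delta>" "y < real N * \<delta>" "\<And>j. j < N \<Longrightarrow> 0 \<le> a j"
    and "\<And>j. j < N \<Longrightarrow> real j * \<delta> < y \<Longrightarrow> a j = 1"
  shows "y \<le> (\<Sum>j<N. \<delta> * a j)"
proof -
  define k where "k = nat \<lceil>y / \<delta>\<rceil>"
  have jk: "real j * \<delta> < y" if "j < k" for j
    using that assms(1) unfolding k_def by (simp add: zless_nat_eq_int_zless less_ceiling_iff pos_less_divide_eq)
  have "k \<le> N"
  proof (rule ccontr)
    assume "\<not> k \<le> N"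
    with jk[of N] assms(2) show False by simp
  qed
  have "y / \<delta> \<le> real k"
    unfolding k_def by linarith
  then have "y \<le> real k * \<delta>"
    using assms(1) by (simp add: pos_divide_le_eq)
  also have "\<dots> = (\<Sum>j<k. \<delta> * a j)"
    using jk assms(4) \<open>k \<le> N\<close> by simp
  also have "\<dots> \<le> (\<Sum>j<N. \<delta> * a j)"
    using \<open>k \<le> N\<close> assms(1,3) by (intro sum_mono2) auto
  finally show ?thesis .
qed

text \<open>At most floor(y / \<delta>) of the levels 1, 2, ... can contribute. Compared with
  \<open>staircase_ge\<close> level 0 is left out: the upper and the lower staircase differ by one
  layer of height \<delta>.\<close>

lemma staircase_le:
  fixes a :: "nat \<Rightarrow> real"
  assumes "0 < \<delta>" "0 \<le> y" "\<And>j. j < N \<Longrightarrow> a j \<le> 1"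
    and "\<And>j. j < N \<Longrightarrow> y < real j * \<delta> \<Longrightarrow> a j = 0"
  shows "(\<Sum>j\<in>{1..<N}. \<delta> * a j) \<le> y"
proof -
  define k where "k = nat \<lfloor>y / \<delta>\<rfloor>"
  have "\<delta> * a j \<le> (if j \<le> k then \<delta> else 0)" if "j < N" for j
  proof (cases "j \<le> k")
    case False
    then have "y / \<delta> < real j" unfolding k_def using assms(1,2) by linarith
    then have "y < real j * \<delta>" using assms(1) by (simp add: pos_divide_less_eq)
    then show ?thesis using assms(4)[OF that] False by simp
  qed (use assms(1) assms(3)[OF that] in auto)
  then have "(\<Sum>j\<in>{1..<N}. \<delta> * a j) \<le> (\<Sum>j\<in>{1..<N}. if j \<le> k then \<delta> else 0)"
    by (intro sum_mono) auto
  also have "\<dots> = (\<Sum>j\<in>{1..<N} \<inter> {j. j \<le> k}. \<delta>)"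
    by (subst sum.inter_restrict) auto
  also have "\<dots> \<le> (\<Sum>j\<in>{1..k}. \<delta>)"
    using assms(1) by (intro sum_mono2) auto
  also have "\<dots> = real k * \<delta>" by simp
  also have "\<dots> \<le> y"
  proof -
    have "real k \<le> y / \<delta>" unfolding k_def using assms(1,2) by simp
    then show ?thesis using assms(1) by (simp add: pos_le_divide_eq)
  qed
  finally show ?thesis .
qed

lemma integrable_test_function:
  assumes [measurable_cong]: "sets M = sets borel" and "\<And>K. compact K \<Longrightarrow> emeasure M K < \<infinity>"
    and "test_function UNIV (f :: 'a::euclidean_space \<Rightarrow> real)"
  shows "integrable M f"
  using assms(3)
proof (rule test_functionE)
  fix K assume K: "smooth f" "compact K" "K \<subseteq> UNIV" "\<And>x. x \<notin> K \<Longrightarrow> f x = 0"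
  obtain C where C: "0 \<le> C" "\<And>x. \<bar>f x\<bar> \<le> C" using test_function_bounded[OF assms(3)] by blast
  have "f \<in> borel_measurable borel"
    using smooth_continuous[OF K(1)] by (rule borel_measurable_continuous_onI)
  then have f: "f \<in> borel_measurable M"
    by (simp add: measurable_cong_sets[OF assms(1) refl])
  have "K \<in> sets M" using K(2) by (simp add: assms(1) borel_compact)
  then show ?thesis
    using f K(4) C assms(2)[OF K(2)] by (intro integrableI_bounded_set[of K _ _ C]) auto
qed

locale positive_functional =
  fixes \<Lambda> :: "('a::euclidean_space \<Rightarrow> real) \<Rightarrow> real"
  assumes add: "test_function UNIV f \<Longrightarrow> test_function UNIV g \<Longrightarrow> \<Lambda> (\<lambda>x. f x + g x) = \<Lambda> f + \<Lambda> g"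
    and cmult: "test_function UNIV f \<Longrightarrow> \<Lambda> (\<lambda>x. c * f x) = c * \<Lambda> f"
    and nonneg: "test_function UNIV f \<Longrightarrow> (\<And>x. 0 \<le> f x) \<Longrightarrow> 0 \<le> \<Lambda> f"
begin

lemma zero: "\<Lambda> (\<lambda>x. 0) = 0"
  using cmult[OF test_function_zero, of 0] by simp

lemma diff: "test_function UNIV f \<Longrightarrow> test_function UNIV g \<Longrightarrow> \<Lambda> (\<lambda>x. f x - g x) = \<Lambda> f - \<Lambda> g"
  using add[of f "\<lambda>x. (-1) * g x"] cmult[of g "-1"] test_function_cmult[of UNIV g "-1"] by simp

lemma sum: "(\<And>i. i \<in> I \<Longrightarrow> test_function UNIV (f i)) \<Longrightarrow> \<Lambda> (\<lambda>x. \<Sum>i\<in>I. f i x) = (\<Sum>i\<in>I. \<Lambda> (f i))"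
  by (induction I rule: infinite_finite_induct) (auto simp: zero add test_function_sum)

lemma mono:
  assumes "test_function UNIV f" "test_function UNIV g" "\<And>x. f x \<le> g x"
  shows "\<Lambda> f \<le> \<Lambda> g"
  using nonneg[of "\<lambda>x. g x - f x"] diff[of g f] test_function_diff[of UNIV g f] assms by simp

text \<open>The classical Riesz construction with smooth competitors in place of continuous ones,
  because the functional is known on test functions only.\<close>

definition cutoffs :: "'a set \<Rightarrow> ('a \<Rightarrow> real) set" where
  "cutoffs S = {f. test_function S f \<and> (\<forall>x. 0 \<le> f x \<and> f x \<le> 1)}"

definition content :: "'a set \<Rightarrow> ennreal" where
  "content S = (SUP f\<in>cutoffs S. ennreal (\<Lambda> f))"

definition outer :: "'a set \<Rightarrow> ennreal" where
  "outer A = (INF S\<in>{S. open S \<and> A \<subseteq> S}. content S)"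

lemma cutoffsD: "f \<in> cutoffs S \<Longrightarrow> test_function UNIV f"
  by (auto simp: cutoffs_def intro: test_function_subset)

lemma content_upper: "f \<in> cutoffs S \<Longrightarrow> ennreal (\<Lambda> f) \<le> content S"
  unfolding content_def by (rule SUP_upper)

lemma content_mono: "S \<subseteq> S' \<Longrightarrow> content S \<le> content S'"
  unfolding content_def
  by (rule SUP_subset_mono) (auto simp: cutoffs_def intro: test_function_subset)

lemma content_le_dominated:
  assumes "test_function UNIV g" "\<And>x. 0 \<le> g x" "\<And>x. x \<in> S \<Longrightarrow> 1 \<le> g x"
  shows "content S \<le> ennreal (\<Lambda> g)"
  unfolding content_def
proof (rule SUP_least)
  fix f assume f: "f \<in> cutoffs S"
  have "f x \<le> g x" for x
    using f assms(2)[of x] assms(3)[of x] test_function_outside[of S f x]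
    by (cases "x \<in> S") (auto simp: cutoffs_def intro: order_trans)
  then show "ennreal (\<Lambda> f) \<le> ennreal (\<Lambda> g)"
    using mono[OF cutoffsD[OF f] assms(1)] by (simp add: ennreal_leI)
qed

lemma outer_open: "open S \<Longrightarrow> outer S = content S"
  unfolding outer_def by (rule antisym) (auto intro!: INF_lower INF_greatest content_mono)

lemma outer_mono: "A \<subseteq> B \<Longrightarrow> outer A \<le> outer B"
  unfolding outer_def by (rule INF_superset_mono) auto

lemma outer_approx:
  assumes "outer A < \<infinity>" "0 < e"
  obtains S where "open S" "A \<subseteq> S" "content S \<le> outer A + ennreal e"
proof -
  have "outer A < outer A + ennreal e"
    using assms by (simp add: ennreal_add_left_cancel_less[of _ 0, simplified] less_top[symmetric])
  then obtain S where "open S" "A \<subseteq> S" "content S < outer A + ennreal e"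
    unfolding outer_def[of A] INF_less_iff by auto
  then show ?thesis using that less_imp_le by blast
qed

lemma content_approx:
  assumes "r < content S"
  obtains f where "f \<in> cutoffs S" "r < ennreal (\<Lambda> f)"
  using assms unfolding content_def less_SUP_iff by auto

text \<open>A cutoff f of the union, vanishing off a compact K, is split by a function h supported
  in S that is 1 near K - S': h f lives in S, and f (1 - h) lives in K minus a neighbourhood of K -
  S', a compact part of S'.\<close>

lemma content_Un_le:
  assumes "open S" "open S'"
  shows "content (S \<union> S') \<le> content S + content S'"
  unfolding content_def[of "S \<union> S'"]
proof (rule SUP_least)
  fix f assume f: "f \<in> cutoffs (S \<union> S')"
  then have "test_function (S \<union> S') f" by (simp add: cutoffs_def)
  then obtain K where K: "smooth f" "compact K" "K \<subseteq> S \<union> S'" "\<And>x. x \<notin> K \<Longrightarrow> f x = 0"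
    by (rule test_functionE) blast
  have "compact (K - S')" "K - S' \<subseteq> S"
    using K assms by (auto simp: compact_diff)
  then obtain h W where h: "test_function S h" "\<And>x. 0 \<le> h x" "\<And>x. h x \<le> 1"
    "open W" "K - S' \<subseteq> W" "\<And>x. x \<in> W \<Longrightarrow> h x = 1"
    using smooth_urysohn[OF _ assms(1)] by blast
  have fU: "test_function UNIV f" using cutoffsD[OF f] .
  have f01: "0 \<le> f x" "f x \<le> 1" for x using f by (auto simp: cutoffs_def)
  have 1: "(\<lambda>x. h x * f x) \<in> cutoffs S"
    using h f01 by (auto simp: cutoffs_def test_function_mult K(1) mult_le_one)
  have 2: "(\<lambda>x. f x * (1 - h x)) \<in> cutoffs S'"
  proof -
    have "test_function S' (\<lambda>x. f x * (1 - h x))"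
    proof (rule test_functionI)
      show "smooth (\<lambda>x. f x * (1 - h x))"
        using h(1) by (intro smooth_mult smooth_diff K(1) smooth_const) (auto simp: test_function_def)
      show "compact (K - W)" using K(2) h(4) by (rule compact_diff)
      show "K - W \<subseteq> S'" using h(5) by blast
      show "f x * (1 - h x) = 0" if "x \<notin> K - W" for x
        using that h(6) K(4) by auto
    qed
    then show ?thesis using f01 h(2,3) by (auto simp: cutoffs_def mult_le_one)
  qed
  have "\<Lambda> f = \<Lambda> (\<lambda>x. h x * f x + f x * (1 - h x))" by (simp add: algebra_simps)
  also have "\<dots> = \<Lambda> (\<lambda>x. h x * f x) + \<Lambda> (\<lambda>x. f x * (1 - h x))"
    by (rule add[OF cutoffsD[OF 1] cutoffsD[OF 2]])
  finally have "ennreal (\<Lambda> f) \<le> ennreal (\<Lambda> (\<lambda>x. h x * f x)) + ennreal (\<Lambda> (\<lambda>x. f x * (1 - h x)))"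
    using nonneg[OF cutoffsD[OF 1]] nonneg[OF cutoffsD[OF 2]] f01 h(2,3) by (simp add: ennreal_plus)
  also have "\<dots> \<le> content S + content S'"
    by (intro add_mono content_upper 1 2)
  finally show "ennreal (\<Lambda> f) \<le> content S + content S'" .
qed

lemma content_empty: "content {} = 0"
proof -
  have "content {} \<le> ennreal (\<Lambda> (\<lambda>x. 0))"
    by (rule content_le_dominated) (auto simp: test_function_zero)
  then show ?thesis by (simp add: zero)
qed

text \<open>Each competitor has compact support, so finitely many of the sets already cover it and
  the finite case applies.\<close>

lemma content_UN_le:
  assumes "\<And>i::nat. open (S i)"
  shows "content (\<Union>i. S i) \<le> (\<Sum>i. content (S i))"
proof -
  have fin: "content (\<Union>i<n. S i) \<le> (\<Sum>i<n. content (S i))" for n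
  proof (induction n)
    case (Suc n)
    have "content (\<Union>i<Suc n. S i) \<le> content (\<Union>i<n. S i) + content (S n)"
      using content_Un_le[of "\<Union>i<n. S i" "S n"] assms by (auto simp: lessThan_Suc Un_commute)
    also have "\<dots> \<le> (\<Sum>i<n. content (S i)) + content (S n)"
      using Suc.IH add_right_mono by blast
    finally show ?case by simp
  qed (simp add: content_empty)
  show ?thesis unfolding content_def[of "\<Union>i. S i"]
  proof (rule SUP_least)
    fix f assume f: "f \<in> cutoffs (\<Union>i. S i)"
    then have "test_function (\<Union>i. S i) f" by (simp add: cutoffs_def)
    then obtain K where K: "smooth f" "compact K" "K \<subseteq> (\<Union>i. S i)" "\<And>x. x \<notin> K \<Longrightarrow> f x = 0"
      by (rule test_functionE) blast
    then obtain I where I: "finite I" "K \<subseteq> (\<Union>i\<in>I. S i)"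
      using compactE_image[of K UNIV S] assms by auto
    obtain n where n: "\<And>i. i \<in> I \<Longrightarrow> i < n"
      using I(1) finite_nat_set_iff_bounded by auto
    have "f \<in> cutoffs (\<Union>i<n. S i)"
      using f K I(2) n by (force simp: cutoffs_def intro!: test_functionI[OF K(1,2)])
    then have "ennreal (\<Lambda> f) \<le> (\<Sum>i<n. content (S i))"
      using content_upper fin[of n] order_trans by blast
    also have "\<dots> \<le> (\<Sum>i. content (S i))"
      by (rule sum_le_suminf) auto
    finally show "ennreal (\<Lambda> f) \<le> (\<Sum>i. content (S i))" .
  qed
qed

lemma outer_measure_space_outer: "outer_measure_space UNIV outer"
  unfolding outer_measure_space_def
proof (intro conjI)
  show "positive UNIV outer"
    by (simp add: positive_def outer_open content_empty)
  show "increasing UNIV outer"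
    by (simp add: increasing_def outer_mono)
  show "countably_subadditive UNIV outer"
    unfolding countably_subadditive_def
  proof (intro allI impI)
    fix A :: "nat \<Rightarrow> 'a set"
    show "outer (\<Union>i. A i) \<le> (\<Sum>i. outer (A i))"
    proof (cases "\<exists>i. outer (A i) = \<infinity>")
      case True
      then obtain i where "outer (A i) = \<infinity>" by blast
      then have "(\<Sum>i. outer (A i)) = \<infinity>"
        using sum_le_suminf[of "\<lambda>i. outer (A i)" "{i}"] by (simp add: top_unique)
      then show ?thesis by simp
    next
      case False
      show ?thesis
      proof (rule ennreal_le_epsilon)
        fix e :: real assume e: "0 < e"
        have "\<exists>S. open S \<and> A i \<subseteq> S \<and> content S \<le> outer (A i) + ennreal (e * (1/2) ^ Suc i)" for i
        proof -
          have "outer (A i) < \<infinity>" "0 < e * (1/2) ^ Suc i"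
            using False e by (auto simp: less_top)
          then show ?thesis by (metis outer_approx)
        qed
        then obtain S where S: "\<And>i. open (S i)" "\<And>i. A i \<subseteq> S i"
          "\<And>i. content (S i) \<le> outer (A i) + ennreal (e * (1/2) ^ Suc i)" by metis
        have "outer (\<Union>i. A i) \<le> outer (\<Union>i. S i)"
          using S(2) by (intro outer_mono) blast
        also have "\<dots> = content (\<Union>i. S i)" using S(1) by (intro outer_open) auto
        also have "\<dots> \<le> (\<Sum>i. content (S i))" by (rule content_UN_le[OF S(1)])
        also have "\<dots> \<le> (\<Sum>i. outer (A i) + ennreal (e * (1/2) ^ Suc i))"
          by (intro suminf_le S(3)) auto
        also have "\<dots> = (\<Sum>i. outer (A i)) + (\<Sum>i. ennreal (e * (1/2) ^ Suc i))"
          by (rule suminf_add[symmetric]) auto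
        also have "(\<Sum>i. ennreal (e * (1/2) ^ Suc i)) = ennreal e"
          using e sums_mult[OF power_half_series, of e]
          by (subst suminf_ennreal_eq[of _ e]) auto
        finally show "outer (\<Union>i. A i) \<le> (\<Sum>i. outer (A i)) + ennreal e" .
      qed
    qed
  qed
qed

text \<open>Caratheodory's condition is checked first against open V. A near-optimal cutoff f of S
  \<inter> V has a closed support F, and V - F is open and contains V - S; a cutoff g of V - F never
  meets f, so f + g competes for V. Arbitrary sets follow by outer approximation.\<close>

lemma open_lambda_system:
  assumes "open S"
  shows "S \<in> lambda_system UNIV UNIV outer"
  unfolding lambda_system_def
proof (intro CollectI conjI ballI)
  fix A :: "'a set"
  have open_case: "outer (S \<inter> V) + outer (V - S) \<le> outer V" if V: "open V" for V
  proof -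
    have SV: "open (S \<inter> V)" using assms V by auto
    have *: "r + outer (V - S) \<le> content V" if r: "r < content (S \<inter> V)" for r
    proof -
      obtain f where f: "f \<in> cutoffs (S \<inter> V)" "r < ennreal (\<Lambda> f)"
        using content_approx[OF r] by blast
      define F where "F = closure {x. f x \<noteq> 0}"
      have F: "closed F" "F \<subseteq> S \<inter> V" "\<And>x. x \<notin> F \<Longrightarrow> f x = 0"
        using f closure_subset[of "{x. f x \<noteq> 0}"] by (auto simp: F_def cutoffs_def test_function_def)
      have "outer (V - S) \<le> content (V - F)"
        unfolding outer_def using V F by (intro INF_lower) (auto simp: open_Diff)
      moreover have "ennreal (\<Lambda> f) + content (V - F) \<le> content V"
      proof -
        have "ennreal (\<Lambda> f) + ennreal (\<Lambda> g) \<le> content V" if g: "g \<in> cutoffs (V - F)" for g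
        proof -
          have fg: "f x = 0 \<or> g x = 0" for x
            using F(3)[of x] test_function_outside[of "V - F" g x] g by (auto simp: cutoffs_def)
          have fV: "test_function V f" and gV: "test_function V g"
            using f(1) g by (auto simp: cutoffs_def intro: test_function_subset)
          have "f x + g x \<le> 1" "0 \<le> f x + g x" for x
            using fg[of x] f(1) g by (auto simp: cutoffs_def)
          then have "(\<lambda>x. f x + g x) \<in> cutoffs V"
            using test_function_add[OF fV gV] by (auto simp: cutoffs_def)
          from content_upper[OF this] show ?thesis
            using nonneg[OF cutoffsD[OF f(1)]] nonneg[OF cutoffsD[OF g]] f(1) g add[OF cutoffsD[OF f(1)] cutoffsD[OF g]]
            by (simp add: ennreal_plus cutoffs_def)
        qed
        moreover have ne: "cutoffs (V - F) \<noteq> {}"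
          by (auto simp: cutoffs_def intro!: exI[of _ "\<lambda>x. 0"] test_function_zero)
        ultimately show ?thesis
          unfolding content_def[of "V - F"]
          by (simp add: ennreal_SUP_add_right[OF ne] SUP_least)
      qed
      ultimately show ?thesis
        using f(2) by (meson add_mono less_imp_le order_trans)
    qed
    show ?thesis
    \<comment> \<open>The content may be infinite, so no epsilon is subtracted; the bound is carried
      to the supremum over all r below the content. This needs some such r, hence the case
      split.\<close>
    proof (cases "content (S \<inter> V) = 0")
      case True
      then show ?thesis using outer_open[OF SV] outer_mono[of "V - S" V] by simp
    next
      case False
      have "outer (V - S) + content (S \<inter> V) \<le> content V"
      proof (rule ccontr)
        assume "\<not> ?thesis"
        then have lt: "content V < outer (V - S) + content (S \<inter> V)" by simp
        have "(SUP r\<in>{r. r < content (S \<inter> V)}. outer (V - S) + r) = outer (V - S) + content (S \<inter> V)"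
        proof -
          have ne: "{r. r < content (S \<inter> V)} \<noteq> {}" using False by (auto simp: zero_less_iff_neq_zero[symmetric])
          have "Sup {r. r < content (S \<inter> V)} = content (S \<inter> V)"
            by (rule Sup_eqI) (auto intro: dense_le)
          then show ?thesis
            using ennreal_SUP_add_right[OF ne, of "outer (V - S)" "\<lambda>r. r"] by simp
        qed
        then obtain r where "r < content (S \<inter> V)" "content V < outer (V - S) + r"
          using lt by (metis (mono_tags, lifting) less_SUP_iff mem_Collect_eq)
        with *[of r] show False by (simp add: add.commute)
      qed
      then show ?thesis using outer_open[OF SV] outer_open[OF V] by (simp add: add.commute)
    qed
  qed
  have "outer (S \<inter> A) + outer (A - S) \<le> outer A"
    unfolding outer_def[of A]
  proof (rule INF_greatest)
    fix V assume V: "V \<in> {V. open V \<and> A \<subseteq> V}"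
    have "outer (S \<inter> A) + outer (A - S) \<le> outer (S \<inter> V) + outer (V - S)"
      using V by (intro add_mono outer_mono) auto
    then show "outer (S \<inter> A) + outer (A - S) \<le> content V"
      using open_case[of V] outer_open[of V] V by auto
  qed
  moreover have "outer A \<le> outer (S \<inter> A) + outer (A - S)"
  proof -
    have "subadditive UNIV outer"
    proof (rule ring_of_sets.countably_subadditive_subadditive)
      show "ring_of_sets UNIV (UNIV :: 'a set set)"
        using sigma_algebra_Pow[of "UNIV :: 'a set"]
        by (auto dest!: sigma_algebra.axioms(1) algebra.axioms(1))
    qed (use outer_measure_space_outer in \<open>auto simp: outer_measure_space_def\<close>)
    then have "outer ((S \<inter> A) \<union> (A - S)) \<le> outer (S \<inter> A) + outer (A - S)"
      unfolding subadditive_def by (elim ballE[of _ _ "S \<inter> A"] ballE[of _ _ "A - S"]) auto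
    moreover have "(S \<inter> A) \<union> (A - S) = A" by blast
    ultimately show ?thesis by simp
  qed
  moreover have "(UNIV - S) \<inter> A = A - S" by blast
  ultimately show "outer (S \<inter> A) + outer ((UNIV - S) \<inter> A) = outer A" by auto
qed simp

definition riesz_measure :: "'a measure" where
  "riesz_measure = measure_of UNIV (sets borel) outer"

lemma sets_riesz_measure [simp, measurable_cong]: "sets riesz_measure = sets borel"
  unfolding riesz_measure_def using sets.sigma_sets_eq[of borel] by (simp add: sets_measure_of)

text \<open>The sets satisfying Caratheodory's condition form a sigma algebra that contains the open
  sets, hence all Borel sets.\<close>

lemma emeasure_riesz_measure:
  assumes "B \<in> sets borel"
  shows "emeasure riesz_measure B = outer B"
proof -
  have L: "measure_space UNIV (lambda_system UNIV UNIV outer) outer"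
    using sigma_algebra.caratheodory_lemma[OF sigma_algebra_Pow[of UNIV], of outer] outer_measure_space_outer
    by simp
  have "sigma_algebra UNIV (lambda_system UNIV UNIV outer)"
    using L by (simp add: measure_space_def)
  then have "sets borel \<subseteq> lambda_system UNIV UNIV outer"
    unfolding borel_def using open_lambda_system
    by (simp add: sets_measure_of) (rule sigma_algebra.sigma_sets_subset, auto)
  then have "measure_space UNIV (sets borel) outer"
    using measure_down[OF L] sets.sigma_algebra_axioms[of borel] by simp
  then show ?thesis
    unfolding riesz_measure_def measure_space_def using assms
    by (intro emeasure_measure_of_sigma) simp_all
qed

lemma outer_compact_finite:
  assumes "compact K"
  shows "outer K < \<infinity>"
proof -
  obtain h W where h: "test_function UNIV h" "\<And>x. 0 \<le> h x" "\<And>x. h x \<le> 1"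
    "open W" "K \<subseteq> W" "\<And>x. x \<in> W \<Longrightarrow> h x = 1"
    by (rule smooth_urysohn[OF assms open_UNIV subset_UNIV]) blast
  have "outer K \<le> content W" unfolding outer_def using h by (intro INF_lower) auto
  also have "\<dots> \<le> ennreal (\<Lambda> h)" using h by (intro content_le_dominated) auto
  finally show ?thesis using le_less_trans by (metis ennreal_less_top infinity_ennreal_def)
qed

lemma finite_compact_riesz_measure: "compact K \<Longrightarrow> emeasure riesz_measure K < \<infinity>"
  using emeasure_riesz_measure[of K] outer_compact_finite[of K] by (simp add: borel_compact)

lemma integrable_riesz_measure: "test_function UNIV f \<Longrightarrow> integrable riesz_measure f"
  by (rule integrable_test_function) (auto intro: finite_compact_riesz_measure[simplified])

text \<open>Layer cake with step \<delta>. The superlevel sets of f are approximated by test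
  functions with an error of 1/N on each of at most N levels, which costs at most \<delta> in total;
  level 0, present in the upper staircase only, costs at most \<delta> \<mu>(K). Hence C = \<mu>(K)
  + 1, independent of \<delta>.\<close>

lemma riesz_bounds:
  assumes f: "test_function UNIV f" and f0: "\<And>x. 0 \<le> f x"
  obtains C where "\<And>\<delta>. 0 < \<delta> \<Longrightarrow> \<bar>(LINT x|riesz_measure. f x) - \<Lambda> f\<bar> \<le> \<delta> * C"
proof -
  let ?\<mu> = "measure riesz_measure"
  obtain K where K: "smooth f" "compact K" "K \<subseteq> UNIV" "\<And>x. x \<notin> K \<Longrightarrow> f x = 0"
    using f by (rule test_functionE) blast
  obtain B where B: "0 \<le> B" "\<And>x. \<bar>f x\<bar> \<le> B" using test_function_bounded[OF f] by blast
  have cont: "continuous_on UNIV f" using smooth_continuous[OF K(1)] .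
  note int_f = integrable_riesz_measure[OF f]
  have fin: "emeasure riesz_measure A < \<infinity>" if "A \<subseteq> K" "A \<in> sets borel" for A
    using emeasure_mono[of A K riesz_measure] that K(2) finite_compact_riesz_measure[OF K(2)]
    by (auto simp: borel_compact intro: le_less_trans)
  have eme: "outer A = ennreal (?\<mu> A)" if "A \<subseteq> K" "A \<in> sets borel" for A
    using fin[OF that] emeasure_eq_ennreal_measure[of riesz_measure A]
    by (simp flip: emeasure_riesz_measure[OF that(2)])
  have int_ind: "integrable riesz_measure (\<lambda>x. c * indicator A x)" if "A \<subseteq> K" "A \<in> sets borel" for A and c :: real
  proof -
    have "integrable riesz_measure (indicator A :: 'a \<Rightarrow> real)"
      using fin[OF that] that(2) by (intro integrable_real_indicator) auto
    then show ?thesis by (rule integrable_mult_right)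
  qed
  have bound: "\<bar>(LINT x|riesz_measure. f x) - \<Lambda> f\<bar> \<le> \<delta> * (?\<mu> K + 1)" if \<delta>: "0 < \<delta>" for \<delta>
  proof -
    obtain N0 where "B / \<delta> < real N0" using reals_Archimedean2 by blast
    define N where "N = Suc N0"
    have N: "B < real N * \<delta>" "0 < N"
      using \<open>B / \<delta> < real N0\<close> \<delta> by (auto simp: N_def field_simps)
    have fN: "f x < real N * \<delta>" for x using B(2)[of x] N(1) by linarith
    have split0: "(\<Sum>j<N. t j) = t 0 + (\<Sum>j\<in>{1..<N}. t j)" for t :: "nat \<Rightarrow> real"
      using N(2) by (simp add: lessThan_atLeast0 sum.atLeast_Suc_lessThan)
    define K' where "K' j = {x \<in> K. real j * \<delta> \<le> f x}" for j :: nat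
    have K': "compact (K' j)" "K' j \<subseteq> K" "K' j \<in> sets borel" for j
    proof -
      have "closed {x. real j * \<delta> \<le> f x}"
        using cont by (intro closed_Collect_le continuous_intros)
      moreover have "K' j = K \<inter> {x. real j * \<delta> \<le> f x}" by (auto simp: K'_def)
      ultimately show "compact (K' j)" using K(2) by (simp add: compact_Int_closed)
      then show "K' j \<in> sets borel" by (simp add: borel_compact)
    qed (auto simp: K'_def)
    \<comment> \<open>Closed superlevel sets are approximated from outside: g is 1 on
      \<open>K' j\<close>, and its value under \<Lambda> exceeds the measure by at most 1/N.\<close>
    have "\<exists>g. test_function UNIV g \<and> (\<forall>x. 0 \<le> g x) \<and> (\<forall>x\<in>K' j. g x = 1) \<and> \<Lambda> g \<le> ?\<mu> (K' j) + 1 / real N" for j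
    proof -
      have "outer (K' j) < \<infinity>" using eme[OF K'(2,3)] by simp
      then obtain S where S: "open S" "K' j \<subseteq> S" "content S \<le> outer (K' j) + ennreal (1 / real N)"
        using outer_approx[of "K' j" "1 / real N"] N(2) by auto
      obtain g W where g: "test_function S g" "\<And>x. 0 \<le> g x" "\<And>x. g x \<le> 1"
        "open W" "K' j \<subseteq> W" "\<And>x. x \<in> W \<Longrightarrow> g x = 1"
        by (rule smooth_urysohn[OF K'(1)[of j] S(1,2)]) blast
      have "g \<in> cutoffs S" using g by (auto simp: cutoffs_def)
      then have "ennreal (\<Lambda> g) \<le> ennreal (?\<mu> (K' j) + 1 / real N)"
        using order_trans[OF content_upper S(3)] eme[OF K'(2,3)] by (simp add: ennreal_plus)
      then have "\<Lambda> g \<le> ?\<mu> (K' j) + 1 / real N" by (subst (asm) ennreal_le_iff) auto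
      then show ?thesis using g cutoffsD[OF \<open>g \<in> cutoffs S\<close>] by (intro exI[of _ g]) auto
    qed
    then obtain g where g: "\<And>j. test_function UNIV (g j)" "\<And>j x. 0 \<le> g j x" "\<And>j x. x \<in> K' j \<Longrightarrow> g j x = 1"
      "\<And>j. \<Lambda> (g j) \<le> ?\<mu> (K' j) + 1 / real N" by metis
    have le1: "f x \<le> (\<Sum>j<N. \<delta> * g j x)" for x
    proof (rule staircase_ge[OF \<delta> fN])
      show "g j x = 1" if "real j * \<delta> < f x" for j
      proof (rule g(3))
        have "0 \<le> real j * \<delta>" using \<delta> by simp
        then have "f x \<noteq> 0" using that by linarith
        then show "x \<in> K' j" using K(4)[of x] that by (auto simp: K'_def)
      qed
    qed (use g in auto)
    have "\<Lambda> f \<le> \<Lambda> (\<lambda>x. \<Sum>j<N. \<delta> * g j x)"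
      by (intro mono f test_function_sum test_function_cmult g le1)
    also have "\<dots> = (\<Sum>j<N. \<delta> * \<Lambda> (g j))"
      using g(1) by (simp add: sum test_function_cmult cmult)
    also have "\<dots> \<le> (\<Sum>j<N. \<delta> * (?\<mu> (K' j) + 1 / real N))"
      using \<delta> g(4) by (intro sum_mono mult_left_mono) auto
    also have "\<dots> = (\<Sum>j<N. \<delta> * ?\<mu> (K' j)) + \<delta>"
      using N(2) by (simp add: distrib_left sum.distrib)
    also have "(\<Sum>j<N. \<delta> * ?\<mu> (K' j)) = \<delta> * ?\<mu> (K' 0) + (\<Sum>j\<in>{1..<N}. \<delta> * ?\<mu> (K' j))"
      by (rule split0)
    also have "K' 0 = K" using f0 by (auto simp: K'_def)
    also have "(\<Sum>j\<in>{1..<N}. \<delta> * ?\<mu> (K' j)) = (LINT x|riesz_measure. (\<Sum>j\<in>{1..<N}. \<delta> * indicator (K' j) x))"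
      by (subst Bochner_Integration.integral_sum[OF int_ind[OF K'(2,3)]]) (simp add: K'(3))
    also have "\<dots> \<le> (LINT x|riesz_measure. f x)"
    proof (rule integral_mono[OF _ int_f])
      show "integrable riesz_measure (\<lambda>x. \<Sum>j\<in>{1..<N}. \<delta> * indicator (K' j) x)"
        by (intro Bochner_Integration.integrable_sum int_ind K')
      show "(\<Sum>j\<in>{1..<N}. \<delta> * indicator (K' j) x) \<le> f x" for x
        by (rule staircase_le[OF \<delta> f0]) (auto simp: K'_def indicator_def)
    qed
    finally have upper: "\<Lambda> f \<le> (LINT x|riesz_measure. f x) + \<delta> * (?\<mu> K + 1)"
      by (simp add: algebra_simps)
    define G where "G j = {x. real j * \<delta> < f x}" for j :: nat
    have G: "open (G j)" "G j \<subseteq> K" "G j \<in> sets borel" for j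
    proof -
      show "open (G j)" unfolding G_def
        using cont by (intro open_Collect_less continuous_intros)
      then show "G j \<in> sets borel" by simp
      show "G j \<subseteq> K"
      proof
        fix x assume "x \<in> G j"
        moreover have "0 \<le> real j * \<delta>" using \<delta> by simp
        ultimately have "f x \<noteq> 0" unfolding G_def by auto
        then show "x \<in> K" using K(4) by blast
      qed
    qed
    \<comment> \<open>Open superlevel sets are approximated from inside. If the measure is at most
      1/N, the zero function will do; otherwise the difference
      \<open>?\<mu> (G j) - 1 / real N\<close> is positive and can be compared in
      \<open>ennreal\<close>.\<close>
    have "\<exists>h. test_function (G j) h \<and> (\<forall>x. 0 \<le> h x \<and> h x \<le> 1) \<and> ?\<mu> (G j) \<le> \<Lambda> h + 1 / real N" for j
    proof (cases "?\<mu> (G j) \<le> 1 / real N")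
      case True
      then show ?thesis by (intro exI[of _ "\<lambda>x. 0"]) (auto simp: zero test_function_zero)
    next
      case False
      have "ennreal (?\<mu> (G j) - 1 / real N) < content (G j)"
        unfolding outer_open[OF G(1), symmetric] eme[OF G(2,3)]
        using False N(2) by (subst ennreal_less_iff) auto
      then obtain h where h: "h \<in> cutoffs (G j)" "ennreal (?\<mu> (G j) - 1 / real N) < ennreal (\<Lambda> h)"
        using content_approx by blast
      then have "?\<mu> (G j) - 1 / real N < \<Lambda> h"
        using False by (subst (asm) ennreal_less_iff) auto
      then show ?thesis using h(1) by (intro exI[of _ h]) (auto simp: cutoffs_def)
    qed
    then obtain h where h: "\<And>j. test_function (G j) (h j)" "\<And>j x. 0 \<le> h j x \<and> h j x \<le> 1"
      "\<And>j. ?\<mu> (G j) \<le> \<Lambda> (h j) + 1 / real N" by metis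
    have hU: "test_function UNIV (h j)" for j using test_function_subset[OF h(1)] by blast
    have "(LINT x|riesz_measure. f x) \<le> (LINT x|riesz_measure. (\<Sum>j<N. \<delta> * indicator (G j) x))"
    proof (rule integral_mono[OF int_f])
      show "integrable riesz_measure (\<lambda>x. \<Sum>j<N. \<delta> * indicator (G j) x)"
        by (intro Bochner_Integration.integrable_sum int_ind G)
      show "f x \<le> (\<Sum>j<N. \<delta> * indicator (G j) x)" for x
        by (rule staircase_ge[OF \<delta> fN]) (auto simp: G_def indicator_def)
    qed
    also have "\<dots> = (\<Sum>j<N. \<delta> * ?\<mu> (G j))"
      by (subst Bochner_Integration.integral_sum[OF int_ind[OF G(2,3)]]) (simp add: G(3))
    also have "\<dots> = \<delta> * ?\<mu> (G 0) + (\<Sum>j\<in>{1..<N}. \<delta> * ?\<mu> (G j))"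
      by (rule split0)
    also have "\<dots> \<le> \<delta> * ?\<mu> K + (\<Sum>j\<in>{1..<N}. \<delta> * (\<Lambda> (h j) + 1 / real N))"
    proof (intro add_mono sum_mono mult_left_mono h(3))
      show "?\<mu> (G 0) \<le> ?\<mu> K"
        using G(2) G(3) K(2) finite_compact_riesz_measure[OF K(2)]
        by (intro measure_mono_fmeasurable) (auto simp: fmeasurable_def borel_compact)
    qed (use \<delta> in auto)
    also have "\<dots> \<le> \<delta> * ?\<mu> K + ((\<Sum>j\<in>{1..<N}. \<delta> * \<Lambda> (h j)) + \<delta>)"
    proof -
      have "(\<Sum>j\<in>{1..<N}. \<delta> * (\<Lambda> (h j) + 1 / real N)) =
          (\<Sum>j\<in>{1..<N}. \<delta> * \<Lambda> (h j)) + real (N - 1) * (\<delta> * (1 / real N))"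
        by (simp add: distrib_left sum.distrib)
      also have "real (N - 1) * (\<delta> * (1 / real N)) \<le> real N * (\<delta> * (1 / real N))"
        using \<delta> by (intro mult_right_mono) auto
      also have "real N * (\<delta> * (1 / real N)) = \<delta>" using N(2) by simp
      finally show ?thesis by simp
    qed
    also have "(\<Sum>j\<in>{1..<N}. \<delta> * \<Lambda> (h j)) = \<Lambda> (\<lambda>x. \<Sum>j\<in>{1..<N}. \<delta> * h j x)"
      using hU by (simp add: sum test_function_cmult cmult)
    also have "\<dots> \<le> \<Lambda> f"
    proof (intro mono f test_function_sum test_function_cmult hU)
      show "(\<Sum>j\<in>{1..<N}. \<delta> * h j x) \<le> f x" for x
      proof (rule staircase_le[OF \<delta> f0])
        show "h j x = 0" if "f x < real j * \<delta>" for j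
          using test_function_outside[OF h(1), of x j] that by (auto simp: G_def)
      qed (use h in auto)
    qed
    finally have "(LINT x|riesz_measure. f x) \<le> \<Lambda> f + \<delta> * (?\<mu> K + 1)"
      by (simp add: algebra_simps)
    with upper show ?thesis by linarith
  qed
  then show ?thesis by (rule that)
qed

lemma riesz_nonneg:
  assumes f: "test_function UNIV f" and f0: "\<And>x. 0 \<le> f x"
  shows "(LINT x|riesz_measure. f x) = \<Lambda> f"
proof -
  obtain C where C: "\<And>\<delta>. 0 < \<delta> \<Longrightarrow> \<bar>(LINT x|riesz_measure. f x) - \<Lambda> f\<bar> \<le> \<delta> * C"
    using riesz_bounds[OF assms] by blast
  have le_e: "\<bar>(LINT x|riesz_measure. f x) - \<Lambda> f\<bar> \<le> e" if "0 < e" for e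
  proof -
    have "\<bar>(LINT x|riesz_measure. f x) - \<Lambda> f\<bar> \<le> e / (1 + \<bar>C\<bar>) * C"
      using that by (intro C) (auto intro: divide_pos_pos add_pos_nonneg)
    also have "\<dots> \<le> e / (1 + \<bar>C\<bar>) * (1 + \<bar>C\<bar>)"
      using that by (intro mult_left_mono) auto
    also have "\<dots> = e" by (simp add: add_pos_nonneg less_imp_neq[symmetric] )
    finally show ?thesis .
  qed
  have "\<bar>(LINT x|riesz_measure. f x) - \<Lambda> f\<bar> \<le> 0"
    by (rule field_le_epsilon) (use le_e in simp)
  then show ?thesis by simp
qed

text \<open>A signed f becomes nonnegative after adding C h, where h is 1 on its support and C
  bounds it; both f + C h and C h are covered by the nonnegative case.\<close>

theorem riesz_representation:
  assumes f: "test_function UNIV f"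
  shows "(LINT x|riesz_measure. f x) = \<Lambda> f"
proof -
  obtain K where K: "smooth f" "compact K" "K \<subseteq> UNIV" "\<And>x. x \<notin> K \<Longrightarrow> f x = 0"
    using f by (rule test_functionE) blast
  obtain C where C: "0 \<le> C" "\<And>x. \<bar>f x\<bar> \<le> C" using test_function_bounded[OF f] by blast
  obtain h W where h: "test_function UNIV h" "\<And>x. 0 \<le> h x" "\<And>x. h x \<le> 1"
    "open W" "K \<subseteq> W" "\<And>x. x \<in> W \<Longrightarrow> h x = 1"
    by (rule smooth_urysohn[OF K(2) open_UNIV subset_UNIV]) blast
  have Ch: "test_function UNIV (\<lambda>x. C * h x)" "\<And>x. 0 \<le> C * h x"
    using h C test_function_cmult by auto
  have pos: "0 \<le> f x + C * h x" for x
  proof (cases "x \<in> K")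
    case True
    then have "h x = 1" using h(5,6) by blast
    then show ?thesis using C(2)[of x] by simp
  qed (use K(4) Ch(2) in simp)
  have "(LINT x|riesz_measure. f x + C * h x) = \<Lambda> f + \<Lambda> (\<lambda>x. C * h x)"
    using riesz_nonneg[OF test_function_add[OF f Ch(1)] pos] add[OF f Ch(1)] by simp
  then show ?thesis
    using riesz_nonneg[OF Ch] Bochner_Integration.integral_add[OF integrable_riesz_measure[OF f] integrable_riesz_measure[OF Ch(1)]]
    by simp
qed

end

section \<open>Kernels of the kinetic formulation and integration by parts in \<xi>\<close>

section \<open>Integrals with locally bounded coefficients\<close>

text \<open>Bounds hold at every point and not merely almost everywhere. The coefficients will be
  Borel representatives chosen with this property, which makes it stable under composition with
  v.\<close>

definition loc_bounded :: "('a::euclidean_space \<Rightarrow> real) \<Rightarrow> bool" where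
  "loc_bounded b \<longleftrightarrow> (\<forall>C. compact C \<longrightarrow> (\<exists>R. \<forall>x\<in>C. \<bar>b x\<bar> \<le> R))"

definition C_c :: "('a::euclidean_space \<Rightarrow> real) \<Rightarrow> bool" where
  "C_c g \<longleftrightarrow> continuous_on UNIV g \<and> (\<exists>K. compact K \<and> (\<forall>x. x \<notin> K \<longrightarrow> g x = 0))"

lemma loc_boundedE:
  assumes "loc_bounded b" "compact C"
  obtains R where "0 \<le> R" "\<And>x. x \<in> C \<Longrightarrow> \<bar>b x\<bar> \<le> R"
proof -
  obtain R where "\<forall>x\<in>C. \<bar>b x\<bar> \<le> R" using assms by (auto simp: loc_bounded_def)
  then show ?thesis by (intro that[of "max 0 R"]) (auto simp: le_max_iff_disj)
qed

lemma ccE: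
  assumes "C_c g"
  obtains K where "continuous_on UNIV g" "compact K" "\<And>x. x \<notin> K \<Longrightarrow> g x = 0"
  using assms by (auto simp: C_c_def)

lemma cc_continuous: "C_c g \<Longrightarrow> continuous_on UNIV g"
  by (simp add: C_c_def)

lemma cc_measurable: "C_c g \<Longrightarrow> g \<in> borel_measurable borel"
  by (auto simp: C_c_def intro: borel_measurable_continuous_onI)

lemma test_function_cc: "test_function \<Omega> f \<Longrightarrow> C_c f"
  by (erule test_functionE) (auto simp: C_c_def smooth_continuous)

lemma loc_bounded_continuous: "continuous_on UNIV f \<Longrightarrow> loc_bounded f"
  unfolding loc_bounded_def
proof (intro allI impI)
  fix C :: "'a set" assume f: "continuous_on UNIV f" and C: "compact C"
  have "bounded (f ` C)"
    by (intro compact_imp_bounded compact_continuous_image continuous_on_subset[OF f] C) simp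
  then show "\<exists>R. \<forall>x\<in>C. \<bar>f x\<bar> \<le> R" by (auto simp: bounded_iff)
qed

lemma loc_bounded_mult: "loc_bounded f \<Longrightarrow> loc_bounded g \<Longrightarrow> loc_bounded (\<lambda>x. f x * g x)"
  unfolding loc_bounded_def
proof (intro allI impI)
  fix C :: "'a set"
  assume *: "\<forall>C. compact C \<longrightarrow> (\<exists>R. \<forall>x\<in>C. \<bar>f x\<bar> \<le> R)" "\<forall>C. compact C \<longrightarrow> (\<exists>R. \<forall>x\<in>C. \<bar>g x\<bar> \<le> R)"
    "compact C"
  then obtain R S where RS: "\<forall>x\<in>C. \<bar>f x\<bar> \<le> R" "\<forall>x\<in>C. \<bar>g x\<bar> \<le> S" by blast
  have "\<bar>f x * g x\<bar> \<le> R * S" if "x \<in> C" for x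
    unfolding abs_mult using RS that by (intro mult_mono) (auto intro: order_trans[OF abs_ge_zero])
  then show "\<exists>R. \<forall>x\<in>C. \<bar>f x * g x\<bar> \<le> R" by blast
qed

lemma loc_bounded_add: "loc_bounded f \<Longrightarrow> loc_bounded g \<Longrightarrow> loc_bounded (\<lambda>x. f x + g x)"
  unfolding loc_bounded_def by (meson abs_triangle_ineq add_mono order_trans)

lemma loc_bounded_bounded: "(\<And>x. \<bar>f x\<bar> \<le> B) \<Longrightarrow> loc_bounded f"
  unfolding loc_bounded_def by blast

lemma loc_bounded_indicator: "loc_bounded (\<lambda>x. indicator W (h x) :: real)"
  by (rule loc_bounded_bounded[of _ 1]) (auto simp: indicator_def)

lemma loc_bounded_compose:
  fixes v :: "'a::euclidean_space \<Rightarrow> real" and f :: "real \<Rightarrow> real"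
  assumes "loc_bounded f" "loc_bounded v"
  shows "loc_bounded (\<lambda>x. f (v x))"
  unfolding loc_bounded_def
proof (intro allI impI)
  fix C :: "'a set" assume "compact C"
  then obtain R where "\<And>x. x \<in> C \<Longrightarrow> \<bar>v x\<bar> \<le> R" using loc_boundedE[OF assms(2)] by blast
  moreover obtain B where "\<And>s. s \<in> cball 0 R \<Longrightarrow> \<bar>f s\<bar> \<le> B" using loc_boundedE[OF assms(1) compact_cball] by blast
  ultimately show "\<exists>B. \<forall>x\<in>C. \<bar>f (v x)\<bar> \<le> B" by auto
qed

lemma loc_bounded_compose_continuous:
  assumes "loc_bounded f" "continuous_on UNIV h"
  shows "loc_bounded (\<lambda>x. f (h x))"
  unfolding loc_bounded_def
proof (intro allI impI)
  fix C :: "'b set" assume "compact C"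
  then have "compact (h ` C)" using assms(2) by (auto intro: compact_continuous_image continuous_on_subset)
  then obtain B where "\<And>s. s \<in> h ` C \<Longrightarrow> \<bar>f s\<bar> \<le> B" using loc_boundedE[OF assms(1)] by blast
  then show "\<exists>B. \<forall>x\<in>C. \<bar>f (h x)\<bar> \<le> B" by auto
qed

lemma integrable_loc_bounded:
  fixes h :: "'a::euclidean_space \<Rightarrow> real"
  assumes "h \<in> borel_measurable borel" "loc_bounded h" "compact K" "\<And>x. x \<notin> K \<Longrightarrow> h x = 0"
  shows "integrable lborel h"
proof -
  obtain R where R: "0 \<le> R" "\<And>x. x \<in> K \<Longrightarrow> \<bar>h x\<bar> \<le> R" using loc_boundedE[OF assms(2,3)] by blast
  show ?thesis
    by (rule integrableI_bounded_set[of K _ _ R])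
       (use assms R emeasure_compact_finite[OF assms(3)] in \<open>auto simp: borel_compact\<close>)
qed

lemma integrable_coeff_cc:
  assumes "b \<in> borel_measurable borel" "loc_bounded b" "C_c g"
  shows "integrable lborel (\<lambda>x. b x * g x)"
  using assms(3)
proof (rule ccE)
  fix K assume K: "continuous_on UNIV g" "compact K" "\<And>x. x \<notin> K \<Longrightarrow> g x = 0"
  show ?thesis
    by (rule integrable_loc_bounded[OF _ _ K(2)])
       (use assms K cc_measurable[OF assms(3)] loc_bounded_mult[OF assms(2) loc_bounded_continuous[OF K(1)]] in auto)
qed

section \<open>The kinetic kernels\<close>

definition kernel :: "(real \<Rightarrow> real \<Rightarrow> real) \<Rightarrow> bool" where
  "kernel c \<longleftrightarrow> (\<lambda>q. c (fst q) (snd q)) \<in> borel_measurable borel \<and> loc_bounded (\<lambda>q. c (fst q) (snd q))"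

text \<open>\<open>flux_kernel f s k\<close> is the flux at \<open>s\<close> of the Kruzhkov half-entropy \<open>max 0 (\<xi> - k)\<close>, shifted
  by \<open>f 0\<close> times the value of its derivative at \<open>0\<close>.\<close>

definition flux_kernel :: "(real \<Rightarrow> real) \<Rightarrow> real \<Rightarrow> real \<Rightarrow> real" where
  "flux_kernel f s k = (if k < s then f s else 0) - (if k < 0 then f 0 else 0) - f k * chi k s"

text \<open>The source enters the entropy inequality as a(v) E'(v), a point value and not a
  primitive, so neither the \<open>chi\<close> term nor the correction at 0 occurs.\<close>

definition source_kernel :: "(real \<Rightarrow> real) \<Rightarrow> real \<Rightarrow> real \<Rightarrow> real" where
  "source_kernel f s k = (if k < s then f s else 0)"

lemma chi_bounded: "\<bar>chi \<xi> s\<bar> \<le> 1"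
  by (simp add: chi_def)

lemma chi_measurable [measurable]:
  assumes [measurable]: "f \<in> borel_measurable M" "g \<in> borel_measurable M"
  shows "(\<lambda>x. chi (f x) (g x)) \<in> borel_measurable M"
  unfolding chi_def by measurable

lemma kernel_source: 
  assumes "continuous_on UNIV f"
  shows "kernel (source_kernel f)"
proof -
  have [measurable]: "f \<in> borel_measurable borel" using assms by (rule borel_measurable_continuous_onI)
  have eq: "source_kernel f s k = (if k < s then 1 else 0) * f s" for s k by (simp add: source_kernel_def)
  have "loc_bounded (\<lambda>q::real\<times>real. (if snd q < fst q then 1 else 0) * f (fst q))"
    by (intro loc_bounded_mult loc_bounded_bounded[of _ 1] loc_bounded_compose_continuous[OF loc_bounded_continuous[OF assms]] continuous_intros) auto
  then show ?thesis
    unfolding kernel_def eq by (auto simp: borel_prod[symmetric])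
qed

lemma kernel_flux:
  assumes "continuous_on UNIV f"
  shows "kernel (flux_kernel f)"
proof -
  have [measurable]: "f \<in> borel_measurable borel" using assms by (rule borel_measurable_continuous_onI)
  have eq: "flux_kernel f s k = (if k < s then 1 else 0) * f s + ((if k < 0 then - f 0 else 0) + (- chi k s) * f k)" for s k
    by (simp add: flux_kernel_def)
  have "loc_bounded (\<lambda>q::real\<times>real. (if snd q < fst q then 1 else 0) * f (fst q) +
      ((if snd q < 0 then - f 0 else 0) + (- chi (snd q) (fst q)) * f (snd q)))"
    by (intro loc_bounded_add loc_bounded_mult loc_bounded_bounded[of _ 1] loc_bounded_bounded[of _ "\<bar>f 0\<bar>"]
         loc_bounded_compose_continuous[OF loc_bounded_continuous[OF assms]] continuous_intros)
       (auto simp: chi_bounded)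
  then show ?thesis
    unfolding kernel_def eq by (auto simp: borel_prod[symmetric])
qed

text \<open>One shape for all terms of the kinetic functional: p is x at the initial time, with W
  the whole space, or (t,x) with W the upper half space, and g is a slice or a derivative of the
  test function.\<close>

definition kint :: "'p::euclidean_space set \<Rightarrow> ('p \<Rightarrow> real) \<Rightarrow> (real \<Rightarrow> real \<Rightarrow> real) \<Rightarrow> ('p \<times> real \<Rightarrow> real) \<Rightarrow> real" where
  "kint W v c g = (LINT q|lborel. (indicator W (fst q) * c (v (fst q)) (snd q)) * g q)"

lemma kint_coeff:
  fixes v :: "'p::euclidean_space \<Rightarrow> real"
  assumes [measurable]: "W \<in> sets borel" "v \<in> borel_measurable borel" and "loc_bounded v" and c: "kernel c"
  shows "(\<lambda>q. indicator W (fst q) * c (v (fst q)) (snd q)) \<in> borel_measurable borel"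
    and "loc_bounded (\<lambda>q. indicator W (fst q) * c (v (fst q)) (snd q))"
proof -
  have [measurable]: "(\<lambda>q. c (fst q) (snd q)) \<in> borel_measurable (borel \<Otimes>\<^sub>M borel)"
    using c by (simp add: kernel_def borel_prod)
  have "(\<lambda>q. c (v (fst q)) (snd q)) \<in> borel_measurable (borel \<Otimes>\<^sub>M borel)"
    using measurable_compose[of "\<lambda>q. (v (fst q), snd q)" "borel \<Otimes>\<^sub>M borel" "borel \<Otimes>\<^sub>M borel" "\<lambda>q. c (fst q) (snd q)"]
    by simp
  then show "(\<lambda>q. indicator W (fst q) * c (v (fst q)) (snd q)) \<in> borel_measurable borel"
    by (simp add: borel_prod[symmetric])
  have "loc_bounded (\<lambda>q. c (v (fst q)) (snd q))"
    unfolding loc_bounded_def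
  proof (intro allI impI)
    fix C :: "('p \<times> real) set" assume C: "compact C"
    have "compact (fst ` C)" "compact (snd ` C)"
      using C by (auto intro!: compact_continuous_image continuous_intros)
    then obtain R S where RS: "\<And>p. p \<in> fst ` C \<Longrightarrow> \<bar>v p\<bar> \<le> R" "\<And>k. k \<in> snd ` C \<Longrightarrow> \<bar>k\<bar> \<le> S"
      using assms(3) loc_bounded_continuous[OF continuous_on_id] unfolding loc_bounded_def by meson
    have "compact (cball (0::real) R \<times> cball (0::real) S)" by (intro compact_Times compact_cball)
    moreover have "loc_bounded (\<lambda>q. c (fst q) (snd q))" using c by (simp add: kernel_def)
    ultimately obtain B where B: "\<And>q. q \<in> cball 0 R \<times> cball (0::real) S \<Longrightarrow> \<bar>c (fst q) (snd q)\<bar> \<le> B"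
      unfolding loc_bounded_def by meson
    have "\<bar>c (v (fst q)) (snd q)\<bar> \<le> B" if "q \<in> C" for q
      using B[of "(v (fst q), snd q)"] RS that by auto
    then show "\<exists>B. \<forall>q\<in>C. \<bar>c (v (fst q)) (snd q)\<bar> \<le> B" by blast
  qed
  then show "loc_bounded (\<lambda>q. indicator W (fst q) * c (v (fst q)) (snd q))"
    by (intro loc_bounded_mult loc_bounded_indicator)
qed

lemma kint_integrable:
  assumes "W \<in> sets borel" "v \<in> borel_measurable borel" "loc_bounded v" "kernel c" "C_c g"
  shows "integrable lborel (\<lambda>q. (indicator W (fst q) * c (v (fst q)) (snd q)) * g q)"
  by (rule integrable_coeff_cc[OF kint_coeff[OF assms(1-4)] assms(5)])

lemma kint_add:
  assumes "W \<in> sets borel" "v \<in> borel_measurable borel" "loc_bounded v" "kernel c" "C_c g" "C_c h"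
  shows "kint W v c (\<lambda>q. g q + h q) = kint W v c g + kint W v c h"
  unfolding kint_def distrib_left
  by (rule Bochner_Integration.integral_add[OF kint_integrable[OF assms(1-4,5)] kint_integrable[OF assms(1-4,6)]])

lemma kint_cmult: "kint W v c (\<lambda>q. r * g q) = r * kint W v c g"
  unfolding kint_def by (subst integral_mult_right_zero[symmetric]) (simp add: ac_simps)

lemma kint_fubini:
  assumes "W \<in> sets borel" "v \<in> borel_measurable borel" "loc_bounded v" "kernel c" "C_c g"
  shows "kint W v c g = (LINT p|lborel. indicator W p * (LINT k|lborel. c (v p) k * g (p, k)))"
proof -
  have "kint W v c g = (LINT p|lborel. LINT k|lborel. (indicator W p * c (v p) k) * g (p, k))"
    using lborel_pair.integral_fst'[of "\<lambda>q. (indicator W (fst q) * c (v (fst q)) (snd q)) * g q"]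
      kint_integrable[OF assms] by (simp add: kint_def lborel_prod)
  then show ?thesis
    by (simp add: mult.assoc)
qed

section \<open>Integration by parts against the indicator function\<close>

lemma integral_below:
  fixes e \<theta> :: "real \<Rightarrow> real"
  assumes e: "\<And>x. (e has_real_derivative \<theta> x) (at x)" and \<theta>: "C_c \<theta>" and a: "\<And>x. x \<le> a \<Longrightarrow> e x = 0"
  shows "integrable lborel (\<lambda>k. (if k < s then 1 else 0) * \<theta> k)"
    and "(LINT k|lborel. (if k < s then 1 else 0) * \<theta> k) = e s"
proof -
  show "integrable lborel (\<lambda>k. (if k < s then 1 else 0) * \<theta> k)"
    by (rule integrable_coeff_cc[OF _ _ \<theta>]) (auto intro: loc_bounded_bounded[of _ 1])
  have [measurable]: "\<theta> \<in> borel_measurable borel" using cc_measurable[OF \<theta>] .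
  have \<theta>0: "\<theta> x = 0" if "x < a" for x
  proof -
    have "((\<lambda>x. 0) has_real_derivative 0) (at x)" by simp
    then have "(e has_real_derivative 0) (at x)"
      by (rule has_field_derivative_transform_within_open[of _ _ _ "{..<a}"]) (use that a in auto)
    then show ?thesis using e[of x] DERIV_unique by blast
  qed
  \<comment> \<open>If s lies below a, the interval degenerates to a point and both sides are
    0.\<close>
  define b where "b = min a s"
  have "(LINT k|lborel. (if k < s then 1 else 0) * \<theta> k) = (LINT k|lborel. indicator {b..s} k *\<^sub>R \<theta> k)"
  proof (rule integral_cong_AE)
    have "AE k in lborel. k \<noteq> s" "AE k in lborel. k \<noteq> a" by (rule AE_lborel_singleton)+
    then show "AE k in lborel. (if k < s then 1 else 0) * \<theta> k = indicator {b..s} k *\<^sub>R \<theta> k"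
      by eventually_elim (use \<theta>0 in \<open>auto simp: b_def min_def indicator_def\<close>)
  qed auto
  also have "\<dots> = e s - e b"
  proof (rule integral_FTC_Icc)
    show "b \<le> s" by (simp add: b_def)
    show "(e has_vector_derivative \<theta> x) (at x within {b..s})" for x
      using e[of x] by (auto simp: has_real_derivative_iff_has_vector_derivative intro: has_vector_derivative_at_within)
    show "continuous_on {b..s} \<theta>" using cc_continuous[OF \<theta>] continuous_on_subset by blast
  qed
  also have "e b = 0" by (rule a) (simp add: b_def)
  finally show "(LINT k|lborel. (if k < s then 1 else 0) * \<theta> k) = e s" by simp
qed

lemma integral_source_kernel:
  assumes "\<And>x. (e has_real_derivative \<theta> x) (at x)" "C_c \<theta>" "\<And>x. x \<le> a \<Longrightarrow> e x = 0"
  shows "(LINT k|lborel. source_kernel f s k * \<theta> k) = f s * e s"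
proof -
  have "source_kernel f s k * \<theta> k = f s * ((if k < s then 1 else 0) * \<theta> k)" for k
    by (simp add: source_kernel_def)
  then show ?thesis by (simp only: integral_mult_right_zero integral_below(2)[OF assms])
qed

text \<open>The three parts of the kernel integrate separately. The identity serves twice: for e a
  \<xi>-slice of a test function it produces the trace term of K2, and for e = E' it produces the
  entropy flux.\<close>

lemma integral_flux_kernel:
  assumes "\<And>x. (e has_real_derivative \<theta> x) (at x)" "C_c \<theta>" "\<And>x. x \<le> a \<Longrightarrow> e x = 0" "continuous_on UNIV f"
  shows "(LINT k|lborel. flux_kernel f s k * \<theta> k) =
    f s * e s - f 0 * e 0 - (LINT k|lborel. f k * chi k s * \<theta> k)"
proof -
  have eq: "flux_kernel f s k * \<theta> k = f s * ((if k < s then 1 else 0) * \<theta> k) - f 0 * ((if k < 0 then 1 else 0) * \<theta> k)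
     - (f k * chi k s) * \<theta> k" for k
    by (simp add: flux_kernel_def algebra_simps)
  have "f \<in> borel_measurable borel" using assms(4) by (rule borel_measurable_continuous_onI)
  then have "integrable lborel (\<lambda>k. (f k * chi k s) * \<theta> k)"
    by (intro integrable_coeff_cc[OF _ _ assms(2)] loc_bounded_mult loc_bounded_continuous[OF assms(4)] loc_bounded_bounded[of _ 1])
       (auto simp: chi_bounded)
  then show ?thesis
    unfolding eq using integral_below[OF assms(1-3)]
    by (simp add: Bochner_Integration.integral_diff Bochner_Integration.integrable_diff)
qed

lemma cc_slice:
  assumes "C_c (g :: 'p::euclidean_space \<times> real \<Rightarrow> real)"
  shows "C_c (\<lambda>k. g (p, k))"
proof -
  obtain K where K: "continuous_on UNIV g" "compact K" "\<And>q. q \<notin> K \<Longrightarrow> g q = 0" using assms by (rule ccE) blast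
  have "compact (snd ` K)" using K(2) by (auto intro!: compact_continuous_image continuous_intros)
  moreover have "g (p, k) = 0" if "k \<notin> snd ` K" for k using K(3)[of "(p,k)"] that by force
  moreover have "continuous_on UNIV (\<lambda>k. g (p, k))"
    using K(1) by (auto intro!: continuous_on_compose2[of UNIV g] continuous_intros)
  ultimately show ?thesis unfolding C_c_def by blast
qed

lemma cc_bounded:
  assumes "C_c g"
  obtains C where "0 \<le> C" "\<And>x. \<bar>g x\<bar> \<le> C"
proof -
  obtain K where K: "continuous_on UNIV g" "compact K" "\<And>q. q \<notin> K \<Longrightarrow> g q = 0" using assms by (rule ccE) blast
  obtain C where C: "0 \<le> C" "\<And>q. q \<in> K \<Longrightarrow> \<bar>g q\<bar> \<le> C"
    using loc_boundedE[OF loc_bounded_continuous[OF K(1)] K(2)] by blast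
  have "\<bar>g q\<bar> \<le> C" for q using C K(3)[of q] by (cases "q \<in> K") auto
  then show ?thesis using C(1) by (intro that)
qed

lemma cc_support_prod:
  assumes "C_c (g :: 'p::euclidean_space \<times> real \<Rightarrow> real)"
  obtains K S where "compact K" "0 \<le> S" "\<And>p k. p \<notin> K \<or> S < \<bar>k\<bar> \<Longrightarrow> g (p, k) = 0"
proof -
  obtain K where K: "compact K" "\<And>q. q \<notin> K \<Longrightarrow> g q = 0" using assms by (rule ccE) blast
  have Kf: "compact (fst ` K)" "compact (snd ` K)"
    using K(1) by (auto intro!: compact_continuous_image continuous_intros)
  obtain S where S: "0 \<le> S" "\<And>k. k \<in> snd ` K \<Longrightarrow> \<bar>k\<bar> \<le> S"
    using loc_boundedE[OF loc_bounded_continuous[OF continuous_on_id] Kf(2)] by blast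
  have "g (p, k) = 0" if "p \<notin> fst ` K \<or> S < \<bar>k\<bar>" for p k
    using K(2)[of "(p, k)"] S(2)[of k] that by force
  from that[OF Kf(1) S(1) this] show ?thesis .
qed

lemma chi_integrable:
  fixes v :: "'p::euclidean_space \<Rightarrow> real"
  assumes W: "W \<in> sets borel" and v: "v \<in> borel_measurable borel" and f: "continuous_on UNIV f" and g: "C_c g"
  shows "integrable lborel (\<lambda>q. indicator W (fst q) * (f (snd q) * chi (snd q) (v (fst q)) * g q))"
proof -
  note [measurable] = W v
  have fm[measurable]: "f \<in> borel_measurable borel" using f by (rule borel_measurable_continuous_onI)
  have "(\<lambda>q. indicator W (fst q) * (f (snd q) * chi (snd q) (v (fst q))) :: real) \<in> borel_measurable (borel \<Otimes>\<^sub>M borel)"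
    by measurable
  moreover have "loc_bounded (\<lambda>q. indicator W (fst q) * (f (snd q) * chi (snd q) (v (fst q))))"
    by (intro loc_bounded_mult loc_bounded_indicator loc_bounded_bounded[of "\<lambda>q. chi (snd q) (v (fst q))" 1] chi_bounded
        loc_bounded_compose_continuous[OF loc_bounded_continuous[OF f]] continuous_intros)
  ultimately have "integrable lborel (\<lambda>q. indicator W (fst q) * (f (snd q) * chi (snd q) (v (fst q))) * g q)"
    using integrable_coeff_cc[OF _ _ g] by (simp add: borel_prod)
  then show ?thesis by (simp add: mult.assoc)
qed

lemma trace_integrable:
  fixes v w :: "'p::euclidean_space \<Rightarrow> real"
  assumes W: "W \<in> sets borel" and v: "v \<in> borel_measurable borel" "loc_bounded v"
    and w: "w \<in> borel_measurable borel" and f: "continuous_on UNIV f" and g: "C_c g"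
  shows "integrable lborel (\<lambda>p. indicator W p * (f (v p) * g (p, w p)))"
proof -
  note [measurable] = W v(1) w
  have fm[measurable]: "f \<in> borel_measurable borel" using f by (rule borel_measurable_continuous_onI)
  have gm[measurable]: "g \<in> borel_measurable (borel \<Otimes>\<^sub>M borel)"
    using g cc_measurable by (auto simp: borel_prod)
  obtain C where C: "\<And>q. \<bar>g q\<bar> \<le> C" using cc_bounded[OF g] by blast
  obtain K S where K: "compact K" "0 \<le> S" "\<And>p k. p \<notin> K \<or> S < \<bar>k\<bar> \<Longrightarrow> g (p, k) = 0"
    by (rule cc_support_prod[OF g]) blast
  have "loc_bounded (\<lambda>p. indicator W p * (f (v p) * g (p, w p)))"
    by (intro loc_bounded_mult loc_bounded_indicator loc_bounded_compose[OF loc_bounded_continuous[OF f] v(2)]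
       loc_bounded_bounded[of "\<lambda>p. g (p, w p)" C] C)
  moreover have "(\<lambda>p. indicator W p * (f (v p) * g (p, w p)) :: real) \<in> borel_measurable borel"
    by measurable
  ultimately show ?thesis
    by (intro integrable_loc_bounded[OF _ _ K(1)]) (auto simp: K(3))
qed

lemma pair_dchi_integrable:
  fixes v :: "'p::euclidean_space \<Rightarrow> real"
  assumes W: "W \<in> sets borel" and v: "v \<in> borel_measurable borel" "loc_bounded v"
    and f: "continuous_on UNIV f" and g: "C_c g"
  shows "integrable lborel (\<lambda>p. indicator W p * pair_dchi (\<lambda>\<xi>. f \<xi> * g (p, \<xi>)) (v p))"
proof -
  have "loc_bounded (\<lambda>p::'p. 0::real)" by (rule loc_bounded_bounded[of _ 0]) simp
  from Bochner_Integration.integrable_diff[OF trace_integrable[OF W _ this _ f g, of "\<lambda>p. 0"] trace_integrable[OF W v v(1) f g]]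
  show ?thesis by (simp add: pair_dchi_def right_diff_distrib)
qed

lemma cc_eventually_below:
  assumes g: "C_c (g :: 'p::euclidean_space \<times> real \<Rightarrow> real)"
  obtains a where "\<And>p k. k \<le> a \<Longrightarrow> g (p, k) = 0"
proof -
  obtain L S where "compact L" and K: "0 \<le> S" "\<And>p k. p \<notin> L \<or> S < \<bar>k\<bar> \<Longrightarrow> g (p, k) = 0"
    by (rule cc_support_prod[OF g]) blast
  have "g (p, k) = 0" if "k \<le> - S - 1" for p k
    by (rule K(2)) (use that K(1) in linarith)
  then show ?thesis by (rule that)
qed

text \<open>This is how a volume term of K2 and its trace term merge into one pairing of a kernel
  with a \<xi>-derivative.\<close>

lemma kint_flux_by_parts:
  fixes g g' :: "'p::euclidean_space \<times> real \<Rightarrow> real"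
  assumes W: "W \<in> sets borel" and v: "v \<in> borel_measurable borel" "loc_bounded v" and f: "continuous_on UNIV f"
    and g: "C_c g" "C_c g'" "\<And>p \<xi>. ((\<lambda>\<xi>. g (p, \<xi>)) has_real_derivative g' (p, \<xi>)) (at \<xi>)"
  shows "kint W v (flux_kernel f) g' =
      - (LINT q|lborel. indicator W (fst q) * (f (snd q) * chi (snd q) (v (fst q)) * g' q))
      - (LINT p|lborel. indicator W p * pair_dchi (\<lambda>\<xi>. f \<xi> * g (p, \<xi>)) (v p))"
proof -
  obtain a where a: "\<And>p k. k \<le> a \<Longrightarrow> g (p, k) = 0" using cc_eventually_below[OF g(1)] by blast
  have inner: "(LINT k|lborel. flux_kernel f (v p) k * g' (p, k)) =
      - (LINT k|lborel. f k * chi k (v p) * g' (p, k)) - pair_dchi (\<lambda>\<xi>. f \<xi> * g (p, \<xi>)) (v p)" for p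
    using integral_flux_kernel[OF g(3) cc_slice[OF g(2)] a f, where s="v p"]
    by (simp add: pair_dchi_def)
  note int1 = chi_integrable[OF W v(1) f g(2)]
  note int2 = pair_dchi_integrable[OF W v f g(1)]
  have "kint W v (flux_kernel f) g' = (LINT p|lborel. - (LINT k|lborel. indicator W p * (f k * chi k (v p) * g' (p, k)))
     - indicator W p * pair_dchi (\<lambda>\<xi>. f \<xi> * g (p, \<xi>)) (v p))"
    unfolding kint_fubini[OF W v kernel_flux[OF f] g(2)] inner by (simp add: right_diff_distrib)
  also have "\<dots> = - (LINT p|lborel. LINT k|lborel. indicator W p * (f k * chi k (v p) * g' (p, k)))
     - (LINT p|lborel. indicator W p * pair_dchi (\<lambda>\<xi>. f \<xi> * g (p, \<xi>)) (v p))"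
    using lborel_pair.integrable_fst'[of "\<lambda>q. indicator W (fst q) * (f (snd q) * chi (snd q) (v (fst q)) * g' q)"] int1 int2
    by (subst Bochner_Integration.integral_diff) (auto simp: lborel_prod)
  also have "(LINT p|lborel. LINT k|lborel. indicator W p * (f k * chi k (v p) * g' (p, k))) =
     (LINT q|lborel. indicator W (fst q) * (f (snd q) * chi (snd q) (v (fst q)) * g' q))"
    using lborel_pair.integral_fst'[of "\<lambda>q. indicator W (fst q) * (f (snd q) * chi (snd q) (v (fst q)) * g' q)"] int1
    by (simp add: lborel_prod)
  finally show ?thesis .
qed

lemma kint_source_by_parts:
  fixes g g' :: "'p::euclidean_space \<times> real \<Rightarrow> real"
  assumes W: "W \<in> sets borel" and v: "v \<in> borel_measurable borel" "loc_bounded v" and f: "continuous_on UNIV f"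
    and g: "C_c g" "C_c g'" "\<And>p \<xi>. ((\<lambda>\<xi>. g (p, \<xi>)) has_real_derivative g' (p, \<xi>)) (at \<xi>)"
  shows "kint W v (source_kernel f) g' = (LINT p|lborel. indicator W p * (f (v p) * g (p, v p)))"
proof -
  obtain a where a: "\<And>p k. k \<le> a \<Longrightarrow> g (p, k) = 0" using cc_eventually_below[OF g(1)] by blast
  show ?thesis
    unfolding kint_fubini[OF W v kernel_source[OF f] g(2)]
    using integral_source_kernel[OF g(3) cc_slice[OF g(2)] a] by simp
qed

section \<open>Integration by parts for weakly differentiable functions\<close>

lemma deriv_smooth_step_eq_0:
  assumes "y < 0 \<or> 1 < y"
  shows "deriv smooth_step y = 0"
proof -
  have c: "((\<lambda>x. c) has_real_derivative 0) (at y)" for c by simp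
  have "(smooth_step has_real_derivative 0) (at y)"
  proof (cases "y < 0")
    case True
    show ?thesis
      by (rule has_field_derivative_transform_within_open[OF c[of 0], of "{..<0}"])
         (use True in \<open>simp_all add: smooth_step_eq_0\<close>)
  next
    case False
    with assms have "1 < y" by simp
    then show ?thesis
      by (intro has_field_derivative_transform_within_open[OF c[of 1], of "{1<..}"])
         (simp_all add: smooth_step_eq_1)
  qed
  then show ?thesis by (rule DERIV_imp_deriv)
qed

lemma cc_deriv_smooth_step: "C_c (deriv smooth_step)"
  unfolding C_c_def using smooth_deriv_real(2)[OF smooth_smooth_step] deriv_smooth_step_eq_0
  by (intro conjI exI[of _ "{0..1}"]) (auto simp: not_le)

lemma integral_deriv_smooth_step: "(LINT y|lborel. deriv smooth_step y) = 1"
proof -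
  have "(if k < 2 then 1 else 0) * deriv smooth_step k = deriv smooth_step k" for k
    using deriv_smooth_step_eq_0[of k] by auto
  then show ?thesis
    using integral_below(2)[OF smooth_deriv_real(1)[OF smooth_smooth_step] cc_deriv_smooth_step smooth_step_eq_0, where s=2 and a=0]
    by (simp only: smooth_step_eq_1)
qed

text \<open>The function \<chi>(., s) is not admissible in the weak formula since it jumps at 0 and
  at s. It is replaced by a difference of smooth steps; the product with \<psi> is a test function,
  the derivatives of the two steps concentrate at 0 and s and leave the values of \<psi> f there,
  and the remaining terms converge by domination. Continuity of f makes the concentration from one
  side harmless.\<close>

lemma integral_weak_derivative:
  assumes f: "continuous_on UNIV f" and f': "f' \<in> borel_measurable borel"
    "\<And>R. integrable lborel (\<lambda>x. indicator (cball 0 R) x * f' x)"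
    and weak: "\<And>\<phi>. test_function UNIV \<phi> \<Longrightarrow> (LINT s|lborel. deriv \<phi> s * f s) = - (LINT s|lborel. \<phi> s * f' s)"
    and \<psi>: "test_function UNIV \<psi>"
  shows "(LINT k|lborel. f' k * chi k s * \<psi> k) =
    f s * \<psi> s - f 0 * \<psi> 0 - (LINT k|lborel. f k * chi k s * deriv \<psi> k)"
proof -
  have sm: "smooth \<psi>" using \<psi> by (rule test_function_smooth)
  note [measurable] = f'(1) borel_measurable_continuous_onI[OF f] borel_measurable_continuous_onI[OF smooth_continuous[OF sm]]
    borel_measurable_continuous_onI[OF smooth_deriv_real(2)[OF sm]]
    borel_measurable_continuous_onI[OF smooth_continuous[OF smooth_smooth_step]]
    borel_measurable_continuous_onI[OF smooth_deriv_real(2)[OF smooth_smooth_step]]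
  have ccd: "C_c (deriv \<psi>)"
  proof -
    have "test_function UNIV (\<lambda>x. frechet_derivative \<psi> (at x) 1)" by (rule test_function_frechet[OF \<psi>])
    moreover have "(\<lambda>x. frechet_derivative \<psi> (at x) 1) = deriv \<psi>"
      using frechet_derivative_real[OF differentiableI[OF smooth_has_derivative[OF sm]], of _ 1] by auto
    ultimately show ?thesis using test_function_cc by metis
  qed
  obtain B where B: "0 \<le> B" "\<And>x. \<bar>\<psi> x\<bar> \<le> B" using test_function_bounded[OF \<psi>] by blast
  obtain K where K: "compact K" "\<And>x. x \<notin> K \<Longrightarrow> \<psi> x = 0" using \<psi> by (rule test_functionE) blast
  obtain R where R: "\<And>k. k \<in> K \<Longrightarrow> \<bar>k\<bar> \<le> R"
    using loc_boundedE[OF loc_bounded_continuous[OF continuous_on_id] K(1)] by blast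
  have \<psi>R: "\<psi> x = indicator (cball 0 R) x * \<psi> x" for x using K(2)[of x] R[of x] by (auto simp: indicator_def)
  \<comment> \<open>The argument n (k - r) is written as a constant plus a linear map to match
    \<open>smooth_compose_affine\<close>.\<close>
  define \<tau> where "\<tau> n r k = smooth_step ((- (real n * r)) + real n * k)" for n r k
  have \<tau>_smooth: "smooth (\<tau> n r)" for n r
    unfolding \<tau>_def by (intro smooth_compose_affine smooth_smooth_step bounded_linear_mult_right)
  have \<tau>_deriv: "(\<tau> n r has_real_derivative real n * deriv smooth_step (real n * (k - r))) (at k)" for n r k
    unfolding \<tau>_def
    by (rule DERIV_chain'[of _ "real n", THEN DERIV_cong])
       (auto intro!: derivative_eq_intros smooth_deriv_real(1)[OF smooth_smooth_step] simp: algebra_simps)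
  have \<tau>01: "\<bar>\<tau> n r k\<bar> \<le> 1" for n r k using smooth_step_bounds by (simp add: \<tau>_def)
  have \<tau>_lim: "(\<lambda>n. \<tau> n r k) \<longlonglongrightarrow> (if r < k then 1 else 0)" for r k
  proof (cases "r < k")
    case True
    obtain N where N: "1 / (k - r) < real N" using reals_Archimedean2 by blast
    have "\<tau> n r k = 1" if "N \<le> n" for n
    proof -
      have "1 / (k - r) < real n" using N that by linarith
      then have "1 \<le> real n * (k - r)" using True by (simp add: field_simps)
      then show ?thesis unfolding \<tau>_def by (intro smooth_step_eq_1) (simp add: algebra_simps)
    qed
    then show ?thesis using True by (auto intro!: tendsto_eventually eventually_sequentiallyI)
  next
    case False
    then have "\<tau> n r k = 0" for n
      unfolding \<tau>_def by (intro smooth_step_eq_0) (simp add: mult_left_mono)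
    then show ?thesis using False by simp
  qed
  text \<open>The derivatives of the smoothed Heaviside functions form an approximate identity.\<close>
  have conc: "(\<lambda>n. LINT k|lborel. (real (Suc n) * deriv smooth_step (real (Suc n) * (k - r))) * h k) \<longlonglongrightarrow> h r"
    if h: "continuous_on UNIV h" for h :: "real \<Rightarrow> real" and r
  proof -
    have [measurable]: "h \<in> borel_measurable borel" using h by (rule borel_measurable_continuous_onI)
    have eq: "(LINT k|lborel. (real (Suc n) * deriv smooth_step (real (Suc n) * (k - r))) * h k) =
        (LINT y|lborel. deriv smooth_step y * h (r + y / real (Suc n)))" for n
    proof -
      define N where "N = real (Suc n)"
      have N: "0 < N" by (simp add: N_def)
      have "(LINT k|lborel. (N * deriv smooth_step (N * (k - r))) * h k) =
          \<bar>1 / N\<bar> *\<^sub>R (LINT y|lborel. (N * deriv smooth_step (N * (r + 1 / N * y - r))) * h (r + 1 / N * y))"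
        using N by (intro lborel_integral_real_affine) simp
      also have "\<dots> = (LINT y|lborel. \<bar>1 / N\<bar> * ((N * deriv smooth_step (N * (r + 1 / N * y - r))) * h (r + 1 / N * y)))"
        by simp
      also have "\<dots> = (LINT y|lborel. deriv smooth_step y * h (r + y / N))"
        using N by (intro Bochner_Integration.integral_cong refl) simp
      finally show ?thesis by (simp add: N_def)
    qed
    obtain D where D: "0 \<le> D" "\<And>y. y \<in> cball r 1 \<Longrightarrow> \<bar>h y\<bar> \<le> D"
      using loc_boundedE[OF loc_bounded_continuous[OF h] compact_cball] by blast
    have "(\<lambda>n. LINT y|lborel. deriv smooth_step y * h (r + y / real (Suc n))) \<longlonglongrightarrow> (LINT y|lborel. deriv smooth_step y * h r)"
    proof (rule integral_dominated_convergence[where w="\<lambda>y. \<bar>deriv smooth_step y\<bar> * D"])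
      show "integrable lborel (\<lambda>y. \<bar>deriv smooth_step y\<bar> * D)"
        using integrable_coeff_cc[of "\<lambda>x. 1", OF _ _ cc_deriv_smooth_step] loc_bounded_bounded[of "\<lambda>x::real. 1" 1] by auto
      show "AE y in lborel. (\<lambda>n. deriv smooth_step y * h (r + y / real (Suc n))) \<longlonglongrightarrow> deriv smooth_step y * h r"
      proof (rule AE_I2)
        fix y
        have "(\<lambda>n. r + y / real (Suc n)) \<longlonglongrightarrow> r + 0"
          by (intro tendsto_intros LIMSEQ_Suc[OF lim_const_over_n])
        then have "(\<lambda>n. h (r + y / real (Suc n))) \<longlonglongrightarrow> h r"
          using h by (auto simp: continuous_on_eq_continuous_at intro: isCont_tendsto_compose[where g=h])
        then show "(\<lambda>n. deriv smooth_step y * h (r + y / real (Suc n))) \<longlonglongrightarrow> deriv smooth_step y * h r"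
          by (rule tendsto_mult_left)
      qed
      show "AE y in lborel. norm (deriv smooth_step y * h (r + y / real (Suc n))) \<le> \<bar>deriv smooth_step y\<bar> * D" for n
      proof (rule AE_I2)
        fix y
        show "norm (deriv smooth_step y * h (r + y / real (Suc n))) \<le> \<bar>deriv smooth_step y\<bar> * D"
        proof (cases "y < 0 \<or> 1 < y")
          case False
          then have "\<bar>y / real (Suc n)\<bar> \<le> 1" by (simp add: field_simps)
          then have "\<bar>h (r + y / real (Suc n))\<bar> \<le> D" by (intro D(2)) (simp add: dist_real_def)
          then show ?thesis by (simp add: abs_mult mult_left_mono)
        qed (simp add: deriv_smooth_step_eq_0)
      qed
    qed auto
    then show ?thesis unfolding eq using integral_deriv_smooth_step by simp
  qed
  define X where "X n k = \<tau> (Suc n) 0 k - \<tau> (Suc n) s k" for n k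
  have X_lim: "(\<lambda>n. X n k) \<longlonglongrightarrow> chi k s" if "k \<noteq> 0" "k \<noteq> s" for k
  proof -
    \<comment> \<open>A difference of two Heaviside functions is \<chi> for either sign of s, except
      at the two jumps, which form a null set.\<close>
    have "(\<lambda>n. X n k) \<longlonglongrightarrow> (if 0 < k then 1 else 0) - (if s < k then 1 else 0)"
      unfolding X_def by (intro tendsto_diff LIMSEQ_Suc[OF \<tau>_lim])
    also have "(if 0 < k then 1 else 0) - (if s < k then 1 else 0) = chi k s"
      using that by (auto simp: chi_def)
    finally show ?thesis .
  qed
  have X2: "\<bar>X n k\<bar> \<le> 2" for n k using \<tau>01[of "Suc n" 0 k] \<tau>01[of "Suc n" s k] by (simp add: X_def)
  have X_smooth: "smooth (X n)" for n unfolding X_def by (intro smooth_diff \<tau>_smooth)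
  have [measurable]: "X n \<in> borel_measurable borel" for n
    using smooth_continuous[OF X_smooth] by (rule borel_measurable_continuous_onI)
  have ae: "AE k in lborel. k \<noteq> 0 \<and> k \<noteq> s"
    using AE_lborel_singleton[of 0] AE_lborel_singleton[of s] by eventually_elim auto
  \<comment> \<open>f' is only locally integrable, so the majorant keeps f' itself, restricted to a
    ball that contains the support of \<psi>.\<close>
  have L1: "(\<lambda>n. LINT k|lborel. (\<psi> k * X n k) * f' k) \<longlonglongrightarrow> (LINT k|lborel. f' k * chi k s * \<psi> k)"
  proof (rule integral_dominated_convergence[where w="\<lambda>k. 2 * B * \<bar>indicator (cball 0 R) k * f' k\<bar>"])
    show "integrable lborel (\<lambda>k. 2 * B * \<bar>indicator (cball 0 R) k * f' k\<bar>)"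
      using f'(2)[of R] by (intro integrable_mult_right integrable_abs)
    show "AE k in lborel. (\<lambda>n. (\<psi> k * X n k) * f' k) \<longlonglongrightarrow> f' k * chi k s * \<psi> k"
      using ae
    proof eventually_elim
      fix k assume "k \<noteq> 0 \<and> k \<noteq> s"
      then have "(\<lambda>n. (\<psi> k * X n k) * f' k) \<longlonglongrightarrow> (\<psi> k * chi k s) * f' k"
        by (intro tendsto_intros X_lim) auto
      then show "(\<lambda>n. (\<psi> k * X n k) * f' k) \<longlonglongrightarrow> f' k * chi k s * \<psi> k" by (simp add: ac_simps)
    qed
    show "AE k in lborel. norm ((\<psi> k * X n k) * f' k) \<le> 2 * B * \<bar>indicator (cball 0 R) k * f' k\<bar>" for n
    proof (rule AE_I2)
      fix k
      have "\<bar>\<psi> k\<bar> * \<bar>X n k\<bar> \<le> B * 2" by (intro mult_mono B X2) auto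
      then have "\<bar>\<psi> k\<bar> * \<bar>X n k\<bar> * \<bar>indicator (cball 0 R) k * f' k\<bar> \<le> (B * 2) * \<bar>indicator (cball 0 R) k * f' k\<bar>"
        by (intro mult_right_mono) auto
      then show "norm ((\<psi> k * X n k) * f' k) \<le> 2 * B * \<bar>indicator (cball 0 R) k * f' k\<bar>"
        using \<psi>R[of k] by (cases "k \<in> cball 0 R") (auto simp: abs_mult ac_simps)
    qed
  qed auto
  have L2: "(\<lambda>n. LINT k|lborel. (deriv \<psi> k * X n k) * f k) \<longlonglongrightarrow> (LINT k|lborel. f k * chi k s * deriv \<psi> k)"
  proof (rule integral_dominated_convergence[where w="\<lambda>k. 2 * \<bar>f k * deriv \<psi> k\<bar>"])
    show "integrable lborel (\<lambda>k. 2 * \<bar>f k * deriv \<psi> k\<bar>)"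
      by (intro integrable_mult_right integrable_abs integrable_coeff_cc ccd loc_bounded_continuous[OF f]) simp
    show "AE k in lborel. (\<lambda>n. (deriv \<psi> k * X n k) * f k) \<longlonglongrightarrow> f k * chi k s * deriv \<psi> k"
      using ae
    proof eventually_elim
      fix k assume "k \<noteq> 0 \<and> k \<noteq> s"
      then have "(\<lambda>n. (deriv \<psi> k * X n k) * f k) \<longlonglongrightarrow> (deriv \<psi> k * chi k s) * f k"
        by (intro tendsto_intros X_lim) auto
      then show "(\<lambda>n. (deriv \<psi> k * X n k) * f k) \<longlonglongrightarrow> f k * chi k s * deriv \<psi> k" by (simp add: ac_simps)
    qed
    show "AE k in lborel. norm ((deriv \<psi> k * X n k) * f k) \<le> 2 * \<bar>f k * deriv \<psi> k\<bar>" for n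
    proof (rule AE_I2)
      fix k
      have "\<bar>X n k\<bar> * \<bar>f k * deriv \<psi> k\<bar> \<le> 2 * \<bar>f k * deriv \<psi> k\<bar>"
        by (intro mult_right_mono X2) auto
      then show "norm ((deriv \<psi> k * X n k) * f k) \<le> 2 * \<bar>f k * deriv \<psi> k\<bar>"
        by (simp add: abs_mult ac_simps)
    qed
  qed auto
  define d where "d r n k = (real (Suc n) * deriv smooth_step (real (Suc n) * (k - r))) * (\<psi> k * f k)" for r n k
  have cf: "continuous_on UNIV (\<lambda>k. \<psi> k * f k)"
    by (intro continuous_on_mult f smooth_continuous[OF sm])
  have L3: "(\<lambda>n. LINT k|lborel. d r n k) \<longlonglongrightarrow> \<psi> r * f r" for r
    unfolding d_def by (rule conc[OF cf])
  have dint: "integrable lborel (d r n)" for r n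
  proof -
    have "integrable lborel (\<lambda>k. (real (Suc n) * deriv smooth_step (real (Suc n) * (k - r)) * f k) * \<psi> k)"
      by (intro integrable_coeff_cc test_function_cc[OF \<psi>] loc_bounded_continuous continuous_intros f
        continuous_on_compose2[OF smooth_deriv_real(2)[OF smooth_smooth_step]]) auto
    then show ?thesis unfolding d_def by (simp add: ac_simps)
  qed
  \<comment> \<open>The weak formula for \<psi> times the smoothed \<chi>; the product rule isolates
    the terms that concentrate at 0 and at s.\<close>
  have "(LINT k|lborel. (deriv \<psi> k * X n k) * f k) + ((LINT k|lborel. d 0 n k) - (LINT k|lborel. d s n k)) =
      - (LINT k|lborel. (\<psi> k * X n k) * f' k)" for n
  proof -
    have t: "test_function UNIV (\<lambda>k. \<psi> k * X n k)" by (rule test_function_mult[OF \<psi> X_smooth])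
    have "((\<lambda>k. \<psi> k * X n k) has_real_derivative (deriv \<psi> k * X n k +
       (real (Suc n) * deriv smooth_step (real (Suc n) * (k - 0)) - real (Suc n) * deriv smooth_step (real (Suc n) * (k - s))) * \<psi> k)) (at k)" for k
      unfolding X_def by (rule DERIV_mult) (intro smooth_deriv_real[OF sm] DERIV_diff \<tau>_deriv)+
    then have "deriv (\<lambda>k. \<psi> k * X n k) k = deriv \<psi> k * X n k +
       (real (Suc n) * deriv smooth_step (real (Suc n) * (k - 0)) - real (Suc n) * deriv smooth_step (real (Suc n) * (k - s))) * \<psi> k" for k
      by (rule DERIV_imp_deriv)
    then have "deriv (\<lambda>k. \<psi> k * X n k) k * f k = (deriv \<psi> k * X n k) * f k + (d 0 n k - d s n k)" for k
      by (simp only: d_def) (simp add: algebra_simps)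
    then have "(LINT k|lborel. (deriv \<psi> k * X n k) * f k + (d 0 n k - d s n k)) = - (LINT k|lborel. (\<psi> k * X n k) * f' k)"
      using weak[OF t] by simp
    moreover have "integrable lborel (\<lambda>k. (deriv \<psi> k * X n k) * f k)"
    proof -
      have "integrable lborel (\<lambda>k. (X n k * f k) * deriv \<psi> k)"
        by (intro integrable_coeff_cc ccd loc_bounded_continuous continuous_on_mult smooth_continuous[OF X_smooth] f) auto
      then show ?thesis by (simp add: ac_simps)
    qed
    ultimately show ?thesis
      using dint by (simp add: Bochner_Integration.integral_add Bochner_Integration.integral_diff Bochner_Integration.integrable_diff)
  qed
  moreover have "(\<lambda>n. (LINT k|lborel. (deriv \<psi> k * X n k) * f k) + ((LINT k|lborel. d 0 n k) - (LINT k|lborel. d s n k)))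
    \<longlonglongrightarrow> (LINT k|lborel. f k * chi k s * deriv \<psi> k) + (\<psi> 0 * f 0 - \<psi> s * f s)"
    by (intro tendsto_intros L2 L3)
  ultimately have "(\<lambda>n. - (LINT k|lborel. (\<psi> k * X n k) * f' k))
    \<longlonglongrightarrow> (LINT k|lborel. f k * chi k s * deriv \<psi> k) + (\<psi> 0 * f 0 - \<psi> s * f s)" by simp
  from LIMSEQ_unique[OF this tendsto_minus[OF L1]] show ?thesis by (simp add: algebra_simps)
qed

section \<open>Entropy fluxes against tensor products\<close>

text \<open>The entropy flux of one component, parametrized by e = E' because only derivatives of E
  enter. This admits constants e, which stand for affine entropies.\<close>

definition sflux :: "(real \<Rightarrow> real) \<Rightarrow> (real \<Rightarrow> real) \<Rightarrow> real \<Rightarrow> real" where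
  "sflux e f s = f s * e s - (LINT k|lborel. f k * chi k s * deriv e k)"

lemma cc_tensor:
  assumes "C_c \<theta>" "C_c w"
  shows "C_c (\<lambda>q::'p::euclidean_space\<times>real. \<theta> (snd q) * w (fst q))"
proof -
  obtain K where K: "continuous_on UNIV \<theta>" "compact K" "\<And>x. x \<notin> K \<Longrightarrow> \<theta> x = 0" using assms(1) by (rule ccE) blast
  obtain L where L: "continuous_on UNIV w" "compact L" "\<And>x. x \<notin> L \<Longrightarrow> w x = 0" using assms(2) by (rule ccE) blast
  have "continuous_on UNIV (\<lambda>q::'p\<times>real. \<theta> (snd q) * w (fst q))"
    by (intro continuous_intros continuous_on_compose2[OF K(1)] continuous_on_compose2[OF L(1)]) auto
  moreover have "compact (L \<times> K)" using K L by (intro compact_Times)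
  moreover have "\<theta> (snd q) * w (fst q) = 0" if "q \<notin> L \<times> K" for q using that K L by (cases q) auto
  ultimately show ?thesis unfolding C_c_def by blast
qed

text \<open>On a tensor product the pairing is the entropy flux at v. The constant
  \<open>f 0 * e 0\<close> comes from the shift in \<open>flux_kernel\<close>; it is removed later,
  by \<open>U 0 = 0\<close> for U and by integration in x for A.\<close>

lemma kint_flux_tensor:
  assumes "W \<in> sets borel" "v \<in> borel_measurable borel" "loc_bounded v" "continuous_on UNIV f"
    and e: "\<And>x. (e has_real_derivative deriv e x) (at x)" "C_c (deriv e)" "\<And>x. x \<le> a \<Longrightarrow> e x = 0" and w: "C_c w"
  shows "kint W v (flux_kernel f) (\<lambda>q. deriv e (snd q) * w (fst q)) =
    (LINT p|lborel. indicator W p * ((sflux e f (v p) - f 0 * e 0) * w p))"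
proof -
  have "(LINT k|lborel. flux_kernel f s k * (deriv e k * r)) = (sflux e f s - f 0 * e 0) * r" for s r
    using integral_flux_kernel[OF e assms(4), where s=s]
    by (simp add: sflux_def flip: mult.assoc)
  then show ?thesis
    by (simp add: kint_fubini[OF assms(1-3) kernel_flux[OF assms(4)] cc_tensor[OF e(2) w]])
qed

lemma kint_source_tensor:
  assumes "W \<in> sets borel" "v \<in> borel_measurable borel" "loc_bounded v" "continuous_on UNIV f"
    and e: "\<And>x. (e has_real_derivative deriv e x) (at x)" "C_c (deriv e)" "\<And>x. x \<le> a \<Longrightarrow> e x = 0" and w: "C_c w"
  shows "kint W v (source_kernel f) (\<lambda>q. deriv e (snd q) * w (fst q)) =
    (LINT p|lborel. indicator W p * (f (v p) * e (v p) * w p))"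
proof -
  have "(LINT k|lborel. source_kernel f s k * (deriv e k * r)) = f s * e s * r" for s r
    using integral_source_kernel[OF e, where s=s]
    by (simp flip: mult.assoc)
  then show ?thesis
    by (simp add: kint_fubini[OF assms(1-3) kernel_source[OF assms(4)] cc_tensor[OF e(2) w]])
qed

text \<open>The K1 counterpart of \<open>kint_flux_by_parts\<close>: the same kernel integral arises
  from f' \<chi> paired with g. As f' need not be locally bounded, integrability rests on a majorant
  that is a product of an indicator in p and a truncation of f' in \<xi>.\<close>

lemma kint_flux_weak:
  fixes g g' :: "'p::euclidean_space \<times> real \<Rightarrow> real"
  assumes W: "W \<in> sets borel" and v: "v \<in> borel_measurable borel" "loc_bounded v" and f: "continuous_on UNIV f"
    and f': "f' \<in> borel_measurable borel" "\<And>R. integrable lborel (\<lambda>x. indicator (cball 0 R) x * f' x)"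
    and weak: "\<And>\<phi>. test_function UNIV \<phi> \<Longrightarrow> (LINT s|lborel. deriv \<phi> s * f s) = - (LINT s|lborel. \<phi> s * f' s)"
    and g: "C_c g" "C_c g'" "\<And>p \<xi>. ((\<lambda>\<xi>. g (p, \<xi>)) has_real_derivative g' (p, \<xi>)) (at \<xi>)"
      "\<And>p. test_function UNIV (\<lambda>\<xi>. g (p, \<xi>))"
  shows "integrable lborel (\<lambda>q. indicator W (fst q) * (f' (snd q) * chi (snd q) (v (fst q)) * g q))" (is ?int)
    and "(LINT q|lborel. indicator W (fst q) * (f' (snd q) * chi (snd q) (v (fst q)) * g q)) = kint W v (flux_kernel f) g'"
proof -
  note [measurable] = W v(1) f'(1)
  have gm[measurable]: "g \<in> borel_measurable (borel \<Otimes>\<^sub>M borel)"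
    using g cc_measurable by (auto simp: borel_prod)
  obtain C where C: "0 \<le> C" "\<And>q. \<bar>g q\<bar> \<le> C" using cc_bounded[OF g(1)] by blast
  obtain K S where K: "compact K" "0 \<le> S" "\<And>p k. p \<notin> K \<or> S < \<bar>k\<bar> \<Longrightarrow> g (p, k) = 0"
    by (rule cc_support_prod[OF g(1)]) blast
  have K'[measurable]: "K \<in> sets borel" using K(1) by (rule borel_compact)
  show int: ?int
  proof (rule Bochner_Integration.integrable_bound)
    have "integrable (lborel \<Otimes>\<^sub>M lborel) (\<lambda>q::'p \<times> real. C * indicator K (fst q) * \<bar>indicator (cball 0 S) (snd q) * f' (snd q)\<bar>)"
    proof (rule lborel_pair.Fubini_integrable)
      have iK: "integrable lborel (indicator K :: 'p \<Rightarrow> real)"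
        using emeasure_compact_finite[OF K(1)] by (intro integrable_real_indicator) auto
      have "(LINT k|lborel. \<bar>(C * indicator K p) * (indicator (cball 0 S) k * f' k)\<bar>) =
          C * indicator K p * (LINT k|lborel. \<bar>indicator (cball 0 S) k * f' k\<bar>)" for p
        using C(1) by (simp add: abs_mult)
      then show "integrable lborel (\<lambda>p. LINT k|lborel. norm (C * indicator K (fst (p, k)) * \<bar>indicator (cball 0 S) (snd (p, k)) * f' (snd (p, k))\<bar>))"
        using integrable_mult_left[OF integrable_mult_right[OF iK, of C], of "LINT k|lborel. \<bar>indicator (cball 0 S) k * f' k\<bar>"]
        by (simp add: abs_mult)
      show "AE p in lborel. integrable lborel (\<lambda>k. C * indicator K (fst (p, k)) * \<bar>indicator (cball 0 S) (snd (p, k)) * f' (snd (p, k))\<bar>)"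
        using f'(2)[of S] by (intro AE_I2) (simp only: fst_conv snd_conv, intro integrable_mult_right integrable_abs)
      have [measurable]: "cball (0::real) S \<in> sets borel" by simp
      have "(\<lambda>q::'p \<times> real. C * indicator K (fst q) * \<bar>indicator (cball 0 S) (snd q) * f' (snd q)\<bar>) \<in> borel_measurable (borel \<Otimes>\<^sub>M borel)"
        by measurable
      then show "(\<lambda>q::'p \<times> real. C * indicator K (fst q) * \<bar>indicator (cball 0 S) (snd q) * f' (snd q)\<bar>) \<in> borel_measurable (lborel \<Otimes>\<^sub>M lborel)"
        by (simp add: lborel_prod borel_prod)
    qed
    then show "integrable lborel (\<lambda>q::'p \<times> real. C * indicator K (fst q) * \<bar>indicator (cball 0 S) (snd q) * f' (snd q)\<bar>)"
      by (simp add: lborel_prod)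
    have "(\<lambda>q. indicator W (fst q) * (f' (snd q) * chi (snd q) (v (fst q)) * g q)) \<in> borel_measurable (borel \<Otimes>\<^sub>M borel)"
      by measurable
    then show "(\<lambda>q. indicator W (fst q) * (f' (snd q) * chi (snd q) (v (fst q)) * g q)) \<in> borel_measurable lborel"
      by (simp add: borel_prod)
    show "AE q in lborel. norm (indicator W (fst q) * (f' (snd q) * chi (snd q) (v (fst q)) * g q))
       \<le> norm (C * indicator K (fst q) * \<bar>indicator (cball 0 S) (snd q) * f' (snd q)\<bar>)"
    proof (rule AE_I2)
      fix q :: "'p \<times> real"
      show "norm (indicator W (fst q) * (f' (snd q) * chi (snd q) (v (fst q)) * g q))
       \<le> norm (C * indicator K (fst q) * \<bar>indicator (cball 0 S) (snd q) * f' (snd q)\<bar>)"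
      proof (cases "fst q \<in> K \<and> \<bar>snd q\<bar> \<le> S")
        case True
        have "\<bar>indicator W (fst q) * chi (snd q) (v (fst q))\<bar> * \<bar>g q\<bar> \<le> 1 * C"
          by (intro mult_mono C) (auto simp: indicator_def chi_bounded)
        then have "\<bar>f' (snd q)\<bar> * (\<bar>indicator W (fst q) * chi (snd q) (v (fst q))\<bar> * \<bar>g q\<bar>) \<le> \<bar>f' (snd q)\<bar> * (1 * C)"
          by (intro mult_left_mono) auto
        then show ?thesis using True C(1) by (simp add: abs_mult ac_simps)
      next
        case False
        then have "g q = 0" using K(3)[of "fst q" "snd q"] by auto
        then show ?thesis by simp
      qed
    qed
  qed
  obtain a where a: "\<And>p k. k \<le> a \<Longrightarrow> g (p, k) = 0" using cc_eventually_below[OF g(1)] by blast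
  have dg: "deriv (\<lambda>\<xi>. g (p, \<xi>)) k = g' (p, k)" for p k
    using g(3) by (rule DERIV_imp_deriv)
  have inner: "(LINT k|lborel. f' k * chi k s * g (p, k)) = (LINT k|lborel. flux_kernel f s k * g' (p, k))" for p s
    using integral_weak_derivative[OF f f' weak g(4), of s p] integral_flux_kernel[OF g(3) cc_slice[OF g(2)] a f, where s=s]
    by (simp add: dg)
  have "(LINT q|lborel. indicator W (fst q) * (f' (snd q) * chi (snd q) (v (fst q)) * g q)) =
      (LINT p|lborel. LINT k|lborel. indicator W p * (f' k * chi k (v p) * g (p, k)))"
    using lborel_pair.integral_fst'[of "\<lambda>q. indicator W (fst q) * (f' (snd q) * chi (snd q) (v (fst q)) * g q)"] int
    by (simp add: lborel_prod)
  also have "\<dots> = kint W v (flux_kernel f) g'"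
    unfolding kint_fubini[OF W v kernel_flux[OF f] g(2)] by (simp add: inner)
  finally show "(LINT q|lborel. indicator W (fst q) * (f' (snd q) * chi (snd q) (v (fst q)) * g q)) = kint W v (flux_kernel f) g'" .
qed

section \<open>From Lebesgue to Borel measurability; partial derivatives; grouping of the
  variables\<close>

section \<open>Borel representatives\<close>

lemma borel_measurable_lebesgue_AE:
  fixes f g :: "'a::euclidean_space \<Rightarrow> real"
  assumes g: "g \<in> borel_measurable lebesgue" and ae: "AE x in lebesgue. f x = g x"
  shows "f \<in> borel_measurable lebesgue"
proof (rule measurableI)
  fix S :: "real set" assume S: "S \<in> sets borel"
  have "AE x in lebesgue. x \<in> g -` S \<longleftrightarrow> x \<in> f -` S" using ae by eventually_elim auto
  moreover have "g -` S \<in> sets lebesgue" using measurable_sets[OF g S] by simp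
  ultimately have "f -` S \<in> sets lebesgue"
    by (rule completion.in_sets_AE) simp
  then show "f -` S \<inter> space lebesgue \<in> sets lebesgue" by simp
qed simp

lemma AE_lebesgue_on_iff:
  assumes "W \<in> sets (borel :: 'a::euclidean_space measure)"
  shows "(AE x in lebesgue_on W. P x) \<longleftrightarrow> (AE x in lborel. x \<in> W \<longrightarrow> P x)"
  using assms by (simp add: AE_restrict_space_iff AE_completion_iff)

text \<open>Completeness of Lebesgue measure makes F measurable as soon as it agrees almost
  everywhere with a Borel function, so all further work happens on the Borel side.\<close>

lemma integral_lebesgue_on_cong_borel:
  fixes F F' :: "'a::euclidean_space \<Rightarrow> real"
  assumes W[measurable]: "W \<in> sets borel" and ae: "AE x in lborel. x \<in> W \<longrightarrow> F x = F' x"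
    and F': "(\<lambda>x. indicator W x * F' x) \<in> borel_measurable borel"
  shows "(LINT x|lebesgue_on W. F x) = (LINT x|lborel. indicator W x * F' x)"
proof -
  have "(LINT x|lebesgue_on W. F x) = (LINT x|lebesgue. indicator W x *\<^sub>R F x)"
    by (rule integral_restrict_space) simp
  also have "\<dots> = (LINT x|lebesgue. indicator W x * F' x)"
  proof (rule integral_cong_AE)
    have eq: "AE x in lebesgue. indicator W x *\<^sub>R F x = indicator W x * F' x"
      using AE_completion[OF ae] by eventually_elim (auto simp: indicator_def)
    then show "AE x in lebesgue. indicator W x *\<^sub>R F x = indicator W x * F' x" .
    show m: "(\<lambda>x. indicator W x * F' x) \<in> borel_measurable lebesgue"
      using F' by (intro measurable_completion) simp
    show "(\<lambda>x. indicator W x *\<^sub>R F x) \<in> borel_measurable lebesgue"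
      by (rule borel_measurable_lebesgue_AE[OF m eq])
  qed
  also have "\<dots> = (LINT x|lborel. indicator W x * F' x)"
    using F' by (intro integral_completion) simp
  finally show ?thesis .
qed

lemma AE_lborel_null_set:
  assumes "AE x in lborel. P x"
  obtains N where "N \<in> null_sets lborel" "\<And>x. x \<notin> N \<Longrightarrow> P x"
  using assms
proof (rule AE_E)
  fix N assume "{x \<in> space lborel. \<not> P x} \<subseteq> N" "emeasure lborel N = 0" "N \<in> sets lborel"
  then show ?thesis by (intro that[of N]) (auto simp: null_sets_def)
qed

lemma emeasure_lborel_Times:
  assumes "A \<in> sets (borel :: 'a::euclidean_space measure)" "B \<in> sets (borel :: 'b::euclidean_space measure)"
  shows "emeasure lborel (A \<times> B) = emeasure lborel A * emeasure lborel B"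
  using lborel.emeasure_pair_measure_Times[of A lborel B] assms by (simp add: lborel_prod)

lemma AE_lborel_fst:
  assumes "AE x in (lborel :: 'a::euclidean_space measure). P x"
  shows "AE q in (lborel :: ('a \<times> 'b::euclidean_space) measure). P (fst q)"
proof -
  obtain N where N: "N \<in> null_sets lborel" "\<And>x. x \<notin> N \<Longrightarrow> P x"
    using assms by (rule AE_lborel_null_set) blast
  have "N \<in> sets borel" using N(1) by auto
  then have "N \<times> UNIV \<in> null_sets (lborel :: ('a \<times> 'b) measure)"
    using N(1) borel_Times[of N "UNIV :: 'b set"] by (auto simp: null_sets_def emeasure_lborel_Times)
  then show ?thesis by (rule AE_I') (use N(2) in \<open>auto intro: ccontr\<close>)
qed

lemma AE_lborel_snd:
  assumes "AE x in (lborel :: 'b::euclidean_space measure). P x"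
  shows "AE q in (lborel :: ('a::euclidean_space \<times> 'b) measure). P (snd q)"
proof -
  obtain N where N: "N \<in> null_sets lborel" "\<And>x. x \<notin> N \<Longrightarrow> P x"
    using assms by (rule AE_lborel_null_set) blast
  have "N \<in> sets borel" using N(1) by auto
  then have "UNIV \<times> N \<in> null_sets (lborel :: ('a \<times> 'b) measure)"
    using N(1) borel_Times[of "UNIV :: 'a set" N] by (auto simp: null_sets_def emeasure_lborel_Times)
  then show ?thesis by (rule AE_I') (use N(2) in \<open>auto intro: ccontr\<close>)
qed

text \<open>Countably many essential bounds, one for each ball of integer radius, fail on a single
  null set. Setting the Borel version to 0 there turns them into bounds at every point.\<close>

lemma borel_representative:
  fixes v :: "'a::euclidean_space \<Rightarrow> real"
  assumes W[measurable]: "W \<in> sets borel" and v: "v \<in> borel_measurable (lebesgue_on W)"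
    and bd: "\<And>n::nat. \<exists>R. AE x in lborel. x \<in> W \<and> x \<in> cball 0 (real n) \<longrightarrow> \<bar>v x\<bar> \<le> R"
  obtains w where "w \<in> borel_measurable borel" "loc_bounded w" "AE x in lborel. x \<in> W \<longrightarrow> v x = w x"
proof -
  have "(\<lambda>x. indicator W x *\<^sub>R v x) \<in> borel_measurable lebesgue"
    using v by (subst borel_measurable_restrict_space_iff[symmetric]) auto
  then obtain w0 where w0[measurable]: "w0 \<in> borel_measurable lborel" "AE x in lborel. indicator W x *\<^sub>R v x = w0 x"
    using completion_ex_borel_measurable_real by blast
  from bd obtain R where R: "\<And>n::nat. AE x in lborel. x \<in> W \<and> x \<in> cball 0 (real n) \<longrightarrow> \<bar>v x\<bar> \<le> R n" by metis
  have "AE x in lborel. \<forall>n::nat. x \<in> cball 0 (real n) \<longrightarrow> \<bar>w0 x\<bar> \<le> \<bar>R n\<bar>"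
    unfolding AE_all_countable
  proof
    fix n :: nat
    show "AE x in lborel. x \<in> cball 0 (real n) \<longrightarrow> \<bar>w0 x\<bar> \<le> \<bar>R n\<bar>"
      using R[of n] w0(2) by eventually_elim (smt (verit) indicator_simps scaleR_one scaleR_zero_left)
  qed
  then obtain N where N: "N \<in> null_sets lborel" "\<And>x. x \<notin> N \<Longrightarrow> \<forall>n::nat. x \<in> cball 0 (real n) \<longrightarrow> \<bar>w0 x\<bar> \<le> \<bar>R n\<bar>"
    by (rule AE_lborel_null_set) blast
  have [measurable]: "N \<in> sets borel" using N(1) by auto
  define w where "w x = (if x \<in> N then 0 else w0 x)" for x
  have le: "\<bar>w x\<bar> \<le> \<bar>R n\<bar>" if "x \<in> cball 0 (real n)" for x and n :: nat
    using N(2)[of x] that by (auto simp: w_def)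
  show ?thesis
  proof (rule that)
    show "w \<in> borel_measurable borel" using w0(1) unfolding w_def by simp
    show "loc_bounded w"
      unfolding loc_bounded_def
    proof (intro allI impI)
      fix C :: "'a set" assume "compact C"
      then obtain r where r: "\<And>x. x \<in> C \<Longrightarrow> norm x \<le> r" using compact_imp_bounded bounded_iff by metis
      obtain n :: nat where "r \<le> real n" using real_arch_simple by blast
      then have "x \<in> cball 0 (real n)" if "x \<in> C" for x using r[OF that] by simp
      then show "\<exists>R. \<forall>x\<in>C. \<bar>w x\<bar> \<le> R" using le by blast
    qed
    have "AE x in lborel. x \<notin> N" using N(1) by (rule AE_not_in)
    then show "AE x in lborel. x \<in> W \<longrightarrow> v x = w x"
      using w0(2) by eventually_elim (auto simp: w_def indicator_def)
  qed
qed

text \<open>The definitions integrate over (t, (x, \<xi>)), whereas Fubini in \<xi> wants ((t, x),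
  \<xi>). Regrouping maps boxes to boxes of equal measure, which determines Lebesgue
  measure.\<close>

lemma lborel_assoc:
  "distr (lborel :: (('a::euclidean_space \<times> 'b::euclidean_space) \<times> 'c::euclidean_space) measure) borel
     (\<lambda>q. (fst (fst q), snd (fst q), snd q)) = (lborel :: ('a \<times> 'b \<times> 'c) measure)"
proof (rule lborel_eqI[symmetric])
  have m: "(\<lambda>q. (fst (fst q), snd (fst q), snd q)) \<in> borel_measurable (lborel :: (('a \<times> 'b) \<times> 'c) measure)"
    by (simp, intro borel_measurable_continuous_onI continuous_intros)
  fix l u :: "'a \<times> 'b \<times> 'c"
  assume le: "\<And>b. b \<in> Basis \<Longrightarrow> l \<bullet> b \<le> u \<bullet> b"
  have box: "box l u = box (fst l) (fst u) \<times> box (fst (snd l)) (fst (snd u)) \<times> box (snd (snd l)) (snd (snd u))"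
    by (cases l; cases u) (auto simp: box_def Basis_prod_def ball_Un)
  let ?B1 = "box (fst l) (fst u)" and ?B2 = "box (fst (snd l)) (fst (snd u))" and ?B3 = "box (snd (snd l)) (snd (snd u))"
  have "emeasure (distr lborel borel (\<lambda>q. (fst (fst q), snd (fst q), snd q))) (box l u) =
      emeasure (lborel :: (('a \<times> 'b) \<times> 'c) measure) ((?B1 \<times> ?B2) \<times> ?B3)"
    unfolding box by (subst emeasure_distr[OF m]) (auto intro!: arg_cong[where f="emeasure lborel"] borel_open open_Times)
  also have "\<dots> = emeasure lborel ?B1 * emeasure lborel ?B2 * emeasure lborel ?B3"
    by (simp add: emeasure_lborel_Times borel_Times)
  also have "\<dots> = emeasure (lborel :: ('a \<times> 'b \<times> 'c) measure) (?B1 \<times> ?B2 \<times> ?B3)"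
    by (simp add: emeasure_lborel_Times borel_Times mult.assoc)
  also have "\<dots> = emeasure lborel (box l u)" unfolding box ..
  also have "\<dots> = (\<Prod>b\<in>Basis. (u - l) \<bullet> b)"
    using le by (rule emeasure_lborel_box)
  finally show "emeasure (distr lborel borel (\<lambda>q. (fst (fst q), snd (fst q), snd q))) (box l u) = (\<Prod>b\<in>Basis. (u - l) \<bullet> b)" .
qed simp

section \<open>Partial derivatives of test functions\<close>

text \<open>In the form of directional Frechet derivatives the partial derivatives inherit
  smoothness and compact support, and Schwarz's theorem lets them commute.\<close>

lemma D_t_eq_frechet:
  fixes \<phi> :: "real \<times> 'a::euclidean_space \<Rightarrow> real"
  assumes "smooth \<phi>"
  shows "D_t \<phi> = (\<lambda>q. frechet_derivative \<phi> (at q) (1, 0))"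
proof
  fix q :: "real \<times> 'a"
  obtain t y where q: "q = (t, y)" by (cases q)
  have "((\<lambda>s. \<phi> (s, y)) has_derivative (\<lambda>r. frechet_derivative \<phi> (at (t, y)) (r, 0))) (at t)"
    by (rule has_derivative_compose[of "\<lambda>s. (s, y)" "\<lambda>r. (r, 0)", OF _ smooth_has_derivative[OF assms]])
       (intro has_derivative_Pair has_derivative_ident has_derivative_const)
  moreover have "(\<lambda>r. frechet_derivative \<phi> (at (t, y)) (r, 0)) = (*) (frechet_derivative \<phi> (at (t, y)) (1, 0))"
  proof
    fix r show "frechet_derivative \<phi> (at (t, y)) (r, 0) = frechet_derivative \<phi> (at (t, y)) (1, 0) * r"
      using linear_cmul[OF has_derivative_linear[OF smooth_has_derivative[OF assms, of "(t, y)"]], of r "(1, 0)"] by simp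
  qed
  ultimately have "((\<lambda>s. \<phi> (s, y)) has_real_derivative frechet_derivative \<phi> (at (t, y)) (1, 0)) (at t)"
    by (simp add: has_field_derivative_def)
  then show "D_t \<phi> q = frechet_derivative \<phi> (at q) (1, 0)"
    by (simp add: D_t_def q DERIV_imp_deriv)
qed

lemma D_xi_has_derivative:
  fixes \<phi> :: "real \<times> (real^'d) \<times> real \<Rightarrow> real"
  assumes "smooth \<phi>"
  shows "((\<lambda>\<eta>. \<phi> (t, x, \<eta>)) has_real_derivative frechet_derivative \<phi> (at (t, x, \<xi>)) (0, 0, 1)) (at \<xi>)"
proof -
  have "((\<lambda>s. \<phi> (t, x, s)) has_derivative (\<lambda>r. frechet_derivative \<phi> (at (t, x, \<xi>)) (0, 0, r))) (at \<xi>)"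
    by (rule has_derivative_compose[of "\<lambda>s. (t, x, s)" "\<lambda>r. (0, 0, r)", OF _ smooth_has_derivative[OF assms]])
       (intro has_derivative_Pair has_derivative_ident has_derivative_const)
  moreover have "(\<lambda>r. frechet_derivative \<phi> (at (t, x, \<xi>)) (0, 0, r)) = (*) (frechet_derivative \<phi> (at (t, x, \<xi>)) (0, 0, 1))"
  proof
    fix r show "frechet_derivative \<phi> (at (t, x, \<xi>)) (0, 0, r) = frechet_derivative \<phi> (at (t, x, \<xi>)) (0, 0, 1) * r"
      using linear_cmul[OF has_derivative_linear[OF smooth_has_derivative[OF assms, of "(t, x, \<xi>)"]], of r "(0, 0, 1)"] by simp
  qed
  ultimately show ?thesis
    by (simp add: has_field_derivative_def)
qed

lemma D_xi_eq_frechet: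
  fixes \<phi> :: "real \<times> (real^'d) \<times> real \<Rightarrow> real"
  assumes "smooth \<phi>"
  shows "D_xi \<phi> = (\<lambda>q. frechet_derivative \<phi> (at q) (0, 0, 1))"
  using D_xi_has_derivative[OF assms] by (auto simp: D_xi_def fun_eq_iff intro!: DERIV_imp_deriv)

lemma kgrad_x_eq_frechet:
  fixes \<phi> :: "real \<times> (real^'d) \<times> real \<Rightarrow> real"
  assumes "smooth \<phi>"
  shows "kgrad_x \<phi> q $ i = frechet_derivative \<phi> (at q) (0, axis i 1, 0)"
proof -
  obtain t x \<xi> where q: "q = (t, x, \<xi>)" by (cases q)
  have "((\<lambda>y. \<phi> (t, y, \<xi>)) has_derivative (\<lambda>h. frechet_derivative \<phi> (at (t, x, \<xi>)) (0, h, 0))) (at x)"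
    by (rule has_derivative_compose[of "\<lambda>y. (t, y, \<xi>)" "\<lambda>h. (0, h, 0)", OF _ smooth_has_derivative[OF assms]])
       (intro has_derivative_Pair has_derivative_ident has_derivative_const)
  from frechet_derivative_at[OF this, symmetric] show ?thesis
    by (simp add: kgrad_x_def grad_def q)
qed

lemma grad_x_eq_frechet:
  fixes \<phi> :: "real \<times> (real^'d) \<Rightarrow> real"
  assumes "smooth \<phi>"
  shows "grad_x \<phi> q $ i = frechet_derivative \<phi> (at q) (0, axis i 1)"
proof -
  obtain t x where q: "q = (t, x)" by (cases q)
  have "((\<lambda>y. \<phi> (t, y)) has_derivative (\<lambda>h. frechet_derivative \<phi> (at (t, x)) (0, h))) (at x)"
    by (rule has_derivative_compose[of "\<lambda>y. (t, y)" "\<lambda>h. (0, h)", OF _ smooth_has_derivative[OF assms]])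
       (intro has_derivative_Pair has_derivative_ident has_derivative_const)
  from frechet_derivative_at[OF this, symmetric] show ?thesis
    by (simp add: grad_x_def grad_def q)
qed

definition Dx :: "'d::finite \<Rightarrow> (real \<times> (real^'d) \<times> real \<Rightarrow> real) \<Rightarrow> real \<times> (real^'d) \<times> real \<Rightarrow> real" where
  "Dx i \<phi> = (\<lambda>q. kgrad_x \<phi> q $ i)"

lemma Dx_eq_frechet: "smooth \<phi> \<Longrightarrow> Dx i \<phi> = (\<lambda>q. frechet_derivative \<phi> (at q) (0, axis i 1, 0))"
  by (simp add: Dx_def kgrad_x_eq_frechet)

lemma test_function_D_t: "test_function \<Omega> \<phi> \<Longrightarrow> test_function \<Omega> (D_t \<phi>)"
  by (simp add: D_t_eq_frechet test_function_smooth test_function_frechet)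

lemma test_function_D_xi: "test_function \<Omega> \<phi> \<Longrightarrow> test_function \<Omega> (D_xi \<phi>)"
  by (simp add: D_xi_eq_frechet test_function_smooth test_function_frechet)

lemma test_function_Dx: "test_function \<Omega> \<phi> \<Longrightarrow> test_function \<Omega> (Dx i \<phi>)"
  by (simp add: Dx_eq_frechet test_function_smooth test_function_frechet)

lemma D_xi_D_t_commute:
  assumes "smooth \<phi>"
  shows "D_xi (D_t \<phi>) = D_t (D_xi \<phi>)"
  using assms by (simp add: D_t_eq_frechet D_xi_eq_frechet smooth_frechet) (intro ext schwarz_mixed_derivative)

lemma D_xi_Dx_commute:
  assumes "smooth \<phi>"
  shows "D_xi (Dx i \<phi>) = Dx i (D_xi \<phi>)"
  using assms by (simp add: Dx_eq_frechet D_xi_eq_frechet smooth_frechet) (intro ext schwarz_mixed_derivative)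

section \<open>Space-time-velocity integrals\<close>

definition assoc :: "('a \<times> 'b) \<times> 'c \<Rightarrow> 'a \<times> 'b \<times> 'c" where
  "assoc q = (fst (fst q), snd (fst q), snd q)"

lemma assoc_simp [simp]: "assoc ((t, x), \<xi>) = (t, x, \<xi>)"
  by (simp add: assoc_def)

lemma continuous_assoc: "continuous_on UNIV (assoc :: ('a::topological_space \<times> 'b::topological_space) \<times> 'c::topological_space \<Rightarrow> _)"
  unfolding assoc_def by (intro continuous_intros)

text \<open>Three changes at once: the lift V becomes its representative v, the coefficients in
  \<xi> become G' (for K1 these contain Borel versions of the weak derivatives), and the variables
  are regrouped.\<close>

lemma integral_upper_half_transfer:
  fixes V v :: "real \<times> 'x::euclidean_space \<Rightarrow> real" and G G' :: "real \<Rightarrow> real \<times> 'x \<times> real \<Rightarrow> real"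
  assumes V: "AE p in lborel. p \<in> upper_half \<longrightarrow> V p = v p"
    and G: "AE k in lborel. \<forall>s t x. G s (t, x, k) = G' s (t, x, k)"
    and m: "(\<lambda>q. indicator upper_half (fst q) * G' (v (fst q)) (assoc q)) \<in> borel_measurable borel"
  shows "(LINT q|lebesgue_on upper_half. G (V (fst q, fst (snd q))) q) =
    (LINT q|lborel. indicator upper_half (fst q) * G' (v (fst q)) (assoc q))"
proof -
  define F where "F q = indicator upper_half q * G' (v (fst q, fst (snd q))) q" for q :: "real \<times> 'x \<times> real"
  define bi where "bi q = ((fst q, fst (snd q)), snd (snd q))" for q :: "real \<times> 'x \<times> real"
  have bi: "bi \<in> borel_measurable borel"
    unfolding bi_def by (intro borel_measurable_continuous_onI continuous_intros)
  have Fa: "F (assoc q) = indicator upper_half (fst q) * G' (v (fst q)) (assoc q)" for q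
    by (cases q) (auto simp: F_def indicator_def)
  have Fm: "F \<in> borel_measurable borel"
  proof -
    have "F = (\<lambda>q. indicator upper_half (fst q) * G' (v (fst q)) (assoc q)) \<circ> bi"
      by (auto simp: fun_eq_iff F_def bi_def indicator_def)
    then show ?thesis using measurable_comp[OF bi m] by simp
  qed
  have am: "assoc \<in> borel_measurable (lborel :: ((real \<times> 'x) \<times> real) measure)"
    using borel_measurable_continuous_onI[OF continuous_assoc] by simp
  have AEp: "AE q in (lborel :: (real \<times> 'x \<times> real) measure). q \<in> upper_half \<longrightarrow> V (fst q, fst (snd q)) = v (fst q, fst (snd q))"
  proof -
    obtain N where N: "N \<in> null_sets lborel" "\<And>p. p \<notin> N \<Longrightarrow> p \<in> upper_half \<longrightarrow> V p = v p"
      using V by (rule AE_lborel_null_set) blast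
    have [measurable]: "N \<in> sets borel" using N(1) by auto
    have "AE q in (lborel :: ((real \<times> 'x) \<times> real) measure). (fst (assoc q), fst (snd (assoc q))) \<notin> N"
      using AE_lborel_fst[OF AE_not_in[OF N(1)]] by (simp add: assoc_def)
    moreover have "{q \<in> space borel. (fst q, fst (snd q)) \<notin> N} \<in> sets (borel :: (real \<times> 'x \<times> real) measure)"
    proof -
      have "continuous_on UNIV (\<lambda>q::real \<times> 'x \<times> real. (fst q, fst (snd q)))"
        by (intro continuous_intros)
      from measurable_sets[OF borel_measurable_continuous_onI[OF this], of "- N"]
      show ?thesis by (simp add: vimage_def)
    qed
    ultimately have "AE q in distr lborel borel (assoc :: (real \<times> 'x) \<times> real \<Rightarrow> _). (fst q, fst (snd q)) \<notin> N"
      by (subst AE_distr_iff[OF am]) simp_all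
    then have "AE q in (lborel :: (real \<times> 'x \<times> real) measure). (fst q, fst (snd q)) \<notin> N"
      unfolding assoc_def lborel_assoc .
    then show ?thesis
    proof (rule eventually_mono)
      fix q :: "real \<times> 'x \<times> real" assume "(fst q, fst (snd q)) \<notin> N"
      from N(2)[OF this] show "q \<in> upper_half \<longrightarrow> V (fst q, fst (snd q)) = v (fst q, fst (snd q))"
        by (simp add: mem_Times_iff)
    qed
  qed
  have "AE q in (lborel :: (real \<times> 'x \<times> real) measure). \<forall>s. G s q = G' s q"
    using AE_lborel_snd[OF AE_lborel_snd[OF G]] by (rule AE_mp) (auto intro!: AE_I2)
  with AEp have "AE q in lborel. q \<in> upper_half \<longrightarrow> G (V (fst q, fst (snd q))) q = G' (v (fst q, fst (snd q))) q"
    by eventually_elim auto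
  then have "(LINT q|lebesgue_on upper_half. G (V (fst q, fst (snd q))) q) = (LINT q|lborel. F q)"
    unfolding F_def using Fm by (intro integral_lebesgue_on_cong_borel) (auto simp: F_def[abs_def] intro!: borel_open open_Times)
  also have "\<dots> = (LINT q|distr lborel borel assoc. F q)"
    unfolding assoc_def lborel_assoc ..
  also have "\<dots> = (LINT q|lborel. F (assoc q))"
    by (rule integral_distr[OF am Fm])
  finally show ?thesis unfolding Fa .
qed

definition lift :: "(real \<times> 'x \<times> real \<Rightarrow> real) \<Rightarrow> (real \<times> 'x) \<times> real \<Rightarrow> real" where
  "lift \<psi> q = \<psi> (assoc q)"

definition lift0 :: "(real \<times> 'x \<times> real \<Rightarrow> real) \<Rightarrow> 'x \<times> real \<Rightarrow> real" where
  "lift0 \<psi> q = \<psi> (0, q)"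

lemma cc_lift:
  assumes "C_c (\<psi> :: real \<times> 'x::euclidean_space \<times> real \<Rightarrow> real)"
  shows "C_c (lift \<psi>)"
proof -
  obtain K where K: "continuous_on UNIV \<psi>" "compact K" "\<And>q. q \<notin> K \<Longrightarrow> \<psi> q = 0" using assms by (rule ccE) blast
  have "compact ((\<lambda>q. ((fst q, fst (snd q)), snd (snd q))) ` K)"
    using K(2) by (intro compact_continuous_image continuous_intros)
  moreover have "lift \<psi> q = 0" if "q \<notin> (\<lambda>q. ((fst q, fst (snd q)), snd (snd q))) ` K" for q
    unfolding lift_def by (rule K(3)) (use that in \<open>force simp: assoc_def image_iff\<close>)
  moreover have "continuous_on UNIV (lift \<psi>)"
    unfolding lift_def using continuous_on_compose2[OF K(1) continuous_assoc] by simp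
  ultimately show ?thesis unfolding C_c_def by blast
qed

lemma cc_lift0:
  assumes "C_c (\<psi> :: real \<times> 'x::euclidean_space \<times> real \<Rightarrow> real)"
  shows "C_c (lift0 \<psi>)"
proof -
  obtain K where K: "continuous_on UNIV \<psi>" "compact K" "\<And>q. q \<notin> K \<Longrightarrow> \<psi> q = 0" using assms by (rule ccE) blast
  have "compact (snd ` K)"
    using K(2) by (intro compact_continuous_image continuous_intros)
  moreover have "lift0 \<psi> q = 0" if "q \<notin> snd ` K" for q
    unfolding lift0_def by (rule K(3)) (use that in force)
  moreover have "continuous_on UNIV (lift0 \<psi>)"
    unfolding lift0_def by (intro continuous_on_compose2[OF K(1)] continuous_intros) auto
  ultimately show ?thesis unfolding C_c_def by blast
qed

lemma upper_half_borel [measurable]: "(upper_half :: (real \<times> 'x::euclidean_space) set) \<in> sets borel"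
  by (intro borel_open open_Times) auto

lemma weak_deriv_works: "W11_loc f \<Longrightarrow> has_weak_deriv f (weak_deriv f)"
  unfolding W11_loc_def weak_deriv_def by (metis someI_ex)

text \<open>A coordinate is pulled out of a Bochner integral by way of integrability of the
  vector-valued integrand, which the compact support of \<phi> provides.\<close>

lemma has_weak_deriv_component:
  fixes A :: "real \<Rightarrow> real^'d"
  assumes A: "continuous_on UNIV A" and g: "has_weak_deriv A g"
  shows "has_weak_deriv (\<lambda>s. A s $ i) (\<lambda>s. g s $ i)"
  unfolding has_weak_deriv_def
proof (intro conjI allI impI)
  have L1: "g absolutely_integrable_on K" if "compact K" for K
    using g that by (auto simp: has_weak_deriv_def L1_loc_def)
  have comp: "bounded_linear (\<lambda>x :: real^'d. x $ i)" by (rule bounded_linear_vec_nth)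
  show "L1_loc (\<lambda>s. g s $ i)"
    unfolding L1_loc_def using absolutely_integrable_linear[OF L1 comp] by (auto simp: o_def)
  fix \<phi> :: "real \<Rightarrow> real" assume \<phi>: "test_function UNIV \<phi>"
  have weak: "(LINT s|lebesgue. deriv \<phi> s *\<^sub>R A s) = - (LINT s|lebesgue. \<phi> s *\<^sub>R g s)"
    using g \<phi> by (simp add: has_weak_deriv_def)
  obtain K where K: "smooth \<phi>" "compact K" "\<And>x. x \<notin> K \<Longrightarrow> \<phi> x = 0" using \<phi> by (rule test_functionE) blast
  have dK: "deriv \<phi> x = 0" if "x \<notin> K" for x
    using frechet_derivative_eq_0_outside[of K \<phi> x 1] K(2,3) that
      frechet_derivative_real[OF differentiableI[OF smooth_has_derivative[OF K(1)]], of x 1] by simp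
  have int: "integrable lebesgue (\<lambda>s. \<psi> s *\<^sub>R h s)"
    if \<psi>: "continuous_on UNIV \<psi>" "\<And>x. x \<notin> K \<Longrightarrow> \<psi> x = 0" and h: "h absolutely_integrable_on K" for \<psi> and h :: "real \<Rightarrow> real^'d"
  proof -
    have "(\<lambda>s. \<psi> s *\<^sub>R h s) absolutely_integrable_on K"
    proof (rule absolutely_integrable_bounded_measurable_product[where h="(*\<^sub>R)", OF _ _ _ _ h])
      show "bilinear ((*\<^sub>R) :: real \<Rightarrow> real^'d \<Rightarrow> _)" by (simp add: bilinear_conv_bounded_bilinear bounded_bilinear_scaleR)
      have c: "continuous_on K \<psi>" using \<psi>(1) continuous_on_subset by blast
      show "K \<in> sets lebesgue" using K(2) by (simp add: borel_compact)
      then show "\<psi> \<in> borel_measurable (lebesgue_on K)" by (intro continuous_imp_measurable_on_sets_lebesgue c)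
      show "bounded (\<psi> ` K)" by (intro compact_imp_bounded compact_continuous_image c K(2))
    qed
    then have "integrable lebesgue (\<lambda>s. indicator K s *\<^sub>R (\<psi> s *\<^sub>R h s))" by (simp add: set_integrable_def)
    moreover have "indicator K s *\<^sub>R (\<psi> s *\<^sub>R h s) = \<psi> s *\<^sub>R h s" for s using \<psi>(2)[of s] by (auto simp: indicator_def)
    ultimately show ?thesis by (simp only:)
  qed
  have Aint: "A absolutely_integrable_on K"
  proof -
    have "integrable lborel (\<lambda>x. indicator K x *\<^sub>R A x)"
      by (intro borel_integrable_compact K(2) continuous_on_subset[OF A]) simp
    then show ?thesis unfolding set_integrable_def
      by (subst integrable_completion) (auto dest: borel_measurable_integrable)
  qed
  have "(LINT s|lebesgue. deriv \<phi> s *\<^sub>R A s $ i) = (LINT s|lebesgue. deriv \<phi> s *\<^sub>R A s) $ i"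
    using integral_bounded_linear[OF comp int[OF smooth_deriv_real(2)[OF K(1)] dK Aint]] by simp
  moreover have "(LINT s|lebesgue. \<phi> s *\<^sub>R g s $ i) = (LINT s|lebesgue. \<phi> s *\<^sub>R g s) $ i"
    using integral_bounded_linear[OF comp int[OF smooth_continuous[OF K(1)] K(3) L1[OF K(2)]]] by simp
  ultimately show "(LINT s|lebesgue. deriv \<phi> s *\<^sub>R A s $ i) = - (LINT s|lebesgue. \<phi> s *\<^sub>R g s $ i)"
    using weak by simp
qed

text \<open>A weak derivative is determined only up to null sets. Its Lebesgue measurability comes
  from local integrability, as a limit of truncations to balls; a Borel version then satisfies the
  same weak formula.\<close>

lemma weak_derivative_representative:
  fixes f g :: "real \<Rightarrow> real"
  assumes f: "continuous_on UNIV f" and g: "has_weak_deriv f g"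
  obtains f' where "f' \<in> borel_measurable borel" "AE k in lborel. g k = f' k"
    "\<And>R. integrable lborel (\<lambda>x. indicator (cball 0 R) x * f' x)"
    "\<And>\<phi>. test_function UNIV \<phi> \<Longrightarrow> (LINT s|lborel. deriv \<phi> s * f s) = - (LINT s|lborel. \<phi> s * f' s)"
proof -
  have L1: "integrable lebesgue (\<lambda>x. indicator (cball 0 R) x * g x)" for R
    using g compact_cball[of 0 R] unfolding has_weak_deriv_def L1_loc_def set_integrable_def by auto
  have gm: "g \<in> borel_measurable lebesgue"
  proof (rule borel_measurable_LIMSEQ_real)
    show "(\<lambda>x. indicator (cball 0 (real n)) x * g x) \<in> borel_measurable lebesgue" for n
      using L1 by (rule borel_measurable_integrable)
    show "(\<lambda>n. indicator (cball 0 (real n)) x * g x) \<longlonglongrightarrow> g x" for x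
    proof (rule tendsto_eventually)
      obtain N :: nat where "\<bar>x\<bar> \<le> real N" using real_arch_simple by blast
      then show "\<forall>\<^sub>F n in sequentially. indicator (cball 0 (real n)) x * g x = g x"
        by (intro eventually_sequentiallyI[of N]) (auto simp: indicator_def)
    qed
  qed
  then obtain f' where f': "f' \<in> borel_measurable lborel" "AE x in lborel. g x = f' x"
    using completion_ex_borel_measurable_real by blast
  have f'm[measurable]: "f' \<in> borel_measurable borel" using f'(1) by simp
  have ae: "AE x in lebesgue. g x = f' x" using f'(2) by (rule AE_completion)
  have fm[measurable]: "f \<in> borel_measurable borel" using f by (rule borel_measurable_continuous_onI)
  show ?thesis
  proof (rule that[OF f'm f'(2)])
    fix R :: real
    have [measurable]: "cball (0::real) R \<in> sets borel" by simp
    have m: "(\<lambda>x. indicator (cball 0 R) x * f' x) \<in> borel_measurable borel" by measurable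
    have "integrable lebesgue (\<lambda>x. indicator (cball 0 R) x * f' x)"
    proof (rule integrable_cong_AE_imp[OF L1[of R]])
      show "(\<lambda>x. indicator (cball 0 R) x * f' x) \<in> borel_measurable lebesgue"
        using m by (intro measurable_completion) simp
      show "AE x in lebesgue. indicator (cball 0 R) x * g x = indicator (cball 0 R) x * f' x"
        using ae by eventually_elim simp
    qed
    then show "integrable lborel (\<lambda>x. indicator (cball 0 R) x * f' x)"
      using m by (subst (asm) integrable_completion) auto
  next
    fix \<phi> :: "real \<Rightarrow> real" assume \<phi>: "test_function UNIV \<phi>"
    note [measurable] = borel_measurable_continuous_onI[OF smooth_continuous[OF test_function_smooth[OF \<phi>]]]
      borel_measurable_continuous_onI[OF smooth_deriv_real(2)[OF test_function_smooth[OF \<phi>]]]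
    have m: "(\<lambda>s. \<phi> s * f' s) \<in> borel_measurable borel" "(\<lambda>s. deriv \<phi> s * f s) \<in> borel_measurable borel" by measurable
    have m': "(\<lambda>s. \<phi> s * f' s) \<in> borel_measurable lebesgue" using m(1) by (intro measurable_completion) simp
    have eq: "AE s in lebesgue. \<phi> s * g s = \<phi> s * f' s" using ae by eventually_elim simp
    have "(LINT s|lborel. deriv \<phi> s * f s) = (LINT s|lebesgue. deriv \<phi> s * f s)"
      using m(2) by (intro integral_completion[symmetric]) simp
    also have "\<dots> = - (LINT s|lebesgue. \<phi> s * g s)"
      using g \<phi> by (simp add: has_weak_deriv_def)
    also have "(LINT s|lebesgue. \<phi> s * g s) = (LINT s|lebesgue. \<phi> s * f' s)"
      by (rule integral_cong_AE[OF borel_measurable_lebesgue_AE[OF m' eq] m' eq])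
    also have "\<dots> = (LINT s|lborel. \<phi> s * f' s)"
      using m(1) by (intro integral_completion) simp
    finally show "(LINT s|lborel. deriv \<phi> s * f s) = - (LINT s|lborel. \<phi> s * f' s)" .
  qed
qed

section \<open>Both kinetic formulations in terms of one functional\<close>

section \<open>The kinetic functional\<close>

locale kinetic_data =
  fixes U :: "real \<Rightarrow> real" and A :: "real \<Rightarrow> real^'d" and a :: "real \<Rightarrow> real"
    and v :: "real \<times> (real^'d) \<Rightarrow> real" and v\<^sub>0 :: "real^'d \<Rightarrow> real"
  assumes U: "continuous_on UNIV U" and U0: "U 0 = 0"
    and A: "continuous_on UNIV A" and a: "continuous_on UNIV a"
    and v: "v \<in> borel_measurable borel" "loc_bounded v"
    and v\<^sub>0: "v\<^sub>0 \<in> borel_measurable borel" "loc_bounded v\<^sub>0"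
begin

abbreviation H :: "(real \<times> (real^'d)) set" where "H \<equiv> upper_half"

lemma Ai: "continuous_on UNIV (\<lambda>s. A s $ i)"
  by (intro continuous_intros A)

text \<open>Both formulations evaluate T at \<psi> = \<open>D_xi \<phi>\<close>. No \<xi>-derivative
  of \<psi> occurs, so T also makes sense for test functions that are not \<xi>-derivatives of test
  functions, in particular for nonnegative ones.\<close>

definition T :: "(real \<times> (real^'d) \<times> real \<Rightarrow> real) \<Rightarrow> real" where
  "T \<psi> = kint UNIV v\<^sub>0 (flux_kernel U) (lift0 \<psi>) + kint H v (flux_kernel U) (lift (D_t \<psi>))
     + (\<Sum>i\<in>UNIV. kint H v (flux_kernel (\<lambda>s. A s $ i)) (lift (Dx i \<psi>))) + kint H v (source_kernel a) (lift \<psi>)"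

context
  fixes V :: "real \<times> (real^'d) \<Rightarrow> real" and V\<^sub>0 :: "real^'d \<Rightarrow> real"
  assumes V: "AE p in lborel. p \<in> H \<longrightarrow> V p = v p" and V\<^sub>0: "AE x in lborel. V\<^sub>0 x = v\<^sub>0 x"
begin

lemma transfer_H:
  fixes G :: "real \<Rightarrow> real \<times> (real^'d) \<Rightarrow> real"
  assumes "(\<lambda>p. indicator H p * G (v p) p) \<in> borel_measurable borel"
  shows "(LINT p|lebesgue_on H. G (V p) p) = (LINT p|lborel. indicator H p * G (v p) p)"
  by (rule integral_lebesgue_on_cong_borel[OF upper_half_borel _ assms])
     (use V in \<open>auto elim!: eventually_mono\<close>)

lemma transfer_initial:
  fixes G :: "real \<Rightarrow> real^'d \<Rightarrow> real"
  assumes "(\<lambda>x. G (v\<^sub>0 x) x) \<in> borel_measurable borel"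
  shows "(LINT x|lebesgue. G (V\<^sub>0 x) x) = (LINT x|lborel. G (v\<^sub>0 x) x)"
proof -
  have "AE x in lborel. x \<in> UNIV \<longrightarrow> G (V\<^sub>0 x) x = G (v\<^sub>0 x) x"
    using V\<^sub>0 by eventually_elim simp
  from integral_lebesgue_on_cong_borel[OF _ this] assms show ?thesis
    by (simp add: lebesgue_on_UNIV_eq)
qed

lemma transfer_initial_xi:
  fixes G :: "real \<Rightarrow> (real^'d) \<times> real \<Rightarrow> real"
  assumes "(\<lambda>q. G (v\<^sub>0 (fst q)) q) \<in> borel_measurable borel"
  shows "(LINT q|lebesgue. G (V\<^sub>0 (fst q)) q) = (LINT q|lborel. G (v\<^sub>0 (fst q)) q)"
proof -
  have "AE q in lborel. q \<in> UNIV \<longrightarrow> G (V\<^sub>0 (fst q)) q = G (v\<^sub>0 (fst q)) q"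
    using AE_lborel_fst[OF V\<^sub>0] by eventually_elim simp
  from integral_lebesgue_on_cong_borel[OF _ this] assms show ?thesis
    by (simp add: lebesgue_on_UNIV_eq)
qed

context
  fixes \<phi> :: "real \<times> (real^'d) \<times> real \<Rightarrow> real"
  assumes \<phi>: "test_function UNIV \<phi>"
begin

lemma smooth_\<phi>: "smooth \<phi>"
  using \<phi> by (rule test_function_smooth)

lemma lift_deriv:
  assumes "smooth \<psi>"
  shows "((\<lambda>\<xi>. lift \<psi> (p, \<xi>)) has_real_derivative lift (D_xi \<psi>) (p, \<xi>)) (at \<xi>)"
  using D_xi_has_derivative[OF assms] by (cases p) (simp add: lift_def D_xi_eq_frechet[OF assms])

lemma lift0_deriv:
  assumes "smooth \<psi>"
  shows "((\<lambda>\<xi>. lift0 \<psi> (p, \<xi>)) has_real_derivative lift0 (D_xi \<psi>) (p, \<xi>)) (at \<xi>)"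
  using D_xi_has_derivative[OF assms] by (simp add: lift0_def D_xi_eq_frechet[OF assms])

lemmas cc_\<phi> = test_function_cc[OF \<phi>] test_function_cc[OF test_function_D_xi[OF \<phi>]]
  test_function_cc[OF test_function_D_t[OF \<phi>]] test_function_cc[OF test_function_D_t[OF test_function_D_xi[OF \<phi>]]]
  test_function_cc[OF test_function_Dx[OF \<phi>]] test_function_cc[OF test_function_Dx[OF test_function_D_xi[OF \<phi>]]]

lemma kint_initial:
  "kint UNIV v\<^sub>0 (flux_kernel U) (lift0 (D_xi \<phi>)) =
    - (LINT q|lborel. indicator UNIV (fst q) * (U (snd q) * chi (snd q) (v\<^sub>0 (fst q)) * lift0 (D_xi \<phi>) q))
    - (LINT x|lborel. indicator UNIV x * pair_dchi (\<lambda>\<xi>. U \<xi> * lift0 \<phi> (x, \<xi>)) (v\<^sub>0 x))"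
  by (rule kint_flux_by_parts[OF _ v\<^sub>0 U]) (auto intro: cc_lift0 cc_\<phi> lift0_deriv smooth_\<phi>)

lemma kint_time:
  "kint H v (flux_kernel U) (lift (D_t (D_xi \<phi>))) =
    - (LINT q|lborel. indicator H (fst q) * (U (snd q) * chi (snd q) (v (fst q)) * lift (D_t (D_xi \<phi>)) q))
    - (LINT p|lborel. indicator H p * pair_dchi (\<lambda>\<xi>. U \<xi> * lift (D_t \<phi>) (p, \<xi>)) (v p))"
  \<comment> \<open>By Schwarz's theorem the argument is the \<xi>-derivative of the lifted
    \<open>D_t \<phi>\<close>, as integration by parts requires.\<close>
  unfolding D_xi_D_t_commute[OF smooth_\<phi>, symmetric]
  by (rule kint_flux_by_parts[OF _ v U cc_lift cc_lift lift_deriv])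
     (auto intro: cc_\<phi> test_function_smooth[OF test_function_D_t[OF \<phi>]] simp: D_xi_D_t_commute[OF smooth_\<phi>])

lemma kint_space:
  "kint H v (flux_kernel (\<lambda>s. A s $ i)) (lift (Dx i (D_xi \<phi>))) =
    - (LINT q|lborel. indicator H (fst q) * (A (snd q) $ i * chi (snd q) (v (fst q)) * lift (Dx i (D_xi \<phi>)) q))
    - (LINT p|lborel. indicator H p * pair_dchi (\<lambda>\<xi>. A \<xi> $ i * lift (Dx i \<phi>) (p, \<xi>)) (v p))"
  unfolding D_xi_Dx_commute[OF smooth_\<phi>, symmetric]
  by (rule kint_flux_by_parts[OF _ v Ai cc_lift cc_lift lift_deriv])
     (auto intro: cc_\<phi> test_function_smooth[OF test_function_Dx[OF \<phi>]] simp: D_xi_Dx_commute[OF smooth_\<phi>])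

lemma kint_space_sum:
  "(\<Sum>i\<in>UNIV. kint H v (flux_kernel (\<lambda>s. A s $ i)) (lift (Dx i (D_xi \<phi>)))) =
    - (LINT q|lborel. indicator H (fst q) * (chi (snd q) (v (fst q)) * (A (snd q) \<bullet> kgrad_x (D_xi \<phi>) (assoc q))))
    - (LINT p|lborel. indicator H p * pair_dchi (\<lambda>\<xi>. A \<xi> \<bullet> kgrad_x \<phi> (assoc (p, \<xi>))) (v p))"
proof -
  have 1: "indicator H (fst q) * (chi (snd q) (v (fst q)) * (A (snd q) \<bullet> kgrad_x (D_xi \<phi>) (assoc q))) =
      (\<Sum>i\<in>UNIV. indicator H (fst q) * (A (snd q) $ i * chi (snd q) (v (fst q)) * lift (Dx i (D_xi \<phi>)) q))" for q
    by (simp add: inner_vec_def lift_def Dx_def sum_distrib_left ac_simps)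
  have 2: "indicator H p * pair_dchi (\<lambda>\<xi>. A \<xi> \<bullet> kgrad_x \<phi> (assoc (p, \<xi>))) (v p) =
      (\<Sum>i\<in>UNIV. indicator H p * pair_dchi (\<lambda>\<xi>. A \<xi> $ i * lift (Dx i \<phi>) (p, \<xi>)) (v p))" for p
    by (simp add: pair_dchi_def inner_vec_def lift_def Dx_def sum_distrib_left sum_subtractf right_diff_distrib)
  have "(LINT q|lborel. indicator H (fst q) * (chi (snd q) (v (fst q)) * (A (snd q) \<bullet> kgrad_x (D_xi \<phi>) (assoc q)))) =
      (\<Sum>i\<in>UNIV. LINT q|lborel. indicator H (fst q) * (A (snd q) $ i * chi (snd q) (v (fst q)) * lift (Dx i (D_xi \<phi>)) q))"
    unfolding 1 by (rule Bochner_Integration.integral_sum) (intro chi_integrable v Ai cc_lift cc_\<phi> upper_half_borel)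
  moreover have "(LINT p|lborel. indicator H p * pair_dchi (\<lambda>\<xi>. A \<xi> \<bullet> kgrad_x \<phi> (assoc (p, \<xi>))) (v p)) =
      (\<Sum>i\<in>UNIV. LINT p|lborel. indicator H p * pair_dchi (\<lambda>\<xi>. A \<xi> $ i * lift (Dx i \<phi>) (p, \<xi>)) (v p))"
    unfolding 2 by (rule Bochner_Integration.integral_sum) (intro pair_dchi_integrable v Ai cc_lift cc_\<phi> upper_half_borel)
  ultimately show ?thesis
    by (simp add: kint_space sum_subtractf sum_negf)
qed

lemma kint_source:
  "kint H v (source_kernel a) (lift (D_xi \<phi>)) = (LINT p|lborel. indicator H p * (a (v p) * lift \<phi> (p, v p)))"
  by (rule kint_source_by_parts[OF _ v a cc_lift cc_lift lift_deriv]) (auto intro: cc_\<phi> smooth_\<phi>)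

text \<open>The first six terms pair up, each volume term with its trace term, into the flux kernels
  at the initial time, in t and in x; the last term gives the source kernel.\<close>

lemma K2_rhs:
  "- (LINT (x, \<xi>)|lebesgue. U \<xi> * chi \<xi> (V\<^sub>0 x) * D_xi \<phi> (0, x, \<xi>))
   - (LINT x|lebesgue. pair_dchi (\<lambda>\<xi>. U \<xi> * \<phi> (0, x, \<xi>)) (V\<^sub>0 x))
   - (LINT (t, x, \<xi>)|lebesgue_on upper_half. U \<xi> * chi \<xi> (V (t, x)) * D_t (D_xi \<phi>) (t, x, \<xi>))
   - (LINT (t, x)|lebesgue_on upper_half. pair_dchi (\<lambda>\<xi>. U \<xi> * D_t \<phi> (t, x, \<xi>)) (V (t, x)))
   - (LINT (t, x, \<xi>)|lebesgue_on upper_half. chi \<xi> (V (t, x)) * (A \<xi> \<bullet> kgrad_x (D_xi \<phi>) (t, x, \<xi>)))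
   - (LINT (t, x)|lebesgue_on upper_half. pair_dchi (\<lambda>\<xi>. A \<xi> \<bullet> kgrad_x \<phi> (t, x, \<xi>)) (V (t, x)))
   + (LINT (t, x)|lebesgue_on upper_half. a 0 * \<phi> (t, x, 0) - pair_dchi (\<lambda>\<xi>. a \<xi> * \<phi> (t, x, \<xi>)) (V (t, x)))
   = T (D_xi \<phi>)"
proof -
  have triv: "AE k in lborel. \<forall>s t x. (G :: real \<Rightarrow> real \<times> (real^'d) \<times> real \<Rightarrow> real) s (t, x, k) = G s (t, x, k)" for G by simp
  have sumA: "A \<xi> \<bullet> w = (\<Sum>i\<in>UNIV. A \<xi> $ i * w $ i)" for \<xi> and w :: "real^'d" by (simp add: inner_vec_def)
  have "(LINT (x, \<xi>)|lebesgue. U \<xi> * chi \<xi> (V\<^sub>0 x) * D_xi \<phi> (0, x, \<xi>)) =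
      (LINT q|lborel. indicator UNIV (fst q) * (U (snd q) * chi (snd q) (v\<^sub>0 (fst q)) * lift0 (D_xi \<phi>) q))"
    using transfer_initial_xi[of "\<lambda>s q. U (snd q) * chi (snd q) s * lift0 (D_xi \<phi>) q"]
      borel_measurable_integrable[OF chi_integrable[OF _ v\<^sub>0(1) U cc_lift0[OF cc_\<phi>(2)], of UNIV]]
    by (simp add: lift0_def case_prod_beta')
  moreover have "(LINT x|lebesgue. pair_dchi (\<lambda>\<xi>. U \<xi> * \<phi> (0, x, \<xi>)) (V\<^sub>0 x)) =
      (LINT x|lborel. indicator UNIV x * pair_dchi (\<lambda>\<xi>. U \<xi> * lift0 \<phi> (x, \<xi>)) (v\<^sub>0 x))"
    using transfer_initial[of "\<lambda>s x. pair_dchi (\<lambda>\<xi>. U \<xi> * lift0 \<phi> (x, \<xi>)) s"]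
      borel_measurable_integrable[OF pair_dchi_integrable[OF _ v\<^sub>0 U cc_lift0[OF cc_\<phi>(1)], of UNIV]]
    by (simp add: lift0_def)
  moreover have "(LINT (t, x, \<xi>)|lebesgue_on upper_half. U \<xi> * chi \<xi> (V (t, x)) * D_t (D_xi \<phi>) (t, x, \<xi>)) =
      (LINT q|lborel. indicator H (fst q) * (U (snd q) * chi (snd q) (v (fst q)) * lift (D_t (D_xi \<phi>)) q))"
    using integral_upper_half_transfer[OF V triv, of "\<lambda>s q. U (snd (snd q)) * chi (snd (snd q)) s * D_t (D_xi \<phi>) q"]
      borel_measurable_integrable[OF chi_integrable[OF upper_half_borel v(1) U cc_lift[OF cc_\<phi>(4)]]]
    by (simp add: lift_def case_prod_beta' assoc_def)
  moreover have "(LINT (t, x)|lebesgue_on upper_half. pair_dchi (\<lambda>\<xi>. U \<xi> * D_t \<phi> (t, x, \<xi>)) (V (t, x))) =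
      (LINT p|lborel. indicator H p * pair_dchi (\<lambda>\<xi>. U \<xi> * lift (D_t \<phi>) (p, \<xi>)) (v p))"
    using transfer_H[of "\<lambda>s p. pair_dchi (\<lambda>\<xi>. U \<xi> * lift (D_t \<phi>) (p, \<xi>)) s"]
      borel_measurable_integrable[OF pair_dchi_integrable[OF upper_half_borel v U cc_lift[OF cc_\<phi>(3)]]]
    by (simp add: lift_def case_prod_beta' assoc_def)
  moreover have "(LINT (t, x, \<xi>)|lebesgue_on upper_half. chi \<xi> (V (t, x)) * (A \<xi> \<bullet> kgrad_x (D_xi \<phi>) (t, x, \<xi>))) =
      (LINT q|lborel. indicator H (fst q) * (chi (snd q) (v (fst q)) * (A (snd q) \<bullet> kgrad_x (D_xi \<phi>) (assoc q))))"
  proof -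
    have "(\<lambda>q. \<Sum>i\<in>UNIV. indicator H (fst q) * (A (snd q) $ i * chi (snd q) (v (fst q)) * lift (Dx i (D_xi \<phi>)) q)) \<in> borel_measurable borel"
      using borel_measurable_integrable[OF chi_integrable[OF upper_half_borel v(1) Ai cc_lift[OF cc_\<phi>(6)]]]
      by (intro borel_measurable_sum) simp
    then have "(\<lambda>q. indicator H (fst q) * (chi (snd q) (v (fst q)) * (A (snd q) \<bullet> kgrad_x (D_xi \<phi>) (assoc q)))) \<in> borel_measurable borel"
      by (simp add: inner_vec_def lift_def Dx_def sum_distrib_left ac_simps)
    then show ?thesis
      using integral_upper_half_transfer[OF V triv, of "\<lambda>s q. chi (snd (snd q)) s * (A (snd (snd q)) \<bullet> kgrad_x (D_xi \<phi>) q)"]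
      by (simp add: case_prod_beta' assoc_def)
  qed
  moreover have "(LINT (t, x)|lebesgue_on upper_half. pair_dchi (\<lambda>\<xi>. A \<xi> \<bullet> kgrad_x \<phi> (t, x, \<xi>)) (V (t, x))) =
      (LINT p|lborel. indicator H p * pair_dchi (\<lambda>\<xi>. A \<xi> \<bullet> kgrad_x \<phi> (assoc (p, \<xi>))) (v p))"
  proof -
    have "(\<lambda>p. \<Sum>i\<in>UNIV. indicator H p * pair_dchi (\<lambda>\<xi>. A \<xi> $ i * lift (Dx i \<phi>) (p, \<xi>)) (v p)) \<in> borel_measurable borel"
      using borel_measurable_integrable[OF pair_dchi_integrable[OF upper_half_borel v Ai cc_lift[OF cc_\<phi>(5)]]]
      by (intro borel_measurable_sum) simp
    then have "(\<lambda>p. indicator H p * pair_dchi (\<lambda>\<xi>. A \<xi> \<bullet> kgrad_x \<phi> (assoc (p, \<xi>))) (v p)) \<in> borel_measurable borel"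
      by (simp add: pair_dchi_def inner_vec_def lift_def Dx_def sum_distrib_left sum_subtractf right_diff_distrib)
    then show ?thesis
      using transfer_H[of "\<lambda>s p. pair_dchi (\<lambda>\<xi>. A \<xi> \<bullet> kgrad_x \<phi> (assoc (p, \<xi>))) s"]
      by (simp add: case_prod_beta' assoc_def)
  qed
  \<comment> \<open>The term a(0) \<phi>(t,x,0) cancels against the value at 0 in the pairing; a(v)
    \<phi>(t,x,v) is left.\<close>
  moreover have "(LINT (t, x)|lebesgue_on upper_half. a 0 * \<phi> (t, x, 0) - pair_dchi (\<lambda>\<xi>. a \<xi> * \<phi> (t, x, \<xi>)) (V (t, x))) =
      (LINT p|lborel. indicator H p * (a (v p) * lift \<phi> (p, v p)))"
    using transfer_H[of "\<lambda>s p. a s * lift \<phi> (p, s)"]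
      borel_measurable_integrable[OF trace_integrable[OF upper_half_borel v v(1) a cc_lift[OF cc_\<phi>(1)]]]
    by (simp add: lift_def case_prod_beta' assoc_def pair_dchi_def)
  ultimately show ?thesis
    unfolding T_def kint_initial kint_time kint_space_sum kint_source by simp
qed

text \<open>Here the \<xi>-derivative sits on the coefficients instead of on \<phi>;
  \<open>kint_flux_weak\<close> moves it to \<phi>, term by term, and arrives at the same kernels as
  K2.\<close>

lemma K1_rhs:
  assumes W: "W11_loc U" "W11_loc A" "W11_loc a"
  shows "(LINT (x, \<xi>)|lebesgue. weak_deriv U \<xi> * chi \<xi> (V\<^sub>0 x) * \<phi> (0, x, \<xi>))
   + (LINT (t, x, \<xi>)|lebesgue_on upper_half.
        weak_deriv U \<xi> * chi \<xi> (V (t, x)) * D_t \<phi> (t, x, \<xi>)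
        + chi \<xi> (V (t, x)) * (weak_deriv A \<xi> \<bullet> kgrad_x \<phi> (t, x, \<xi>))
        + weak_deriv a \<xi> * chi \<xi> (V (t, x)) * \<phi> (t, x, \<xi>)
        + a \<xi> * chi \<xi> (V (t, x)) * D_xi \<phi> (t, x, \<xi>))
   + (LINT (t, x)|lebesgue_on upper_half. a 0 * \<phi> (t, x, 0))
   = T (D_xi \<phi>)"
proof -
  have wd: "has_weak_deriv U (weak_deriv U)" "has_weak_deriv A (weak_deriv A)" "has_weak_deriv a (weak_deriv a)"
    using W weak_deriv_works by auto
  obtain U' where U': "U' \<in> borel_measurable borel" "AE k in lborel. weak_deriv U k = U' k"
    "\<And>R. integrable lborel (\<lambda>x. indicator (cball 0 R) x * U' x)"
    "\<And>\<phi>. test_function UNIV \<phi> \<Longrightarrow> (LINT s|lborel. deriv \<phi> s * U s) = - (LINT s|lborel. \<phi> s * U' s)"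
    by (rule weak_derivative_representative[OF U wd(1)]) blast
  obtain a' where a': "a' \<in> borel_measurable borel" "AE k in lborel. weak_deriv a k = a' k"
    "\<And>R. integrable lborel (\<lambda>x. indicator (cball 0 R) x * a' x)"
    "\<And>\<phi>. test_function UNIV \<phi> \<Longrightarrow> (LINT s|lborel. deriv \<phi> s * a s) = - (LINT s|lborel. \<phi> s * a' s)"
    by (rule weak_derivative_representative[OF a wd(3)]) blast
  have "\<exists>f'. f' \<in> borel_measurable borel \<and> (AE k in lborel. weak_deriv A k $ i = f' k) \<and>
      (\<forall>R. integrable lborel (\<lambda>x. indicator (cball 0 R) x * f' x)) \<and>
      (\<forall>\<phi>. test_function UNIV \<phi> \<longrightarrow> (LINT s|lborel. deriv \<phi> s * A s $ i) = - (LINT s|lborel. \<phi> s * f' s))" for i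
    by (rule weak_derivative_representative[OF Ai[of i] has_weak_deriv_component[OF A wd(2), of i]]) blast
  then obtain A' where A': "\<And>i. A' i \<in> borel_measurable borel" "\<And>i. AE k in lborel. weak_deriv A k $ i = A' i k"
    "\<And>i R. integrable lborel (\<lambda>x. indicator (cball 0 R) x * A' i x)"
    "\<And>i \<phi>. test_function UNIV \<phi> \<Longrightarrow> (LINT s|lborel. deriv \<phi> s * A s $ i) = - (LINT s|lborel. \<phi> s * A' i s)"
    using choice[of "\<lambda>i f'. f' \<in> borel_measurable borel \<and> (AE k in lborel. weak_deriv A k $ i = f' k) \<and>
      (\<forall>R. integrable lborel (\<lambda>x. indicator (cball 0 R) x * f' x)) \<and>
      (\<forall>\<phi>. test_function UNIV \<phi> \<longrightarrow> (LINT s|lborel. deriv \<phi> s * A s $ i) = - (LINT s|lborel. \<phi> s * f' s))"]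
    by fast
  have slice: "test_function UNIV (\<lambda>\<xi>. lift \<psi> (p, \<xi>))" if \<psi>: "test_function UNIV \<psi>" for \<psi> :: "real \<times> (real^'d) \<times> real \<Rightarrow> real" and p
  proof -
    obtain K where K: "compact K" "\<And>x. x \<notin> K \<Longrightarrow> \<psi> x = 0" using \<psi> by (rule test_functionE) blast
    have "smooth (\<lambda>\<xi>. \<psi> ((fst p, snd p, 0) + (0, 0, \<xi>)))"
      by (intro smooth_compose_affine[OF test_function_smooth[OF \<psi>]] bounded_linear_Pair bounded_linear_zero bounded_linear_ident)
    then have "smooth (\<lambda>\<xi>. lift \<psi> (p, \<xi>))" by (simp add: lift_def assoc_def)
    moreover have "compact ((\<lambda>q. snd (snd q)) ` K)"
      using K(1) by (intro compact_continuous_image continuous_intros)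
    moreover have "lift \<psi> (p, \<xi>) = 0" if "\<xi> \<notin> (\<lambda>q. snd (snd q)) ` K" for \<xi>
      unfolding lift_def by (rule K(2)) (use that in \<open>force simp: assoc_def\<close>)
    ultimately show ?thesis by (rule test_functionI[OF _ _ subset_UNIV])
  qed
  have slice0: "test_function UNIV (\<lambda>\<xi>. lift0 \<phi> (x, \<xi>))" for x
    using slice[OF \<phi>, of "(0, x)"] by (simp add: lift_def lift0_def)
  have dt: "((\<lambda>\<xi>. lift (D_t \<phi>) (p, \<xi>)) has_real_derivative lift (D_t (D_xi \<phi>)) (p, \<xi>)) (at \<xi>)" for p \<xi>
    using lift_deriv[OF test_function_smooth[OF test_function_D_t[OF \<phi>]]] by (simp add: D_xi_D_t_commute[OF smooth_\<phi>])
  have dx: "((\<lambda>\<xi>. lift (Dx i \<phi>) (p, \<xi>)) has_real_derivative lift (Dx i (D_xi \<phi>)) (p, \<xi>)) (at \<xi>)" for i p \<xi>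
    using lift_deriv[OF test_function_smooth[OF test_function_Dx[OF \<phi>]]] by (simp add: D_xi_Dx_commute[OF smooth_\<phi>])
  note wU0 = kint_flux_weak[OF _ v\<^sub>0 U U'(1,3,4) cc_lift0[OF cc_\<phi>(1)] cc_lift0[OF cc_\<phi>(2)] lift0_deriv[OF smooth_\<phi>] slice0, of UNIV]
  note wU = kint_flux_weak[OF upper_half_borel v U U'(1,3,4) cc_lift[OF cc_\<phi>(3)] cc_lift[OF cc_\<phi>(4)] dt slice[OF test_function_D_t[OF \<phi>]]]
  note wA = kint_flux_weak[OF upper_half_borel v Ai A'(1,3,4) cc_lift[OF cc_\<phi>(5)] cc_lift[OF cc_\<phi>(6)] dx slice[OF test_function_Dx[OF \<phi>]]]
  note wa = kint_flux_weak[OF upper_half_borel v a a'(1,3,4) cc_lift[OF cc_\<phi>(1)] cc_lift[OF cc_\<phi>(2)] lift_deriv[OF smooth_\<phi>] slice[OF \<phi>]]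
  note ca = chi_integrable[OF upper_half_borel v(1) a cc_lift[OF cc_\<phi>(2)]]
  have initial: "(LINT (x, \<xi>)|lebesgue. weak_deriv U \<xi> * chi \<xi> (V\<^sub>0 x) * \<phi> (0, x, \<xi>)) =
      kint UNIV v\<^sub>0 (flux_kernel U) (lift0 (D_xi \<phi>))"
  proof -
    have "AE q in lborel. q \<in> UNIV \<longrightarrow> weak_deriv U (snd q) * chi (snd q) (V\<^sub>0 (fst q)) * lift0 \<phi> q =
        U' (snd q) * chi (snd q) (v\<^sub>0 (fst q)) * lift0 \<phi> q"
      using AE_lborel_fst[OF V\<^sub>0] AE_lborel_snd[OF U'(2)] by eventually_elim simp
    from integral_lebesgue_on_cong_borel[OF _ this] borel_measurable_integrable[OF wU0(1)] wU0(2)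
    show ?thesis by (simp add: lebesgue_on_UNIV_eq lift0_def[abs_def] case_prod_beta')
  qed
  define G where "G = (\<lambda>s (q :: real \<times> (real^'d) \<times> real). weak_deriv U (snd (snd q)) * chi (snd (snd q)) s * D_t \<phi> q
        + chi (snd (snd q)) s * (weak_deriv A (snd (snd q)) \<bullet> kgrad_x \<phi> q)
        + weak_deriv a (snd (snd q)) * chi (snd (snd q)) s * \<phi> q
        + a (snd (snd q)) * chi (snd (snd q)) s * D_xi \<phi> q)"
  define G' where "G' = (\<lambda>s (q :: real \<times> (real^'d) \<times> real). U' (snd (snd q)) * chi (snd (snd q)) s * D_t \<phi> q
        + (\<Sum>i\<in>UNIV. A' i (snd (snd q)) * chi (snd (snd q)) s * Dx i \<phi> q)
        + a' (snd (snd q)) * chi (snd (snd q)) s * \<phi> q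
        + a (snd (snd q)) * chi (snd (snd q)) s * D_xi \<phi> q)"
  have "AE k in lborel. \<forall>i. weak_deriv A k $ i = A' i k"
    using A'(2) by (simp add: AE_all_countable)
  with U'(2) a'(2) have GG': "AE k in lborel. \<forall>s t x. G s (t, x, k) = G' s (t, x, k)"
    by eventually_elim (simp add: G_def G'_def inner_vec_def Dx_def sum_distrib_left ac_simps)
  have G'eq: "indicator H (fst q) * G' (v (fst q)) (assoc q) =
      indicator H (fst q) * (U' (snd q) * chi (snd q) (v (fst q)) * lift (D_t \<phi>) q)
      + (\<Sum>i\<in>UNIV. indicator H (fst q) * (A' i (snd q) * chi (snd q) (v (fst q)) * lift (Dx i \<phi>) q))
      + indicator H (fst q) * (a' (snd q) * chi (snd q) (v (fst q)) * lift \<phi> q)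
      + indicator H (fst q) * (a (snd q) * chi (snd q) (v (fst q)) * lift (D_xi \<phi>) q)" for q
    by (simp add: G'_def lift_def distrib_left sum_distrib_left assoc_def)
  \<comment> \<open>Resolution leaves the coordinate index as an unknown function of the summation
    variable; it is set to the identity.\<close>
  note int_sum = Bochner_Integration.integrable_sum[OF wA(1), of UNIV "\<lambda>i. i"]
  have G'int: "integrable lborel (\<lambda>q. indicator H (fst q) * G' (v (fst q)) (assoc q))"
    unfolding G'eq by (intro Bochner_Integration.integrable_add wU(1) wa(1) ca int_sum)
  have "(LINT (t, x, \<xi>)|lebesgue_on upper_half.
        weak_deriv U \<xi> * chi \<xi> (V (t, x)) * D_t \<phi> (t, x, \<xi>)
        + chi \<xi> (V (t, x)) * (weak_deriv A \<xi> \<bullet> kgrad_x \<phi> (t, x, \<xi>))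
        + weak_deriv a \<xi> * chi \<xi> (V (t, x)) * \<phi> (t, x, \<xi>)
        + a \<xi> * chi \<xi> (V (t, x)) * D_xi \<phi> (t, x, \<xi>)) = (LINT q|lebesgue_on upper_half. G (V (fst q, fst (snd q))) q)"
    by (simp add: G_def case_prod_beta')
  also have "\<dots> = (LINT q|lborel. indicator H (fst q) * G' (v (fst q)) (assoc q))"
    using integral_upper_half_transfer[OF V GG'] borel_measurable_integrable[OF G'int] by simp
  also have "\<dots> = kint H v (flux_kernel U) (lift (D_t (D_xi \<phi>)))
     + (\<Sum>i\<in>UNIV. kint H v (flux_kernel (\<lambda>s. A s $ i)) (lift (Dx i (D_xi \<phi>))))
     + kint H v (flux_kernel a) (lift (D_xi \<phi>))
     + (LINT q|lborel. indicator H (fst q) * (a (snd q) * chi (snd q) (v (fst q)) * lift (D_xi \<phi>) q))"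
    unfolding G'eq
    by (simp only: Bochner_Integration.integral_add Bochner_Integration.integrable_add wU wa ca int_sum
        Bochner_Integration.integral_sum[OF wA(1), of UNIV "\<lambda>i. i"] wA(2))
  finally have bulk: "(LINT (t, x, \<xi>)|lebesgue_on upper_half.
        weak_deriv U \<xi> * chi \<xi> (V (t, x)) * D_t \<phi> (t, x, \<xi>)
        + chi \<xi> (V (t, x)) * (weak_deriv A \<xi> \<bullet> kgrad_x \<phi> (t, x, \<xi>))
        + weak_deriv a \<xi> * chi \<xi> (V (t, x)) * \<phi> (t, x, \<xi>)
        + a \<xi> * chi \<xi> (V (t, x)) * D_xi \<phi> (t, x, \<xi>)) = \<dots>" .
  have zero: "(\<lambda>_. 0) \<in> borel_measurable borel" "loc_bounded (\<lambda>p :: real \<times> (real^'d). 0)"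
    by (auto intro: loc_bounded_bounded[of _ 0])
  have tr0: "integrable lborel (\<lambda>p. indicator H p * (a 0 * lift \<phi> (p, 0)))"
    by (rule trace_integrable[OF upper_half_borel zero zero(1) a cc_lift[OF cc_\<phi>(1)]])
  have tr: "(LINT (t, x)|lebesgue_on upper_half. a 0 * \<phi> (t, x, 0)) = (LINT p|lborel. indicator H p * (a 0 * lift \<phi> (p, 0)))"
    using transfer_H[of "\<lambda>s p. a 0 * lift \<phi> (p, 0)"] borel_measurable_integrable[OF tr0]
    by (simp add: lift_def case_prod_beta' assoc_def)
  \<comment> \<open>In K1 the source first yields a flux kernel. Its volume part cancels the term a
    \<chi> \<open>D_xi \<phi>\<close>, and its trace part together with a(0) \<phi>(t,x,0) leaves
    a(v) \<phi>(t,x,v), which is the source kernel.\<close>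
  have "kint H v (flux_kernel a) (lift (D_xi \<phi>)) =
    - (LINT q|lborel. indicator H (fst q) * (a (snd q) * chi (snd q) (v (fst q)) * lift (D_xi \<phi>) q))
    - (LINT p|lborel. indicator H p * pair_dchi (\<lambda>\<xi>. a \<xi> * lift \<phi> (p, \<xi>)) (v p))"
    by (rule kint_flux_by_parts[OF _ v a cc_lift cc_lift lift_deriv]) (auto intro: cc_\<phi> smooth_\<phi>)
  moreover have "(LINT p|lborel. indicator H p * (a 0 * lift \<phi> (p, 0)))
    - (LINT p|lborel. indicator H p * pair_dchi (\<lambda>\<xi>. a \<xi> * lift \<phi> (p, \<xi>)) (v p)) = kint H v (source_kernel a) (lift (D_xi \<phi>))"
    unfolding kint_source
    by (subst Bochner_Integration.integral_diff[OF tr0 pair_dchi_integrable[OF upper_half_borel v a cc_lift[OF cc_\<phi>(1)]], symmetric])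
       (simp add: pair_dchi_def algebra_simps)
  ultimately show ?thesis
    unfolding T_def initial bulk tr by simp
qed

end
end
end

section \<open>Entropy fluxes and the entropy production functional\<close>

section \<open>Entropy fluxes\<close>

lemma deriv_eq_local:
  assumes "open S" "x \<in> S" "\<And>y. y \<in> S \<Longrightarrow> f y = g y"
  shows "deriv f x = (deriv g x :: real)"
proof (rule deriv_cong_ev)
  show "\<forall>\<^sub>F y in nhds x. f y = g y"
    using eventually_nhds_in_open[OF assms(1,2)] by (rule eventually_mono) (rule assms(3))
qed simp

lemma sflux_cong:
  assumes "\<And>k. \<bar>k\<bar> \<le> R \<Longrightarrow> e k = e' k" "\<bar>s\<bar> \<le> R"
  shows "sflux e f s = sflux e' f s"
proof -
  have eq: "f k * chi k s * deriv e k = f k * chi k s * deriv e' k" for k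
  proof (cases "\<bar>k\<bar> < R")
    case True
    have "deriv e k = deriv e' k"
      by (rule deriv_eq_local[of "{-R<..<R}"]) (use True assms(1) in auto)
    then show ?thesis by simp
  next
    case False
    \<comment> \<open>At |k| = R the two derivatives may differ, but \<chi> vanishes there because
      its inequalities are strict.\<close>
    then have "chi k s = 0" using assms(2) by (auto simp: chi_def)
    then show ?thesis by simp
  qed
  show ?thesis unfolding sflux_def eq using assms by simp
qed

lemma sflux_const: "sflux (\<lambda>_. c) f s = c * f s"
  by (simp add: sflux_def)

lemma sflux_measurable:
  assumes e: "smooth e" and f: "continuous_on UNIV f"
  shows "sflux e f \<in> borel_measurable borel"
proof -
  note [measurable] = borel_measurable_continuous_onI[OF f] borel_measurable_continuous_onI[OF smooth_continuous[OF e]]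
    borel_measurable_continuous_onI[OF smooth_deriv_real(2)[OF e]]
  have "(\<lambda>s. LINT k|lborel. f k * chi k s * deriv e k) \<in> borel_measurable borel"
    by (rule lborel.borel_measurable_lebesgue_integral) simp
  then show ?thesis unfolding sflux_def[abs_def] by simp
qed

lemma sflux_loc_bounded:
  assumes e: "smooth e" and f: "continuous_on UNIV f"
  shows "loc_bounded (sflux e f)"
proof -
  note [measurable] = borel_measurable_continuous_onI[OF f] borel_measurable_continuous_onI[OF smooth_deriv_real(2)[OF e]]
  have "loc_bounded (\<lambda>s. LINT k|lborel. f k * chi k s * deriv e k)"
    unfolding loc_bounded_def
  proof (intro allI impI)
    fix C :: "real set" assume "compact C"
    then obtain R where R: "\<And>s. s \<in> C \<Longrightarrow> \<bar>s\<bar> \<le> R"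
      using loc_boundedE[OF loc_bounded_continuous[OF continuous_on_id]] by blast
    have int: "integrable lborel (\<lambda>k. indicator {-R..R} k *\<^sub>R \<bar>f k * deriv e k\<bar>)"
      by (intro borel_integrable_compact compact_Icc continuous_intros continuous_on_subset[OF f]
          continuous_on_subset[OF smooth_deriv_real(2)[OF e]]) auto
    have "\<bar>LINT k|lborel. f k * chi k s * deriv e k\<bar> \<le> (LINT k|lborel. indicator {-R..R} k *\<^sub>R \<bar>f k * deriv e k\<bar>)" if "s \<in> C" for s
    proof -
      have le: "\<bar>f k * chi k s * deriv e k\<bar> \<le> indicator {-R..R} k *\<^sub>R \<bar>f k * deriv e k\<bar>" for k
        using R[OF that] by (auto simp: chi_def indicator_def abs_mult)
      have "integrable lborel (\<lambda>k. f k * chi k s * deriv e k)"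
        by (rule Bochner_Integration.integrable_bound[OF int]) (use le in \<open>auto intro!: AE_I2 simp: abs_mult\<close>)
      then have "norm (LINT k|lborel. f k * chi k s * deriv e k) \<le> (LINT k|lborel. indicator {-R..R} k *\<^sub>R \<bar>f k * deriv e k\<bar>)"
        by (rule Bochner_Integration.integral_norm_bound_integral[OF _ int]) (use le in simp)
      then show ?thesis by simp
    qed
    then show "\<exists>B. \<forall>s\<in>C. \<bar>LINT k|lborel. f k * chi k s * deriv e k\<bar> \<le> B" by blast
  qed
  then have "loc_bounded (\<lambda>s. f s * e s + (\<lambda>_. - 1) s * (LINT k|lborel. f k * chi k s * deriv e k))"
    by (intro loc_bounded_add[OF loc_bounded_mult[OF loc_bounded_continuous[OF f] loc_bounded_continuous[OF smooth_continuous[OF e]]]]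
        loc_bounded_mult[OF loc_bounded_bounded[of _ 1]]) auto
  then show ?thesis by (simp add: sflux_def[abs_def])
qed

text \<open>The sign of \<chi> is the orientation of the integral from 0 to s.\<close>

lemma interval_integral_eq_chi:
  fixes h :: "real \<Rightarrow> 'b::euclidean_space"
  shows "(LBINT t=ereal 0..ereal s. h t) = (LINT k|lborel. chi k s *\<^sub>R h k)"
proof (cases "0 \<le> s")
  case True
  have eq: "indicator (einterval (ereal 0) (ereal s)) k *\<^sub>R h k = chi k s *\<^sub>R h k" for k
    using True by (auto simp: chi_def einterval_def indicator_def)
  show ?thesis
    using True by (simp only: interval_lebesgue_integral_def set_lebesgue_integral_def eq ereal_less_eq if_True)
next
  case False
  have eq: "- (indicator (einterval (ereal s) (ereal 0)) k *\<^sub>R h k) = chi k s *\<^sub>R h k" for k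
    using False by (auto simp: chi_def einterval_def indicator_def)
  show ?thesis
    using False by (simp only: interval_lebesgue_integral_def set_lebesgue_integral_def
        Bochner_Integration.integral_minus[symmetric] eq ereal_less_eq if_False)
qed

lemma entropy_flux_real: "entropy_flux E f s = sflux (deriv E) f s"
  by (simp add: entropy_flux_def sflux_def interval_integral_eq_chi ac_simps)

lemma entropy_flux_vec:
  fixes A :: "real \<Rightarrow> real^'d"
  assumes E: "smooth E" and A: "continuous_on UNIV A"
  shows "entropy_flux E A s $ i = sflux (deriv E) (\<lambda>s. A s $ i) s"
proof -
  let ?\<theta> = "deriv (deriv E)"
  have c: "continuous_on UNIV ?\<theta>" using smooth_deriv_real(2)[OF smooth_deriv[OF E]] .
  have "integrable lborel (\<lambda>k. indicator {-\<bar>s\<bar>..\<bar>s\<bar>} k *\<^sub>R (?\<theta> k *\<^sub>R A k))"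
    by (intro borel_integrable_compact compact_Icc continuous_intros continuous_on_subset[OF c] continuous_on_subset[OF A]) auto
  then have "integrable lborel (\<lambda>k. chi k s *\<^sub>R (?\<theta> k *\<^sub>R A k))"
  proof (rule Bochner_Integration.integrable_bound)
    have [measurable]: "?\<theta> \<in> borel_measurable borel" "A \<in> borel_measurable borel"
      using c A by (auto intro: borel_measurable_continuous_onI)
    show "(\<lambda>k. chi k s *\<^sub>R (?\<theta> k *\<^sub>R A k)) \<in> borel_measurable lborel" by simp
    show "AE k in lborel. norm (chi k s *\<^sub>R (?\<theta> k *\<^sub>R A k)) \<le> norm (indicator {-\<bar>s\<bar>..\<bar>s\<bar>} k *\<^sub>R (?\<theta> k *\<^sub>R A k))"
      by (intro AE_I2) (auto simp: chi_def indicator_def)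
  qed
  from integral_bounded_linear[OF bounded_linear_vec_nth this, of i]
  have "(LINT k|lborel. chi k s *\<^sub>R (?\<theta> k *\<^sub>R A k)) $ i = (LINT k|lborel. chi k s * (?\<theta> k * A k $ i))" by (simp add: mult.assoc)
  then show ?thesis
    by (simp add: entropy_flux_def sflux_def interval_integral_eq_chi ac_simps)
qed

text \<open>Difference quotients of g integrate to 0 over W, since W and Lebesgue measure are
  invariant under translations along h; dominated convergence passes to the derivative. It will be
  applied with h a space direction and W the upper half space.\<close>

lemma integral_translation_derivative_eq_0:
  fixes g :: "'a::euclidean_space \<Rightarrow> real"
  assumes g: "test_function UNIV g" and W[measurable]: "W \<in> sets borel"
    and inv: "\<And>x s. x + s *\<^sub>R h \<in> W \<longleftrightarrow> x \<in> W"
  shows "(LINT x|lborel. indicator W x * frechet_derivative g (at x) h) = 0"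
proof -
  have sm: "smooth g" using g by (rule test_function_smooth)
  define g' where "g' x = frechet_derivative g (at x) h" for x
  have g't: "test_function UNIV g'" unfolding g'_def by (rule test_function_frechet[OF g])
  obtain K where K: "compact K" "\<And>x. x \<notin> K \<Longrightarrow> g x = 0" using g by (rule test_functionE) blast
  obtain C where C: "0 \<le> C" "\<And>x. \<bar>g' x\<bar> \<le> C" using test_function_bounded[OF g't] by blast
  obtain r where r: "\<And>x. x \<in> K \<Longrightarrow> norm x \<le> r" using compact_imp_bounded[OF K(1)] by (auto simp: bounded_iff)
  \<comment> \<open>All difference quotients with step at most 1 vanish outside the ball of radius
    R.\<close>
  define R where "R = r + norm h"
  have gm[measurable]: "g \<in> borel_measurable borel" "g' \<in> borel_measurable borel"
    using cc_measurable[OF test_function_cc[OF g]] cc_measurable[OF test_function_cc[OF g't]] by auto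
  have line: "((\<lambda>s. g (x + s *\<^sub>R h)) has_real_derivative g' (x + s *\<^sub>R h)) (at s)" for x s
  proof -
    have "((\<lambda>s. g (x + s *\<^sub>R h)) has_derivative (\<lambda>r. frechet_derivative g (at (x + s *\<^sub>R h)) (r *\<^sub>R h))) (at s)"
      by (rule has_derivative_compose[OF _ smooth_has_derivative[OF sm]]) (auto intro!: derivative_eq_intros)
    moreover have "frechet_derivative g (at (x + s *\<^sub>R h)) (r *\<^sub>R h) = g' (x + s *\<^sub>R h) * r" for r
      using linear_cmul[OF has_derivative_linear[OF smooth_has_derivative[OF sm]]] by (simp add: g'_def)
    ultimately show ?thesis by (simp add: has_field_derivative_def)
  qed
  define d where "d n x = real (Suc n) * (g (x + inverse (real (Suc n)) *\<^sub>R h) - g x)" for n x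
  have int_g: "integrable lborel (\<lambda>x. indicator W x * g (x + y))" for y
  proof -
    have "C_c (\<lambda>x. g (x + y))"
    proof -
      have "continuous_on UNIV (\<lambda>x. g (x + y))"
        by (intro continuous_on_compose2[OF smooth_continuous[OF sm]] continuous_intros) auto
      moreover have "compact ((\<lambda>x. x - y) ` K)" using K(1) by (intro compact_continuous_image continuous_intros)
      moreover have "g (x + y) = 0" if "x \<notin> (\<lambda>x. x - y) ` K" for x
        by (rule K(2)) (use that in \<open>force simp: image_iff\<close>)
      ultimately show ?thesis unfolding C_c_def by blast
    qed
    then show ?thesis
      by (intro integrable_coeff_cc loc_bounded_indicator) auto
  qed
  have d0: "(LINT x|lborel. indicator W x * d n x) = 0" for n
  proof -
    let ?y = "inverse (real (Suc n)) *\<^sub>R h"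
    have "(LINT x|lborel. indicator W x * g x) = (LINT x|distr lborel borel ((+) ?y). indicator W x * g x)"
      by (simp add: lborel_distr_plus)
    also have "\<dots> = (LINT x|lborel. indicator W (?y + x) * g (?y + x))"
      by (rule integral_distr) auto
    also have "\<dots> = (LINT x|lborel. indicator W x * g (x + ?y))"
    proof -
      have "indicator W (?y + x) = (indicator W x :: real)" for x
        using inv[of x "inverse (real (Suc n))"] by (simp add: indicator_def add.commute)
      then show ?thesis by (simp add: add.commute)
    qed
    finally have eq: "(LINT x|lborel. indicator W x * g x) = (LINT x|lborel. indicator W x * g (x + ?y))" .
    have "(LINT x|lborel. indicator W x * d n x) = (LINT x|lborel. real (Suc n) * (indicator W x * g (x + ?y) - indicator W x * g (x + 0)))"
      by (simp add: d_def algebra_simps)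
    also have "\<dots> = real (Suc n) * ((LINT x|lborel. indicator W x * g (x + ?y)) - (LINT x|lborel. indicator W x * g (x + 0)))"
      by (simp only: integral_mult_right_zero Bochner_Integration.integral_diff[OF int_g int_g])
    finally show ?thesis using eq by simp
  qed
  have "(\<lambda>n. LINT x|lborel. indicator W x * d n x) \<longlonglongrightarrow> (LINT x|lborel. indicator W x * g' x)"
  proof (rule integral_dominated_convergence[where w="\<lambda>x. C * indicator (cball 0 R) x"])
    show "integrable lborel (\<lambda>x. C * indicator (cball 0 R) x :: real)"
      by (intro integrable_mult_right integrable_real_indicator) (use emeasure_compact_finite[OF compact_cball] in auto)
    show "AE x in lborel. (\<lambda>n. indicator W x * d n x) \<longlonglongrightarrow> indicator W x * g' x"
    proof (intro AE_I2 tendsto_mult_left)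
      fix x
      have "((\<lambda>s. (g (x + s *\<^sub>R h) - g (x + 0 *\<^sub>R h)) / (s - 0)) \<longlongrightarrow> g' (x + 0 *\<^sub>R h)) (at 0)"
        using line[of x 0] by (simp add: has_field_derivative_iff)
      moreover have "filterlim (\<lambda>n. inverse (real (Suc n))) (at 0) sequentially"
        using LIMSEQ_inverse_real_of_nat by (auto simp: filterlim_at)
      ultimately have "(\<lambda>n. (g (x + inverse (real (Suc n)) *\<^sub>R h) - g (x + 0 *\<^sub>R h)) / (inverse (real (Suc n)) - 0)) \<longlonglongrightarrow> g' (x + 0 *\<^sub>R h)"
        by (rule filterlim_compose)
      then show "(\<lambda>n. d n x) \<longlonglongrightarrow> g' x" by (simp add: d_def divide_inverse mult.commute)
    qed
    show "AE x in lborel. norm (indicator W x * d n x) \<le> C * indicator (cball 0 R) x" for n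
    proof (rule AE_I2)
      fix x
      let ?s = "inverse (real (Suc n))"
      have s: "0 < ?s" "?s \<le> 1" by (auto simp: field_simps)
      have "norm (d n x) \<le> C * indicator (cball 0 R) x"
      proof (cases "norm x \<le> R")
        case True
        obtain z where "g (x + ?s *\<^sub>R h) - g (x + 0 *\<^sub>R h) = (?s - 0) * g' (x + z *\<^sub>R h)"
          using MVT2[OF s(1), of "\<lambda>s. g (x + s *\<^sub>R h)" "\<lambda>s. g' (x + s *\<^sub>R h)"] line by blast
        then have "d n x = g' (x + z *\<^sub>R h)" by (simp add: d_def)
        then show ?thesis using C True by simp
      next
        case False
        have "norm (?s *\<^sub>R h) \<le> norm h" using s by (simp add: mult_left_le_one_le)
        moreover have "norm x \<le> norm (x + ?s *\<^sub>R h) + norm (?s *\<^sub>R h)" by (metis add_diff_cancel norm_triangle_ineq4)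
        ultimately have "x \<notin> K" "x + ?s *\<^sub>R h \<notin> K" using False r[of x] r[of "x + ?s *\<^sub>R h"] norm_ge_zero[of h] unfolding R_def by linarith+
        then show ?thesis using K(2) C(1) by (simp add: d_def)
      qed
      then show "norm (indicator W x * d n x) \<le> C * indicator (cball 0 R) x"
        by (auto simp: indicator_def C(1) split: if_splits)
    qed
  qed (auto simp: d_def)
  then have "(\<lambda>n. 0) \<longlonglongrightarrow> (LINT x|lborel. indicator W x * g' x)" unfolding d0 .
  then show ?thesis using LIMSEQ_unique[OF tendsto_const] unfolding g'_def by metis
qed

section \<open>The entropy functional\<close>

definition tensor :: "(real \<Rightarrow> real) \<Rightarrow> (real \<times> 'x \<Rightarrow> real) \<Rightarrow> real \<times> 'x \<times> real \<Rightarrow> real" where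
  "tensor \<theta> \<phi> q = \<theta> (snd (snd q)) * \<phi> (fst q, fst (snd q))"

lemma test_function_tensor:
  fixes \<phi> :: "real \<times> 'x::euclidean_space \<Rightarrow> real"
  assumes "test_function UNIV \<theta>" "test_function UNIV \<phi>"
  shows "test_function UNIV (tensor \<theta> \<phi>)"
proof -
  obtain K where K: "smooth \<theta>" "compact K" "\<And>x. x \<notin> K \<Longrightarrow> \<theta> x = 0" using assms(1) by (rule test_functionE) blast
  obtain L where L: "smooth \<phi>" "compact L" "\<And>x. x \<notin> L \<Longrightarrow> \<phi> x = 0" using assms(2) by (rule test_functionE) blast
  have "smooth (\<lambda>q :: real \<times> 'x \<times> real. \<theta> (snd (snd q)) * \<phi> (fst q, fst (snd q)))"
    by (intro smooth_mult smooth_compose_linear[OF K(1)] smooth_compose_linear[OF L(1)] bounded_linear_intros)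
  moreover have "compact ((\<lambda>q. (fst (fst q), snd (fst q), snd q)) ` (L \<times> K))"
    using K(2) L(2) by (intro compact_continuous_image compact_Times continuous_intros)
  moreover have "tensor \<theta> \<phi> q = 0" if "q \<notin> (\<lambda>q. (fst (fst q), snd (fst q), snd q)) ` (L \<times> K)" for q
  proof -
    have "(fst q, fst (snd q)) \<notin> L \<or> snd (snd q) \<notin> K"
      using that by (force simp: image_iff)
    then show ?thesis using K(3) L(3) by (auto simp: tensor_def)
  qed
  ultimately show ?thesis
    unfolding tensor_def[abs_def] by (intro test_functionI[OF _ _ subset_UNIV])
qed

lemma D_t_tensor:
  fixes \<phi> :: "real \<times> 'x::euclidean_space \<Rightarrow> real"
  assumes "smooth \<phi>"
  shows "D_t (tensor \<theta> \<phi>) = tensor \<theta> (D_t \<phi>)"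
proof
  fix q :: "real \<times> 'x \<times> real"
  obtain t x k where q: "q = (t, x, k)" by (cases q)
  have "((\<lambda>s. (s, x)) has_derivative (\<lambda>r. (r, 0))) (at t)"
    by (intro has_derivative_Pair has_derivative_ident has_derivative_const)
  from differentiableI[OF has_derivative_compose[OF this smooth_has_derivative[OF assms]]]
  have "(\<lambda>s. \<phi> (s, x)) differentiable (at t)" .
  then have "(\<lambda>s. \<phi> (s, x)) field_differentiable (at t)"
    using DERIV_deriv_iff_real_differentiable field_differentiable_def by blast
  then show "D_t (tensor \<theta> \<phi>) q = tensor \<theta> (D_t \<phi>) q"
    by (simp add: D_t_def tensor_def q)
qed

lemma Dx_tensor:
  fixes \<phi> :: "real \<times> (real^'d) \<Rightarrow> real"
  assumes "smooth \<phi>"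
  shows "Dx i (tensor \<theta> \<phi>) = tensor \<theta> (\<lambda>p. grad_x \<phi> p $ i)"
proof
  fix q :: "real \<times> (real^'d) \<times> real"
  obtain t x k where q: "q = (t, x, k)" by (cases q)
  have "((\<lambda>y. \<phi> (t, y)) has_derivative (\<lambda>h. frechet_derivative \<phi> (at (t, x)) (0, h))) (at x)"
    by (rule has_derivative_compose[of "\<lambda>y. (t, y)" "\<lambda>h. (0, h)", OF _ smooth_has_derivative[OF assms]])
       (intro has_derivative_Pair has_derivative_ident has_derivative_const)
  then have "frechet_derivative (\<lambda>y. \<theta> k * \<phi> (t, y)) (at x) = (\<lambda>h. \<theta> k * frechet_derivative \<phi> (at (t, x)) (0, h))"
    by (intro frechet_derivative_at[symmetric] has_derivative_mult_right)
  moreover have "frechet_derivative (\<lambda>y. \<phi> (t, y)) (at x) = (\<lambda>h. frechet_derivative \<phi> (at (t, x)) (0, h))"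
    using \<open>((\<lambda>y. \<phi> (t, y)) has_derivative _) (at x)\<close> by (rule frechet_derivative_at[symmetric])
  ultimately show "Dx i (tensor \<theta> \<phi>) q = tensor \<theta> (\<lambda>p. grad_x \<phi> p $ i) q"
    by (simp add: Dx_def kgrad_x_def grad_x_def grad_def tensor_def q)
qed

lemma test_function_grad_x:
  fixes \<phi> :: "real \<times> (real^'d) \<Rightarrow> real"
  assumes "test_function \<Omega> \<phi>"
  shows "test_function \<Omega> (\<lambda>p. grad_x \<phi> p $ i)"
  using assms by (simp add: grad_x_eq_frechet test_function_smooth test_function_frechet)

context kinetic_data
begin

text \<open>The entropy inequality with all its terms on one side and e = E': it reads
  \<open>0 \<le> S e \<phi>\<close>. Splitting the flux into coordinates reduces everything to
  real-valued integrals.\<close>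

definition S :: "(real \<Rightarrow> real) \<Rightarrow> (real \<times> (real^'d) \<Rightarrow> real) \<Rightarrow> real" where
  "S e \<phi> = (LINT x|lborel. sflux e U (v\<^sub>0 x) * \<phi> (0, x))
    + (LINT p|lborel. indicator H p * (sflux e U (v p) * D_t \<phi> p))
    + (\<Sum>i\<in>UNIV. LINT p|lborel. indicator H p * (sflux e (\<lambda>s. A s $ i) (v p) * grad_x \<phi> p $ i))
    + (LINT p|lborel. indicator H p * (a (v p) * e (v p) * \<phi> p))"

lemma cc_initial:
  fixes \<phi> :: "real \<times> (real^'d) \<Rightarrow> real"
  assumes "C_c \<phi>"
  shows "C_c (\<lambda>x. \<phi> (0, x))"
proof -
  obtain K where K: "continuous_on UNIV \<phi>" "compact K" "\<And>q. q \<notin> K \<Longrightarrow> \<phi> q = 0" using assms by (rule ccE) blast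
  have "compact (snd ` K)" using K(2) by (intro compact_continuous_image continuous_intros)
  moreover have "\<phi> (0, x) = 0" if "x \<notin> snd ` K" for x by (rule K(3)) (use that in force)
  moreover have "continuous_on UNIV (\<lambda>x. \<phi> (0, x))"
    by (intro continuous_on_compose2[OF K(1)] continuous_intros) auto
  ultimately show ?thesis unfolding C_c_def by blast
qed

lemma H_coeff:
  assumes [measurable]: "b \<in> borel_measurable borel" and "loc_bounded b" "C_c \<phi>"
  shows "integrable lborel (\<lambda>p. indicator H p * (b (v p) * \<phi> p))"
proof -
  note [measurable] = v(1)
  have "integrable lborel (\<lambda>p. (indicator H p * b (v p)) * \<phi> p)"
    by (intro integrable_coeff_cc assms loc_bounded_mult loc_bounded_indicator loc_bounded_compose[OF assms(2) v(2)])
       measurable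
  then show ?thesis by (simp add: mult.assoc)
qed

lemma initial_coeff:
  assumes [measurable]: "b \<in> borel_measurable borel" and "loc_bounded b" "C_c \<phi>"
  shows "integrable lborel (\<lambda>x. b (v\<^sub>0 x) * \<phi> x)"
proof -
  note [measurable] = v\<^sub>0(1)
  show ?thesis
    by (intro integrable_coeff_cc assms loc_bounded_compose[OF assms(2) v\<^sub>0(2)]) measurable
qed

lemma source_coeff:
  assumes "smooth e"
  shows "(\<lambda>s. a s * e s) \<in> borel_measurable borel" "loc_bounded (\<lambda>s. a s * e s)"
  using continuous_on_mult[OF a smooth_continuous[OF assms]]
  by (auto intro: borel_measurable_continuous_onI loc_bounded_continuous)

text \<open>The corrections \<open>f 0 * e 0\<close> left by \<open>kint_flux_tensor\<close> vanish:
  for U because \<open>U 0 = 0\<close>, for A because a constant times a space derivative of \<phi>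
  integrates to 0 over the upper half space.\<close>

lemma T_tensor:
  assumes e: "smooth e" "test_function UNIV (deriv e)" "\<And>x. x \<le> b \<Longrightarrow> e x = 0" and \<phi>: "test_function UNIV \<phi>"
  shows "T (tensor (deriv e) \<phi>) = S e \<phi>"
proof -
  have sm: "smooth \<phi>" using \<phi> by (rule test_function_smooth)
  have de: "(e has_real_derivative deriv e x) (at x)" for x by (rule smooth_deriv_real(1)[OF e(1)])
  note cce = test_function_cc[OF e(2)]
  have l0: "lift0 (tensor (deriv e) \<phi>) = (\<lambda>q. deriv e (snd q) * \<phi> (0, fst q))"
    by (auto simp: lift0_def tensor_def)
  have l: "lift (tensor (deriv e) \<psi>) = (\<lambda>q. deriv e (snd q) * \<psi> (fst q))" for \<psi> :: "real \<times> (real^'d) \<Rightarrow> real"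
    by (auto simp: lift_def tensor_def assoc_def)
  have z: "(LINT p|lborel. indicator H p * (A 0 $ i * e 0 * grad_x \<phi> p $ i)) = 0" for i
  proof -
    have "(LINT p|lborel. indicator H p * grad_x \<phi> p $ i) = 0"
      using integral_translation_derivative_eq_0[OF \<phi> upper_half_borel, of "(0, axis i 1)"]
      by (simp add: grad_x_eq_frechet[OF sm] mem_Times_iff)
    then have "(LINT p|lborel. (A 0 $ i * e 0) * (indicator H p * grad_x \<phi> p $ i)) = 0" by simp
    then show ?thesis by (simp add: ac_simps)
  qed
  have time: "kint H v (flux_kernel U) (lift (D_t (tensor (deriv e) \<phi>))) =
      (LINT p|lborel. indicator H p * (sflux e U (v p) * D_t \<phi> p))"
    unfolding D_t_tensor[OF sm] l
    by (subst kint_flux_tensor[OF upper_half_borel v U de cce e(3) test_function_cc[OF test_function_D_t[OF \<phi>]]]) (simp_all add: U0)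
  have space: "kint H v (flux_kernel (\<lambda>s. A s $ i)) (lift (Dx i (tensor (deriv e) \<phi>))) =
      (LINT p|lborel. indicator H p * (sflux e (\<lambda>s. A s $ i) (v p) * grad_x \<phi> p $ i))" for i
  proof -
    have cg: "C_c (\<lambda>p. grad_x \<phi> p $ i)" by (rule test_function_cc[OF test_function_grad_x[OF \<phi>]])
    have i1: "integrable lborel (\<lambda>p. indicator H p * (sflux e (\<lambda>s. A s $ i) (v p) * grad_x \<phi> p $ i))"
      by (intro H_coeff sflux_measurable sflux_loc_bounded e Ai cg)
    have i2: "integrable lborel (\<lambda>p. indicator H p * (A 0 $ i * e 0 * grad_x \<phi> p $ i))"
      using H_coeff[of "\<lambda>_. A 0 $ i * e 0" "\<lambda>p. grad_x \<phi> p $ i"] cg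
      by (simp add: loc_bounded_bounded[of _ "\<bar>A 0 $ i * e 0\<bar>"])
    have "kint H v (flux_kernel (\<lambda>s. A s $ i)) (lift (Dx i (tensor (deriv e) \<phi>))) =
      (LINT p|lborel. indicator H p * (sflux e (\<lambda>s. A s $ i) (v p) * grad_x \<phi> p $ i)
        - indicator H p * (A 0 $ i * e 0 * grad_x \<phi> p $ i))"
      unfolding Dx_tensor[OF sm] l
      by (subst kint_flux_tensor[OF upper_half_borel v Ai de cce e(3) cg], assumption)
         (simp only: left_diff_distrib right_diff_distrib)
    also have "\<dots> = (LINT p|lborel. indicator H p * (sflux e (\<lambda>s. A s $ i) (v p) * grad_x \<phi> p $ i))"
      unfolding Bochner_Integration.integral_diff[OF i1 i2] z by simp
    finally show ?thesis .
  qed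
  have init: "kint UNIV v\<^sub>0 (flux_kernel U) (lift0 (tensor (deriv e) \<phi>)) = (LINT x|lborel. sflux e U (v\<^sub>0 x) * \<phi> (0, x))"
    unfolding l0
    by (subst kint_flux_tensor[OF _ v\<^sub>0 U de cce e(3) cc_initial[OF test_function_cc[OF \<phi>]]]) (simp_all add: U0)
  have src: "kint H v (source_kernel a) (lift (tensor (deriv e) \<phi>)) = (LINT p|lborel. indicator H p * (a (v p) * e (v p) * \<phi> p))"
    unfolding l by (rule kint_source_tensor[OF upper_half_borel v a de cce e(3) test_function_cc[OF \<phi>]])
  show ?thesis
    unfolding T_def S_def time space init src ..
qed

text \<open>S sees e only on the range of v and \<open>v\<^sub>0\<close> over the support of \<phi>.
  This permits cutting off e for large arguments, and replacing an e that is constant on that range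
  by the constant.\<close>

lemma S_cong:
  assumes K: "compact K" "\<And>p. p \<notin> K \<Longrightarrow> \<phi> p = 0" and \<phi>: "smooth \<phi>"
    and v: "\<And>p. p \<in> K \<Longrightarrow> \<bar>v p\<bar> \<le> R" and v\<^sub>0: "\<And>x. (0, x) \<in> K \<Longrightarrow> \<bar>v\<^sub>0 x\<bar> \<le> R"
    and e: "\<And>k. \<bar>k\<bar> \<le> R \<Longrightarrow> e k = e' k"
  shows "S e \<phi> = S e' \<phi>"
proof -
  have d: "D_t \<phi> p = 0" "grad_x \<phi> p $ i = 0" if "p \<notin> K" for p i
    using frechet_derivative_eq_0_outside[of K \<phi> p] K that
    by (auto simp: D_t_eq_frechet[OF \<phi>] grad_x_eq_frechet[OF \<phi>])
  have 0: "sflux e U (v\<^sub>0 x) * \<phi> (0, x) = sflux e' U (v\<^sub>0 x) * \<phi> (0, x)" for x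
    using sflux_cong[of R e e', OF e v\<^sub>0] K(2)[of "(0, x)"] by (cases "(0, x) \<in> K") auto
  have 1: "sflux e f (v p) * D_t \<phi> p = sflux e' f (v p) * D_t \<phi> p" for p f
    using sflux_cong[of R e e', OF e v] d(1)[of p] by (cases "p \<in> K") auto
  have 2: "sflux e f (v p) * grad_x \<phi> p $ i = sflux e' f (v p) * grad_x \<phi> p $ i" for p f i
    using sflux_cong[of R e e', OF e v] d(2)[of p i] by (cases "p \<in> K") auto
  have 3: "a (v p) * e (v p) * \<phi> p = a (v p) * e' (v p) * \<phi> p" for p
    using e[OF v, of p] K(2)[of p] by (cases "p \<in> K") auto
  show ?thesis unfolding S_def 0 1 2 3 ..
qed

lemma S_const: "S (\<lambda>_. c) \<phi> = c * S (\<lambda>_. 1) \<phi>"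
  unfolding S_def sflux_const distrib_left sum_distrib_left integral_mult_right_zero[symmetric]
  by (simp add: ac_simps)

context
  fixes V :: "real \<times> (real^'d) \<Rightarrow> real" and V\<^sub>0 :: "real^'d \<Rightarrow> real"
  assumes V: "AE p in lborel. p \<in> H \<longrightarrow> V p = v p" and V\<^sub>0: "AE x in lborel. V\<^sub>0 x = v\<^sub>0 x"
begin

lemma entropy_functional_eq:
  assumes E: "smooth E" and \<phi>: "test_function UNIV \<phi>"
  shows "(LINT p|lebesgue_on upper_half. entropy_flux E U (V p) * D_t \<phi> p + entropy_flux E A (V p) \<bullet> grad_x \<phi> p)
     + (LINT p|lebesgue_on upper_half. a (V p) * deriv E (V p) * \<phi> p)
     + (LINT x|lebesgue. entropy_flux E U (V\<^sub>0 x) * \<phi> (0, x)) = S (deriv E) \<phi>"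
proof -
  let ?e = "deriv E"
  have e: "smooth ?e" using E by (rule smooth_deriv)
  have i1: "integrable lborel (\<lambda>p. indicator H p * (sflux ?e U (v p) * D_t \<phi> p))"
    by (intro H_coeff sflux_measurable sflux_loc_bounded e U test_function_cc[OF test_function_D_t[OF \<phi>]])
  have i2: "integrable lborel (\<lambda>p. indicator H p * (sflux ?e (\<lambda>s. A s $ i) (v p) * grad_x \<phi> p $ i))" for i
    by (intro H_coeff sflux_measurable sflux_loc_bounded e Ai test_function_cc[OF test_function_grad_x[OF \<phi>]])
  have i3: "integrable lborel (\<lambda>p. indicator H p * (a (v p) * ?e (v p) * \<phi> p))"
    by (rule H_coeff[OF source_coeff[OF e] test_function_cc[OF \<phi>]])
  have i4: "integrable lborel (\<lambda>x. sflux ?e U (v\<^sub>0 x) * \<phi> (0, x))"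
    by (intro initial_coeff sflux_measurable sflux_loc_bounded e U cc_initial[OF test_function_cc[OF \<phi>]])
  have eq: "indicator H p * (entropy_flux E U s * D_t \<phi> p + entropy_flux E A s \<bullet> grad_x \<phi> p) =
      indicator H p * (sflux ?e U s * D_t \<phi> p) + (\<Sum>i\<in>UNIV. indicator H p * (sflux ?e (\<lambda>s. A s $ i) s * grad_x \<phi> p $ i))" for p s
    by (simp add: entropy_flux_real inner_vec_def entropy_flux_vec[OF E A] distrib_left sum_distrib_left)
  have i2s: "integrable lborel (\<lambda>p. \<Sum>i\<in>UNIV. indicator H p * (sflux ?e (\<lambda>s. A s $ i) (v p) * grad_x \<phi> p $ i))"
    by (intro Bochner_Integration.integrable_sum i2)
  have sum2: "(LINT p|lborel. (\<Sum>i\<in>UNIV. indicator H p * (sflux ?e (\<lambda>s. A s $ i) (v p) * grad_x \<phi> p $ i))) =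
      (\<Sum>i\<in>UNIV. LINT p|lborel. indicator H p * (sflux ?e (\<lambda>s. A s $ i) (v p) * grad_x \<phi> p $ i))"
    by (rule Bochner_Integration.integral_sum) (rule i2)
  note i12 = Bochner_Integration.integrable_add[OF i1 i2s]
  have "(LINT p|lebesgue_on upper_half. entropy_flux E U (V p) * D_t \<phi> p + entropy_flux E A (V p) \<bullet> grad_x \<phi> p) =
      (LINT p|lborel. indicator H p * (entropy_flux E U (v p) * D_t \<phi> p + entropy_flux E A (v p) \<bullet> grad_x \<phi> p))"
    using borel_measurable_integrable[OF i12]
    by (intro transfer_H[OF V V\<^sub>0, of "\<lambda>s p. entropy_flux E U s * D_t \<phi> p + entropy_flux E A s \<bullet> grad_x \<phi> p"]) (simp add: eq)
  also have "\<dots> = (LINT p|lborel. indicator H p * (sflux ?e U (v p) * D_t \<phi> p))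
      + (\<Sum>i\<in>UNIV. LINT p|lborel. indicator H p * (sflux ?e (\<lambda>s. A s $ i) (v p) * grad_x \<phi> p $ i))"
    unfolding eq
    by (simp only: Bochner_Integration.integral_add[OF i1 i2s] sum2)
  finally have 1: "(LINT p|lebesgue_on upper_half. entropy_flux E U (V p) * D_t \<phi> p + entropy_flux E A (V p) \<bullet> grad_x \<phi> p) = \<dots>" .
  have 2: "(LINT p|lebesgue_on upper_half. a (V p) * ?e (V p) * \<phi> p) = (LINT p|lborel. indicator H p * (a (v p) * ?e (v p) * \<phi> p))"
    using borel_measurable_integrable[OF i3]
    by (intro transfer_H[OF V V\<^sub>0, of "\<lambda>s p. a s * ?e s * \<phi> p"]) simp
  have 3: "(LINT x|lebesgue. entropy_flux E U (V\<^sub>0 x) * \<phi> (0, x)) = (LINT x|lborel. sflux ?e U (v\<^sub>0 x) * \<phi> (0, x))"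
    using borel_measurable_integrable[OF i4] transfer_initial[OF V V\<^sub>0, of "\<lambda>s x. sflux ?e U s * \<phi> (0, x)"]
    by (simp add: entropy_flux_real)
  show ?thesis unfolding 1 2 3 S_def by simp
qed

end
end

section \<open>From tensor products to arbitrary nonnegative test functions\<close>

section \<open>Positivity of the kinetic functional\<close>

text \<open>The primitive starts to the left of the support of \<theta>. At plus infinity it equals
  the integral of \<theta>, in general not 0, so e is smooth but usually not a test
  function.\<close>

lemma test_function_primitive:
  fixes \<theta> :: "real \<Rightarrow> real"
  assumes "test_function UNIV \<theta>"
  obtains e b where "smooth e" "deriv e = \<theta>" "\<And>x. x \<le> b \<Longrightarrow> e x = 0"
proof -
  obtain K where K: "smooth \<theta>" "compact K" "\<And>x. x \<notin> K \<Longrightarrow> \<theta> x = 0" using assms by (rule test_functionE) blast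
  obtain R where R: "\<And>x. x \<in> K \<Longrightarrow> \<bar>x\<bar> \<le> R"
    using loc_boundedE[OF loc_bounded_continuous[OF continuous_on_id] K(2)] by blast
  obtain F where F: "\<And>x. (F has_real_derivative \<theta> x) (at x)" "F 0 = 0"
    using continuous_antiderivative[OF smooth_continuous[OF K(1)]] by blast
  define b where "b = - R - 1"
  define e where "e x = F x - F b" for x
  have de: "(e has_real_derivative \<theta> x) (at x)" for x
    unfolding e_def by (auto intro!: derivative_eq_intros F)
  have z: "\<theta> x = 0" if "x \<le> b" for x
    by (rule K(3)) (use R[of x] that in \<open>auto simp: b_def\<close>)
  have "e x = 0" if "x \<le> b" for x
  proof (cases "x = b")
    case False
    then have "x < b" using that by simp
    then obtain y where "x < y" "y < b" "F b - F x = (b - x) * \<theta> y" using MVT2[of x b F \<theta>] F(1) by blast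
    then show ?thesis using z[of y] by (simp add: e_def)
  qed (simp add: e_def)
  moreover have "deriv e = \<theta>" using de by (auto intro: DERIV_imp_deriv)
  ultimately show ?thesis
    using that smooth_antiderivative[OF de K(1)] by blast
qed

text \<open>A smooth partition of unity at scale \<open>1/N\<close>; it telescopes.\<close>

definition hat :: "nat \<Rightarrow> int \<Rightarrow> real \<Rightarrow> real" where
  "hat N j k = smooth_step ((1 - real_of_int j) + real N * k) - smooth_step (- real_of_int j + real N * k)"

lemma hat_nonneg: "0 \<le> hat N j k"
  unfolding hat_def using monoD[OF mono_smooth_step, of "- real_of_int j + real N * k" "(1 - real_of_int j) + real N * k"] by simp

lemma hat_eq_0: "1 \<le> \<bar>real N * k - real_of_int j\<bar> \<Longrightarrow> hat N j k = 0"
  unfolding hat_def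
  by (cases "0 \<le> real N * k - real_of_int j") (auto simp: smooth_step_eq_0 smooth_step_eq_1)

lemma test_function_hat:
  assumes "0 < N"
  shows "test_function UNIV (hat N j)"
proof (rule test_functionI[OF _ compact_cball subset_UNIV])
  show "smooth (hat N j)"
    unfolding hat_def[abs_def]
    by (intro smooth_diff smooth_compose_affine[OF smooth_smooth_step] bounded_linear_mult_right)
  show "hat N j k = 0" if k: "k \<notin> cball (real_of_int j / real N) (1 / real N)" for k
  proof (rule hat_eq_0)
    have "1 / real N < \<bar>k - real_of_int j / real N\<bar>" using k by (simp add: dist_real_def abs_minus_commute)
    then have "real N * (1 / real N) \<le> real N * \<bar>k - real_of_int j / real N\<bar>"
      by (intro mult_left_mono) auto
    also have "\<dots> = \<bar>real N * (k - real_of_int j / real N)\<bar>" by (simp add: abs_mult)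
    finally show "1 \<le> \<bar>real N * k - real_of_int j\<bar>" using assms by (simp add: right_diff_distrib)
  qed
qed

lemma sum_hat:
  "(\<Sum>j\<in>{- int J..int J}. hat N j k) = smooth_step ((1 + real J) + real N * k) - smooth_step (- real J + real N * k)"
proof (induction J)
  case 0
  then show ?case by (simp add: hat_def)
next
  case (Suc J)
  have "{- int (Suc J)..int (Suc J)} = insert (- int (Suc J)) (insert (int (Suc J)) {- int J..int J})" by auto
  then have "(\<Sum>j\<in>{- int (Suc J)..int (Suc J)}. hat N j k) =
      hat N (- int (Suc J)) k + (hat N (int (Suc J)) k + (\<Sum>j\<in>{- int J..int J}. hat N j k))"
    by simp
  then show ?case
    unfolding Suc.IH by (simp add: hat_def algebra_simps)
qed

text \<open>Sampling in \<xi> only, at the grid points j/N: for fixed N a finite sum of tensor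
  products, whose factors are nonnegative if g is. The range of j covers [-M, M].\<close>

definition approx :: "nat \<Rightarrow> nat \<Rightarrow> ('p \<times> real \<Rightarrow> real) \<Rightarrow> 'p \<times> real \<Rightarrow> real" where
  "approx N M g q = (\<Sum>j\<in>{- int (N * M)..int (N * M)}. hat N j (snd q) * g (fst q, real_of_int j / real N))"

lemma approx_tendsto:
  fixes g :: "'p::euclidean_space \<times> real \<Rightarrow> real"
  assumes g: "continuous_on UNIV g" and M: "\<And>p k. real M < \<bar>k\<bar> \<Longrightarrow> g (p, k) = 0"
  shows "(\<lambda>n. approx (Suc n) M g q) \<longlonglongrightarrow> g q"
proof (rule LIMSEQ_I)
  fix \<epsilon> :: real assume \<epsilon>: "0 < \<epsilon>"
  obtain p k where q: "q = (p, k)" by (cases q)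
  have "continuous_on UNIV (\<lambda>k. g (p, k))"
    by (intro continuous_on_compose2[OF g] continuous_intros) auto
  then have "isCont (\<lambda>k. g (p, k)) k" by (simp add: continuous_on_eq_continuous_at)
  then obtain \<delta> where \<delta>: "0 < \<delta>" "\<And>k'. \<bar>k' - k\<bar> < \<delta> \<Longrightarrow> \<bar>g (p, k') - g (p, k)\<bar> < \<epsilon> / 2"
    using \<epsilon> unfolding continuous_at_eps_delta by (metis dist_real_def half_gt_zero)
  obtain n0 where n0: "inverse (real (Suc n0)) < \<delta>" using reals_Archimedean[OF \<delta>(1)] by blast
  have "norm (approx (Suc n) M g q - g q) < \<epsilon>" if n: "n0 \<le> n" for n
  proof -
    define N where "N = Suc n"
    have N: "0 < real N" "1 / real N < \<delta>"
    proof -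
      have "1 / real N \<le> inverse (real (Suc n0))" using n by (simp add: N_def field_simps)
      then show "1 / real N < \<delta>" using n0 by linarith
    qed (simp add: N_def)
    let ?J = "{- int (N * M)..int (N * M)}"
    have le1: "(\<Sum>j\<in>?J. hat N j k) \<le> 1"
      unfolding sum_hat using smooth_step_bounds[of "(1 + real (N * M)) + real N * k"] smooth_step_bounds[of "- real (N * M) + real N * k"] by linarith
    have eq1: "(\<Sum>j\<in>?J. hat N j k) = 1" if "\<bar>k\<bar> \<le> real M"
    proof -
      have "\<bar>real N * k\<bar> \<le> real N * real M" using that N(1) by (simp add: abs_mult)
      then have "1 \<le> (1 + real (N * M)) + real N * k" "- real (N * M) + real N * k \<le> 0" by auto
      then show ?thesis unfolding sum_hat by (simp only: smooth_step_eq_0 smooth_step_eq_1)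
    qed
    \<comment> \<open>Where the hats need not add up to 1, g vanishes.\<close>
    have "g (p, k) = (\<Sum>j\<in>?J. hat N j k) * g (p, k)"
      using eq1 M[of k p] by (cases "\<bar>k\<bar> \<le> real M") auto
    then have "approx N M g q - g q = (\<Sum>j\<in>?J. hat N j k * (g (p, real_of_int j / real N) - g (p, k)))"
      by (simp add: approx_def q right_diff_distrib sum_subtractf sum_distrib_right)
    also have "\<bar>\<dots>\<bar> \<le> (\<Sum>j\<in>?J. hat N j k * (\<epsilon> / 2))"
    proof (rule order_trans[OF sum_abs sum_mono])
      fix j
      show "\<bar>hat N j k * (g (p, real_of_int j / real N) - g (p, k))\<bar> \<le> hat N j k * (\<epsilon> / 2)"
      proof (cases "1 \<le> \<bar>real N * k - real_of_int j\<bar>")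
        case True
        then show ?thesis by (simp add: hat_eq_0)
      next
        case False
        have "real_of_int j / real N - k = (real_of_int j - real N * k) / real N"
          using N(1) by (simp add: diff_divide_distrib)
        then have "\<bar>real_of_int j / real N - k\<bar> = \<bar>real N * k - real_of_int j\<bar> / real N"
          by (simp add: abs_divide abs_minus_commute)
        also have "\<dots> < 1 / real N" using False N(1) by (intro divide_strict_right_mono) auto
        finally have "\<bar>g (p, real_of_int j / real N) - g (p, k)\<bar> < \<epsilon> / 2" using N(2) by (intro \<delta>(2)) linarith
        then show ?thesis unfolding abs_mult abs_of_nonneg[OF hat_nonneg]
          by (intro mult_left_mono less_imp_le hat_nonneg)
      qed
    qed
    also have "\<dots> = (\<Sum>j\<in>?J. hat N j k) * (\<epsilon> / 2)" by (simp add: sum_distrib_right)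
    also have "\<dots> \<le> 1 * (\<epsilon> / 2)" using le1 \<epsilon> by (intro mult_right_mono) auto
    finally show ?thesis using \<epsilon> by (simp add: N_def)
  qed
  then show "\<exists>no. \<forall>n\<ge>no. norm (approx (Suc n) M g q - g q) < \<epsilon>" by blast
qed

lemma approx_bound:
  fixes g :: "'p::euclidean_space \<times> real \<Rightarrow> real"
  assumes C: "\<And>q. \<bar>g q\<bar> \<le> C" and K: "\<And>p k. p \<notin> K \<Longrightarrow> g (p, k) = 0"
  shows "\<bar>approx (Suc n) M g q\<bar> \<le> C * indicator (K \<times> cball 0 (real M + 1)) q"
proof -
  obtain p k where q: "q = (p, k)" by (cases q)
  let ?N = "Suc n"
  let ?J = "{- int (?N * M)..int (?N * M)}"
  have C0: "0 \<le> C" using C[of q] by linarith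
  show ?thesis
  proof (cases "p \<in> K \<and> \<bar>k\<bar> \<le> real M + 1")
    case True
    have "\<bar>approx ?N M g q\<bar> \<le> (\<Sum>j\<in>?J. hat ?N j k * C)"
      unfolding approx_def q
    proof (rule order_trans[OF sum_abs sum_mono])
      fix j show "\<bar>hat ?N j (snd (p, k)) * g (fst (p, k), real_of_int j / real ?N)\<bar> \<le> hat ?N j k * C"
        using C hat_nonneg[of ?N j k] by (simp add: abs_mult mult_left_mono)
    qed
    also have "\<dots> = (\<Sum>j\<in>?J. hat ?N j k) * C" by (simp only: sum_distrib_right)
    also have "\<dots> \<le> 1 * C"
    proof (rule mult_right_mono[OF _ C0])
      show "(\<Sum>j\<in>?J. hat ?N j k) \<le> 1"
        unfolding sum_hat using smooth_step_bounds[of "(1 + real (?N * M)) + real ?N * k"] smooth_step_bounds[of "- real (?N * M) + real ?N * k"] by linarith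
    qed
    finally show ?thesis using True by (simp add: q)
  next
    case False
    \<comment> \<open>A hat centred in [-M, M] reaches at most 1/N \<le> 1 further, hence the radius
      M + 1.\<close>
    have "hat ?N j k * g (p, real_of_int j / real ?N) = 0" if j: "j \<in> ?J" for j
    proof (cases "p \<in> K")
      case True
      with False have k: "real M + 1 < \<bar>k\<bar>" by simp
      have "real_of_int \<bar>j\<bar> \<le> real_of_int (int (?N * M))" using j by (subst of_int_le_iff) auto
      then have "\<bar>real_of_int j\<bar> \<le> real ?N * real M" by (simp add: algebra_simps)
      moreover have "real ?N * (real M + 1) \<le> real ?N * \<bar>k\<bar>" using k by (intro mult_left_mono) auto
      moreover have "real ?N * \<bar>k\<bar> = \<bar>real ?N * k\<bar>" by (simp add: abs_mult)
      moreover have "real ?N * (real M + 1) = real ?N * real M + real ?N" by (simp add: distrib_left)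
      moreover have "1 \<le> real ?N" by simp
      ultimately have "1 \<le> \<bar>real ?N * k - real_of_int j\<bar>" by linarith
      then show ?thesis by (simp add: hat_eq_0)
    qed (simp add: K)
    then have "approx ?N M g q = 0" unfolding approx_def q by (intro sum.neutral) auto
    then show ?thesis using C0 by simp
  qed
qed

lemma kint_sum:
  assumes "W \<in> sets borel" "v \<in> borel_measurable borel" "loc_bounded v" "kernel c"
    and "\<And>j. j \<in> J \<Longrightarrow> C_c (g j)"
  shows "kint W v c (\<lambda>q. \<Sum>j\<in>J. g j q) = (\<Sum>j\<in>J. kint W v c (g j))"
  unfolding kint_def sum_distrib_left
  by (rule Bochner_Integration.integral_sum) (rule kint_integrable[OF assms(1-4)], rule assms(5))

lemma cc_at:
  assumes "C_c (g :: 'p::euclidean_space \<times> real \<Rightarrow> real)"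
  shows "C_c (\<lambda>p. g (p, r))"
proof -
  obtain K where K: "continuous_on UNIV g" "compact K" "\<And>q. q \<notin> K \<Longrightarrow> g q = 0" using assms by (rule ccE) blast
  have "compact (fst ` K)" using K(2) by (intro compact_continuous_image continuous_intros)
  moreover have "g (p, r) = 0" if "p \<notin> fst ` K" for p by (rule K(3)) (use that in force)
  moreover have "continuous_on UNIV (\<lambda>p. g (p, r))"
    by (intro continuous_on_compose2[OF K(1)] continuous_intros) auto
  ultimately show ?thesis unfolding C_c_def by blast
qed

lemma kint_approx_tendsto:
  fixes g :: "'p::euclidean_space \<times> real \<Rightarrow> real"
  assumes W: "W \<in> sets borel" and v: "v \<in> borel_measurable borel" "loc_bounded v" and c: "kernel c"
    and g: "C_c g" and M: "\<And>p k. real M < \<bar>k\<bar> \<Longrightarrow> g (p, k) = 0"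
  shows "(\<lambda>n. kint W v c (approx (Suc n) M g)) \<longlonglongrightarrow> kint W v c g"
proof -
  obtain C where C: "0 \<le> C" "\<And>x. \<bar>g x\<bar> \<le> C" using cc_bounded[OF g] by blast
  obtain K S where K: "compact K" "0 \<le> S" "\<And>p k. p \<notin> K \<or> S < \<bar>k\<bar> \<Longrightarrow> g (p, k) = 0"
    by (rule cc_support_prod[OF g]) blast
  let ?c = "\<lambda>q. indicator W (fst q) * c (v (fst q)) (snd q)"
  note cm = kint_coeff[OF W v c]
  note [measurable] = cm(1) cc_measurable[OF g]
  let ?B = "K \<times> cball (0::real) (real M + 1)"
  have B: "compact ?B" by (intro compact_Times K compact_cball)
  have [measurable]: "?B \<in> sets borel" using B by (rule borel_compact)
  have am[measurable]: "approx (Suc n) M g \<in> borel_measurable borel" for n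
  proof -
    have "C_c (\<lambda>q. hat (Suc n) j (snd q) * g (fst q, real_of_int j / real (Suc n)))" for j
      by (intro cc_tensor[OF test_function_cc[OF test_function_hat]] cc_at g) simp
    then show ?thesis unfolding approx_def[abs_def] by (intro borel_measurable_sum cc_measurable)
  qed
  show ?thesis
    unfolding kint_def
  proof (rule integral_dominated_convergence[where w="\<lambda>q. \<bar>?c q\<bar> * (C * indicator ?B q)"])
    have "integrable lborel (\<lambda>q. \<bar>?c q * (C * indicator ?B q)\<bar>)"
    proof (intro integrable_abs integrable_loc_bounded[OF _ _ B])
      show "loc_bounded (\<lambda>q. ?c q * (C * indicator ?B q))"
        using C(1) by (intro loc_bounded_mult cm(2) loc_bounded_bounded[of "\<lambda>q. C" C] loc_bounded_indicator) auto
    qed auto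
    then show "integrable lborel (\<lambda>q. \<bar>?c q\<bar> * (C * indicator ?B q))" using C(1) by (simp add: abs_mult)
    show "AE q in lborel. (\<lambda>n. ?c q * approx (Suc n) M g q) \<longlonglongrightarrow> ?c q * g q"
      by (intro AE_I2 tendsto_mult_left approx_tendsto cc_continuous[OF g] M)
    show "AE q in lborel. norm (?c q * approx (Suc n) M g q) \<le> \<bar>?c q\<bar> * (C * indicator ?B q)" for n
    proof (intro AE_I2)
      fix q
      have "\<bar>approx (Suc n) M g q\<bar> \<le> C * indicator ?B q"
        by (rule approx_bound[OF C(2)]) (simp add: K(3))
      then show "norm (?c q * approx (Suc n) M g q) \<le> \<bar>?c q\<bar> * (C * indicator ?B q)"
        by (simp only: real_norm_def abs_mult) (intro mult_left_mono, auto)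
    qed
  qed measurable
qed

context kinetic_data
begin

lemma T_add:
  assumes "test_function UNIV f" "test_function UNIV g"
  shows "T (\<lambda>q. f q + g q) = T f + T g"
proof -
  have sm: "smooth f" "smooth g" "smooth (\<lambda>q. f q + g q)"
    using assms by (auto intro: test_function_smooth smooth_add)
  have fd: "frechet_derivative (\<lambda>q. f q + g q) (at q) h = frechet_derivative f (at q) h + frechet_derivative g (at q) h" for q h
    using frechet_derivative_at[OF has_derivative_add[OF smooth_has_derivative[OF sm(1)] smooth_has_derivative[OF sm(2)]], symmetric]
    by simp
  have 1: "lift0 (\<lambda>q. f q + g q) = (\<lambda>q. lift0 f q + lift0 g q)" by (auto simp: lift0_def)
  have 2: "lift (\<lambda>q. f q + g q) = (\<lambda>q. lift f q + lift g q)" by (auto simp: lift_def)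
  have 3: "lift (D_t (\<lambda>q. f q + g q)) = (\<lambda>q. lift (D_t f) q + lift (D_t g) q)"
    by (auto simp: lift_def D_t_eq_frechet sm fd)
  have 4: "lift (Dx i (\<lambda>q. f q + g q)) = (\<lambda>q. lift (Dx i f) q + lift (Dx i g) q)" for i
    by (auto simp: lift_def Dx_eq_frechet sm fd)
  note t = test_function_cc[OF assms(1)] test_function_cc[OF assms(2)]
    test_function_cc[OF test_function_D_t[OF assms(1)]] test_function_cc[OF test_function_D_t[OF assms(2)]]
    test_function_cc[OF test_function_Dx[OF assms(1)]] test_function_cc[OF test_function_Dx[OF assms(2)]]
  show ?thesis
    unfolding T_def 1 2 3 4
    by (simp add: kint_add v v\<^sub>0 kernel_flux kernel_source U Ai a cc_lift cc_lift0 t upper_half_borel sum.distrib)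
qed

lemma T_cmult:
  assumes "test_function UNIV f"
  shows "T (\<lambda>q. r * f q) = r * T f"
proof -
  have sm: "smooth f" "smooth (\<lambda>q. r * f q)"
    using assms by (auto intro: test_function_smooth smooth_cmult)
  have fd: "frechet_derivative (\<lambda>q. r * f q) (at q) h = r * frechet_derivative f (at q) h" for q h
    using frechet_derivative_at[OF has_derivative_mult_right[OF smooth_has_derivative[OF sm(1)]], symmetric] by simp
  have 1: "lift0 (\<lambda>q. r * f q) = (\<lambda>q. r * lift0 f q)" by (auto simp: lift0_def)
  have 2: "lift (\<lambda>q. r * f q) = (\<lambda>q. r * lift f q)" by (auto simp: lift_def)
  have 3: "lift (D_t (\<lambda>q. r * f q)) = (\<lambda>q. r * lift (D_t f) q)"
    by (auto simp: lift_def D_t_eq_frechet sm fd)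
  have 4: "lift (Dx i (\<lambda>q. r * f q)) = (\<lambda>q. r * lift (Dx i f) q)" for i
    by (auto simp: lift_def Dx_eq_frechet sm fd)
  show ?thesis
    unfolding T_def 1 2 3 4 kint_cmult by (simp add: distrib_left sum_distrib_left)
qed

text \<open>\<psi> is replaced by its sampled version in \<xi>. Sampling commutes with derivatives
  in t and x, and T takes no derivative in \<xi>, so dominated pointwise convergence suffices
  although the \<xi>-derivatives of the hats grow like N.\<close>

lemma T_nonneg:
  assumes pos: "\<And>\<theta> \<phi>. test_function UNIV \<theta> \<Longrightarrow> (\<And>x. 0 \<le> \<theta> x) \<Longrightarrow> test_function UNIV \<phi> \<Longrightarrow> (\<And>p. 0 \<le> \<phi> p) \<Longrightarrow> 0 \<le> T (tensor \<theta> \<phi>)"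
    and \<psi>: "test_function UNIV \<psi>" and \<psi>0: "\<And>q. 0 \<le> \<psi> q"
  shows "0 \<le> T \<psi>"
proof -
  obtain K where K: "smooth \<psi>" "compact K" "\<And>q. q \<notin> K \<Longrightarrow> \<psi> q = 0" using \<psi> by (rule test_functionE) blast
  have "compact ((\<lambda>q. snd (snd q)) ` K)" using K(2) by (intro compact_continuous_image continuous_intros)
  then obtain R where R: "\<And>k. k \<in> (\<lambda>q. snd (snd q)) ` K \<Longrightarrow> \<bar>k\<bar> \<le> R"
    using loc_boundedE[OF loc_bounded_continuous[OF continuous_on_id]] by blast
  obtain M :: nat where M: "R \<le> real M" using real_arch_simple by blast
  have out: "(t, x, k) \<notin> K" if "real M < \<bar>k\<bar>" for t x k
    using R[of k] M that by force
  have z: "\<psi> (t, x, k) = 0" "D_t \<psi> (t, x, k) = 0" "Dx i \<psi> (t, x, k) = 0" if "real M < \<bar>k\<bar>" for t x k i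
    using K(3)[OF out[OF that]] frechet_derivative_eq_0_outside[OF K(2) _ out[OF that], of \<psi>] K(3)
    by (auto simp: D_t_eq_frechet[OF K(1)] Dx_eq_frechet[OF K(1)])
  have z0: "lift0 \<psi> (x, k) = 0" and zl: "lift \<psi> (p, k) = 0" "lift (D_t \<psi>) (p, k) = 0" "lift (Dx i \<psi>) (p, k) = 0"
    if "real M < \<bar>k\<bar>" for x k p i
    using z[OF that] by (auto simp: lift0_def lift_def assoc_def)
  note t = test_function_cc[OF \<psi>] test_function_cc[OF test_function_D_t[OF \<psi>]] test_function_cc[OF test_function_Dx[OF \<psi>]]
  define T' where "T' n = kint UNIV v\<^sub>0 (flux_kernel U) (approx (Suc n) M (lift0 \<psi>)) + kint H v (flux_kernel U) (approx (Suc n) M (lift (D_t \<psi>)))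
     + (\<Sum>i\<in>UNIV. kint H v (flux_kernel (\<lambda>s. A s $ i)) (approx (Suc n) M (lift (Dx i \<psi>)))) + kint H v (source_kernel a) (approx (Suc n) M (lift \<psi>))" for n
  have "T' \<longlonglongrightarrow> T \<psi>"
    unfolding T'_def T_def
    by (intro tendsto_add tendsto_sum kint_approx_tendsto v v\<^sub>0 kernel_flux kernel_source U Ai a cc_lift cc_lift0 t upper_half_borel z0 zl) auto
  moreover have "0 \<le> T' n" for n
  proof -
    define N where "N = Suc n"
    define \<phi> where "\<phi> j = (\<lambda>p. \<psi> (fst p, snd p, real_of_int j / real N))" for j
    let ?J = "{- int (N * M)..int (N * M)}"
    have N: "0 < N" by (simp add: N_def)
    have \<phi>t: "test_function UNIV (\<phi> j)" for j
    proof (rule test_functionI[OF _ _ subset_UNIV])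
      have "smooth (\<lambda>p. \<psi> ((0, 0, real_of_int j / real N) + (fst p, snd p, 0)))"
        by (intro smooth_compose_affine[OF K(1)] bounded_linear_Pair bounded_linear_fst bounded_linear_snd bounded_linear_zero)
      then show "smooth (\<phi> j)" by (simp add: \<phi>_def)
      show "compact ((\<lambda>q. (fst q, fst (snd q))) ` K)" using K(2) by (intro compact_continuous_image continuous_intros)
      show "\<phi> j p = 0" if "p \<notin> (\<lambda>q. (fst q, fst (snd q))) ` K" for p
        unfolding \<phi>_def by (rule K(3)) (use that in \<open>force simp: image_iff\<close>)
    qed
    have 1: "lift0 (tensor (hat N j) (\<phi> j)) = (\<lambda>q. hat N j (snd q) * lift0 \<psi> (fst q, real_of_int j / real N))" for j
      by (auto simp: lift0_def tensor_def \<phi>_def)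
    have 2: "lift (tensor (hat N j) (\<phi> j)) = (\<lambda>q. hat N j (snd q) * lift \<psi> (fst q, real_of_int j / real N))" for j
      by (auto simp: lift_def tensor_def \<phi>_def assoc_def)
    have 3: "lift (D_t (tensor (hat N j) (\<phi> j))) = (\<lambda>q. hat N j (snd q) * lift (D_t \<psi>) (fst q, real_of_int j / real N))" for j
      unfolding D_t_tensor[OF test_function_smooth[OF \<phi>t]]
      by (auto simp: lift_def tensor_def \<phi>_def assoc_def D_t_def)
    have 4: "lift (Dx i (tensor (hat N j) (\<phi> j))) = (\<lambda>q. hat N j (snd q) * lift (Dx i \<psi>) (fst q, real_of_int j / real N))" for j i
      unfolding Dx_tensor[OF test_function_smooth[OF \<phi>t]]
      by (auto simp: lift_def tensor_def \<phi>_def assoc_def Dx_def kgrad_x_def grad_x_def)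
    have ccj: "C_c (\<lambda>q. hat N j (snd q) * g (fst q, real_of_int j / real N))" if "C_c g" for g :: "'p::euclidean_space \<times> real \<Rightarrow> real" and j
      by (intro cc_tensor[OF test_function_cc[OF test_function_hat[OF N]]] cc_at that)
    have UNIVb: "(UNIV :: (real^'d) set) \<in> sets borel" by simp
    have "T' n = (\<Sum>j\<in>?J. T (tensor (hat N j) (\<phi> j)))"
      unfolding T'_def T_def N_def[symmetric] 1 2 3 4 sum.distrib approx_def[abs_def]
      by (simp only: kint_sum[OF UNIVb v\<^sub>0 kernel_flux[OF U]] kint_sum[OF upper_half_borel v kernel_flux[OF U]]
          kint_sum[OF upper_half_borel v kernel_flux[OF Ai]] kint_sum[OF upper_half_borel v kernel_source[OF a]]
          ccj cc_lift cc_lift0 t sum.swap[of _ ?J UNIV])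
    also have "0 \<le> \<dots>"
      using \<psi>0 by (intro sum_nonneg pos test_function_hat[OF N] \<phi>t hat_nonneg) (simp add: \<phi>_def)
    finally show ?thesis .
  qed
  ultimately show ?thesis by (intro tendsto_lowerbound[of T' "T \<psi>" sequentially 0]) auto
qed

end

locale entropy_data = kinetic_data U A a v v\<^sub>0
  for U :: "real \<Rightarrow> real" and A :: "real \<Rightarrow> real^'d" and a :: "real \<Rightarrow> real"
    and v :: "real \<times> (real^'d) \<Rightarrow> real" and v\<^sub>0 :: "real^'d \<Rightarrow> real" +
  assumes mono_U: "mono U"
    and entropy: "smooth e \<Longrightarrow> test_function UNIV (deriv e) \<Longrightarrow> (\<And>x. 0 \<le> deriv e x) \<Longrightarrow>
      test_function UNIV \<phi> \<Longrightarrow> (\<And>p. 0 \<le> \<phi> p) \<Longrightarrow> 0 \<le> S e \<phi>"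
begin

lemma positive_functional_T: "positive_functional T"
proof
  fix \<psi> :: "real \<times> (real^'d) \<times> real \<Rightarrow> real" assume \<psi>: "test_function UNIV \<psi>" "\<And>q. 0 \<le> \<psi> q"
  show "0 \<le> T \<psi>"
  proof (rule T_nonneg[OF _ \<psi>])
    fix \<theta> :: "real \<Rightarrow> real" and \<phi> :: "real \<times> (real^'d) \<Rightarrow> real"
    assume *: "test_function UNIV \<theta>" "\<And>x. 0 \<le> \<theta> x" "test_function UNIV \<phi>" "\<And>p. 0 \<le> \<phi> p"
    obtain e b where e: "smooth e" "deriv e = \<theta>" "\<And>x. x \<le> b \<Longrightarrow> e x = 0"
      by (rule test_function_primitive[OF *(1)]) blast
    have "T (tensor (deriv e) \<phi>) = S e \<phi>"
      by (rule T_tensor[OF e(1) _ e(3) *(3)]) (simp add: e(2) *(1))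
    then show "0 \<le> T (tensor \<theta> \<phi>)"
      using entropy[OF e(1) _ _ *(3,4)] * by (simp add: e(2))
  qed
qed (auto intro: T_add T_cmult)

sublocale R: positive_functional T
  by (rule positive_functional_T)

definition M :: "(real \<times> (real^'d) \<times> real) measure" where
  "M = R.riesz_measure"

lemma sets_M [simp, measurable_cong]: "sets M = sets borel"
  by (simp add: M_def)

lemma finite_M: "compact K \<Longrightarrow> emeasure M K < \<infinity>"
  unfolding M_def by (rule R.finite_compact_riesz_measure)

lemma integral_M: "test_function UNIV \<psi> \<Longrightarrow> integrable M \<psi>" "test_function UNIV \<psi> \<Longrightarrow> (LINT q|M. \<psi> q) = T \<psi>"
  unfolding M_def by (rule R.integrable_riesz_measure, assumption) (rule R.riesz_representation)

text \<open>Both constants 1 and -1 are admissible, which turns the inequality into an equality: the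
  weak form of the balance law for U(v) with flux A(v) and source a(v).\<close>

lemma S_one_eq_0:
  assumes \<phi>: "test_function UNIV \<phi>" "\<And>p. 0 \<le> \<phi> p"
  shows "S (\<lambda>_. 1) \<phi> = 0"
proof -
  have "deriv (\<lambda>_. c) = (\<lambda>_. 0)" for c :: real by auto
  then have "0 \<le> S (\<lambda>_. c) \<phi>" for c
    using test_function_zero[of UNIV] by (intro entropy \<phi>) auto
  from this[of 1] this[of "-1"] show ?thesis
    using S_const[of "-1" \<phi>] by simp
qed

end

section \<open>The initial trace of U(v)\<close>

section \<open>Density of test functions\<close>

text \<open>Induction over the construction of integrable functions; a set is squeezed between a
  closed and an open set of almost the same measure. The approximants stay supported in B, so that
  bounds with constants depending on B remain usable.\<close>

lemma L1_test_function_dense: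
  fixes g :: "'a::euclidean_space \<Rightarrow> real"
  assumes g: "integrable lborel g" and B: "open B" "bounded B" and "0 < \<epsilon>"
  shows "\<exists>h. test_function B h \<and> (LINT x|lborel. \<bar>indicator B x * g x - h x\<bar>) < \<epsilon>"
  using g assms(4)
proof (induction arbitrary: \<epsilon> rule: integrable_induct)
  case (base A c)
  have [measurable]: "A \<in> sets borel" "B \<in> sets borel" using base(1) B(1) by auto
  define S where "S = A \<inter> B"
  have S[measurable]: "S \<in> sets borel" by (simp add: S_def)
  \<comment> \<open>The approximation errs on a set of measure at most 2 \<eta>, by at most |c|, and
    2 |c| \<eta> < \<epsilon>.\<close>
  define \<eta> where "\<eta> = \<epsilon> / (2 * (\<bar>c\<bar> + 1))"
  have \<eta>: "0 < \<eta>" using base(3) by (simp add: \<eta>_def add_nonneg_pos)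
  obtain F where F: "closed F" "F \<subseteq> S" "S - F \<in> lmeasurable" "emeasure lebesgue (S - F) < ennreal \<eta>"
    using sets_lebesgue_inner_closed[of S \<eta>] \<eta> S by auto
  obtain G where G: "open G" "S \<subseteq> G" "G - S \<in> lmeasurable" "emeasure lebesgue (G - S) < ennreal \<eta>"
    using sets_lebesgue_outer_open[of S \<eta>] \<eta> S by auto
  have "bounded F" by (rule bounded_subset[OF B(2)]) (use F(2) in \<open>auto simp: S_def\<close>)
  then have "compact F" using F(1) by (simp add: compact_eq_bounded_closed)
  moreover have "open (G \<inter> B)" "F \<subseteq> G \<inter> B" using G B(1) F(2) by (auto simp: S_def)
  ultimately obtain h W where h: "test_function (G \<inter> B) h" "\<And>x. 0 \<le> h x" "\<And>x. h x \<le> 1"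
    "open W" "F \<subseteq> W" "\<And>x. x \<in> W \<Longrightarrow> h x = 1"
    by (rule smooth_urysohn) blast
  let ?D = "(S - F) \<union> (G \<inter> B - S)"
  have D[measurable]: "?D \<in> sets borel" using F(1) G(1) by auto
  have "emeasure lborel ?D \<le> emeasure lborel (S - F) + emeasure lborel (G \<inter> B - S)"
    using F(1) G(1) by (intro emeasure_subadditive) auto
  also have "\<dots> \<le> emeasure lborel (S - F) + emeasure lborel (G - S)"
    using G(1) by (intro add_left_mono emeasure_mono) auto
  also have "\<dots> \<le> ennreal \<eta> + ennreal \<eta>"
    using F G by (intro add_mono less_imp_le) auto
  also have "\<dots> = ennreal (2 * \<eta>)" using \<eta> by (simp add: ennreal_plus[symmetric] del: ennreal_plus)
  finally have D2: "emeasure lborel ?D \<le> ennreal (2 * \<eta>)" .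
  then have Dfin: "emeasure lborel ?D < \<infinity>" by (simp add: order.strict_trans1)
  have hB: "test_function B h" using h(1) test_function_subset by blast
  have hm: "h \<in> borel_measurable borel" by (rule cc_measurable[OF test_function_cc[OF hB]])
  have le: "\<bar>indicator B x * (indicator A x *\<^sub>R c) - c * h x\<bar> \<le> \<bar>c\<bar> * indicator ?D x" for x
  proof -
    have eq: "indicator B x * (indicator A x *\<^sub>R c) - c * h x = c * (indicator S x - h x)"
      by (auto simp: S_def indicator_def right_diff_distrib)
    have "\<bar>indicator S x - h x\<bar> \<le> indicator ?D x"
    proof (cases "x \<in> F")
      case True
      then have "h x = 1" "x \<in> S" using h(5,6) F(2) by auto
      then show ?thesis by simp
    next
      case False
      have "h x = 0" if "x \<notin> G \<inter> B" using test_function_outside[OF h(1) that] .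
      then show ?thesis
        using False h(2)[of x] h(3)[of x] G(2) by (auto simp: indicator_def S_def abs_le_iff)
    qed
    then show ?thesis unfolding eq abs_mult by (intro mult_left_mono) auto
  qed
  have int: "integrable lborel (\<lambda>x. \<bar>c\<bar> * indicator ?D x :: real)"
    using Dfin by (intro integrable_mult_right integrable_real_indicator) auto
  have "(LINT x|lborel. \<bar>indicator B x * (indicator A x *\<^sub>R c) - c * h x\<bar>) \<le> (LINT x|lborel. \<bar>c\<bar> * indicator ?D x)"
  proof (rule integral_mono[OF _ int le])
    show "integrable lborel (\<lambda>x. \<bar>indicator B x * (indicator A x *\<^sub>R c) - c * h x\<bar>)"
      by (rule Bochner_Integration.integrable_bound[OF int]) (use le hm in \<open>auto intro!: AE_I2\<close>)
  qed
  also have "\<dots> = \<bar>c\<bar> * measure lborel ?D" by simp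
  also have "\<dots> \<le> \<bar>c\<bar> * (2 * \<eta>)"
  proof (rule mult_left_mono)
    show "measure lborel ?D \<le> 2 * \<eta>"
      using D2 \<eta> by (simp add: measure_def enn2real_leI)
  qed simp
  also have "\<dots> < (\<bar>c\<bar> + 1) * (2 * \<eta>)" using \<eta> by (simp add: distrib_right)
  also have "\<dots> = \<epsilon>" by (simp add: \<eta>_def add_pos_nonneg field_simps)
  finally show ?case
    by (intro exI[of _ "\<lambda>x. c * h x"]) (simp add: test_function_cmult[OF hB])
next
  case (add f g)
  have [measurable]: "B \<in> sets borel" using B(1) by auto
  obtain h1 where h1: "test_function B h1" "(LINT x|lborel. \<bar>indicator B x * f x - h1 x\<bar>) < \<epsilon> / 2"
    using add(3)[of "\<epsilon> / 2"] add(5) by auto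
  obtain h2 where h2: "test_function B h2" "(LINT x|lborel. \<bar>indicator B x * g x - h2 x\<bar>) < \<epsilon> / 2"
    using add(4)[of "\<epsilon> / 2"] add(5) by auto
  have int: "integrable lborel (\<lambda>x. \<bar>indicator B x * f x - h x\<bar>)" if "integrable lborel f" "test_function B h" for f h :: "'a \<Rightarrow> real"
    using integrable_mult_indicator[of B lborel f] that(1)
      integrable_test_function[of lborel h] test_function_subset[OF that(2)] emeasure_compact_finite
    by (intro integrable_abs Bochner_Integration.integrable_diff) auto
  have "(LINT x|lborel. \<bar>indicator B x * (f x + g x) - (h1 x + h2 x)\<bar>) \<le>
     (LINT x|lborel. \<bar>indicator B x * f x - h1 x\<bar> + \<bar>indicator B x * g x - h2 x\<bar>)"
  proof (rule integral_mono)
    show "integrable lborel (\<lambda>x. \<bar>indicator B x * (f x + g x) - (h1 x + h2 x)\<bar>)"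
      by (intro int Bochner_Integration.integrable_add add test_function_add h1 h2)
    show "\<bar>indicator B x * (f x + g x) - (h1 x + h2 x)\<bar> \<le> \<bar>indicator B x * f x - h1 x\<bar> + \<bar>indicator B x * g x - h2 x\<bar>" for x
      by (simp add: distrib_left)
  qed (intro Bochner_Integration.integrable_add int add h1 h2)
  also have "\<dots> = (LINT x|lborel. \<bar>indicator B x * f x - h1 x\<bar>) + (LINT x|lborel. \<bar>indicator B x * g x - h2 x\<bar>)"
    by (intro Bochner_Integration.integral_add int add h1 h2)
  also have "\<dots> < \<epsilon>" using h1 h2 by simp
  finally show ?case by (intro exI[of _ "\<lambda>x. h1 x + h2 x"]) (simp add: test_function_add h1 h2)
next
  case (lim f s)
  have [measurable]: "B \<in> sets borel" using B(1) by auto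
  note [measurable] = borel_measurable_integrable[OF lim(1)] borel_measurable_integrable[OF lim(4)]
  have "(\<lambda>i. LINT x|lborel. \<bar>f x - s i x\<bar>) \<longlonglongrightarrow> (LINT x|(lborel :: 'a measure). 0)"
  proof (rule integral_dominated_convergence[where w="\<lambda>x. 3 * \<bar>f x\<bar>"])
    show "AE x in lborel. (\<lambda>i. \<bar>f x - s i x\<bar>) \<longlonglongrightarrow> 0"
    proof (rule AE_I2)
      fix x
      have "(\<lambda>i. \<bar>f x - s i x\<bar>) \<longlonglongrightarrow> \<bar>f x - f x\<bar>"
        by (intro tendsto_intros lim(2)) simp
      then show "(\<lambda>i. \<bar>f x - s i x\<bar>) \<longlonglongrightarrow> 0" by simp
    qed
    show "AE x in lborel. norm \<bar>f x - s i x\<bar> \<le> 3 * \<bar>f x\<bar>" for i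
    proof (rule AE_I2)
      fix x
      have "\<bar>s i x\<bar> \<le> 2 * \<bar>f x\<bar>" using lim(3)[of x i] by simp
      then show "norm \<bar>f x - s i x\<bar> \<le> 3 * \<bar>f x\<bar>" by simp
    qed
  qed (use lim(4) in auto)
  then have "(\<lambda>i. LINT x|lborel. \<bar>f x - s i x\<bar>) \<longlonglongrightarrow> 0" by simp
  then have "\<forall>\<^sub>F i in sequentially. (LINT x|lborel. \<bar>f x - s i x\<bar>) < \<epsilon> / 2"
    using lim(6) by (intro order_tendstoD) auto
  then obtain i where i: "(LINT x|lborel. \<bar>f x - s i x\<bar>) < \<epsilon> / 2"
    by (auto simp: eventually_sequentially)
  obtain h where h: "test_function B h" "(LINT x|lborel. \<bar>indicator B x * s i x - h x\<bar>) < \<epsilon> / 2"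
    using lim(5)[of "\<epsilon> / 2" i] lim(6) by auto
  have int: "integrable lborel (\<lambda>x. \<bar>indicator B x * f x - h x\<bar>)" if "integrable lborel f" for f :: "'a \<Rightarrow> real"
    using integrable_mult_indicator[of B lborel f] that
      integrable_test_function[of lborel h] test_function_subset[OF h(1)] emeasure_compact_finite
    by (intro integrable_abs Bochner_Integration.integrable_diff) auto
  have int2: "integrable lborel (\<lambda>x. \<bar>f x - s i x\<bar>)"
    by (intro integrable_abs Bochner_Integration.integrable_diff lim)
  have "(LINT x|lborel. \<bar>indicator B x * f x - h x\<bar>) \<le>
     (LINT x|lborel. \<bar>f x - s i x\<bar> + \<bar>indicator B x * s i x - h x\<bar>)"
  proof (rule integral_mono)
    show "\<bar>indicator B x * f x - h x\<bar> \<le> \<bar>f x - s i x\<bar> + \<bar>indicator B x * s i x - h x\<bar>" for x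
      by (auto simp: indicator_def)
  qed (intro Bochner_Integration.integrable_add int int2 lim)+
  also have "\<dots> = (LINT x|lborel. \<bar>f x - s i x\<bar>) + (LINT x|lborel. \<bar>indicator B x * s i x - h x\<bar>)"
    by (intro Bochner_Integration.integral_add int int2 lim)
  also have "\<dots> < \<epsilon>" using i h by simp
  finally show ?case using h(1) by blast
qed

lemma integrable_tensor:
  fixes f :: "'a::euclidean_space \<Rightarrow> real" and g :: "'b::euclidean_space \<Rightarrow> real"
  assumes f: "integrable lborel f" and g: "integrable lborel g"
  shows "integrable lborel (\<lambda>p. f (fst p) * g (snd p))"
    and "(LINT p|lborel. f (fst p) * g (snd p)) = (LINT x|lborel. f x) * (LINT y|lborel. g y)"
proof -
  have fm[measurable]: "f \<in> borel_measurable borel" "g \<in> borel_measurable borel"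
    using f g by (auto dest: borel_measurable_integrable)
  have int: "integrable (lborel \<Otimes>\<^sub>M lborel) (\<lambda>p. f (fst p) * g (snd p))"
  proof (rule lborel_pair.Fubini_integrable)
    have "(\<lambda>p. f (fst p) * g (snd p)) \<in> borel_measurable (borel \<Otimes>\<^sub>M borel)" by measurable
    then show "(\<lambda>p. f (fst p) * g (snd p)) \<in> borel_measurable (lborel \<Otimes>\<^sub>M lborel)"
      by (simp add: lborel_prod borel_prod)
    show "integrable lborel (\<lambda>x. LINT y|lborel. norm (f (fst (x, y)) * g (snd (x, y))))"
      using f by (simp add: abs_mult)
    show "AE x in lborel. integrable lborel (\<lambda>y. f (fst (x, y)) * g (snd (x, y)))"
      using g by simp
  qed
  then show "integrable lborel (\<lambda>p. f (fst p) * g (snd p))" by (simp add: lborel_prod)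
  from lborel_pair.integral_fst'[OF int]
  show "(LINT p|lborel. f (fst p) * g (snd p)) = (LINT x|lborel. f x) * (LINT y|lborel. g y)"
    by (simp add: lborel_prod)
qed

section \<open>Strong initial trace\<close>

lemma integral_chi_deriv:
  assumes "smooth e"
  shows "continuous_on UNIV f \<Longrightarrow> integrable lborel (\<lambda>k. f k * chi k s * deriv e k)"
    and "(LINT k|lborel. chi k s * deriv e k) = e s - e 0"
proof -
  have cont: "continuous_on UNIV (deriv e)" by (rule smooth_deriv_real(2)[OF assms])
  show "integrable lborel (\<lambda>k. f k * chi k s * deriv e k)" if f: "continuous_on UNIV f"
  proof (rule Bochner_Integration.integrable_bound)
    note [measurable] = borel_measurable_continuous_onI[OF f] borel_measurable_continuous_onI[OF cont]
    show "integrable lborel (\<lambda>k. indicator {-\<bar>s\<bar>..\<bar>s\<bar>} k *\<^sub>R (f k * deriv e k))"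
      by (intro borel_integrable_compact compact_Icc continuous_intros continuous_on_subset[OF f] continuous_on_subset[OF cont]) auto
    show "(\<lambda>k. f k * chi k s * deriv e k) \<in> borel_measurable lborel" by simp
    show "AE k in lborel. norm (f k * chi k s * deriv e k) \<le> norm (indicator {-\<bar>s\<bar>..\<bar>s\<bar>} k *\<^sub>R (f k * deriv e k))"
      by (intro AE_I2) (auto simp: chi_def indicator_def abs_mult)
  qed
  have "(LBINT t=ereal 0..ereal s. deriv e t) = e s - e 0"
    using interval_integral_FTC_finite[of 0 s "deriv e" e] cont smooth_deriv_real(1)[OF assms]
    by (auto simp: has_real_derivative_iff_has_vector_derivative zero_ereal_def intro: has_vector_derivative_at_within continuous_on_subset)
  then show "(LINT k|lborel. chi k s * deriv e k) = e s - e 0"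
    by (simp add: interval_integral_eq_chi)
qed

text \<open>The flux \<open>sflux e U\<close> is a convex function of \<open>U\<close> with slope \<open>e\<close>.\<close>

lemma sflux_subgradient:
  assumes e: "smooth e" "\<And>x. 0 \<le> deriv e x" and U: "continuous_on UNIV U" "mono U"
  shows "sflux e U s\<^sub>0 - sflux e U s \<le> e s\<^sub>0 * (U s\<^sub>0 - U s)"
proof -
  note int = integral_chi_deriv(1)[OF e(1) U(1)]
  have int1: "integrable lborel (\<lambda>k. chi k s * deriv e k)" for s
    using integral_chi_deriv(1)[OF e(1), of "\<lambda>_. 1" s] by simp
  have "(LINT k|lborel. U k * chi k s * deriv e k) - (LINT k|lborel. U k * chi k s\<^sub>0 * deriv e k) =
      (LINT k|lborel. U k * chi k s * deriv e k - U k * chi k s\<^sub>0 * deriv e k)"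
    by (rule Bochner_Integration.integral_diff[symmetric, OF int int])
  also have "\<dots> \<le> (LINT k|lborel. U s * (chi k s * deriv e k - chi k s\<^sub>0 * deriv e k))"
  proof (rule integral_mono)
    show "U k * chi k s * deriv e k - U k * chi k s\<^sub>0 * deriv e k \<le> U s * (chi k s * deriv e k - chi k s\<^sub>0 * deriv e k)" for k
    proof -
      \<comment> \<open>The difference of the two \<chi> is positive only for k \<le> s, where U(k)
        \<le> U(s), and negative only for k \<ge> s, where U(k) \<ge> U(s).\<close>
      have "U k * (chi k s - chi k s\<^sub>0) \<le> U s * (chi k s - chi k s\<^sub>0)"
        using monoD[OF U(2), of k s] monoD[OF U(2), of s k] by (auto simp: chi_def)
      then have "U k * (chi k s - chi k s\<^sub>0) * deriv e k \<le> U s * (chi k s - chi k s\<^sub>0) * deriv e k"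
        by (rule mult_right_mono[OF _ e(2)])
      then show ?thesis by (simp add: algebra_simps)
    qed
  qed (intro Bochner_Integration.integrable_diff integrable_mult_right int int1)+
  also have "\<dots> = U s * ((LINT k|lborel. chi k s * deriv e k) - (LINT k|lborel. chi k s\<^sub>0 * deriv e k))"
    by (simp only: integral_mult_right_zero Bochner_Integration.integral_diff[OF int1 int1])
  also have "\<dots> = U s * (e s - e s\<^sub>0)" by (simp add: integral_chi_deriv(2)[OF e(1)])
  finally show ?thesis by (simp add: sflux_def algebra_simps)
qed

text \<open>The derivative of the rescaled step \<open>smooth_step (real (Suc n) * t)\<close>: a
  nonnegative approximate delta at 0 of mass 1, living on positive times.\<close>

definition bump :: "nat \<Rightarrow> real \<Rightarrow> real" where
  "bump n t = real (Suc n) * deriv smooth_step (real (Suc n) * t)"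

lemma bump_nonneg: "0 \<le> bump n t"
proof -
  have "0 \<le> deriv smooth_step y" for y
    using mono_on_imp_deriv_nonneg[of UNIV smooth_step _ y] mono_smooth_step smooth_deriv_real(1)[OF smooth_smooth_step] by auto
  then show ?thesis by (simp add: bump_def)
qed

lemma bump_eq_0: "t < 0 \<or> 1 < t \<Longrightarrow> bump n t = 0"
proof -
  assume "t < 0 \<or> 1 < t"
  then have "real (Suc n) * t < 0 \<or> 1 < real (Suc n) * t"
  proof
    assume t: "1 < t"
    have "1 * t \<le> real (Suc n) * t" using t by (intro mult_right_mono) auto
    then show ?thesis using t by linarith
  next
    assume "t < 0"
    then show ?thesis by (simp add: mult_pos_neg)
  qed
  then show ?thesis by (simp add: bump_def deriv_smooth_step_eq_0)
qed

lemma cc_bump: "C_c (bump n)"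
proof -
  have "continuous_on UNIV (bump n)"
    unfolding bump_def
    by (intro continuous_intros continuous_on_compose2[OF smooth_deriv_real(2)[OF smooth_smooth_step]]) auto
  then show ?thesis
    unfolding C_c_def using bump_eq_0 by (intro conjI exI[of _ "{0..1}"]) (auto simp: not_le)
qed

lemma integrable_cc: "C_c g \<Longrightarrow> integrable lborel g"
  using integrable_coeff_cc[of "\<lambda>_. 1" g] loc_bounded_bounded[of "\<lambda>_. 1" 1] by auto

lemma integral_bump: "(LINT t|lborel. bump n t) = 1"
proof -
  define N where "N = real (Suc n)"
  have N: "0 < N" by (simp add: N_def)
  have "(LINT t|lborel. deriv smooth_step t) = \<bar>N\<bar> *\<^sub>R (LINT t|lborel. deriv smooth_step (0 + N * t))"
    using N by (intro lborel_integral_real_affine) simp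
  then show ?thesis
    unfolding bump_def N_def[symmetric] using N integral_deriv_smooth_step by simp
qed

lemma indicator_upper_half: "indicator upper_half p = (indicator {0<..} (fst p) :: real)"
  by (cases p) (auto simp: indicator_def)

lemma integral_bump_pos:
  shows "integrable lborel (\<lambda>t. indicator {0<..} t * bump n t)"
    and "(LINT t|lborel. indicator {0<..} t * bump n t) = 1"
proof -
  have [measurable]: "bump n \<in> borel_measurable borel" by (rule cc_measurable[OF cc_bump])
  show "integrable lborel (\<lambda>t. indicator {0<..} t * bump n t)"
    using integrable_coeff_cc[OF _ loc_bounded_indicator[of "{0<..}" "\<lambda>t. t"] cc_bump] by auto
  have "AE t in lborel. t \<noteq> (0::real)" by (rule AE_lborel_singleton)
  then have "AE t in lborel. indicator {0<..} t * bump n t = bump n t"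
    by eventually_elim (auto simp: indicator_def bump_eq_0)
  then have "(LINT t|lborel. indicator {0<..} t * bump n t) = (LINT t|lborel. bump n t)"
    by (intro integral_cong_AE) auto
  then show "(LINT t|lborel. indicator {0<..} t * bump n t) = 1" by (simp add: integral_bump)
qed

context entropy_data
begin

definition jump :: "real \<times> (real^'d) \<Rightarrow> real" where
  "jump p = U (v\<^sub>0 (snd p)) - U (v p)"

text \<open>The entropy production of \<open>E(\<xi>) = \<xi>\<close> concentrated in \<open>0 < t < 1/(n+1)\<close>, tested with \<open>g\<close>.\<close>

definition trace_defect :: "nat \<Rightarrow> (real^'d \<Rightarrow> real) \<Rightarrow> real" where
  "trace_defect n g = (LINT p|lborel. indicator H p * bump n (fst p) * (g (snd p) * jump p))"

lemma jump_props: "jump \<in> borel_measurable borel" "loc_bounded jump"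
proof -
  have [measurable]: "U \<in> borel_measurable borel" "v \<in> borel_measurable borel" "v\<^sub>0 \<in> borel_measurable borel"
    using U v v\<^sub>0 by (auto intro: borel_measurable_continuous_onI)
  have [measurable]: "snd \<in> borel_measurable (borel :: (real \<times> (real^'d)) measure)"
    by (intro borel_measurable_continuous_onI continuous_intros)
  show "jump \<in> borel_measurable borel" unfolding jump_def[abs_def] by measurable
  have "loc_bounded (\<lambda>p. U (v\<^sub>0 (snd p)) + (\<lambda>_. -1) p * U (v p))"
    by (intro loc_bounded_add[OF loc_bounded_compose_continuous[OF loc_bounded_compose[OF loc_bounded_continuous[OF U] v\<^sub>0(2)]]]
        loc_bounded_mult[OF loc_bounded_bounded[of _ 1]] loc_bounded_compose[OF loc_bounded_continuous[OF U] v(2)] continuous_intros) auto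
  then show "loc_bounded jump" by (simp add: jump_def[abs_def])
qed

text \<open>Compact support of h is asked in x only; compactness in time comes from the
  bump.\<close>

lemma bump_weight_integrable:
  assumes "h \<in> borel_measurable borel" "loc_bounded h" "compact K" "\<And>p. snd p \<notin> K \<Longrightarrow> h p = 0"
  shows "integrable lborel (\<lambda>p. indicator H p * bump n (fst p) * h p)"
proof (rule integrable_loc_bounded)
  have [measurable]: "fst \<in> borel_measurable (borel :: (real \<times> (real^'d)) measure)"
    by (intro borel_measurable_continuous_onI continuous_intros)
  note [measurable] = cc_measurable[OF cc_bump] assms(1)
  show "(\<lambda>p. indicator H p * bump n (fst p) * h p) \<in> borel_measurable borel" by measurable
  show "loc_bounded (\<lambda>p. indicator H p * bump n (fst p) * h p)"
    by (intro loc_bounded_mult loc_bounded_indicator assms(2)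
        loc_bounded_compose_continuous[OF loc_bounded_continuous[OF cc_continuous[OF cc_bump]]] continuous_intros)
  show "compact ({0..1::real} \<times> K)" by (intro compact_Times compact_Icc assms(3))
  show "indicator H p * bump n (fst p) * h p = 0" if "p \<notin> {0..1} \<times> K" for p
    using that bump_eq_0[of "fst p" n] assms(4)[of p] by (cases p) (auto simp: not_le)
qed

text \<open>Since the bumps have mass 1, the bound is uniform in n, and it involves g only through
  its L1 norm on a fixed ball. This is what a density argument needs.\<close>

lemma trace_defect_bound:
  obtains C where "0 \<le> C" "\<And>n g. integrable lborel g \<Longrightarrow> (\<And>x. x \<notin> cball 0 \<rho> \<Longrightarrow> g x = 0) \<Longrightarrow>
    integrable lborel (\<lambda>p. indicator H p * bump n (fst p) * (g (snd p) * jump p)) \<and>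
    \<bar>trace_defect n g\<bar> \<le> C * (LINT x|lborel. \<bar>g x\<bar>)"
proof -
  \<comment> \<open>All bumps live in 0 \<le> t \<le> 1, so a single compact set bounds the jump for
    every n.\<close>
  have "compact ({0..1::real} \<times> cball (0::real^'d) \<rho>)" by (intro compact_Times compact_Icc compact_cball)
  then obtain C where C: "0 \<le> C" "\<And>p. p \<in> {0..1} \<times> cball 0 \<rho> \<Longrightarrow> \<bar>jump p\<bar> \<le> C"
    using loc_boundedE[OF jump_props(2)] by blast
  show ?thesis
  proof (rule that[OF C(1)])
    fix n and g :: "real^'d \<Rightarrow> real"
    assume g: "integrable lborel g" and g0: "\<And>x. x \<notin> cball 0 \<rho> \<Longrightarrow> g x = 0"
    let ?f = "\<lambda>p. indicator H p * bump n (fst p) * (g (snd p) * jump p)"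
    let ?w = "\<lambda>p. (indicator {0<..} (fst p) * bump n (fst p)) * (C * \<bar>g (snd p)\<bar>)"
    have gi: "integrable lborel (\<lambda>x. C * \<bar>g x\<bar>)" using g by (intro integrable_mult_right integrable_abs)
    have w: "integrable lborel ?w" "(LINT p|lborel. ?w p) = C * (LINT x|lborel. \<bar>g x\<bar>)"
      using integrable_tensor[OF integral_bump_pos(1)[of n] gi] by (simp_all add: integral_bump_pos)
    have [measurable]: "fst \<in> borel_measurable (borel :: (real \<times> (real^'d)) measure)" "snd \<in> borel_measurable (borel :: (real \<times> (real^'d)) measure)"
      by (intro borel_measurable_continuous_onI continuous_intros)+
    have [measurable]: "g \<in> borel_measurable borel" using borel_measurable_integrable[OF g] by simp
    note [measurable] = cc_measurable[OF cc_bump] jump_props(1)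
    have le: "\<bar>?f p\<bar> \<le> ?w p" for p
    proof (cases "0 < fst p \<and> fst p \<le> 1 \<and> snd p \<in> cball 0 \<rho>")
      case True
      then have "\<bar>jump p\<bar> \<le> C" by (intro C(2)) (cases p, auto)
      then have "\<bar>g (snd p)\<bar> * \<bar>jump p\<bar> \<le> \<bar>g (snd p)\<bar> * C" by (intro mult_left_mono) auto
      then show ?thesis
        unfolding abs_mult indicator_upper_half abs_of_nonneg[OF bump_nonneg] abs_indicator
        by (intro mult_left_mono) (auto simp: bump_nonneg mult.commute)
    next
      case False
      then show ?thesis
        using g0[of "snd p"] bump_eq_0[of "fst p" n] C(1) bump_nonneg[of n "fst p"]
        by (auto simp: indicator_upper_half indicator_def not_le)
    qed
    have fi: "integrable lborel ?f"
      by (rule Bochner_Integration.integrable_bound[OF w(1)]) (use le in \<open>auto intro!: AE_I2 intro: order_trans[OF _ abs_ge_self]\<close>)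
    have "norm (LINT p|lborel. ?f p) \<le> (LINT p|lborel. ?w p)"
      by (rule Bochner_Integration.integral_norm_bound_integral[OF fi w(1)]) (use le in simp)
    then show "integrable lborel ?f \<and> \<bar>trace_defect n g\<bar> \<le> C * (LINT x|lborel. \<bar>g x\<bar>)"
      using fi w(2) by (simp add: trace_defect_def)
  qed
qed

text \<open>Unchanged for t \<le> 0 and 0 once (n+1) t \<ge> 1: the test functions retreat to the
  initial hyperplane from above. Minus the time derivative of the factor is
  \<open>bump n\<close>.\<close>

definition cut :: "nat \<Rightarrow> (real \<times> (real^'d) \<Rightarrow> real) \<Rightarrow> real \<times> (real^'d) \<Rightarrow> real" where
  "cut n \<zeta> p = (1 - smooth_step (real (Suc n) * fst p)) * \<zeta> p"

lemma test_function_cut: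
  assumes "test_function UNIV \<zeta>"
  shows "test_function UNIV (cut n \<zeta>)"
proof -
  have "smooth (\<lambda>p :: real \<times> (real^'d). 1 - smooth_step (real (Suc n) * fst p))"
    by (intro smooth_diff smooth_const smooth_compose_real[OF smooth_smooth_step] smooth_cmult smooth_linear bounded_linear_fst)
  moreover have "cut n \<zeta> = (\<lambda>p. \<zeta> p * (1 - smooth_step (real (Suc n) * fst p)))"
    by (auto simp: cut_def)
  ultimately show ?thesis
    using test_function_mult[OF assms] by simp
qed

lemma D_t_cut:
  assumes "smooth \<zeta>"
  shows "D_t (cut n \<zeta>) p = - bump n (fst p) * \<zeta> p + (1 - smooth_step (real (Suc n) * fst p)) * D_t \<zeta> p"
proof -
  obtain t x where p: "p = (t, x)" by (cases p)
  have "((\<lambda>s. (s, x)) has_derivative (\<lambda>r. (r, 0))) (at t)"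
    by (intro has_derivative_Pair has_derivative_ident has_derivative_const)
  from differentiableI[OF has_derivative_compose[OF this smooth_has_derivative[OF assms]]]
  have "((\<lambda>s. \<zeta> (s, x)) has_real_derivative deriv (\<lambda>s. \<zeta> (s, x)) t) (at t)"
    using DERIV_deriv_iff_real_differentiable by blast
  moreover have "((\<lambda>s. 1 - smooth_step (real (Suc n) * s)) has_real_derivative - bump n t) (at t)"
  proof -
    have "((\<lambda>s. smooth_step (real (Suc n) * s)) has_real_derivative deriv smooth_step (real (Suc n) * t) * real (Suc n)) (at t)"
      by (rule DERIV_chain2[OF smooth_deriv_real(1)[OF smooth_smooth_step]]) (auto intro!: derivative_eq_intros)
    from DERIV_diff[OF DERIV_const[of 1] this] show ?thesis by (simp add: bump_def mult.commute)
  qed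
  ultimately have "((\<lambda>s. (1 - smooth_step (real (Suc n) * s)) * \<zeta> (s, x)) has_real_derivative
      - bump n t * \<zeta> (t, x) + deriv (\<lambda>s. \<zeta> (s, x)) t * (1 - smooth_step (real (Suc n) * t))) (at t)"
    by (intro DERIV_mult)
  then show ?thesis
    by (simp add: p D_t_def cut_def DERIV_imp_deriv mult.commute)
qed

lemma grad_x_cut:
  assumes "smooth \<zeta>"
  shows "grad_x (cut n \<zeta>) p $ i = (1 - smooth_step (real (Suc n) * fst p)) * grad_x \<zeta> p $ i"
proof -
  obtain t x where p: "p = (t, x)" by (cases p)
  let ?k = "1 - smooth_step (real (Suc n) * t)"
  have d: "((\<lambda>y. \<zeta> (t, y)) has_derivative (\<lambda>h. frechet_derivative \<zeta> (at (t, x)) (0, h))) (at x)"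
    by (rule has_derivative_compose[of "\<lambda>y. (t, y)" "\<lambda>h. (0, h)", OF _ smooth_has_derivative[OF assms]])
       (intro has_derivative_Pair has_derivative_ident has_derivative_const)
  then have "frechet_derivative (\<lambda>y. ?k * \<zeta> (t, y)) (at x) = (\<lambda>h. ?k * frechet_derivative \<zeta> (at (t, x)) (0, h))"
    by (intro frechet_derivative_at[symmetric] has_derivative_mult_right)
  moreover have "frechet_derivative (\<lambda>y. \<zeta> (t, y)) (at x) = (\<lambda>h. frechet_derivative \<zeta> (at (t, x)) (0, h))"
    using d by (rule frechet_derivative_at[symmetric])
  ultimately show ?thesis
    by (simp add: p grad_x_def grad_def cut_def)
qed

text \<open>At each t > 0 the factor is 0 as soon as (n+1) t \<ge> 1, and it never exceeds 1, so
  convergence is dominated.\<close>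

lemma cut_weight:
  assumes g: "integrable lborel (\<lambda>p. indicator H p * g p)"
  shows "integrable lborel (\<lambda>p. indicator H p * ((1 - smooth_step (real (Suc n) * fst p)) * g p))" (is ?int)
    and "(\<lambda>n. LINT p|lborel. indicator H p * ((1 - smooth_step (real (Suc n) * fst p)) * g p)) \<longlonglongrightarrow> 0" (is ?lim)
proof -
  let ?k = "\<lambda>n p. 1 - smooth_step (real (Suc n) * fst (p :: real \<times> (real^'d)))"
  have [measurable]: "(\<lambda>p. indicator H p * g p) \<in> borel_measurable borel" using borel_measurable_integrable[OF g] by simp
  have [measurable]: "?k n \<in> borel_measurable borel" for n
    by (intro borel_measurable_continuous_onI continuous_intros continuous_on_compose2[OF smooth_continuous[OF smooth_smooth_step]]) auto
  have eq: "indicator H p * (?k n p * g p) = ?k n p * (indicator H p * g p)" for n p by simp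
  have k: "\<bar>?k n p\<bar> \<le> 1" for n p using smooth_step_bounds[of "real (Suc n) * fst p"] by simp
  have le: "norm (?k n p * (indicator H p * g p)) \<le> norm (indicator H p * g p)" for n p
    unfolding norm_mult using k[of n p] by (intro mult_left_le_one_le) auto
  have "(\<lambda>p. ?k n p * (indicator H p * g p)) \<in> borel_measurable borel" by measurable
  then show ?int
    unfolding eq by (intro Bochner_Integration.integrable_bound[OF g] AE_I2 le) simp
  have "(\<lambda>n. LINT p|lborel. ?k n p * (indicator H p * g p)) \<longlonglongrightarrow> (LINT p|(lborel :: (real \<times> (real^'d)) measure). 0)"
  proof (rule integral_dominated_convergence[where w="\<lambda>p. norm (indicator H p * g p)"])
    show "integrable lborel (\<lambda>p. norm (indicator H p * g p))" using g by (rule integrable_norm)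
    show "AE p in lborel. (\<lambda>n. ?k n p * (indicator H p * g p)) \<longlonglongrightarrow> 0"
    proof (rule AE_I2)
      fix p :: "real \<times> (real^'d)"
      show "(\<lambda>n. ?k n p * (indicator H p * g p)) \<longlonglongrightarrow> 0"
      proof (cases "0 < fst p")
        case True
        obtain n0 where n0: "1 / fst p \<le> real n0" using real_arch_simple by blast
        have "?k n p * (indicator H p * g p) = 0" if "n0 \<le> n" for n
        proof -
          have "1 / fst p \<le> real (Suc n)" using n0 that by linarith
          then have "1 \<le> real (Suc n) * fst p" using True by (simp add: pos_divide_le_eq)
          then show ?thesis by (simp only: smooth_step_eq_1) simp
        qed
        then show ?thesis by (intro tendsto_eventually eventually_sequentiallyI)
      next
        case False
        then show ?thesis by (simp add: indicator_upper_half)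
      qed
    qed
    show "AE p in lborel. norm (?k n p * (indicator H p * g p)) \<le> norm (indicator H p * g p)" for n
      using le by (intro AE_I2)
  qed measurable
  then show ?lim unfolding eq by simp
qed

text \<open>All terms without a derivative of the cutoff factor are integrals over a slab of
  vanishing thickness and disappear. What stays is the initial term and the time derivative that
  falls on the factor.\<close>

lemma S_cut:
  assumes e: "smooth e" and \<zeta>: "test_function UNIV \<zeta>"
  shows "(\<lambda>n. S e (cut n \<zeta>) - (LINT x|lborel. sflux e U (v\<^sub>0 x) * \<zeta> (0, x))
    + (LINT p|lborel. indicator H p * bump n (fst p) * (sflux e U (v p) * \<zeta> p))) \<longlonglongrightarrow> 0"
proof -
  have sm: "smooth \<zeta>" using \<zeta> by (rule test_function_smooth)
  let ?k = "\<lambda>n p. 1 - smooth_step (real (Suc n) * fst (p :: real \<times> (real^'d)))"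
  have i1: "integrable lborel (\<lambda>p. indicator H p * (sflux e U (v p) * D_t \<zeta> p))"
    by (intro H_coeff sflux_measurable sflux_loc_bounded e U test_function_cc[OF test_function_D_t[OF \<zeta>]])
  have i2: "integrable lborel (\<lambda>p. indicator H p * (sflux e (\<lambda>s. A s $ i) (v p) * grad_x \<zeta> p $ i))" for i
    by (intro H_coeff sflux_measurable sflux_loc_bounded e Ai test_function_cc[OF test_function_grad_x[OF \<zeta>]])
  have i3: "integrable lborel (\<lambda>p. indicator H p * (a (v p) * e (v p) * \<zeta> p))"
    by (rule H_coeff[OF source_coeff[OF e] test_function_cc[OF \<zeta>]])
  obtain K where K: "compact K" "\<And>p. p \<notin> K \<Longrightarrow> \<zeta> p = 0" using \<zeta> by (rule test_functionE) blast
  have Ks: "compact (snd ` K)" using K(1) by (intro compact_continuous_image continuous_intros)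
  have z: "\<zeta> p = 0" if "snd p \<notin> snd ` K" for p using K(2)[of p] that by force
  note [measurable] = cc_measurable[OF test_function_cc[OF \<zeta>]] v(1) sflux_measurable[OF e U]
  have ib: "integrable lborel (\<lambda>p. indicator H p * bump n (fst p) * (sflux e U (v p) * \<zeta> p))" for n
  proof (rule bump_weight_integrable[OF _ _ Ks])
    show "loc_bounded (\<lambda>p. sflux e U (v p) * \<zeta> p)"
      by (intro loc_bounded_mult loc_bounded_compose[OF sflux_loc_bounded[OF e U] v(2)] loc_bounded_continuous[OF cc_continuous[OF test_function_cc[OF \<zeta>]]])
  qed (use z in auto)
  have time: "(LINT p|lborel. indicator H p * (sflux e U (v p) * D_t (cut n \<zeta>) p)) =
      (LINT p|lborel. indicator H p * (?k n p * (sflux e U (v p) * D_t \<zeta> p)))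
      - (LINT p|lborel. indicator H p * bump n (fst p) * (sflux e U (v p) * \<zeta> p))" for n
    unfolding Bochner_Integration.integral_diff[OF cut_weight(1)[OF i1] ib, symmetric] D_t_cut[OF sm]
    by (intro Bochner_Integration.integral_cong refl) (simp add: algebra_simps)
  have init: "cut n \<zeta> (0, x) = \<zeta> (0, x)" for n x by (simp add: cut_def smooth_step_eq_0)
  have eq: "S e (cut n \<zeta>) - (LINT x|lborel. sflux e U (v\<^sub>0 x) * \<zeta> (0, x))
    + (LINT p|lborel. indicator H p * bump n (fst p) * (sflux e U (v p) * \<zeta> p)) =
    (LINT p|lborel. indicator H p * (?k n p * (sflux e U (v p) * D_t \<zeta> p)))
    + (\<Sum>i\<in>UNIV. LINT p|lborel. indicator H p * (?k n p * (sflux e (\<lambda>s. A s $ i) (v p) * grad_x \<zeta> p $ i)))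
    + (LINT p|lborel. indicator H p * (?k n p * (a (v p) * e (v p) * \<zeta> p)))" for n
    unfolding S_def time init grad_x_cut[OF sm] by (simp add: cut_def ac_simps)
  have "(\<lambda>n. (LINT p|lborel. indicator H p * (?k n p * (sflux e U (v p) * D_t \<zeta> p)))
    + (\<Sum>i\<in>UNIV. LINT p|lborel. indicator H p * (?k n p * (sflux e (\<lambda>s. A s $ i) (v p) * grad_x \<zeta> p $ i)))
    + (LINT p|lborel. indicator H p * (?k n p * (a (v p) * e (v p) * \<zeta> p)))) \<longlonglongrightarrow> 0 + (\<Sum>i\<in>(UNIV :: 'd set). 0) + 0"
    by (intro tendsto_add tendsto_sum cut_weight(2) i1 i2 i3)
  then show ?thesis unfolding eq by simp
qed

definition tx_prod :: "(real \<Rightarrow> real) \<Rightarrow> (real^'d \<Rightarrow> real) \<Rightarrow> real \<times> (real^'d) \<Rightarrow> real" where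
  "tx_prod \<tau> w p = \<tau> (fst p) * w (snd p)"

lemma test_function_tx:
  assumes "test_function UNIV \<tau>" "test_function UNIV w"
  shows "test_function UNIV (tx_prod \<tau> w)"
proof -
  obtain K where K: "smooth \<tau>" "compact K" "\<And>x. x \<notin> K \<Longrightarrow> \<tau> x = 0" using assms(1) by (rule test_functionE) blast
  obtain L where L: "smooth w" "compact L" "\<And>x. x \<notin> L \<Longrightarrow> w x = 0" using assms(2) by (rule test_functionE) blast
  have "smooth (tx_prod \<tau> w)"
    unfolding tx_prod_def[abs_def]
    by (intro smooth_mult smooth_compose_linear[OF K(1)] smooth_compose_linear[OF L(1)] bounded_linear_fst bounded_linear_snd)
  then show ?thesis
    by (rule test_functionI[OF _ compact_Times[OF K(2) L(2)] subset_UNIV])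
       (use K(3) L(3) in \<open>auto simp: tx_prod_def mem_Times_iff\<close>)
qed

lemma bump_flux_integrable:
  assumes e: "smooth e" and w: "test_function UNIV w"
  shows "integrable lborel (\<lambda>p. indicator H p * bump n (fst p) * (w (snd p) * sflux e U (v\<^sub>0 (snd p))))"
    and "integrable lborel (\<lambda>p. indicator H p * bump n (fst p) * (w (snd p) * sflux e U (v p)))"
proof -
  obtain K where K: "compact K" "\<And>x. x \<notin> K \<Longrightarrow> w x = 0" using w by (rule test_functionE) blast
  have [measurable]: "snd \<in> borel_measurable (borel :: (real \<times> (real^'d)) measure)"
    by (intro borel_measurable_continuous_onI continuous_intros)
  note [measurable] = cc_measurable[OF test_function_cc[OF w]] v(1) v\<^sub>0(1) sflux_measurable[OF e U]
  have wl: "loc_bounded (\<lambda>p :: real \<times> (real^'d). w (snd p))"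
    by (intro loc_bounded_compose_continuous[OF loc_bounded_continuous[OF cc_continuous[OF test_function_cc[OF w]]]] continuous_intros)
  show "integrable lborel (\<lambda>p. indicator H p * bump n (fst p) * (w (snd p) * sflux e U (v\<^sub>0 (snd p))))"
    by (rule bump_weight_integrable[OF _ _ K(1)])
       (use K(2) in \<open>auto intro!: loc_bounded_mult wl loc_bounded_compose_continuous[OF loc_bounded_compose[OF sflux_loc_bounded[OF e U] v\<^sub>0(2)]] continuous_intros\<close>)
  show "integrable lborel (\<lambda>p. indicator H p * bump n (fst p) * (w (snd p) * sflux e U (v p)))"
    by (rule bump_weight_integrable[OF _ _ K(1)])
       (use K(2) in \<open>auto intro!: loc_bounded_mult wl loc_bounded_compose[OF sflux_loc_bounded[OF e U] v(2)]\<close>)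
qed

text \<open>As the bump has mass 1, the initial term can be written as an average over the same
  slab, so that the fluxes at \<open>v\<^sub>0 x\<close> and at v(t,x) are compared under one
  integral.\<close>

lemma S_cut_tx:
  assumes e: "smooth e" and \<tau>: "test_function UNIV \<tau>" "\<And>t. t \<in> {0..1} \<Longrightarrow> \<tau> t = 1" and w: "test_function UNIV w"
  shows "(\<lambda>n. S e (cut n (tx_prod \<tau> w)) - (LINT p|lborel. indicator H p * bump n (fst p) *
      (w (snd p) * (sflux e U (v\<^sub>0 (snd p)) - sflux e U (v p))))) \<longlonglongrightarrow> 0"
proof -
  note ia = bump_flux_integrable(1)[OF e w] and ib = bump_flux_integrable(2)[OF e w]
  have gi: "integrable lborel (\<lambda>x. w x * sflux e U (v\<^sub>0 x))"
    using initial_coeff[OF sflux_measurable[OF e U] sflux_loc_bounded[OF e U] test_function_cc[OF w]] by (simp add: mult.commute)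
  have 1: "(LINT x|lborel. sflux e U (v\<^sub>0 x) * tx_prod \<tau> w (0, x)) =
      (LINT p|lborel. indicator H p * bump n (fst p) * (w (snd p) * sflux e U (v\<^sub>0 (snd p))))" for n
  proof -
    have "(LINT p|lborel. indicator H p * bump n (fst p) * (w (snd p) * sflux e U (v\<^sub>0 (snd p)))) = (LINT x|lborel. w x * sflux e U (v\<^sub>0 x))"
      using integrable_tensor(2)[OF integral_bump_pos(1)[of n] gi] by (simp only: indicator_upper_half integral_bump_pos(2))
    moreover have "sflux e U (v\<^sub>0 x) * tx_prod \<tau> w (0, x) = w x * sflux e U (v\<^sub>0 x)" for x
      using \<tau>(2)[of 0] by (simp add: tx_prod_def)
    ultimately show ?thesis by (simp only:)
  qed
  \<comment> \<open>The time factor is 1 wherever the bump is not 0.\<close>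
  have "bump n (fst p) * \<tau> (fst p) = bump n (fst p)" for n and p :: "real \<times> (real^'d)"
    using \<tau>(2)[of "fst p"] bump_eq_0[of "fst p" n] by (cases "fst p \<in> {0..1}") auto
  then have 2: "indicator H p * bump n (fst p) * (sflux e U (v p) * tx_prod \<tau> w p) =
      indicator H p * bump n (fst p) * (w (snd p) * sflux e U (v p))" for n p
    by (simp add: tx_prod_def) (metis (no_types, lifting) mult.assoc mult.commute)
  have 3: "S e (cut n (tx_prod \<tau> w)) - (LINT x|lborel. sflux e U (v\<^sub>0 x) * tx_prod \<tau> w (0, x))
    + (LINT p|lborel. indicator H p * bump n (fst p) * (sflux e U (v p) * tx_prod \<tau> w p)) =
    S e (cut n (tx_prod \<tau> w)) - (LINT p|lborel. indicator H p * bump n (fst p) *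
      (w (snd p) * (sflux e U (v\<^sub>0 (snd p)) - sflux e U (v p))))" for n
    unfolding 1[of n] 2 using Bochner_Integration.integral_diff[OF ia[of n] ib[of n]]
    by (simp add: right_diff_distrib)
  show ?thesis
    using S_cut[OF e test_function_tx[OF \<tau>(1) w]] unfolding 3 .
qed

lemma cut_nonneg: "0 \<le> \<zeta> p \<Longrightarrow> 0 \<le> cut n \<zeta> p"
  using smooth_step_bounds by (simp add: cut_def)

text \<open>The interval reaches up to 1 to contain the support of every bump, and down to -r to
  cover the negative times of the box in \<open>M_initial_box\<close>.\<close>

lemma time_cutoff:
  fixes r :: real
  shows "\<exists>\<tau>. test_function UNIV \<tau> \<and> (\<forall>t. 0 \<le> \<tau> t) \<and> (\<forall>t\<in>{-r..1}. \<tau> t = 1)"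
proof -
  obtain \<tau> W where \<tau>: "test_function UNIV \<tau>" "\<And>x. 0 \<le> \<tau> x" "\<And>x. \<tau> x \<le> 1"
    "open W" "{-r..1} \<subseteq> W" "\<And>x. x \<in> W \<Longrightarrow> \<tau> x = 1"
    by (rule smooth_urysohn[OF compact_Icc open_UNIV subset_UNIV, of "-r" 1]) blast
  show ?thesis
    by (intro exI[of _ \<tau>] conjI allI ballI \<tau>(1,2)) (use \<tau>(5,6) in blast)
qed

text \<open>For e = 1 the flux is U and S vanishes, so \<open>S_cut_tx\<close> says precisely that
  U(v) has the initial trace U(\<open>v\<^sub>0\<close>), weakly in x and averaged in t.\<close>

lemma trace_defect_test_function:
  assumes w: "test_function UNIV w" "\<And>x. 0 \<le> w x"
  shows "(\<lambda>n. trace_defect n w) \<longlonglongrightarrow> 0"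
proof -
  obtain \<tau> :: "real \<Rightarrow> real" where \<tau>: "test_function UNIV \<tau>" "\<forall>t. 0 \<le> \<tau> t" "\<forall>t\<in>{0..1}. \<tau> t = 1"
    using time_cutoff[of 0] by auto
  have "S (\<lambda>_. 1) (cut n (tx_prod \<tau> w)) = 0" for n
    by (intro S_one_eq_0 test_function_cut test_function_tx \<tau> w cut_nonneg) (simp add: tx_prod_def \<tau> w)
  moreover have "(\<lambda>n. S (\<lambda>_. 1) (cut n (tx_prod \<tau> w)) - (LINT p|lborel. indicator H p * bump n (fst p) *
      (w (snd p) * (sflux (\<lambda>_. 1) U (v\<^sub>0 (snd p)) - sflux (\<lambda>_. 1) U (v p))))) \<longlonglongrightarrow> 0"
    by (rule S_cut_tx[OF smooth_const \<tau>(1) _ w(1)]) (use \<tau>(3) in simp)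
  ultimately have "(\<lambda>n. - trace_defect n w) \<longlonglongrightarrow> 0"
    by (simp add: sflux_const trace_defect_def jump_def)
  then show ?thesis using tendsto_minus by fastforce
qed

text \<open>Extension from smooth to integrable weights by density and the uniform bound. It is
  needed because the weight used for the defect measure contains E'(\<open>v\<^sub>0\<close>), which
  is merely measurable and locally bounded.\<close>

lemma trace_defect_tendsto_0:
  assumes g: "integrable lborel g" "\<And>x. x \<notin> ball 0 \<rho> \<Longrightarrow> g x = 0"
  shows "(\<lambda>n. trace_defect n g) \<longlonglongrightarrow> 0"
proof (rule LIMSEQ_I)
  fix \<epsilon> :: real assume \<epsilon>: "0 < \<epsilon>"
  obtain C where C: "0 \<le> C" "\<And>n g. integrable lborel g \<Longrightarrow> (\<And>x. x \<notin> cball 0 \<rho> \<Longrightarrow> g x = 0) \<Longrightarrow>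
    integrable lborel (\<lambda>p. indicator H p * bump n (fst p) * (g (snd p) * jump p)) \<and>
    \<bar>trace_defect n g\<bar> \<le> C * (LINT x|lborel. \<bar>g x\<bar>)"
    by (rule trace_defect_bound) blast
  have diff: "trace_defect n (\<lambda>x. f x - h x) = trace_defect n f - trace_defect n h"
    if "integrable lborel f" "\<And>x. x \<notin> cball 0 \<rho> \<Longrightarrow> f x = 0" "integrable lborel h" "\<And>x. x \<notin> cball 0 \<rho> \<Longrightarrow> h x = 0" for f h n
  proof -
    have "integrable lborel (\<lambda>p. indicator H p * bump n (fst p) * (f (snd p) * jump p))"
      "integrable lborel (\<lambda>p. indicator H p * bump n (fst p) * (h (snd p) * jump p))"
      using C(2)[OF that(1,2)] C(2)[OF that(3,4)] by auto
    from Bochner_Integration.integral_diff[OF this] show ?thesis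
      unfolding trace_defect_def by (simp add: algebra_simps)
  qed
  have "0 < \<epsilon> / (2 * (C + 1))" using \<epsilon> C(1) by simp
  from L1_test_function_dense[OF g(1) open_ball bounded_ball this]
  obtain h where h: "test_function (ball 0 \<rho>) h" "(LINT x|lborel. \<bar>indicator (ball 0 \<rho>) x * g x - h x\<bar>) < \<epsilon> / (2 * (C + 1))" by blast
  have gB: "indicator (ball 0 \<rho>) x * g x = g x" for x using g(2)[of x] by (auto simp: indicator_def)
  have hU: "test_function UNIV h" using h(1) test_function_subset by blast
  have hi: "integrable lborel h" by (rule integrable_cc[OF test_function_cc[OF hU]])
  have h0: "h x = 0" if "x \<notin> cball 0 \<rho>" for x
    by (rule test_function_outside[OF h(1)]) (use that in auto)
  have g0: "g x = 0" if "x \<notin> cball 0 \<rho>" for x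
    by (rule g(2)) (use that in auto)
  have "(\<lambda>n. trace_defect n h) \<longlonglongrightarrow> 0"
  proof -
    obtain B where B: "0 \<le> B" "\<And>x. \<bar>h x\<bar> \<le> B" using test_function_bounded[OF hU] by blast
    obtain K where K: "smooth h" "compact K" "K \<subseteq> ball 0 \<rho>" "\<And>x. x \<notin> K \<Longrightarrow> h x = 0" using h(1) by (rule test_functionE) blast
    obtain k W where k: "test_function (ball 0 \<rho>) k" "\<And>x. 0 \<le> k x" "\<And>x. k x \<le> 1"
      "open W" "K \<subseteq> W" "\<And>x. x \<in> W \<Longrightarrow> k x = 1"
      by (rule smooth_urysohn[OF K(2) open_ball K(3)]) blast
    \<comment> \<open>The approximant h may change sign; it is written as (h + B k) - B k with both
      parts nonnegative.\<close>
    have kU: "test_function UNIV (\<lambda>x. B * k x)" using k(1) test_function_subset test_function_cmult by blast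
    have pos: "0 \<le> h x + B * k x" for x
    proof (cases "x \<in> K")
      case True
      then have "k x = 1" using k(5,6) by blast
      then show ?thesis using B(2)[of x] by simp
    qed (use K(4) B(1) k(2) in simp)
    have "trace_defect n h = trace_defect n (\<lambda>x. h x + B * k x) - trace_defect n (\<lambda>x. B * k x)" for n
    proof -
      have "trace_defect n (\<lambda>x. (h x + B * k x) - B * k x) = trace_defect n (\<lambda>x. h x + B * k x) - trace_defect n (\<lambda>x. B * k x)"
      proof (rule diff)
        show "integrable lborel (\<lambda>x. h x + B * k x)" "integrable lborel (\<lambda>x. B * k x)"
          using integrable_cc[OF test_function_cc[OF test_function_add[OF hU kU]]] integrable_cc[OF test_function_cc[OF kU]] by auto
        show "B * k x = 0" if "x \<notin> cball 0 \<rho>" for x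
          using test_function_outside[OF k(1), of x] that by auto
        then show "h x + B * k x = 0" if "x \<notin> cball 0 \<rho>" for x using h0 that by simp
      qed
      then show ?thesis by simp
    qed
    moreover have "(\<lambda>n. trace_defect n (\<lambda>x. h x + B * k x) - trace_defect n (\<lambda>x. B * k x)) \<longlonglongrightarrow> 0 - 0"
      by (intro tendsto_diff trace_defect_test_function test_function_add hU kU pos) (simp add: B(1) k(2))
    ultimately show ?thesis by simp
  qed
  from LIMSEQ_D[OF this, of "\<epsilon> / 2"] \<epsilon> obtain n0 where n0: "\<And>n. n0 \<le> n \<Longrightarrow> \<bar>trace_defect n h\<bar> < \<epsilon> / 2" by auto
  have "norm (trace_defect n g - 0) < \<epsilon>" if "n0 \<le> n" for n
  proof -
    have "\<bar>trace_defect n (\<lambda>x. g x - h x)\<bar> \<le> C * (LINT x|lborel. \<bar>g x - h x\<bar>)"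
      using C(2)[of "\<lambda>x. g x - h x" n] g(1) hi g0 h0 by simp
    also have "\<dots> \<le> C * (\<epsilon> / (2 * (C + 1)))"
      using h(2) C(1) by (intro mult_left_mono) (auto simp: gB)
    also have "\<dots> \<le> (C + 1) * (\<epsilon> / (2 * (C + 1)))"
      using C(1) \<epsilon> by (intro mult_right_mono) auto
    also have "\<dots> = \<epsilon> / 2" using C(1) by (simp add: field_simps add_nonneg_eq_0_iff)
    finally have "\<bar>trace_defect n g - trace_defect n h\<bar> \<le> \<epsilon> / 2"
      using diff[OF g(1) g0 hi h0, of n] by simp
    then show ?thesis using n0[OF that] unfolding real_norm_def diff_zero by linarith
  qed
  then show "\<exists>no. \<forall>n\<ge>no. norm (trace_defect n g - 0) < \<epsilon>" by blast
qed

end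

section \<open>The Riesz measure of T: initial time, support in \<xi>, restriction to the half
  space\<close>

section \<open>The defect measure\<close>

context entropy_data
begin

lemma integral_M_tensor:
  assumes "smooth e" "test_function UNIV (deriv e)" "\<And>x. x \<le> b \<Longrightarrow> e x = 0" "test_function UNIV \<phi>"
  shows "integrable M (tensor (deriv e) \<phi>)" "(LINT q|M. tensor (deriv e) \<phi> q) = S e \<phi>"
  using integral_M[OF test_function_tensor[OF assms(2,4)]] T_tensor[OF assms] by auto

text \<open>For every n the measure of the box is at most the production of a suitable e tested with
  \<open>cut n\<close>. Up to an error tending to 0 this production is the slab average of the flux
  difference between \<open>v\<^sub>0\<close> and v, and the subgradient inequality at
  \<open>v\<^sub>0\<close> bounds that average by \<open>trace_defect n g\<close>, which tends to 0.
  The weak trace is enough because the slope \<open>e (v\<^sub>0 x)\<close> does not depend on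
  t.\<close>

lemma M_initial_box:
  fixes r :: nat
  shows "emeasure M ({- real r..0} \<times> (cball 0 (real r) \<times> cball 0 (real r))) = 0" (is "emeasure M ?Z = 0")
proof -
  have Z: "compact ?Z" by (intro compact_Times compact_Icc compact_cball)
  have Zm: "?Z \<in> sets M" using borel_compact[OF Z] by simp
  obtain w W where w: "test_function (ball 0 (real r + 1)) w" "\<And>x. 0 \<le> w x" "\<And>x. w x \<le> 1"
    "open W" "cball (0 :: real^'d) (real r) \<subseteq> W" "\<And>x. x \<in> W \<Longrightarrow> w x = 1"
    by (rule smooth_urysohn[of "cball 0 (real r)" "ball 0 (real r + 1)"]) (auto simp: subset_iff)
  obtain \<theta> W' where \<theta>: "test_function UNIV \<theta>" "\<And>x. 0 \<le> \<theta> x" "\<And>x. \<theta> x \<le> 1"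
    "open W'" "cball (0 :: real) (real r) \<subseteq> W'" "\<And>x. x \<in> W' \<Longrightarrow> \<theta> x = 1"
    by (rule smooth_urysohn[OF compact_cball open_UNIV subset_UNIV]) blast
  obtain \<tau> :: "real \<Rightarrow> real" where \<tau>: "test_function UNIV \<tau>" "\<forall>t. 0 \<le> \<tau> t" "\<forall>t\<in>{- real r..1}. \<tau> t = 1"
    using time_cutoff[of "real r"] by auto
  obtain e b where e: "smooth e" "deriv e = \<theta>" "\<And>x. x \<le> b \<Longrightarrow> e x = 0"
    by (rule test_function_primitive[OF \<theta>(1)]) blast
  have e': "test_function UNIV (deriv e)" "\<And>x. 0 \<le> deriv e x" using e(2) \<theta> by auto
  have e0: "0 \<le> e x" for x
  proof (cases "x \<le> b")
    case False
    then have "e b \<le> e x"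
      using DERIV_nonneg_imp_nondecreasing[of b x e] smooth_deriv_real(1)[OF e(1)] e'(2) by (meson linear)
    then show ?thesis using e(3)[of b] by simp
  qed (simp add: e(3))
  have wU: "test_function UNIV w" using test_function_subset[OF w(1)] by blast
  define X where "X n = S e (cut n (tx_prod \<tau> w))" for n
  define I where "I n = (LINT p|lborel. indicator H p * bump n (fst p) *
      (w (snd p) * (sflux e U (v\<^sub>0 (snd p)) - sflux e U (v p))))" for n
  define g where "g x = w x * e (v\<^sub>0 x)" for x
  have gi: "integrable lborel g"
  proof -
    have "integrable lborel (\<lambda>x. e (v\<^sub>0 x) * w x)"
      using smooth_continuous[OF e(1)]
      by (intro initial_coeff test_function_cc[OF wU] loc_bounded_continuous borel_measurable_continuous_onI)
    then show ?thesis by (simp add: g_def[abs_def] mult.commute)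
  qed
  have g0: "g x = 0" if "x \<notin> ball 0 (real r + 1)" for x
    using test_function_outside[OF w(1) that] by (simp add: g_def)
  have "(\<lambda>n. X n - I n) \<longlonglongrightarrow> 0"
    unfolding X_def I_def by (rule S_cut_tx[OF e(1) \<tau>(1) _ wU]) (use \<tau>(3) in auto)
  then have lim: "(\<lambda>n. (X n - I n) + trace_defect n g) \<longlonglongrightarrow> 0"
    using tendsto_add[OF _ trace_defect_tendsto_0[OF gi g0]] by fastforce
  obtain C where C: "0 \<le> C" "\<And>n g. integrable lborel g \<Longrightarrow> (\<And>x. x \<notin> cball 0 (real r + 1) \<Longrightarrow> g x = 0) \<Longrightarrow>
    integrable lborel (\<lambda>p. indicator H p * bump n (fst p) * (g (snd p) * jump p)) \<and>
    \<bar>trace_defect n g\<bar> \<le> C * (LINT x|lborel. \<bar>g x\<bar>)"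
    by (rule trace_defect_bound) blast
  have le: "measure M ?Z \<le> (X n - I n) + trace_defect n g" for n
  proof -
    have ct: "test_function UNIV (cut n (tx_prod \<tau> w))" by (intro test_function_cut test_function_tx \<tau> wU)
    have "measure M ?Z = (LINT q|M. indicator ?Z q)" using Zm by simp
    also have "\<dots> \<le> (LINT q|M. tensor (deriv e) (cut n (tx_prod \<tau> w)) q)"
    proof (rule integral_mono)
      show "integrable M (indicator ?Z :: _ \<Rightarrow> real)"
        using Zm finite_M[OF Z] by (intro integrable_real_indicator) auto
      show "integrable M (tensor (deriv e) (cut n (tx_prod \<tau> w)))"
        by (rule integral_M_tensor(1)[OF e(1) e'(1) e(3) ct])
      show "indicator ?Z q \<le> tensor (deriv e) (cut n (tx_prod \<tau> w)) q" for q
      proof (cases "q \<in> ?Z")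
        case True
        then obtain t x k where q: "q = (t, x, k)" "- real r \<le> t" "t \<le> 0" "x \<in> cball 0 (real r)" "k \<in> cball 0 (real r)"
          by (cases q) auto
        have "\<theta> k = 1" "w x = 1" "\<tau> t = 1" using q \<theta>(5,6) w(5,6) \<tau>(3) by auto
        \<comment> \<open>For t \<le> 0 the cutoff factor is 1, so the tensor dominates the
          indicator of the box whatever n is.\<close>
        moreover have "smooth_step (real (Suc n) * t) = 0"
          using q(3) by (intro smooth_step_eq_0 mult_nonneg_nonpos) auto
        ultimately show ?thesis
          by (simp add: q(1) tensor_def e(2) cut_def tx_prod_def indicator_def)
      next
        case False
        then show ?thesis
          using e'(2) w(2) \<tau>(2) by (simp add: tensor_def) (intro mult_nonneg_nonneg cut_nonneg, auto simp: tx_prod_def)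
      qed
    qed
    also have "\<dots> = X n"
      unfolding X_def by (rule integral_M_tensor(2)[OF e(1) e'(1) e(3) ct])
    finally have "measure M ?Z \<le> X n" .
    moreover have "I n \<le> trace_defect n g"
      unfolding I_def trace_defect_def
    proof (rule integral_mono)
      show "integrable lborel (\<lambda>p. indicator H p * bump n (fst p) * (w (snd p) * (sflux e U (v\<^sub>0 (snd p)) - sflux e U (v p))))"
        using Bochner_Integration.integrable_diff[OF bump_flux_integrable(1)[OF e(1) wU] bump_flux_integrable(2)[OF e(1) wU]]
        by (simp add: right_diff_distrib)
      show "integrable lborel (\<lambda>p. indicator H p * bump n (fst p) * (g (snd p) * jump p))"
        using C(2)[OF gi] g0 by auto
      fix p :: "real \<times> (real^'d)"
      have "w (snd p) * (sflux e U (v\<^sub>0 (snd p)) - sflux e U (v p)) \<le> w (snd p) * (e (v\<^sub>0 (snd p)) * jump p)"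
        unfolding jump_def by (intro mult_left_mono sflux_subgradient e(1) e' U mono_U w(2))
      then show "indicator H p * bump n (fst p) * (w (snd p) * (sflux e U (v\<^sub>0 (snd p)) - sflux e U (v p)))
          \<le> indicator H p * bump n (fst p) * (g (snd p) * jump p)"
        unfolding g_def mult.assoc[of "w (snd p)"] by (rule mult_left_mono) (intro mult_nonneg_nonneg bump_nonneg, simp)
    qed
    ultimately show ?thesis by linarith
  qed
  have "measure M ?Z \<le> 0" by (rule LIMSEQ_le_const[OF lim]) (use le in auto)
  then have "measure M ?Z = 0" using measure_nonneg[of M ?Z] by linarith
  then show ?thesis
    using finite_M[OF Z] by (simp add: emeasure_eq_ennreal_measure less_top[symmetric])
qed

text \<open>The boxes of integer size exhaust the closed half space t \<le> 0.\<close>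

lemma AE_M_positive_time: "AE q in M. 0 < fst q"
proof -
  have "AE q in M. \<forall>r::nat. q \<notin> {- real r..0} \<times> (cball 0 (real r) \<times> cball 0 (real r))"
    unfolding AE_all_countable
  proof
    fix r :: nat
    have "compact ({- real r..0} \<times> (cball 0 (real r) \<times> cball 0 (real r)) :: (real \<times> (real^'d) \<times> real) set)"
      by (intro compact_Times compact_Icc compact_cball)
    from borel_compact[OF this] M_initial_box[of r]
    show "AE q in M. q \<notin> {- real r..0} \<times> (cball 0 (real r) \<times> cball 0 (real r))"
      by (intro AE_not_in null_setsI) auto
  qed
  then show ?thesis
  proof (rule eventually_mono)
    fix q :: "real \<times> (real^'d) \<times> real"
    assume *: "\<forall>r::nat. q \<notin> {- real r..0} \<times> (cball 0 (real r) \<times> cball 0 (real r))"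
    obtain t x k where q: "q = (t, x, k)" by (cases q)
    obtain r :: nat where "max \<bar>t\<bar> (max (norm x) \<bar>k\<bar>) \<le> real r" using real_arch_simple by blast
    then have "\<not> t \<le> 0" using *[rule_format, of r] by (auto simp: q)
    then show "0 < fst q" by (simp add: q)
  qed
qed

text \<open>Let R bound v and \<open>v\<^sub>0\<close> over the support of \<phi>. A \<theta> living
  on |k| > R has a primitive that is constant on [-R, R], so its production is that of a constant,
  which is 0. As the integrand is nonnegative, M does not charge |k| > R above K.\<close>

lemma M_support:
  assumes "compact K"
  obtains C where "compact C" "AE q in M. (fst q, fst (snd q)) \<in> K \<longrightarrow> snd (snd q) \<in> C"
proof -
  obtain \<phi> W where \<phi>: "test_function UNIV \<phi>" "\<And>x. 0 \<le> \<phi> x" "\<And>x. \<phi> x \<le> 1"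
    "open W" "K \<subseteq> W" "\<And>x. x \<in> W \<Longrightarrow> \<phi> x = 1"
    by (rule smooth_urysohn[OF assms open_UNIV subset_UNIV]) blast
  obtain L where L: "smooth \<phi>" "compact L" "\<And>p. p \<notin> L \<Longrightarrow> \<phi> p = 0" using \<phi>(1) by (rule test_functionE) blast
  obtain R1 where R1: "0 \<le> R1" "\<And>p. p \<in> L \<Longrightarrow> \<bar>v p\<bar> \<le> R1" using loc_boundedE[OF v(2) L(2)] by blast
  have "compact (snd ` L)" using L(2) by (intro compact_continuous_image continuous_intros)
  then obtain R2 where R2: "0 \<le> R2" "\<And>x. x \<in> snd ` L \<Longrightarrow> \<bar>v\<^sub>0 x\<bar> \<le> R2" using loc_boundedE[OF v\<^sub>0(2)] by blast
  define R where "R = max R1 R2"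
  have R: "\<And>p. p \<in> L \<Longrightarrow> \<bar>v p\<bar> \<le> R" "\<And>x. (0, x) \<in> L \<Longrightarrow> \<bar>v\<^sub>0 x\<bar> \<le> R"
    using R1(2) R2(2) by (force simp: R_def le_max_iff_disj)+
  have "AE q in M. \<forall>n::nat. (fst q, fst (snd q)) \<in> K \<longrightarrow> \<not> (R + inverse (real (Suc n)) \<le> \<bar>snd (snd q)\<bar> \<and> \<bar>snd (snd q)\<bar> \<le> real n)"
    unfolding AE_all_countable
  proof
    fix n :: nat
    \<comment> \<open>Compact pieces that exhaust |k| > R as n grows, since
      \<open>smooth_urysohn\<close> takes a compact set.\<close>
    define Q where "Q = {k. R + inverse (real (Suc n)) \<le> \<bar>k\<bar>} \<inter> cball 0 (real n)"
    have "compact Q"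
      unfolding Q_def by (intro closed_Int_compact closed_Collect_le continuous_intros compact_cball)
    moreover have "open {k. R < \<bar>k\<bar>}" by (intro open_Collect_less continuous_intros)
    moreover have "Q \<subseteq> {k. R < \<bar>k\<bar>}"
    proof
      fix k assume "k \<in> Q"
      then have "R + inverse (real (Suc n)) \<le> \<bar>k\<bar>" unfolding Q_def by blast
      moreover have "0 < inverse (real (Suc n))" by simp
      ultimately have "R < \<bar>k\<bar>" by linarith
      then show "k \<in> {k. R < \<bar>k\<bar>}" by simp
    qed
    ultimately obtain \<theta> W' where \<theta>: "test_function {k. R < \<bar>k\<bar>} \<theta>" "\<And>x. 0 \<le> \<theta> x" "\<And>x. \<theta> x \<le> 1"
      "open W'" "Q \<subseteq> W'" "\<And>x. x \<in> W' \<Longrightarrow> \<theta> x = 1"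
      by (rule smooth_urysohn) blast
    have \<theta>U: "test_function UNIV \<theta>" using test_function_subset[OF \<theta>(1)] by blast
    obtain e b where e: "smooth e" "deriv e = \<theta>" "\<And>x. x \<le> b \<Longrightarrow> e x = 0"
      by (rule test_function_primitive[OF \<theta>U]) blast
    have ec: "e k = e 0" if "\<bar>k\<bar> \<le> R" for k
    proof (cases "k = 0")
      case False
      have z: "deriv e y = 0" if "\<bar>y\<bar> \<le> R" for y
        using test_function_outside[OF \<theta>(1), of y] that by (simp add: e(2))
      have "e (max 0 k) - e (min 0 k) = 0"
      proof -
        have "min 0 k < max 0 k" using False by auto
        then obtain y where "min 0 k < y" "y < max 0 k" "e (max 0 k) - e (min 0 k) = (max 0 k - min 0 k) * deriv e y"
          using MVT2[of "min 0 k" "max 0 k" e "deriv e"] smooth_deriv_real(1)[OF e(1)] by blast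
        then show ?thesis using z[of y] \<open>\<bar>k\<bar> \<le> R\<close> by (auto simp: max_def min_def split: if_splits)
      qed
      then show ?thesis by (auto simp: max_def min_def split: if_splits)
    qed simp
    have "S e \<phi> = S (\<lambda>_. e 0) \<phi>"
      by (rule S_cong[OF L(2,3) L(1) R ec])
    also have "\<dots> = 0" using S_const[of "e 0" \<phi>] S_one_eq_0[OF \<phi>(1,2)] by simp
    finally have "(LINT q|M. tensor \<theta> \<phi> q) = 0"
      using integral_M_tensor(2)[OF e(1) _ e(3) \<phi>(1)] \<theta>U by (simp add: e(2))
    moreover have "integrable M (tensor \<theta> \<phi>)"
      using integral_M_tensor(1)[OF e(1) _ e(3) \<phi>(1)] \<theta>U by (simp add: e(2))
    moreover have "AE q in M. 0 \<le> tensor \<theta> \<phi> q"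
      using \<theta>(2) \<phi>(2) by (simp add: tensor_def)
    ultimately have "AE q in M. tensor \<theta> \<phi> q = 0"
      using integral_nonneg_eq_0_iff_AE[of M "tensor \<theta> \<phi>"] by simp
    then show "AE q in M. (fst q, fst (snd q)) \<in> K \<longrightarrow> \<not> (R + inverse (real (Suc n)) \<le> \<bar>snd (snd q)\<bar> \<and> \<bar>snd (snd q)\<bar> \<le> real n)"
    proof (rule eventually_mono, intro impI notI)
      fix q :: "real \<times> (real^'d) \<times> real"
      assume q: "tensor \<theta> \<phi> q = 0" "(fst q, fst (snd q)) \<in> K"
        "R + inverse (real (Suc n)) \<le> \<bar>snd (snd q)\<bar> \<and> \<bar>snd (snd q)\<bar> \<le> real n"
      then have "\<phi> (fst q, fst (snd q)) = 1" "\<theta> (snd (snd q)) = 1"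
        using \<phi>(5,6) \<theta>(5,6) by (auto simp: Q_def)
      then show False using q(1) by (simp add: tensor_def)
    qed
  qed
  then have "AE q in M. (fst q, fst (snd q)) \<in> K \<longrightarrow> snd (snd q) \<in> cball 0 R"
  proof (rule eventually_mono, intro impI)
    fix q :: "real \<times> (real^'d) \<times> real"
    assume *: "\<forall>n::nat. (fst q, fst (snd q)) \<in> K \<longrightarrow> \<not> (R + inverse (real (Suc n)) \<le> \<bar>snd (snd q)\<bar> \<and> \<bar>snd (snd q)\<bar> \<le> real n)"
      and K: "(fst q, fst (snd q)) \<in> K"
    show "snd (snd q) \<in> cball 0 R"
    proof (rule ccontr)
      assume "snd (snd q) \<notin> cball 0 R"
      then have "0 < \<bar>snd (snd q)\<bar> - R" by simp
      then obtain n1 where n1: "inverse (real (Suc n1)) < \<bar>snd (snd q)\<bar> - R" using reals_Archimedean by blast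
      obtain n2 :: nat where n2: "\<bar>snd (snd q)\<bar> \<le> real n2" using real_arch_simple by blast
      let ?n = "max n1 n2"
      have "inverse (real (Suc ?n)) \<le> inverse (real (Suc n1))" by (intro le_imp_inverse_le) auto
      then have "R + inverse (real (Suc ?n)) \<le> \<bar>snd (snd q)\<bar>" using n1 by linarith
      moreover have "\<bar>snd (snd q)\<bar> \<le> real ?n" using n2 by simp
      ultimately show False using *[rule_format, OF K, of ?n] by blast
    qed
  qed
  then show ?thesis using that[OF compact_cball] by blast
qed

text \<open>A kinetic measure lives on the open half space; restricting M to it does not change
  integrals, by \<open>AE_M_positive_time\<close>. Finiteness of M on all compact sets, including
  those that meet t = 0, provides integrability of \<open>D_xi \<phi>\<close>.\<close>

lemma kinetic_measure_exists:
  "\<exists>m. kinetic_measure m \<and> locally_xi_compactly_supported m \<and>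
     (\<forall>\<phi>. test_function UNIV \<phi> \<longrightarrow> integrable m (D_xi \<phi>) \<and> (LINT q|m. D_xi \<phi> q) = T (D_xi \<phi>))"
proof (intro exI conjI allI impI)
  let ?\<Omega> = "upper_half :: (real \<times> (real^'d) \<times> real) set"
  let ?m = "restrict_space M ?\<Omega>"
  have \<Omega>: "?\<Omega> \<in> sets borel" by (rule upper_half_borel)
  show "kinetic_measure ?m"
    unfolding kinetic_measure_def
  proof (intro conjI allI impI)
    show "sets ?m = sets (restrict_space borel upper_half)"
      by (rule sets_restrict_space_cong) simp
    fix K :: "(real \<times> (real^'d) \<times> real) set" assume K: "compact K \<and> K \<subseteq> upper_half"
    then have "emeasure ?m K = emeasure M K"
      using \<Omega> by (intro emeasure_restrict_space) auto
    then show "emeasure ?m K < \<infinity>" using finite_M K by simp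
  qed
  show "locally_xi_compactly_supported ?m"
    unfolding locally_xi_compactly_supported_def
  proof (intro allI impI)
    fix K :: "(real \<times> (real^'d)) set" assume K: "compact K"
    obtain C where C: "compact C" "AE q in M. (fst q, fst (snd q)) \<in> K \<longrightarrow> snd (snd q) \<in> C"
      by (rule M_support[OF K]) blast
    let ?B = "{(t, x, \<xi>). 0 < t \<and> (t, x) \<in> K \<and> \<xi> \<notin> C}"
    have "emeasure ?m ?B = emeasure M ?B"
      using \<Omega> by (intro emeasure_restrict_space) auto
    also have "\<dots> = 0"
    \<comment> \<open>A set outside the sigma algebra has \<open>emeasure\<close> 0 by convention,
      so both cases agree.\<close>
    proof (cases "?B \<in> sets M")
      case True
      have "AE q in M. q \<notin> ?B" using C(2) by (rule eventually_mono) auto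
      then have "?B \<in> null_sets M" unfolding AE_iff_null_sets[OF True] .
      then show ?thesis by (rule null_setsD1)
    qed (rule emeasure_notin_sets)
    finally show "\<exists>C. compact C \<and> emeasure ?m {(t, x, \<xi>). 0 < t \<and> (t, x) \<in> K \<and> \<xi> \<notin> C} = 0"
      using C(1) by blast
  qed
  fix \<phi> :: "real \<times> (real^'d) \<times> real \<Rightarrow> real" assume "test_function UNIV \<phi>"
  then have D: "test_function UNIV (D_xi \<phi>)" by (rule test_function_D_xi)
  have "integrable M (\<lambda>q. indicator ?\<Omega> q *\<^sub>R D_xi \<phi> q)"
    using \<Omega> by (intro integrable_mult_indicator integral_M(1)[OF D]) simp
  then show "integrable ?m (D_xi \<phi>)"
    using \<Omega> by (subst integrable_restrict_space) simp_all
  have "(LINT q|?m. D_xi \<phi> q) = (LINT q|M. indicator ?\<Omega> q *\<^sub>R D_xi \<phi> q)"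
    using \<Omega> by (intro integral_restrict_space) simp
  also have "\<dots> = (LINT q|M. D_xi \<phi> q)"
  proof (rule integral_cong_AE)
    show "AE q in M. indicator ?\<Omega> q *\<^sub>R D_xi \<phi> q = D_xi \<phi> q"
      using AE_M_positive_time by (rule eventually_mono) (auto simp: indicator_def)
    have [measurable]: "D_xi \<phi> \<in> borel_measurable borel" by (rule cc_measurable[OF test_function_cc[OF D]])
    show "(\<lambda>q. indicator ?\<Omega> q *\<^sub>R D_xi \<phi> q) \<in> borel_measurable M" using \<Omega> by measurable
    show "D_xi \<phi> \<in> borel_measurable M" by measurable
  qed
  also have "\<dots> = T (D_xi \<phi>)" by (rule integral_M(2)[OF D])
  finally show "(LINT q|?m. D_xi \<phi> q) = T (D_xi \<phi>)" .
qed

end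

section \<open>From the kinetic formulation to the entropy inequality\<close>

lemma D_xi_tensor:
  fixes \<phi> :: "real \<times> (real^'d) \<Rightarrow> real"
  assumes "smooth e"
  shows "D_xi (tensor e \<phi>) = tensor (deriv e) \<phi>"
proof
  fix q :: "real \<times> (real^'d) \<times> real"
  obtain t x k where q: "q = (t, x, k)" by (cases q)
  have "((\<lambda>\<eta>. e \<eta> * \<phi> (t, x)) has_real_derivative deriv e k * \<phi> (t, x)) (at k)"
    by (rule DERIV_cmult_right[OF smooth_deriv_real(1)[OF assms]])
  then show "D_xi (tensor e \<phi>) q = tensor (deriv e) \<phi> q"
    by (simp add: q D_xi_def tensor_def DERIV_imp_deriv)
qed

context kinetic_data
begin

text \<open>The product of e and \<phi> need not have compact support in \<xi>, so e is multiplied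
  by a cutoff \<zeta>. If R bounds v and \<open>v\<^sub>0\<close> over the support of \<phi> as well
  as the \<xi>-support of m there, the cutoff leaves S unchanged, and m sees only points where the
  \<xi>-derivative is \<open>deriv e\<close> times \<phi>, which is nonnegative.\<close>

lemma entropy_from_kinetic:
  assumes m: "kinetic_measure m" "locally_xi_compactly_supported m"
    and K2: "\<And>\<phi>. test_function UNIV \<phi> \<Longrightarrow> integrable m (D_xi \<phi>) \<and> (LINT q|m. D_xi \<phi> q) = T (D_xi \<phi>)"
    and e: "smooth e" "\<And>x. 0 \<le> deriv e x"
    and \<phi>: "test_function UNIV (\<phi> :: real \<times> (real^'d) \<Rightarrow> real)" "\<And>p. 0 \<le> \<phi> p"
  shows "0 \<le> S e \<phi>"
proof -
  obtain L where L: "smooth \<phi>" "compact L" "\<And>p. p \<notin> L \<Longrightarrow> \<phi> p = 0" using \<phi>(1) by (rule test_functionE) blast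
  obtain R1 where R1: "0 \<le> R1" "\<And>p. p \<in> L \<Longrightarrow> \<bar>v p\<bar> \<le> R1" using loc_boundedE[OF v(2) L(2)] by blast
  have "compact (snd ` L)" using L(2) by (intro compact_continuous_image continuous_intros)
  then obtain R2 where R2: "0 \<le> R2" "\<And>x. x \<in> snd ` L \<Longrightarrow> \<bar>v\<^sub>0 x\<bar> \<le> R2" using loc_boundedE[OF v\<^sub>0(2)] by blast
  obtain C where C: "compact C" "emeasure m {(t, x, \<xi>). 0 < t \<and> (t, x) \<in> L \<and> \<xi> \<notin> C} = 0"
    using m(2) L(2) unfolding locally_xi_compactly_supported_def by blast
  obtain R3 where R3: "0 \<le> R3" "\<And>k. k \<in> C \<Longrightarrow> \<bar>k\<bar> \<le> R3"
    using loc_boundedE[OF loc_bounded_continuous[OF continuous_on_id] C(1)] by blast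
  define R where "R = max R1 (max R2 R3)"
  have R: "\<And>p. p \<in> L \<Longrightarrow> \<bar>v p\<bar> \<le> R" "\<And>x. (0, x) \<in> L \<Longrightarrow> \<bar>v\<^sub>0 x\<bar> \<le> R" "\<And>k. k \<in> C \<Longrightarrow> \<bar>k\<bar> \<le> R"
    using R1(2) R2(2) R3(2) by (force simp: R_def le_max_iff_disj)+
  \<comment> \<open>The margin 1 makes e and its truncation agree on a neighbourhood of [-R, R],
    hence their derivatives agree on [-R, R].\<close>
  obtain \<zeta> W where \<zeta>: "test_function UNIV \<zeta>" "\<And>x. 0 \<le> \<zeta> x" "\<And>x. \<zeta> x \<le> 1"
    "open W" "cball (0 :: real) (R + 1) \<subseteq> W" "\<And>x. x \<in> W \<Longrightarrow> \<zeta> x = 1"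
    by (rule smooth_urysohn[OF compact_cball open_UNIV subset_UNIV]) blast
  define e2 where "e2 k = \<zeta> k * e k" for k
  have e2t: "test_function UNIV e2" unfolding e2_def[abs_def] by (rule test_function_mult[OF \<zeta>(1) e(1)])
  have e2s: "smooth e2" using e2t by (rule test_function_smooth)
  have e2e: "e2 k = e k" if "\<bar>k\<bar> \<le> R + 1" for k
  proof -
    have "k \<in> W" using \<zeta>(5) that by auto
    then show ?thesis using \<zeta>(6) by (simp add: e2_def)
  qed
  have d2: "deriv e2 k = deriv e k" if "\<bar>k\<bar> \<le> R" for k
    by (rule deriv_eq_local[of "{- R - 1<..<R + 1}"]) (use that e2e in auto)
  have d2t: "test_function UNIV (deriv e2)"
  proof -
    have "(\<lambda>x. frechet_derivative e2 (at x) 1) = deriv e2"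
      using frechet_derivative_real[OF differentiableI[OF smooth_has_derivative[OF e2s]], of _ 1] by auto
    then show ?thesis using test_function_frechet[OF e2t, of 1] by simp
  qed
  obtain b where b: "\<And>x. x \<le> b \<Longrightarrow> e2 x = 0"
  proof -
    obtain K where K: "compact K" "\<And>x. x \<notin> K \<Longrightarrow> e2 x = 0" using e2t by (rule test_functionE) blast
    obtain B where "\<And>k. k \<in> K \<Longrightarrow> \<bar>k\<bar> \<le> B"
      using loc_boundedE[OF loc_bounded_continuous[OF continuous_on_id] K(1)] by blast
    then have "e2 x = 0" if "x \<le> - B - 1" for x using that by (intro K(2)) force
    then show ?thesis by (rule that)
  qed
  have "S e \<phi> = S e2 \<phi>"
    by (rule S_cong[OF L(2,3) L(1) R(1,2)]) (use e2e in auto)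
  also have "\<dots> = T (D_xi (tensor e2 \<phi>))"
    unfolding D_xi_tensor[OF e2s] by (rule T_tensor[OF e2s d2t b \<phi>(1), symmetric])
  also have "\<dots> = (LINT q|m. D_xi (tensor e2 \<phi>) q)"
    using K2[OF test_function_tensor[OF e2t \<phi>(1)]] by simp
  also have "0 \<le> \<dots>"
  proof (rule integral_nonneg_AE)
    let ?B = "{(t, x, \<xi>). 0 < t \<and> (t, x) \<in> L \<and> \<xi> \<notin> C}"
    have sm: "sets m = sets (restrict_space borel upper_half)" using m(1) by (simp add: kinetic_measure_def)
    \<comment> \<open>The value 0 of \<open>emeasure\<close> yields a null set only together with
      measurability.\<close>
    have Bm: "?B \<in> sets m"
    proof -
      have c: "continuous_on UNIV (\<lambda>q :: real \<times> (real^'d) \<times> real. (fst q, fst (snd q)))"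
        "continuous_on UNIV (\<lambda>q :: real \<times> (real^'d) \<times> real. snd (snd q))"
        by (intro continuous_intros)+
      have "((\<lambda>q :: real \<times> (real^'d) \<times> real. (fst q, fst (snd q))) -` L) \<inter> ((\<lambda>q. snd (snd q)) -` (- C)) \<in> sets borel"
        using measurable_sets[OF borel_measurable_continuous_onI[OF c(1)], of L] measurable_sets[OF borel_measurable_continuous_onI[OF c(2)], of "- C"]
          borel_compact[OF L(2)] borel_compact[OF C(1)] by auto
      moreover have "?B = upper_half \<inter> (((\<lambda>q. (fst q, fst (snd q))) -` L) \<inter> ((\<lambda>q. snd (snd q)) -` (- C)))" by auto
      ultimately show ?thesis unfolding sm sets_restrict_space by blast
    qed
    then have "AE q in m. q \<notin> ?B" using C(2) by (intro AE_not_in null_setsI) auto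
    moreover have "AE q in m. q \<in> upper_half"
    proof (rule AE_I2)
      fix q assume "q \<in> space m"
      then show "q \<in> upper_half" using sets_eq_imp_space_eq[OF sm] by (simp add: space_restrict_space)
    qed
    ultimately show "AE q in m. 0 \<le> D_xi (tensor e2 \<phi>) q"
    proof eventually_elim
      fix q :: "real \<times> (real^'d) \<times> real" assume q: "q \<notin> ?B" "q \<in> upper_half"
      obtain t x k where qq: "q = (t, x, k)" by (cases q)
      show "0 \<le> D_xi (tensor e2 \<phi>) q"
      proof (cases "(t, x) \<in> L")
        case True
        then have "k \<in> C" using q by (auto simp: qq)
        then have "deriv e2 k = deriv e k" using R(3) d2 by blast
        then show ?thesis using e(2) \<phi>(2) by (simp add: D_xi_tensor[OF e2s] tensor_def qq)
      next
        case False
        then show ?thesis using L(3) by (simp add: D_xi_tensor[OF e2s] tensor_def qq)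
      qed
    qed
  qed
  finally show ?thesis .
qed

end

text \<open>The tangent inequalities at two points add up to monotonicity of E'.\<close>

lemma convex_imp_deriv2_nonneg:
  fixes E :: "real \<Rightarrow> real"
  assumes E: "smooth E" "convex_on UNIV E"
  shows "0 \<le> deriv (deriv E) x"
proof -
  have tangent: "deriv E c * (x - c) \<le> E x - E c" for c x
    using convex_on_imp_above_tangent[OF E(2), of c x "deriv E c"] smooth_deriv_real(1)[OF E(1)] by auto
  have "mono (deriv E)"
  proof (rule monoI)
    fix x y :: real assume "x \<le> y"
    have "(deriv E y - deriv E x) * (y - x) \<ge> 0"
      using tangent[of x y] tangent[of y x] by (simp add: algebra_simps)
    then show "deriv E x \<le> deriv E y"
      using \<open>x \<le> y\<close> by (cases "x = y") (auto simp: zero_le_mult_iff)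
  qed
  then show ?thesis
    using mono_on_imp_deriv_nonneg[of UNIV "deriv E" "deriv (deriv E) x" x]
      smooth_deriv_real(1)[OF smooth_deriv[OF E(1)], of x] by auto
qed

section \<open>Reduction of the three notions to conditions on representatives of one lift\<close>

section \<open>Bounded Borel representatives of a solution\<close>

text \<open>U may have flat pieces and no inverse, but a monotone U that attains C + 1 and -C - 1
  confines the preimage of [-C, C] between two such points. This is how local boundedness of u
  passes to every lift v.\<close>

lemma monotone_surjective_preimage_bounded:
  fixes U :: "real \<Rightarrow> real"
  assumes "mono U" "range U = UNIV"
  obtains R where "\<And>s. \<bar>U s\<bar> \<le> C \<Longrightarrow> \<bar>s\<bar> \<le> R"
proof -
  obtain p q where p: "U p = C + 1" and q: "U q = - C - 1" using assms(2) by (metis UNIV_I imageE)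
  have "\<bar>s\<bar> \<le> \<bar>p\<bar> + \<bar>q\<bar>" if s: "\<bar>U s\<bar> \<le> C" for s
  proof -
    have "s \<le> p" using monoD[OF assms(1), of p s] s p by (cases "s \<le> p") auto
    moreover have "q \<le> s" using monoD[OF assms(1), of s q] s q by (cases "q \<le> s") auto
    ultimately show ?thesis by linarith
  qed
  then show ?thesis by (rule that)
qed

lemma solution_representatives:
  fixes U :: "real \<Rightarrow> real" and A :: "real \<Rightarrow> real^'d"
  assumes u\<^sub>0: "Linf_loc u\<^sub>0" and par: "continuous_parametrization AF AG U A a"
    and u: "Linf_time_Linf_loc u" and V: "solution_lift U u\<^sub>0 u V V\<^sub>0"
  obtains v v\<^sub>0 where "kinetic_data U A a v v\<^sub>0"
    "AE p in lborel. p \<in> upper_half \<longrightarrow> V p = v p" "AE x in lborel. V\<^sub>0 x = v\<^sub>0 x"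
proof -
  have U: "mono U" "range U = UNIV" "U 0 = 0" "continuous_on UNIV U" "continuous_on UNIV A" "continuous_on UNIV a"
    using par lipschitz_on_continuous_on unfolding continuous_parametrization_def by auto
  have Vm: "V \<in> borel_measurable (lebesgue_on upper_half)" "V\<^sub>0 \<in> borel_measurable lebesgue"
    and Vu: "AE p in lborel. p \<in> upper_half \<longrightarrow> u p = U (V p)" "AE x in lborel. u\<^sub>0 x = U (V\<^sub>0 x)"
    using V unfolding solution_lift_def AE_lebesgue_on_iff[OF upper_half_borel] AE_completion_iff by auto
  have "\<exists>R. AE p in lborel. p \<in> upper_half \<and> p \<in> cball 0 (real n) \<longrightarrow> \<bar>V p\<bar> \<le> R" for n :: nat
  proof -
    \<comment> \<open>In the ball of radius n one has t \<le> n, so the open time interval up to n +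
      1 contains all its positive times.\<close>
    let ?W = "{0<..<real n + 1} \<times> cball (0 :: real^'d) (real n)"
    have W: "?W \<in> sets borel" by (intro borel_Times) auto
    obtain C where "AE p in lebesgue_on ?W. \<bar>u p\<bar> \<le> C"
      using u compact_cball unfolding Linf_time_Linf_loc_def by (metis add_nonneg_pos of_nat_0_le_iff zero_less_one)
    then have C: "AE p in lborel. p \<in> ?W \<longrightarrow> \<bar>u p\<bar> \<le> C" using AE_lebesgue_on_iff[OF W] by simp
    obtain R where R: "\<And>s. \<bar>U s\<bar> \<le> C \<Longrightarrow> \<bar>s\<bar> \<le> R"
      by (rule monotone_surjective_preimage_bounded[OF U(1,2)]) blast
    have "AE p in lborel. p \<in> upper_half \<and> p \<in> cball 0 (real n) \<longrightarrow> \<bar>V p\<bar> \<le> R"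
      using C Vu(1)
    proof eventually_elim
      fix p :: "real \<times> (real^'d)"
      assume p: "p \<in> ?W \<longrightarrow> \<bar>u p\<bar> \<le> C" "p \<in> upper_half \<longrightarrow> u p = U (V p)"
      show "p \<in> upper_half \<and> p \<in> cball 0 (real n) \<longrightarrow> \<bar>V p\<bar> \<le> R"
      proof
        assume h: "p \<in> upper_half \<and> p \<in> cball 0 (real n)"
        have "norm (fst p) \<le> norm p" "norm (snd p) \<le> norm p"
          using norm_fst_le[of "fst p" "snd p"] norm_snd_le[of "snd p" "fst p"] by simp_all
        then have "p \<in> ?W" using h by (auto simp: mem_Times_iff)
        then show "\<bar>V p\<bar> \<le> R" using p h by (intro R) auto
      qed
    qed
    then show ?thesis by blast
  qed
  then obtain v where v: "v \<in> borel_measurable borel" "loc_bounded v" "AE p in lborel. p \<in> upper_half \<longrightarrow> V p = v p"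
    by (rule borel_representative[OF upper_half_borel Vm(1)]) blast
  have bd: "\<exists>R. AE x in lborel. x \<in> UNIV \<and> x \<in> cball 0 (real n) \<longrightarrow> \<bar>V\<^sub>0 x\<bar> \<le> R" for n :: nat
  proof -
    let ?W = "cball (0 :: real^'d) (real n)"
    have W: "?W \<in> sets borel" by auto
    obtain C where "AE x in lebesgue_on ?W. \<bar>u\<^sub>0 x\<bar> \<le> C"
      using u\<^sub>0 compact_cball unfolding Linf_loc_def by metis
    then have C: "AE x in lborel. x \<in> ?W \<longrightarrow> \<bar>u\<^sub>0 x\<bar> \<le> C" using AE_lebesgue_on_iff[OF W] by simp
    obtain R where R: "\<And>s. \<bar>U s\<bar> \<le> C \<Longrightarrow> \<bar>s\<bar> \<le> R"
      by (rule monotone_surjective_preimage_bounded[OF U(1,2)]) blast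
    have "AE x in lborel. x \<in> UNIV \<and> x \<in> ?W \<longrightarrow> \<bar>V\<^sub>0 x\<bar> \<le> R"
      using C Vu(2) by eventually_elim (use R in auto)
    then show ?thesis by blast
  qed
  have V0m: "V\<^sub>0 \<in> borel_measurable (lebesgue_on UNIV)" using Vm(2) by (simp add: lebesgue_on_UNIV_eq)
  have "(UNIV :: (real^'d) set) \<in> sets borel" by simp
  then obtain v\<^sub>0 where v\<^sub>0: "v\<^sub>0 \<in> borel_measurable borel" "loc_bounded v\<^sub>0" "AE x in lborel. x \<in> UNIV \<longrightarrow> V\<^sub>0 x = v\<^sub>0 x"
    by (rule borel_representative[OF _ V0m bd]) blast
  show ?thesis
    by (rule that[OF _ v(3)]) (use U v v\<^sub>0 in \<open>auto intro: kinetic_data.intro\<close>)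
qed

section \<open>Equivalence of the notions of solution\<close>

text \<open>The common normal form of K1 and K2, stated for one pair of representatives.\<close>

definition kinetic_condition ::
  "(real \<Rightarrow> real) \<Rightarrow> (real \<Rightarrow> real^'d) \<Rightarrow> (real \<Rightarrow> real) \<Rightarrow>
   (real \<times> (real^'d) \<Rightarrow> real) \<Rightarrow> (real^'d \<Rightarrow> real) \<Rightarrow> bool" where
  "kinetic_condition U A a v v\<^sub>0 \<longleftrightarrow>
     (\<exists>m. kinetic_measure m \<and> locally_xi_compactly_supported m \<and>
       (\<forall>\<phi>. test_function UNIV \<phi> \<longrightarrow>
          integrable m (D_xi \<phi>) \<and> (LINT q|m. D_xi \<phi> q) = kinetic_data.T U A a v v\<^sub>0 (D_xi \<phi>)))"

definition entropy_condition ::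
  "(real \<Rightarrow> real) \<Rightarrow> (real \<Rightarrow> real^'d) \<Rightarrow> (real \<Rightarrow> real) \<Rightarrow>
   (real \<times> (real^'d) \<Rightarrow> real) \<Rightarrow> (real^'d \<Rightarrow> real) \<Rightarrow> bool" where
  "entropy_condition U A a v v\<^sub>0 \<longleftrightarrow>
     (\<forall>E \<phi>. smooth E \<and> convex_on UNIV E \<and> test_function UNIV (deriv (deriv E)) \<and>
        test_function UNIV \<phi> \<and> (\<forall>p. 0 \<le> \<phi> p) \<longrightarrow> 0 \<le> kinetic_data.S U A a v v\<^sub>0 (deriv E) \<phi>)"

lemma entropy_iff_kinetic_condition:
  assumes "kinetic_data U A a v v\<^sub>0" "mono U"
  shows "entropy_condition U A a v v\<^sub>0 \<longleftrightarrow> kinetic_condition U A a v v\<^sub>0"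
proof
  interpret kinetic_data U A a v v\<^sub>0 by (rule assms(1))
  assume ent: "entropy_condition U A a v v\<^sub>0"
  interpret entropy_data U A a v v\<^sub>0
  proof
    show "mono U" by (rule assms(2))
    fix e :: "real \<Rightarrow> real" and \<phi> :: "real \<times> (real^'a) \<Rightarrow> real"
    assume *: "smooth e" "test_function UNIV (deriv e)" "\<And>x. 0 \<le> deriv e x"
      "test_function UNIV \<phi>" "\<And>p. 0 \<le> \<phi> p"
    \<comment> \<open>S depends on E only through E' = e, so any primitive of e serves as the
      entropy.\<close>
    obtain E where E: "\<And>x. (E has_real_derivative e x) (at x)"
      using continuous_antiderivative[OF smooth_continuous[OF *(1)]] by blast
    have dE: "deriv E = e" using E by (auto intro: DERIV_imp_deriv)
    have "convex_on UNIV E"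
      by (rule f''_ge0_imp_convex[of UNIV E e "deriv e"]) (use E smooth_deriv_real(1)[OF *(1)] *(3) in auto)
    then show "0 \<le> S e \<phi>"
      using ent[unfolded entropy_condition_def, rule_format, of E \<phi>] smooth_antiderivative[OF E *(1)] * by (simp add: dE)
  qed
  show "kinetic_condition U A a v v\<^sub>0"
    unfolding kinetic_condition_def by (rule kinetic_measure_exists)
next
  interpret kinetic_data U A a v v\<^sub>0 by (rule assms(1))
  assume "kinetic_condition U A a v v\<^sub>0"
  then obtain m where m: "kinetic_measure m" "locally_xi_compactly_supported m"
    "\<And>\<phi>. test_function UNIV \<phi> \<Longrightarrow> integrable m (D_xi \<phi>) \<and> (LINT q|m. D_xi \<phi> q) = T (D_xi \<phi>)"
    unfolding kinetic_condition_def by blast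
  show "entropy_condition U A a v v\<^sub>0"
    unfolding entropy_condition_def
    using entropy_from_kinetic[OF m smooth_deriv convex_imp_deriv2_nonneg] by blast
qed

text \<open>The representatives are functions \<open>v V V\<^sub>0\<close> and
  \<open>v\<^sub>0 V V\<^sub>0\<close> of the lift, so that all three notions quantify over the same
  lifts and can be compared lift by lift.\<close>

lemma entropy_weak_solution_iff:
  assumes data: "\<forall>V V\<^sub>0. Linf_time_Linf_loc u \<longrightarrow> solution_lift U u\<^sub>0 u V V\<^sub>0 \<longrightarrow>
      kinetic_data U A a (v V V\<^sub>0) (v\<^sub>0 V V\<^sub>0) \<and>
      (AE p in lborel. p \<in> upper_half \<longrightarrow> V p = v V V\<^sub>0 p) \<and> (AE x in lborel. V\<^sub>0 x = v\<^sub>0 V V\<^sub>0 x)"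
  shows "entropy_weak_solution U A a u\<^sub>0 u \<longleftrightarrow> Linf_time_Linf_loc u \<and>
      (\<exists>V V\<^sub>0. solution_lift U u\<^sub>0 u V V\<^sub>0 \<and> entropy_condition U A a (v V V\<^sub>0) (v\<^sub>0 V V\<^sub>0))"
proof -
  have "(\<forall>T>0. \<forall>E \<phi>.
          smooth E \<and> convex_on UNIV E \<and> test_function UNIV (deriv (deriv E)) \<and>
          test_function ({..<T} \<times> UNIV) \<phi> \<and> (\<forall>p. 0 \<le> \<phi> p) \<longrightarrow>
          (LINT p|lebesgue_on upper_half.
             entropy_flux E U (V p) * D_t \<phi> p + entropy_flux E A (V p) \<bullet> grad_x \<phi> p)
          \<ge> - (LINT p|lebesgue_on upper_half. a (V p) * deriv E (V p) * \<phi> p)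
            - (LINT x|lebesgue. entropy_flux E U (V\<^sub>0 x) * \<phi> (0, x))) \<longleftrightarrow>
      entropy_condition U A a (v V V\<^sub>0) (v\<^sub>0 V V\<^sub>0)" (is "?L \<longleftrightarrow> _")
    if u: "Linf_time_Linf_loc u" and V: "solution_lift U u\<^sub>0 u V V\<^sub>0" for V V\<^sub>0
  proof -
    interpret kinetic_data U A a "v V V\<^sub>0" "v\<^sub>0 V V\<^sub>0" using data[rule_format, OF u V] by blast
    have eq: "(LINT p|lebesgue_on upper_half. entropy_flux E U (V p) * D_t \<phi> p + entropy_flux E A (V p) \<bullet> grad_x \<phi> p)
        \<ge> - (LINT p|lebesgue_on upper_half. a (V p) * deriv E (V p) * \<phi> p)
            - (LINT x|lebesgue. entropy_flux E U (V\<^sub>0 x) * \<phi> (0, x)) \<longleftrightarrow> 0 \<le> S (deriv E) \<phi>"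
      if "smooth E" "test_function UNIV \<phi>" for E \<phi>
      using entropy_functional_eq[OF _ _ that, of V V\<^sub>0] data[rule_format, OF u V] by linarith
    show ?thesis
    proof
      assume L: ?L
      show "entropy_condition U A a (v V V\<^sub>0) (v\<^sub>0 V V\<^sub>0)"
        unfolding entropy_condition_def
      proof (intro allI impI)
        fix E :: "real \<Rightarrow> real" and \<phi> :: "real \<times> (real^'a) \<Rightarrow> real"
        assume *: "smooth E \<and> convex_on UNIV E \<and> test_function UNIV (deriv (deriv E)) \<and>
          test_function UNIV \<phi> \<and> (\<forall>p. 0 \<le> \<phi> p)"
        then have "test_function UNIV \<phi>" by blast
        then obtain K where K: "smooth \<phi>" "compact K" "\<And>p. p \<notin> K \<Longrightarrow> \<phi> p = 0" by (rule test_functionE) blast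
        have "compact (fst ` K)" using K(2) by (intro compact_continuous_image continuous_intros)
        then obtain R where R: "0 \<le> R" "\<And>t. t \<in> fst ` K \<Longrightarrow> \<bar>t\<bar> \<le> R"
          using loc_boundedE[OF loc_bounded_continuous[OF continuous_on_id]] by blast
        \<comment> \<open>Compact support places every test function on the whole space-time below
          some finite time, here R + 1.\<close>
        have "K \<subseteq> {..<R + 1} \<times> UNIV"
          using R(2) by (force simp: abs_le_iff)
        then have "test_function ({..<R + 1} \<times> UNIV) \<phi>" by (intro test_functionI[OF K(1,2) _ K(3)])
        then show "0 \<le> S (deriv E) \<phi>"
          using L[rule_format, of "R + 1" E \<phi>] * R(1) eq[of E \<phi>] by simp
      qed
    next
      assume ec: "entropy_condition U A a (v V V\<^sub>0) (v\<^sub>0 V V\<^sub>0)"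
      show ?L
      proof (intro allI impI)
        fix T :: real and E :: "real \<Rightarrow> real" and \<phi> :: "real \<times> (real^'a) \<Rightarrow> real"
        assume *: "smooth E \<and> convex_on UNIV E \<and> test_function UNIV (deriv (deriv E)) \<and>
          test_function ({..<T} \<times> UNIV) \<phi> \<and> (\<forall>p. 0 \<le> \<phi> p)"
        then have "test_function UNIV \<phi>" using test_function_subset by blast
        then show "(LINT p|lebesgue_on upper_half. entropy_flux E U (V p) * D_t \<phi> p + entropy_flux E A (V p) \<bullet> grad_x \<phi> p)
          \<ge> - (LINT p|lebesgue_on upper_half. a (V p) * deriv E (V p) * \<phi> p)
            - (LINT x|lebesgue. entropy_flux E U (V\<^sub>0 x) * \<phi> (0, x))"
          using eq[of E \<phi>] ec * unfolding entropy_condition_def by blast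
      qed
    qed
  qed
  then show ?thesis unfolding entropy_weak_solution_def by blast
qed

lemma kinetic_solution_II_iff:
  assumes data: "\<forall>V V\<^sub>0. Linf_time_Linf_loc u \<longrightarrow> solution_lift U u\<^sub>0 u V V\<^sub>0 \<longrightarrow>
      kinetic_data U A a (v V V\<^sub>0) (v\<^sub>0 V V\<^sub>0) \<and>
      (AE p in lborel. p \<in> upper_half \<longrightarrow> V p = v V V\<^sub>0 p) \<and> (AE x in lborel. V\<^sub>0 x = v\<^sub>0 V V\<^sub>0 x)"
  shows "kinetic_solution_II U A a u\<^sub>0 u \<longleftrightarrow> Linf_time_Linf_loc u \<and>
      (\<exists>V V\<^sub>0. solution_lift U u\<^sub>0 u V V\<^sub>0 \<and> kinetic_condition U A a (v V V\<^sub>0) (v\<^sub>0 V V\<^sub>0))"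
  unfolding kinetic_solution_II_def kinetic_condition_def
proof (intro conj_cong refl ex_cong1, goal_cases)
  case (1 V V\<^sub>0 m)
  have d: "kinetic_data U A a (v V V\<^sub>0) (v\<^sub>0 V V\<^sub>0)" "AE p in lborel. p \<in> upper_half \<longrightarrow> V p = v V V\<^sub>0 p"
    "AE x in lborel. V\<^sub>0 x = v\<^sub>0 V V\<^sub>0 x"
    using data[rule_format, OF 1(1,2)] by auto
  show ?case by (simp only: kinetic_data.K2_rhs[OF d] cong: imp_cong)
qed

lemma kinetic_solution_I_iff:
  assumes data: "\<forall>V V\<^sub>0. Linf_time_Linf_loc u \<longrightarrow> solution_lift U u\<^sub>0 u V V\<^sub>0 \<longrightarrow>
      kinetic_data U A a (v V V\<^sub>0) (v\<^sub>0 V V\<^sub>0) \<and>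
      (AE p in lborel. p \<in> upper_half \<longrightarrow> V p = v V V\<^sub>0 p) \<and> (AE x in lborel. V\<^sub>0 x = v\<^sub>0 V V\<^sub>0 x)"
    and W: "W11_loc U" "W11_loc A" "W11_loc a"
  shows "kinetic_solution_I U A a u\<^sub>0 u \<longleftrightarrow> Linf_time_Linf_loc u \<and>
      (\<exists>V V\<^sub>0. solution_lift U u\<^sub>0 u V V\<^sub>0 \<and> kinetic_condition U A a (v V V\<^sub>0) (v\<^sub>0 V V\<^sub>0))"
  unfolding kinetic_solution_I_def kinetic_condition_def
proof (intro conj_cong refl ex_cong1, goal_cases)
  case (1 V V\<^sub>0 m)
  have d: "kinetic_data U A a (v V V\<^sub>0) (v\<^sub>0 V V\<^sub>0)" "AE p in lborel. p \<in> upper_half \<longrightarrow> V p = v V V\<^sub>0 p"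
    "AE x in lborel. V\<^sub>0 x = v\<^sub>0 V V\<^sub>0 x"
    using data[rule_format, OF 1(1,2)] by auto
  show ?case by (simp only: kinetic_data.K1_rhs[OF d _ W] cong: imp_cong)
qed

theorem theorem1p1:
  fixes AF :: "((real^'d) \<times> real) set" and AG :: "(real \<times> real) set"
    and U :: "real \<Rightarrow> real" and A :: "real \<Rightarrow> real^'d" and a :: "real \<Rightarrow> real"
    and u\<^sub>0 :: "real^'d \<Rightarrow> real"
  assumes "Linf_loc u\<^sub>0"
    and "continuous_parametrization AF AG U A a"
  shows "(\<forall>u :: real \<times> (real^'d) \<Rightarrow> real.
            entropy_weak_solution U A a u\<^sub>0 u \<longleftrightarrow> kinetic_solution_II U A a u\<^sub>0 u) \<and>
         (W11_loc U \<and> W11_loc A \<and> W11_loc a \<longrightarrow>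
           (\<forall>u :: real \<times> (real^'d) \<Rightarrow> real.
              kinetic_solution_I U A a u\<^sub>0 u \<longleftrightarrow> kinetic_solution_II U A a u\<^sub>0 u))"
proof -
  have mono: "mono U" using assms(2) by (simp add: continuous_parametrization_def)
  have data: "\<exists>v v\<^sub>0. \<forall>V V\<^sub>0. Linf_time_Linf_loc u \<longrightarrow> solution_lift U u\<^sub>0 u V V\<^sub>0 \<longrightarrow>
      kinetic_data U A a (v V V\<^sub>0) (v\<^sub>0 V V\<^sub>0) \<and>
      (AE p in lborel. p \<in> upper_half \<longrightarrow> V p = v V V\<^sub>0 p) \<and> (AE x in lborel. V\<^sub>0 x = v\<^sub>0 V V\<^sub>0 x)"
    for u :: "real \<times> (real^'d) \<Rightarrow> real"
  proof -
    \<comment> \<open>The two representatives are packed into one witness w before choice makes them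
      functions of the lift. For V, \<open>V\<^sub>0\<close> that do not form a lift any value will
      do.\<close>
    have "\<forall>V V\<^sub>0. \<exists>w. Linf_time_Linf_loc u \<longrightarrow> solution_lift U u\<^sub>0 u V V\<^sub>0 \<longrightarrow>
      kinetic_data U A a (fst w) (snd w) \<and>
      (AE p in lborel. p \<in> upper_half \<longrightarrow> V p = fst w p) \<and> (AE x in lborel. V\<^sub>0 x = snd w x)"
    proof (intro allI)
      fix V V\<^sub>0
      show "\<exists>w. Linf_time_Linf_loc u \<longrightarrow> solution_lift U u\<^sub>0 u V V\<^sub>0 \<longrightarrow>
        kinetic_data U A a (fst w) (snd w) \<and>
        (AE p in lborel. p \<in> upper_half \<longrightarrow> V p = fst w p) \<and> (AE x in lborel. V\<^sub>0 x = snd w x)"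
      proof (cases "Linf_time_Linf_loc u \<and> solution_lift U u\<^sub>0 u V V\<^sub>0")
        case True
        then obtain v v\<^sub>0 where "kinetic_data U A a v v\<^sub>0"
          "AE p in lborel. p \<in> upper_half \<longrightarrow> V p = v p" "AE x in lborel. V\<^sub>0 x = v\<^sub>0 x"
          using solution_representatives[OF assms, of u V V\<^sub>0] by blast
        then show ?thesis by (intro exI[of _ "(v, v\<^sub>0)"]) simp
      qed auto
    qed
    then obtain w where "\<forall>V V\<^sub>0. Linf_time_Linf_loc u \<longrightarrow> solution_lift U u\<^sub>0 u V V\<^sub>0 \<longrightarrow>
      kinetic_data U A a (fst (w V V\<^sub>0)) (snd (w V V\<^sub>0)) \<and>
      (AE p in lborel. p \<in> upper_half \<longrightarrow> V p = fst (w V V\<^sub>0) p) \<and> (AE x in lborel. V\<^sub>0 x = snd (w V V\<^sub>0) x)"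
      unfolding choice_iff by (elim exE)
    then show ?thesis by (intro exI[of _ "\<lambda>V V\<^sub>0. fst (w V V\<^sub>0)"] exI[of _ "\<lambda>V V\<^sub>0. snd (w V V\<^sub>0)"])
  qed
  show ?thesis
  proof (intro conjI impI allI)
    fix u :: "real \<times> (real^'d) \<Rightarrow> real"
    from data[of u] obtain v v\<^sub>0 where d: "\<forall>V V\<^sub>0. Linf_time_Linf_loc u \<longrightarrow> solution_lift U u\<^sub>0 u V V\<^sub>0 \<longrightarrow>
      kinetic_data U A a (v V V\<^sub>0) (v\<^sub>0 V V\<^sub>0) \<and>
      (AE p in lborel. p \<in> upper_half \<longrightarrow> V p = v V V\<^sub>0 p) \<and> (AE x in lborel. V\<^sub>0 x = v\<^sub>0 V V\<^sub>0 x)"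
      by (elim exE)
    show "entropy_weak_solution U A a u\<^sub>0 u \<longleftrightarrow> kinetic_solution_II U A a u\<^sub>0 u"
      unfolding entropy_weak_solution_iff[OF d] kinetic_solution_II_iff[OF d]
      using entropy_iff_kinetic_condition[OF _ mono] d by blast
    assume "W11_loc U \<and> W11_loc A \<and> W11_loc a"
    then show "kinetic_solution_I U A a u\<^sub>0 u \<longleftrightarrow> kinetic_solution_II U A a u\<^sub>0 u"
      unfolding kinetic_solution_II_iff[OF d] by (subst kinetic_solution_I_iff[OF d]) auto
  qed
qed

end
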